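(* Let $(A,A^* )$ be a proto-bialgebroid defined by $(\mu,\gamma,\varphi,\psi)$, with $\varphi \in \Gamma (\bigwedge ^3 A)$ and $\psi \in \Gamma (\bigwedge ^3 A ^* )$. If $\partial_*$ is a generator of the Gerstenhaber bracket $[~,~]_\gamma$ of $\Gamma (\bigwedge^{\bullet}A ^* )$, then $d_{\mu} - \partial_*+ i_{\varphi}+e_{\psi}$ is a deriving operator for the Courant bracket of the double, $A \oplus A ^*$, of the proto-bialgebroid $(A,A ^* )$.
   Context: Supermanifold conventions. $A\to M$ is a vector bundle and $\Pi$ denotes change of parity. On $T^*\Pi A$ use local coordinates $x^i$ (on $M$, degree 0), $\xi^a$ (fibre coordinates of $\Pi A$, degree 1) and conjugate momenta $p_i$ (degree 2), $\theta_a$ (degree 1). Sections of $\bigwedge^\bullet A$ are identified with functions polynomial in the $\theta_a$ only, sections of $\bigwedge^\bullet A^*$ with functions polynomial in the $\xi^a$ only. $\{~,~\}$ is the canonical Poisson bracket of the cotangent bundle, of degree $-2$, normalized by $\{p_i,x^j\}=\delta_i^j$, $\{\theta_a,\xi^b\}=\delta_a^b$, with $\{f,g\}=-(-1)^{|f||g|}\{g,f\}$, $\{f,gh\}=\{f,g\}h+(-1)^{|f||g|}g\{f,h\}$, and the graded Jacobi identity. Proto-bialgebroid. A proto-bialgebroid structure on $(A,A^* )$ is a function of degree 3 on $T^*\Pi A$ with Poisson square $0$. It decomposes uniquely as $\mu+\gamma+\varphi+\psi$, where $\mu$ is a sum of terms of type $\xi p$ and $\xi\xi\theta$, $\gamma$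 a sum of terms of type $\theta p$ and $\theta\theta\xi$, $\varphi\in\Gamma(\bigwedge^3A)$, $\psi\in\Gamma(\bigwedge^3A^* )$, and $\{\mu+\gamma+\varphi+\psi,\mu+\gamma+\varphi+\psi\}=0$. It defines, for $x,y\in\Gamma A$, $\xi,\eta\in\Gamma(A^* )$, $f\in C^\infty(M)$: skew-symmetric brackets $[x,y]_\mu=\{\{x,\mu\},y\}$, $[\xi,\eta]_\gamma=\{\{\xi,\gamma\},\eta\}$; anchors $\rho_A(x)f=\{\{x,\mu\},f\}$, $\rho_{A^*}(\xi)f=\{\{\xi,\gamma\},f\}$; quasi-differentials $d_\mu=\{\mu,\cdot\}$ on $\Gamma(\bigwedge^\bullet A^* )$ and $d_\gamma=\{\gamma,\cdot\}$ on $\Gamma(\bigwedge^\bullet A)$ (given by the usual Cartan formulas from the bracket and anchor; they need not have square zero). Notation. $i_x\alpha$ is the interior product of a form $\alpha\in\Gamma(\bigwedge^\bullet A^* )$ by an $A$-multivector $x$, with the sign convention $i_{x\wedge y}=i_x\circ i_y$; the analogous notation and convention are used for the interior product of an $A$-multivector by a form. $e_\zeta$ is left exterior multiplication by $\zeta$ on $\Gamma(\bigwedge^\bullet A^* )$. For $x\in\Gamma A$, $\xi\in\Gamma(A^* )$, $L^\mu_x=[i_x,d_\mu]$ and $L^\gamma_\xi=[i_\xi,d_\gamma]$ (graded commutators). Courant bracket of the double. It is the derived bracket $[x+\xi,y+\eta]=\{\{x+\xi,\mu+\gamma+\varphi+\psi\},y+\eta\}$ on $\Gamma(A\oplus A^*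 )$, i.e. $[x,y]=[x,y]_\mu+i_{x\wedge y}\psi$, $[x,\xi]=-i_\xi d_\gamma x+L^\mu_x\xi$, $[\xi,x]=L^\gamma_\xi x-i_xd_\mu\xi$, $[\xi,\eta]=i_{\xi\wedge\eta}\varphi+[\xi,\eta]_\gamma$. Deriving operator. A differential operator $\mathcal D$ on $\Gamma(\bigwedge^\bullet A^* )$ is a deriving operator for the Courant bracket of $A\oplus A^*$ if, for all $x,y\in\Gamma A$ and $\xi,\eta\in\Gamma(A^* )$, with unsubscripted brackets denoting graded commutators of endomorphisms of $\Gamma(\bigwedge^\bullet A^* )$, $$[[i_x,\mathcal D],i_y]=i_{[x,y]_\mu}+e_{i_{x\wedge y}\psi},\qquad [[i_x,\mathcal D],e_\xi]=-i_{i_\xi d_\gamma x}+e_{L^\mu_x\xi},$$ $$[[e_\xi,\mathcal D],i_x]=i_{L^\gamma_\xi x}-e_{i_xd_\mu\xi},\qquad [[e_\xi,\mathcal D],e_\eta]=i_{i_{\xi\wedge\eta}\varphi}+e_{[\xi,\eta]_\gamma}.$$ Generator. The Gerstenhaber bracket of $\Gamma(\bigwedge^\bullet A^* )$ is the extension of $[~,~]_\gamma$ with $[\xi,f]_\gamma=\rho_{A^*}(\xi)f$, $[u,v]_\gamma=-(-1)^{(|u|-1)(|v|-1)}[v,u]_\gamma$ and $[u,v\wedge w]_\gamma=[u,v]_\gamma\wedge w+(-1)^{(|u|-1)|v|}v\wedge[u,w]_\gamma$ (in the proto-bialgebroid case it need not satisfy the graded Jacobi identity). A generator of it is an $\mathbb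 R$-linear operator $\partial_*$ of degree $-1$ on $\Gamma(\bigwedge^\bullet A^* )$ such that $[u,v]_\gamma=(-1)^{|u|}(\partial_*(u\wedge v)-\partial_*u\wedge v-(-1)^{|u|}u\wedge\partial_*v)$ for all homogeneous $u$ and all $v$. *)

theory Defs
  imports "HOL-Analysis.Analysis" "HOL-Library.Function_Algebras" "HOL-Library.Multiset"
begin

section \<open>Smooth vector bundles\<close>

text \<open>
  The model space of dimension \<open>n\<close> is the library's \<^const>\<open>Euclidean_space\<close> \<open>n\<close>, i.e. the functions
  \<open>nat \<Rightarrow> real\<close> supported on \<open>{..<n}\<close>. Dimension 0 (a Lie algebra over a point) and rank 0 are
  therefore included.
\<close>

definition partial_deriv :: "nat \<Rightarrow> ((nat \<Rightarrow> real) \<Rightarrow> real) \<Rightarrow> (nat \<Rightarrow> real) \<Rightarrow> real" where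
  "partial_deriv i f x = deriv (\<lambda>t. f (x(i := t))) (x i)"

text \<open>
  \<open>f\<close> is of class \<open>C\<^sup>\<infinity>\<close> on the open set \<open>V\<close>: the partial derivatives of all orders exist and are
  continuous.
\<close>

definition smooth_on :: "nat \<Rightarrow> (nat \<Rightarrow> real) set \<Rightarrow> ((nat \<Rightarrow> real) \<Rightarrow> real) \<Rightarrow> bool" where
  "smooth_on n V f \<longleftrightarrow>
    (\<forall>is. set is \<subseteq> {..<n} \<longrightarrow>
      (let g = foldr partial_deriv is f in
        continuous_map (subtopology (Euclidean_space n) V) euclideanreal g \<and>
        (\<forall>i<n. \<forall>x\<in>V. (\<lambda>t. g (x(i := t))) differentiable (at (x i)))))"

text \<open>
  An adapted chart consists of an open set of the base, base coordinates \<open>x\<^sup>i\<close> on it, and linear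
  fibre coordinates on the part of the total space lying over it.
\<close>

record ('m, 'a) vb_chart =
  cdom :: "'m set"
  bcoord :: "'m \<Rightarrow> nat \<Rightarrow> real"
  fcoord :: "'a \<Rightarrow> nat \<Rightarrow> real"

record ('m, 'a) vbundle =
  base :: "'m topology"
  total :: "'a set"
  proj :: "'a \<Rightarrow> 'm"
  bdim :: nat
  rank :: nat
  atlas :: "('m, 'a) vb_chart set"

definition fibre :: "('m, 'a) vbundle \<Rightarrow> 'm \<Rightarrow> 'a set" where
  "fibre B m = {e \<in> total B. proj B e = m}"

definition in_coords :: "('m, 'a) vb_chart \<Rightarrow> ('m \<Rightarrow> real) \<Rightarrow> (nat \<Rightarrow> real) \<Rightarrow> real" where
  "in_coords c h = h \<circ> inv_into (cdom c) (bcoord c)"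

text \<open>\<open>cderiv c i h\<close> is the derivative of \<open>h\<close> with respect to the \<open>i\<close>-th base coordinate of \<open>c\<close>.\<close>

definition cderiv :: "('m, 'a) vb_chart \<Rightarrow> nat \<Rightarrow> ('m \<Rightarrow> real) \<Rightarrow> 'm \<Rightarrow> real" where
  "cderiv c i h m = partial_deriv i (in_coords c h) (bcoord c m)"

definition smooth_in :: "('m, 'a) vbundle \<Rightarrow> ('m, 'a) vb_chart \<Rightarrow> 'm set \<Rightarrow> ('m \<Rightarrow> real) \<Rightarrow> bool" where
  "smooth_in B c W h \<longleftrightarrow> smooth_on (bdim B) (bcoord c ` W) (in_coords c h)"

text \<open>
  The transition matrix from \<open>c\<close> to \<open>d\<close> at \<open>m\<close>: its column \<open>b\<close> lists the fibre coordinates in \<open>d\<close> of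
  the \<open>b\<close>-th vector of the frame of \<open>c\<close>.
\<close>

definition trans_mat ::
  "('m, 'a) vbundle \<Rightarrow> ('m, 'a) vb_chart \<Rightarrow> ('m, 'a) vb_chart \<Rightarrow> nat \<Rightarrow> nat \<Rightarrow> 'm \<Rightarrow> real" where
  "trans_mat B c d a b m =
     fcoord d (inv_into (fibre B m) (fcoord c) (\<lambda>j. if j = b then 1 else 0)) a"

text \<open>
  A smooth vector bundle of rank \<open>r\<close> over a smooth manifold of dimension \<open>n\<close> (Hausdorff and second
  countable). The vector space structure of the fibres and the smooth structure of the total space
  are those carried over by the adapted charts; the last three conditions make this independent of
  the chart.
\<close>

definition vector_bundle :: "('m, 'a) vbundle \<Rightarrow> bool" where
  "vector_bundle B \<longleftrightarrow>
     Hausdorff_space (base B) \<and> second_countable (base B) \<and>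
     proj B ` total B \<subseteq> topspace (base B) \<and>
     (\<Union>c\<in>atlas B. cdom c) = topspace (base B) \<and>
     (\<forall>c\<in>atlas B.
        openin (base B) (cdom c) \<and>
        openin (Euclidean_space (bdim B)) (bcoord c ` cdom c) \<and>
        homeomorphic_map (subtopology (base B) (cdom c))
          (subtopology (Euclidean_space (bdim B)) (bcoord c ` cdom c)) (bcoord c) \<and>
        (\<forall>m\<in>cdom c. bij_betw (fcoord c) (fibre B m) (topspace (Euclidean_space (rank B))))) \<and>
     (\<forall>c\<in>atlas B. \<forall>d\<in>atlas B.
        (\<forall>i<bdim B. smooth_in B c (cdom c \<inter> cdom d) (\<lambda>m. bcoord d m i)) \<and>
        (\<forall>m\<in>cdom c \<inter> cdom d. \<forall>e\<in>fibre B m. \<forall>a<rank B.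
           fcoord d e a = (\<Sum>b<rank B. trans_mat B c d a b m * fcoord c e b)) \<and>
        (\<forall>a<rank B. \<forall>b<rank B. smooth_in B c (cdom c \<inter> cdom d) (trans_mat B c d a b)))"


section \<open>Polynomials in odd and even generators\<close>

text \<open>
  Odd generators are numbered by \<open>nat\<close>: \<open>\<xi>\<^sup>a\<close> is number \<open>2a\<close> and \<open>\<theta>\<^sub>a\<close> is number \<open>2a+1\<close>. The pair
  \<open>(J, K)\<close> stands for the product of the odd generators in \<open>J\<close>, in increasing order, and of the
  momenta \<open>p\<^sub>i\<close>, \<open>i\<close> in the multiset \<open>K\<close>. A polynomial is given by its real coefficients.
\<close>

type_synonym gpoly = "nat set \<times> nat multiset \<Rightarrow> real"

abbreviation xi :: "nat \<Rightarrow> nat" where "xi a \<equiv> 2 * a"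
abbreviation theta :: "nat \<Rightarrow> nat" where "theta a \<equiv> 2 * a + 1"

text \<open>The sign needed to sort the product of the generators in \<open>J\<close> followed by those in \<open>L\<close>.\<close>

definition osign :: "nat set \<Rightarrow> nat set \<Rightarrow> real" where
  "osign J L = (-1) ^ card {(a, b). a \<in> J \<and> b \<in> L \<and> b < a}"

definition gscale :: "real \<Rightarrow> gpoly \<Rightarrow> gpoly" where
  "gscale s f = (\<lambda>JK. s * f JK)"

definition gmult :: "gpoly \<Rightarrow> gpoly \<Rightarrow> gpoly" where
  "gmult f g = (\<lambda>(J, K). \<Sum>J'\<in>Pow J. \<Sum>K'\<in>{K'. K' \<subseteq># K}.
      osign J' (J - J') * f (J', K') * g (J - J', K - K'))"

definition gone :: gpoly where
  "gone = (\<lambda>JK. if JK = ({}, {#}) then 1 else 0)"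

definition godd :: "nat \<Rightarrow> gpoly" where
  "godd j = (\<lambda>JK. if JK = ({j}, {#}) then 1 else 0)"

definition gmom :: "nat \<Rightarrow> gpoly" where
  "gmom i = (\<lambda>JK. if JK = ({}, {#i#}) then 1 else 0)"

definition gprod :: "gpoly list \<Rightarrow> gpoly" where
  "gprod fs = foldr gmult fs gone"

text \<open>Substitution of \<open>s j\<close> for the \<open>j\<close>-th odd generator and of \<open>t i\<close> for \<open>p\<^sub>i\<close>.\<close>

definition gsubst :: "(nat \<Rightarrow> gpoly) \<Rightarrow> (nat \<Rightarrow> gpoly) \<Rightarrow> gpoly \<Rightarrow> gpoly" where
  "gsubst s t f = (\<Sum>(J, K)\<in>{JK. f JK \<noteq> 0}. gscale (f (J, K))
     (gmult (gprod (map s (sorted_list_of_set J))) (gprod (map t (sorted_list_of_multiset K)))))"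

text \<open>Left and right derivatives with respect to an odd generator, derivative with respect to \<open>p\<^sub>i\<close>.\<close>

definition lderiv :: "nat \<Rightarrow> gpoly \<Rightarrow> gpoly" where
  "lderiv j f = (\<lambda>(J, K). if j \<in> J then 0 else osign {j} J * f (insert j J, K))"

definition rderiv :: "nat \<Rightarrow> gpoly \<Rightarrow> gpoly" where
  "rderiv j f = (\<lambda>(J, K). if j \<in> J then 0 else osign J {j} * f (insert j J, K))"

definition pderiv_mom :: "nat \<Rightarrow> gpoly \<Rightarrow> gpoly" where
  "pderiv_mom i f = (\<lambda>(J, K). real (count K i + 1) * f (J, K + {#i#}))"

text \<open>The number of the generator conjugate to a given odd generator.\<close>

definition oconj :: "nat \<Rightarrow> nat" where
  "oconj j = (if even j then j + 1 else j - 1)"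

text \<open>
  Interior product: \<open>\<theta>\<^sub>a\<close> acts as the left derivative with respect to \<open>\<xi>\<^sup>a\<close>, \<open>\<xi>\<^sup>a\<close> as the left
  derivative with respect to \<open>\<theta>\<^sub>a\<close>, and products act by composition.
\<close>

definition gint :: "gpoly \<Rightarrow> gpoly \<Rightarrow> gpoly" where
  "gint f g = (\<Sum>J\<in>{J. f (J, {#}) \<noteq> 0}.
     gscale (f (J, {#})) (foldr (\<lambda>j. lderiv (oconj j)) (sorted_list_of_set J) g))"


section \<open>Functions on \<open>T\<^sup>*\<Pi>A\<close>\<close>

text \<open>
  A function on \<open>T\<^sup>*\<Pi>A\<close> is given by its expression in every adapted chart, with coefficients
  depending on the point of the base; by convention the expression is 0 off the chart's domain. The
  expressions are related by the canonical change of coordinates: writing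
  \<open>\<xi>'\<^sup>a = T\<^sup>a\<^sub>b \<xi>\<^sup>b\<close> for the new fibre coordinates and \<open>S\<close> for the inverse of \<open>T\<close>,
  \<open>\<theta>'\<^sub>a = S\<^sup>b\<^sub>a \<theta>\<^sub>b\<close> and
  \<open>p'\<^sub>i = (\<partial>x\<^sup>j/\<partial>x'\<^sup>i) p\<^sub>j - S\<^sup>c\<^sub>a (\<partial>T\<^sup>a\<^sub>b/\<partial>x'\<^sup>i) \<xi>\<^sup>b \<theta>\<^sub>c\<close>.
  The last formula is forced by \<open>{p'\<^sub>i, x'\<^sup>j} = \<delta>\<close> and \<open>{p'\<^sub>i, \<xi>'\<^sup>a} = {p'\<^sub>i, \<theta>'\<^sub>a} = 0\<close>.
\<close>

type_synonym ('m, 'a) sfield = "('m, 'a) vb_chart \<Rightarrow> 'm \<Rightarrow> gpoly"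

text \<open>The odd coordinates and the momenta of the chart \<open>d\<close>, expressed in the chart \<open>c\<close>.\<close>

definition odd_trans ::
  "('m, 'a) vbundle \<Rightarrow> ('m, 'a) vb_chart \<Rightarrow> ('m, 'a) vb_chart \<Rightarrow> 'm \<Rightarrow> nat \<Rightarrow> gpoly" where
  "odd_trans B c d m j =
     (let a = j div 2 in
      if even j
      then (\<Sum>b<rank B. gscale (trans_mat B c d a b m) (godd (xi b)))
      else (\<Sum>b<rank B. gscale (trans_mat B d c b a m) (godd (theta b))))"

definition mom_trans ::
  "('m, 'a) vbundle \<Rightarrow> ('m, 'a) vb_chart \<Rightarrow> ('m, 'a) vb_chart \<Rightarrow> 'm \<Rightarrow> nat \<Rightarrow> gpoly" where
  "mom_trans B c d m i =
     (\<Sum>j<bdim B. gscale (cderiv d i (\<lambda>m'. bcoord c m' j) m) (gmom j)) -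
     (\<Sum>a<rank B. \<Sum>b<rank B. \<Sum>k<rank B.
        gscale (trans_mat B d c k a m * cderiv d i (trans_mat B c d a b) m)
          (gmult (godd (xi b)) (godd (theta k))))"

definition sfunctions :: "('m, 'a) vbundle \<Rightarrow> ('m, 'a) sfield set" where
  "sfunctions B = {F.
     (\<forall>c m. c \<notin> atlas B \<or> m \<notin> cdom c \<longrightarrow> F c m = 0) \<and>
     (\<forall>c m J K. F c m (J, K) \<noteq> 0 \<longrightarrow> J \<subseteq> {..<2 * rank B} \<and> set_mset K \<subseteq> {..<bdim B}) \<and>
     (\<exists>N. \<forall>c m J K. F c m (J, K) \<noteq> 0 \<longrightarrow> card J + 2 * size K \<le> N) \<and>
     (\<forall>c\<in>atlas B. \<forall>JK. smooth_in B c (cdom c) (\<lambda>m. F c m JK)) \<and>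
     (\<forall>c\<in>atlas B. \<forall>d\<in>atlas B. \<forall>m\<in>cdom c \<inter> cdom d.
        F c m = gsubst (odd_trans B c d m) (mom_trans B c d m) (F d m))}"

definition sfunctions_deg :: "('m, 'a) vbundle \<Rightarrow> nat \<Rightarrow> ('m, 'a) sfield set" where
  "sfunctions_deg B k =
     {F \<in> sfunctions B. \<forall>c m J K. F c m (J, K) \<noteq> 0 \<longrightarrow> card J + 2 * size K = k}"

text \<open>
  Sections of the exterior powers of \<open>A\<^sup>*\<close> and of \<open>A\<close>, as functions of the \<open>\<xi>\<^sup>a\<close> only and of the
  \<open>\<theta>\<^sub>a\<close> only. In degree 0 both are the smooth functions on the base.
\<close>

definition forms :: "('m, 'a) vbundle \<Rightarrow> ('m, 'a) sfield set" where
  "forms B = {F \<in> sfunctions B. \<forall>c m J K. F c m (J, K) \<noteq> 0 \<longrightarrow> K = {#} \<and> J \<subseteq> range xi}"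

definition multivectors :: "('m, 'a) vbundle \<Rightarrow> ('m, 'a) sfield set" where
  "multivectors B = {F \<in> sfunctions B. \<forall>c m J K. F c m (J, K) \<noteq> 0 \<longrightarrow> K = {#} \<and> J \<subseteq> range theta}"

definition forms_deg :: "('m, 'a) vbundle \<Rightarrow> nat \<Rightarrow> ('m, 'a) sfield set" where
  "forms_deg B k = forms B \<inter> sfunctions_deg B k"

definition multivectors_deg :: "('m, 'a) vbundle \<Rightarrow> nat \<Rightarrow> ('m, 'a) sfield set" where
  "multivectors_deg B k = multivectors B \<inter> sfunctions_deg B k"

definition sscale :: "real \<Rightarrow> ('m, 'a) sfield \<Rightarrow> ('m, 'a) sfield" (infixr "*\<^sub>s" 75) where
  "s *\<^sub>s F = (\<lambda>c m. gscale s (F c m))"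

definition smult :: "('m, 'a) sfield \<Rightarrow> ('m, 'a) sfield \<Rightarrow> ('m, 'a) sfield" (infixl "\<odot>" 70) where
  "F \<odot> G = (\<lambda>c m. gmult (F c m) (G c m))"

definition dbase ::
  "('m, 'a) vb_chart \<Rightarrow> nat \<Rightarrow> ('m, 'a) sfield \<Rightarrow> 'm \<Rightarrow> gpoly" where
  "dbase c i F m = (\<lambda>JK. cderiv c i (\<lambda>m'. F c m' JK) m)"

text \<open>
  The canonical Poisson bracket. The combination of right derivatives of the first argument with
  left derivatives of the second is the one for which \<open>{\<theta>\<^sub>a, \<xi>\<^sup>b} = \<delta>\<close> and
  \<open>{f, gh} = {f, g}h + (-1)\<^bsup>|f||g|\<^esup> g{f, h}\<close>.
\<close>

definition poisson ::
  "('m, 'a) vbundle \<Rightarrow> ('m, 'a) sfield \<Rightarrow> ('m, 'a) sfield \<Rightarrow> ('m, 'a) sfield" where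
  "poisson B F G = (\<lambda>c m.
     (\<Sum>i<bdim B. gmult (pderiv_mom i (F c m)) (dbase c i G m) -
                  gmult (dbase c i F m) (pderiv_mom i (G c m))) +
     (\<Sum>a<rank B. gmult (rderiv (theta a) (F c m)) (lderiv (xi a) (G c m)) +
                   gmult (rderiv (xi a) (F c m)) (lderiv (theta a) (G c m))))"


section \<open>Operators\<close>

type_synonym ('m, 'a) soperator = "('m, 'a) sfield \<Rightarrow> ('m, 'a) sfield"

text \<open>
  \<open>iprod X\<close> is used both for multivectors acting on forms and for forms acting on multivectors.
\<close>

definition iprod :: "('m, 'a) sfield \<Rightarrow> ('m, 'a) soperator" where
  "iprod X F = (\<lambda>c m. gint (X c m) (F c m))"

definition eprod :: "('m, 'a) sfield \<Rightarrow> ('m, 'a) soperator" where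
  "eprod Z F = Z \<odot> F"

text \<open>
  The graded commutator of arbitrary linear operators, obtained by splitting them into their even
  and odd parts by means of the grading involution \<open>F \<mapsto> (-1)\<^bsup>|F|\<^esup> F\<close>.
\<close>

definition grading_inv :: "('m, 'a) soperator" where
  "grading_inv F = (\<lambda>c m (J, K). (-1) ^ card J * F c m (J, K))"

definition even_part :: "('m, 'a) soperator \<Rightarrow> ('m, 'a) soperator" where
  "even_part P F = (1/2) *\<^sub>s (P F + grading_inv (P (grading_inv F)))"

definition odd_part :: "('m, 'a) soperator \<Rightarrow> ('m, 'a) soperator" where
  "odd_part P F = (1/2) *\<^sub>s (P F - grading_inv (P (grading_inv F)))"

definition gcomm :: "('m, 'a) soperator \<Rightarrow> ('m, 'a) soperator \<Rightarrow> ('m, 'a) soperator" where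
  "gcomm P Q F = P (Q F) -
     (even_part Q (even_part P F) + even_part Q (odd_part P F) +
      odd_part Q (even_part P F) - odd_part Q (odd_part P F))"

definition linear_operator :: "('m, 'a) vbundle \<Rightarrow> ('m, 'a) soperator \<Rightarrow> bool" where
  "linear_operator B D \<longleftrightarrow>
     (\<forall>u\<in>forms B. D u \<in> forms B) \<and>
     (\<forall>u\<in>forms B. \<forall>v\<in>forms B. D (u + v) = D u + D v) \<and>
     (\<forall>s. \<forall>u\<in>forms B. D (s *\<^sub>s u) = s *\<^sub>s D u)"

text \<open>
  Differential operators of order at most \<open>k\<close> on the module of forms over the smooth functions, in
  the sense of Grothendieck: all \<open>(k+1)\<close>-fold commutators with multiplications by functions vanish.
\<close>

fun diff_op_order :: "('m, 'a) vbundle \<Rightarrow> nat \<Rightarrow> ('m, 'a) soperator \<Rightarrow> bool" where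
  "diff_op_order B 0 D \<longleftrightarrow>
     linear_operator B D \<and> (\<forall>f\<in>forms_deg B 0. \<forall>u\<in>forms B. D (f \<odot> u) = f \<odot> D u)"
| "diff_op_order B (Suc k) D \<longleftrightarrow>
     linear_operator B D \<and> (\<forall>f\<in>forms_deg B 0. diff_op_order B k (\<lambda>u. D (f \<odot> u) - f \<odot> D u))"

definition differential_operator :: "('m, 'a) vbundle \<Rightarrow> ('m, 'a) soperator \<Rightarrow> bool" where
  "differential_operator B D \<longleftrightarrow> (\<exists>k. diff_op_order B k D)"


section \<open>Proto-bialgebroids\<close>

definition proto_bialgebroid ::
  "('m, 'a) vbundle \<Rightarrow> ('m, 'a) sfield \<Rightarrow> ('m, 'a) sfield \<Rightarrow> ('m, 'a) sfield \<Rightarrow> ('m, 'a) sfield \<Rightarrow> bool"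
where
  "proto_bialgebroid B \<mu> \<gamma> \<phi> \<psi> \<longleftrightarrow>
     \<mu> \<in> sfunctions_deg B 3 \<and>
     (\<forall>c m J K. \<mu> c m (J, K) \<noteq> 0 \<longrightarrow>
        (\<exists>a i. J = {xi a} \<and> K = {#i#}) \<or>
        (\<exists>a b k. a \<noteq> b \<and> J = {xi a, xi b, theta k} \<and> K = {#})) \<and>
     \<gamma> \<in> sfunctions_deg B 3 \<and>
     (\<forall>c m J K. \<gamma> c m (J, K) \<noteq> 0 \<longrightarrow>
        (\<exists>a i. J = {theta a} \<and> K = {#i#}) \<or>
        (\<exists>a b k. a \<noteq> b \<and> J = {theta a, theta b, xi k} \<and> K = {#})) \<and>
     \<phi> \<in> multivectors_deg B 3 \<and>
     \<psi> \<in> forms_deg B 3 \<and>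
     poisson B (\<mu> + \<gamma> + \<phi> + \<psi>) (\<mu> + \<gamma> + \<phi> + \<psi>) = 0"

text \<open>
  \<open>derived_bracket B \<mu>\<close> gives the bracket of sections of \<open>A\<close> and, on a section and a function, the
  anchor; \<open>derived_bracket B \<gamma>\<close> does the same for \<open>A\<^sup>*\<close>.
\<close>

definition derived_bracket ::
  "('m, 'a) vbundle \<Rightarrow> ('m, 'a) sfield \<Rightarrow> ('m, 'a) sfield \<Rightarrow> ('m, 'a) sfield \<Rightarrow> ('m, 'a) sfield" where
  "derived_bracket B \<Theta> F G = poisson B (poisson B F \<Theta>) G"

definition quasi_diff :: "('m, 'a) vbundle \<Rightarrow> ('m, 'a) sfield \<Rightarrow> ('m, 'a) soperator" where
  "quasi_diff B \<Theta> F = poisson B \<Theta> F"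

definition lie_deriv ::
  "('m, 'a) vbundle \<Rightarrow> ('m, 'a) sfield \<Rightarrow> ('m, 'a) sfield \<Rightarrow> ('m, 'a) soperator" where
  "lie_deriv B \<Theta> X = gcomm (iprod X) (quasi_diff B \<Theta>)"

definition deriving_operator ::
  "('m, 'a) vbundle \<Rightarrow> ('m, 'a) sfield \<Rightarrow> ('m, 'a) sfield \<Rightarrow> ('m, 'a) sfield \<Rightarrow> ('m, 'a) sfield \<Rightarrow>
   ('m, 'a) soperator \<Rightarrow> bool" where
  "deriving_operator B \<mu> \<gamma> \<phi> \<psi> D \<longleftrightarrow>
     differential_operator B D \<and>
     (\<forall>x\<in>multivectors_deg B 1. \<forall>y\<in>multivectors_deg B 1. \<forall>u\<in>forms B.
        gcomm (gcomm (iprod x) D) (iprod y) u =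
          iprod (derived_bracket B \<mu> x y) u + eprod (iprod (x \<odot> y) \<psi>) u) \<and>
     (\<forall>x\<in>multivectors_deg B 1. \<forall>\<xi>\<in>forms_deg B 1. \<forall>u\<in>forms B.
        gcomm (gcomm (iprod x) D) (eprod \<xi>) u =
          - iprod (iprod \<xi> (quasi_diff B \<gamma> x)) u + eprod (lie_deriv B \<mu> x \<xi>) u) \<and>
     (\<forall>\<xi>\<in>forms_deg B 1. \<forall>x\<in>multivectors_deg B 1. \<forall>u\<in>forms B.
        gcomm (gcomm (eprod \<xi>) D) (iprod x) u =
          iprod (lie_deriv B \<gamma> \<xi> x) u - eprod (iprod x (quasi_diff B \<mu> \<xi>)) u) \<and>
     (\<forall>\<xi>\<in>forms_deg B 1. \<forall>\<eta>\<in>forms_deg B 1. \<forall>u\<in>forms B.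
        gcomm (gcomm (eprod \<xi>) D) (eprod \<eta>) u =
          iprod (iprod (\<xi> \<odot> \<eta>) \<phi>) u + eprod (derived_bracket B \<gamma> \<xi> \<eta>) u)"

text \<open>
  The bracket of degree -1 on forms extending the bracket of sections of \<open>A\<^sup>*\<close> and the anchor; these
  conditions determine it on forms. The signs
  \<open>(-1)\<^bsup>(p-1)(q-1)\<^esup>\<close> and \<open>(-1)\<^bsup>(p-1)q\<^esup>\<close> are written with \<open>p+1\<close>, \<open>q+1\<close> to avoid truncated subtraction.
\<close>

definition gerstenhaber_bracket ::
  "('m, 'a) vbundle \<Rightarrow> ('m, 'a) sfield \<Rightarrow> (('m, 'a) sfield \<Rightarrow> ('m, 'a) sfield \<Rightarrow> ('m, 'a) sfield) \<Rightarrow> bool"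
where
  "gerstenhaber_bracket B \<gamma> G \<longleftrightarrow>
     (\<forall>u\<in>forms B. \<forall>v\<in>forms B. \<forall>w\<in>forms B. \<forall>s.
        G (u + v) w = G u w + G v w \<and> G u (v + w) = G u v + G u w \<and>
        G (s *\<^sub>s u) v = s *\<^sub>s G u v \<and> G u (s *\<^sub>s v) = s *\<^sub>s G u v) \<and>
     (\<forall>f\<in>forms_deg B 0. \<forall>g\<in>forms_deg B 0. G f g = 0) \<and>
     (\<forall>p q k. p + q = Suc k \<longrightarrow> (\<forall>u\<in>forms_deg B p. \<forall>v\<in>forms_deg B q. G u v \<in> forms_deg B k)) \<and>
     (\<forall>\<xi>\<in>forms_deg B 1. \<forall>\<eta>\<in>forms_deg B 1. G \<xi> \<eta> = derived_bracket B \<gamma> \<xi> \<eta>) \<and>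
     (\<forall>\<xi>\<in>forms_deg B 1. \<forall>f\<in>forms_deg B 0. G \<xi> f = derived_bracket B \<gamma> \<xi> f) \<and>
     (\<forall>p q. \<forall>u\<in>forms_deg B p. \<forall>v\<in>forms_deg B q.
        G u v = - ((-1) ^ ((p + 1) * (q + 1)) *\<^sub>s G v u)) \<and>
     (\<forall>p q. \<forall>u\<in>forms_deg B p. \<forall>v\<in>forms_deg B q. \<forall>w\<in>forms B.
        G u (v \<odot> w) = G u v \<odot> w + (-1) ^ ((p + 1) * q) *\<^sub>s (v \<odot> G u w))"

definition generator ::
  "('m, 'a) vbundle \<Rightarrow> (('m, 'a) sfield \<Rightarrow> ('m, 'a) sfield \<Rightarrow> ('m, 'a) sfield) \<Rightarrow>
   ('m, 'a) soperator \<Rightarrow> bool" where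
  "generator B G \<delta> \<longleftrightarrow>
     linear_operator B \<delta> \<and>
     (\<forall>f\<in>forms_deg B 0. \<delta> f = 0) \<and>
     (\<forall>p. \<forall>u\<in>forms_deg B (Suc p). \<delta> u \<in> forms_deg B p) \<and>
     (\<forall>p. \<forall>u\<in>forms_deg B p. \<forall>v\<in>forms B.
        G u v = (-1) ^ p *\<^sub>s (\<delta> (u \<odot> v) - \<delta> u \<odot> v - (-1) ^ p *\<^sub>s (u \<odot> \<delta> v)))"

end

theory Submission
  imports Defs
begin

text \<open>
  The operator \<open>\<D> = d - \<partial> + i + e\<close> is odd, and a double graded commutator of \<open>\<D>\<close> with two of the odd
  operators \<open>i\<^sub>x\<close>, \<open>e\<^sub>\<xi>\<close> is additive in \<open>\<D>\<close>. So each of its four terms can be treated separately, for each of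
  the four kinds of pairs; each term contributes exactly one kind of summand of the Courant bracket.

  The interior product with the three-vector and the exterior product with the three-form contribute by
  pure exterior algebra: they graded-commute with operators of their own kind, and passing them through
  operators of the other kind contracts the three-tensor.

  For the quasi-differential, the double commutator with \<open>i\<^sub>x\<close> and \<open>i\<^sub>y\<close> is a derivation, because graded
  commutators of derivations are derivations. Derivations killing functions are determined by their
  values on one-forms, and there the identity is Cartan's formula, which is the one computation that is
  made in coordinates (lemma \<open>Cartan_formula\<close>). The double commutators with \<open>e\<^sub>\<xi>\<close> follow from the product rule.

  The generator is not a derivation, but its failure to be one is the Gerstenhaber bracket \<open>G\<close>:
  its commutators with multiplication by a function \<open>f\<close> and by a one-form \<open>\<xi>\<close> are, up to sign and a multiplication,
  the derivations \<open>G f\<close> and \<open>G \<xi>\<close>. Comparing values on one-forms, now by Cartan's formula on the dual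
  bundle, gives that \<open>G f\<close> is minus the interior product with the quasi-differential of \<open>f\<close>, and that the commutator of \<open>G \<xi>\<close> with
  \<open>i\<^sub>x\<close> is the interior product with the Lie derivative of \<open>x\<close> (lemmas \<open>bracket_function_eq\<close>, \<open>bracket_iprod\<close> and
  \<open>bracket_iprod_lie\<close>). Hence the double commutators involving some \<open>e\<^sub>\<xi>\<close>. The remaining one, with \<open>i\<^sub>x\<close> and \<open>i\<^sub>y\<close>,
  kills functions, is linear over functions and anticommutes with all \<open>e\<^sub>\<xi>\<close>; as forms are locally
  generated by functions and one-forms, it vanishes (theorem \<open>operator_vanishes_locally\<close>, which rests on bump functions).

  The same commutator formulas show that \<open>\<D>\<close> is a differential operator of order one. A large part of what follows
  is groundwork: the algebra of graded polynomials, smooth functions in charts, and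
  the fact that the quasi-differential of a form is again a form, that is, has the right behaviour under the change of chart.
\<close>

section \<open>Functions with partial derivatives of all orders\<close>

abbreviation model_space :: "nat \<Rightarrow> (nat \<Rightarrow> real) set" where
  "model_space n \<equiv> {x. \<forall>i\<ge>n. x i = 0}"

lemma Euclidean_space_top_of_set: "Euclidean_space n = top_of_set (model_space n)"
  by (simp add: Euclidean_space_def euclidean_product_topology)

lemma openin_Euclidean_space_cube:
  assumes "openin (Euclidean_space n) V" "x \<in> V"
  shows "\<exists>e>0. \<forall>y\<in>model_space n. (\<forall>i<n. \<bar>y i - x i\<bar> < e) \<longrightarrow> y \<in> V"
proof -
  obtain T where T: "openin (powertop_real UNIV) T" "V = T \<inter> model_space n"
    using assms(1) unfolding Euclidean_space_def openin_subtopology by blast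
  then have xT: "x \<in> T" using assms(2) by blast
  obtain U where U: "\<And>i. open (U i)" "x \<in> Pi\<^sub>E UNIV U" "Pi\<^sub>E UNIV U \<subseteq> T"
    using bspec[OF T(1)[unfolded openin_product_topology_alt] xT] by (auto simp flip: open_openin)
  have "\<exists>e>0. ball (x i) e \<subseteq> U i" for i
    using openE[OF U(1), of "x i" i] PiE_mem[OF U(2), of i] by blast
  then obtain e where e: "\<And>i. e i > (0::real)" "\<And>i. ball (x i) (e i) \<subseteq> U i" by metis
  define d where "d = Min (insert 1 (e ` {..<n}))"
  have d0: "d > 0" unfolding d_def using e(1) by (subst Min_gr_iff) auto
  have di: "d \<le> e i" if "i < n" for i unfolding d_def using that by (intro Min_le) auto
  show ?thesis
  proof (intro exI[of _ d] conjI ballI impI d0)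
    fix y assume y: "y \<in> model_space n" "\<forall>i<n. \<bar>y i - x i\<bar> < d"
    have xm: "x \<in> model_space n" using T(2) assms(2) by blast
    have "y i \<in> U i" for i
    proof (cases "i < n")
      case True
      then have "y i \<in> ball (x i) (e i)"
        using y(2)[rule_format, OF True] di[OF True] by (auto simp: dist_real_def abs_minus_commute)
      then show ?thesis using e(2) by blast
    next
      case False
      then have "y i = x i" using y(1) xm by auto
      then show ?thesis using e by (metis centre_in_ball subsetD)
    qed
    then have "y \<in> Pi\<^sub>E UNIV U" by (simp add: PiE_iff)
    then show "y \<in> V" using U(3) T(2) y(1) by blast
  qed
qed

lemma openin_Euclidean_space_subset:
  "openin (Euclidean_space n) V \<Longrightarrow> V \<subseteq> model_space n"
  using openin_subset topspace_Euclidean_space by fastforce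

abbreviation has_partial ::
  "nat \<Rightarrow> ((nat \<Rightarrow> real) \<Rightarrow> real) \<Rightarrow> (nat \<Rightarrow> real) \<Rightarrow> real \<Rightarrow> bool" where
  "has_partial i f x D \<equiv> ((\<lambda>t. f (x(i := t))) has_real_derivative D) (at (x i))"

lemma has_partial_imp_partial_deriv: "has_partial i f x D \<Longrightarrow> partial_deriv i f x = D"
  unfolding partial_deriv_def by (rule DERIV_imp_deriv)

lemma eventually_coordinate_line:
  assumes "openin (Euclidean_space n) V" "x \<in> V" "i < n"
  shows "\<forall>\<^sub>F t in nhds (x i). x(i := t) \<in> V"
proof -
  obtain e where e: "e > 0" "\<And>y. y \<in> model_space n \<Longrightarrow> (\<And>i. i < n \<Longrightarrow> \<bar>y i - x i\<bar> < e) \<Longrightarrow> y \<in> V"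
    using openin_Euclidean_space_cube[OF assms(1,2)] by blast
  have "x \<in> model_space n" using assms openin_Euclidean_space_subset by blast
  then have "x(i := t) \<in> V" if "dist t (x i) < e" for t
    using that e(1) assms(3) by (intro e(2)) (auto simp: dist_real_def)
  then show ?thesis using e(1) unfolding eventually_nhds_metric by blast
qed

lemma has_partial_cong:
  assumes "openin (Euclidean_space n) V" "x \<in> V" "i < n" "\<And>y. y \<in> V \<Longrightarrow> f y = g y"
  shows "has_partial i f x D \<longleftrightarrow> has_partial i g x D"
  using eventually_coordinate_line[OF assms(1-3)]
  by (intro DERIV_cong_ev) (auto elim!: eventually_mono simp: assms(4))

lemma partial_deriv_cong:
  assumes "openin (Euclidean_space n) V" "x \<in> V" "i < n" "\<And>y. y \<in> V \<Longrightarrow> f y = g y"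
  shows "partial_deriv i f x = partial_deriv i g x"
  unfolding partial_deriv_def
  using eventually_coordinate_line[OF assms(1-3)]
  by (intro deriv_cong_ev) (auto elim!: eventually_mono simp: assms(4))

text \<open>
  Stratifying smoothness by the number of derivatives turns all closure properties into inductions
  in which a partial derivative is handled as one more function of the same kind.
\<close>

primrec Ck :: "nat \<Rightarrow> nat \<Rightarrow> (nat \<Rightarrow> real) set \<Rightarrow> ((nat \<Rightarrow> real) \<Rightarrow> real) \<Rightarrow> bool" where
  "Ck 0 n V f \<longleftrightarrow> continuous_on V f"
| "Ck (Suc k) n V f \<longleftrightarrow> continuous_on V f \<and>
     (\<forall>i<n. (\<forall>x\<in>V. \<exists>D. has_partial i f x D) \<and> Ck k n V (partial_deriv i f))"

lemma Ck_continuous: "Ck k n V f \<Longrightarrow> continuous_on V f"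
  by (cases k) auto

lemma Ck_has_partial: "Ck (Suc k) n V f \<Longrightarrow> i < n \<Longrightarrow> x \<in> V \<Longrightarrow> has_partial i f x (partial_deriv i f x)"
  by (metis Ck.simps(2) has_partial_imp_partial_deriv)

lemma Ck_partial_deriv: "Ck (Suc k) n V f \<Longrightarrow> i < n \<Longrightarrow> Ck k n V (partial_deriv i f)"
  by simp

lemma Ck_SucD: "Ck (Suc k) n V f \<Longrightarrow> Ck k n V f"
  by (induction k arbitrary: f) auto

lemma smooth_on_partial_deriv:
  assumes "smooth_on n V f" "i < n"
  shows "smooth_on n V (partial_deriv i f)"
  unfolding smooth_on_def
proof (intro allI impI)
  fix js :: "nat list" assume "set js \<subseteq> {..<n}"
  then have "set (js @ [i]) \<subseteq> {..<n}" using assms(2) by auto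
  then show "let g = foldr partial_deriv js (partial_deriv i f) in
      continuous_map (subtopology (Euclidean_space n) V) euclideanreal g \<and>
      (\<forall>i<n. \<forall>x\<in>V. (\<lambda>t. g (x(i := t))) differentiable (at (x i)))"
    using assms(1)[unfolded smooth_on_def, rule_format, of "js @ [i]"] by simp
qed

lemma smooth_on_iff_Ck:
  assumes "openin (Euclidean_space n) V"
  shows "smooth_on n V f \<longleftrightarrow> (\<forall>k. Ck k n V f)"
proof
  have sub: "subtopology (Euclidean_space n) V = top_of_set V"
    using openin_Euclidean_space_subset[OF assms]
    by (simp add: Euclidean_space_top_of_set subtopology_subtopology inf.absorb2)
  have "Ck k n V f" if "smooth_on n V f" for k
    using that
  proof (induction k arbitrary: f)
    case 0
    then show ?case
      using 0[unfolded smooth_on_def, rule_format, of "[]"] by (simp add: sub)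
  next
    case (Suc k)
    have "continuous_on V f" "\<forall>i<n. \<forall>x\<in>V. (\<lambda>t. f (x(i := t))) differentiable (at (x i))"
      using Suc.prems[unfolded smooth_on_def, rule_format, of "[]"] by (simp_all add: sub)
    moreover have "Ck k n V (partial_deriv i f)" if "i < n" for i
      using Suc.IH smooth_on_partial_deriv[OF Suc.prems that] by blast
    ultimately show ?case by (auto simp: real_differentiable_def)
  qed
  then show "smooth_on n V f \<Longrightarrow> \<forall>k. Ck k n V f" by blast
  assume C: "\<forall>k. Ck k n V f"
  show "smooth_on n V f"
    unfolding smooth_on_def
  proof (intro allI impI)
    fix js :: "nat list" assume js: "set js \<subseteq> {..<n}"
    have "\<forall>k. Ck k n V (foldr partial_deriv js f)"
      using js C
    proof (induction js arbitrary: f rule: rev_induct)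
      case (snoc i js)
      have "\<forall>k. Ck k n V (partial_deriv i f)"
        using snoc.prems by (metis Ck.simps(2) UnI2 lessThan_iff list.set_intros(1) set_append subsetD)
      then show ?case using snoc by simp
    qed simp
    then have "Ck (Suc 0) n V (foldr partial_deriv js f)" by blast
    then show "let g = foldr partial_deriv js f in
      continuous_map (subtopology (Euclidean_space n) V) euclideanreal g \<and>
      (\<forall>i<n. \<forall>x\<in>V. (\<lambda>t. g (x(i := t))) differentiable (at (x i)))"
      by (simp add: sub real_differentiable_def)
  qed
qed

lemma Ck_cong:
  assumes "openin (Euclidean_space n) V" "\<And>x. x \<in> V \<Longrightarrow> f x = g x" "Ck k n V f"
  shows "Ck k n V g"
  using assms(2,3)
proof (induction k arbitrary: f g)
  case 0
  then show ?case using continuous_on_cong[of V V f g] by auto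
next
  case (Suc k)
  have "continuous_on V g" using Suc.prems continuous_on_cong[of V V f g] by auto
  moreover have "\<exists>D. has_partial i g x D" if "i < n" "x \<in> V" for i x
    using Suc.prems that has_partial_cong[OF assms(1) that(2,1), of f g] by fastforce
  moreover have "Ck k n V (partial_deriv i g)" if "i < n" for i
  proof (rule Suc.IH)
    show "Ck k n V (partial_deriv i f)" using Suc.prems that by auto
    show "partial_deriv i f x = partial_deriv i g x" if "x \<in> V" for x
      using partial_deriv_cong[OF assms(1) that \<open>i < n\<close>] Suc.prems by blast
  qed
  ultimately show ?case by auto
qed

lemma Ck_SucI:
  assumes "openin (Euclidean_space n) V" "continuous_on V f"
    and "\<And>i. i < n \<Longrightarrow> Ck k n V (g i) \<and> (\<forall>x\<in>V. has_partial i f x (g i x))"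
  shows "Ck (Suc k) n V f"
proof -
  have "Ck k n V (partial_deriv i f)" if "i < n" for i
    using Ck_cong[OF assms(1), of "g i" "partial_deriv i f"] assms(3)[OF that]
    by (metis has_partial_imp_partial_deriv)
  then show ?thesis using assms by (auto simp: Ball_def)
qed

lemma Ck_subset:
  assumes "Ck k n V f" "W \<subseteq> V"
  shows "Ck k n W f"
  using assms by (induction k arbitrary: f) (auto intro: continuous_on_subset)

lemma Ck_const: "openin (Euclidean_space n) V \<Longrightarrow> Ck k n V (\<lambda>x. s)"
proof (induction k arbitrary: s)
  case (Suc k)
  show ?case
    by (rule Ck_SucI[where g = "\<lambda>i x. 0"]) (auto intro!: Suc)
qed auto

lemma Ck_add:
  assumes "openin (Euclidean_space n) V" "Ck k n V f" "Ck k n V g"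
  shows "Ck k n V (\<lambda>x. f x + g x)"
  using assms(2,3)
proof (induction k arbitrary: f g)
  case (Suc k)
  show ?case
  proof (rule Ck_SucI[where g = "\<lambda>i x. partial_deriv i f x + partial_deriv i g x"])
    show "Ck k n V (\<lambda>x. partial_deriv i f x + partial_deriv i g x) \<and>
      (\<forall>x\<in>V. has_partial i (\<lambda>x. f x + g x) x (partial_deriv i f x + partial_deriv i g x))"
      if "i < n" for i
      by (intro conjI ballI DERIV_add Suc.IH Ck_has_partial[OF Suc.prems(1) that]
          Ck_has_partial[OF Suc.prems(2) that] Ck_partial_deriv[OF Suc.prems(1) that]
          Ck_partial_deriv[OF Suc.prems(2) that])
  qed (intro assms(1) continuous_on_add Ck_continuous[OF Suc.prems(1)] Ck_continuous[OF Suc.prems(2)])+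
qed (auto intro: continuous_on_add)

lemma Ck_mult:
  assumes "openin (Euclidean_space n) V" "Ck k n V f" "Ck k n V g"
  shows "Ck k n V (\<lambda>x. f x * g x)"
  using assms(2,3)
proof (induction k arbitrary: f g)
  case (Suc k)
  show ?case
  proof (rule Ck_SucI[where g = "\<lambda>i x. partial_deriv i f x * g x + partial_deriv i g x * f x"])
    fix i assume i: "i < n"
    have "has_partial i (\<lambda>x. f x * g x) x (partial_deriv i f x * g x + partial_deriv i g x * f x)"
      if "x \<in> V" for x
      using DERIV_mult[OF Ck_has_partial[OF Suc.prems(1) i that] Ck_has_partial[OF Suc.prems(2) i that]]
      by (simp add: fun_upd_def)
    moreover have "Ck k n V (\<lambda>x. partial_deriv i f x * g x + partial_deriv i g x * f x)"
      by (intro Ck_add[OF assms(1)] Suc.IH Ck_SucD[OF Suc.prems(1)] Ck_SucD[OF Suc.prems(2)]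
          Ck_partial_deriv[OF Suc.prems(1) i] Ck_partial_deriv[OF Suc.prems(2) i])
    ultimately show "Ck k n V (\<lambda>x. partial_deriv i f x * g x + partial_deriv i g x * f x) \<and>
      (\<forall>x\<in>V. has_partial i (\<lambda>x. f x * g x) x (partial_deriv i f x * g x + partial_deriv i g x * f x))"
      by blast
  qed (intro assms(1) continuous_on_mult Ck_continuous[OF Suc.prems(1)] Ck_continuous[OF Suc.prems(2)])+
qed (auto intro: continuous_on_mult)

lemma Ck_compose_real:
  assumes "openin (Euclidean_space n) V"
    and H: "\<And>h. h \<in> H \<Longrightarrow> \<exists>h'\<in>H. \<forall>t. (h has_real_derivative h' t) (at t)"
    and "h \<in> H" "Ck k n V f"
  shows "Ck k n V (\<lambda>x. h (f x))"
  using assms(3,4)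
proof (induction k arbitrary: h)
  case 0
  obtain h' where "\<And>t. (h has_real_derivative h' t) (at t)" using H[OF 0(1)] by blast
  then have "continuous_on UNIV h" by (meson DERIV_isCont continuous_at_imp_continuous_on)
  then show ?case
    using continuous_on_compose2[of UNIV h V f] 0(2) by simp
next
  case (Suc k)
  obtain h' where h': "h' \<in> H" "\<And>t. (h has_real_derivative h' t) (at t)"
    using H[OF Suc.prems(1)] by blast
  then have "continuous_on UNIV h" by (meson DERIV_isCont continuous_at_imp_continuous_on)
  then have cont: "continuous_on V (\<lambda>x. h (f x))"
    by (rule continuous_on_compose2[OF _ Ck_continuous[OF Suc.prems(2)]]) simp
  show ?case
  proof (rule Ck_SucI[where g = "\<lambda>i x. h' (f x) * partial_deriv i f x", OF assms(1) cont])
    fix i assume i: "i < n"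
    have "has_partial i (\<lambda>x. h (f x)) x (h' (f x) * partial_deriv i f x)" if "x \<in> V" for x
      using DERIV_chain2[OF h'(2) Ck_has_partial[OF Suc.prems(2) i that]] by (simp add: fun_upd_def)
    moreover have "Ck k n V (\<lambda>x. h' (f x) * partial_deriv i f x)"
      by (rule Ck_mult[OF assms(1) Suc.IH[OF h'(1) Ck_SucD[OF Suc.prems(2)]] Ck_partial_deriv[OF Suc.prems(2) i]])
    ultimately show "Ck k n V (\<lambda>x. h' (f x) * partial_deriv i f x) \<and>
      (\<forall>x\<in>V. has_partial i (\<lambda>x. h (f x)) x (h' (f x) * partial_deriv i f x))" by blast
  qed
qed

lemma Ck_Un:
  assumes "openin (Euclidean_space n) V" "openin (Euclidean_space n) W" "Ck k n V f" "Ck k n W f"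
  shows "Ck k n (V \<union> W) f"
proof -
  have "continuous_on (V \<union> W) g" if "continuous_on V g" "continuous_on W g" for g :: "_ \<Rightarrow> real"
  proof (rule continuous_on_Un_local_open[OF _ _ that])
    have sub: "V \<union> W \<subseteq> model_space n"
      using assms(1,2) openin_Euclidean_space_subset by blast
    show "openin (top_of_set (V \<union> W)) V"
      by (rule openin_subset_trans[OF assms(1)[unfolded Euclidean_space_top_of_set] _ sub]) blast
    show "openin (top_of_set (V \<union> W)) W"
      by (rule openin_subset_trans[OF assms(2)[unfolded Euclidean_space_top_of_set] _ sub]) blast
  qed
  then show ?thesis
    using assms(3,4) by (induction k arbitrary: f) auto
qed

lemmas smooth_on_Ck = smooth_on_iff_Ck[THEN iffD1, rule_format]

lemma smooth_on_continuous:
  "openin (Euclidean_space n) V \<Longrightarrow> smooth_on n V f \<Longrightarrow> continuous_on V f"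
  by (metis smooth_on_Ck Ck_continuous)

lemma smooth_on_has_partial:
  "openin (Euclidean_space n) V \<Longrightarrow> smooth_on n V f \<Longrightarrow> i < n \<Longrightarrow> x \<in> V \<Longrightarrow>
    has_partial i f x (partial_deriv i f x)"
  by (rule Ck_has_partial[OF smooth_on_Ck])

text \<open>
  The chain rule: the increment of \<open>f\<close> along the curve is telescoped into increments along the
  coordinate directions, and the mean value theorem is applied to each of them.
\<close>

lemma chain_rule_along_curve:
  fixes g :: "real \<Rightarrow> nat \<Rightarrow> real"
  assumes V: "openin (Euclidean_space n) V"
    and f: "\<And>i x. i < n \<Longrightarrow> x \<in> V \<Longrightarrow> has_partial i f x (partial_deriv i f x)"
      "\<And>i. i < n \<Longrightarrow> continuous_on V (partial_deriv i f)"
    and g: "g t0 \<in> V" "\<forall>\<^sub>F t in nhds t0. g t \<in> model_space n"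
      "\<And>i. i < n \<Longrightarrow> ((\<lambda>t. g t i) has_real_derivative g' i) (at t0)"
  shows "((\<lambda>t. f (g t)) has_real_derivative (\<Sum>i<n. partial_deriv i f (g t0) * g' i)) (at t0)"
proof -
  define a where "a = g t0"
  have am: "a \<in> model_space n" using g(1) V openin_Euclidean_space_subset a_def by blast
  obtain e where e: "e > 0" "\<And>y. y \<in> model_space n \<Longrightarrow> (\<And>i. i < n \<Longrightarrow> \<bar>y i - a i\<bar> < e) \<Longrightarrow> y \<in> V"
    using openin_Euclidean_space_cube[OF V g(1)] unfolding a_def by blast
  define z where "z k t = (\<lambda>i. if i < k then g t i else a i)" for k t
  define near where "near t \<longleftrightarrow> g t \<in> model_space n \<and> (\<forall>i<n. \<bar>g t i - a i\<bar> < e)" for t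
  have gi: "((\<lambda>t. g t i) \<longlongrightarrow> a i) (at t0)" if "i < n" for i
    using g(3)[OF that] unfolding a_def by (meson DERIV_isCont isContD)
  have "\<forall>\<^sub>F t in at t0. \<forall>i\<in>{..<n}. \<bar>g t i - a i\<bar> < e"
  proof (rule eventually_ball_finite)
    show "\<forall>i\<in>{..<n}. \<forall>\<^sub>F t in at t0. \<bar>g t i - a i\<bar> < e"
      using gi e(1) by (auto simp: tendsto_iff dist_real_def)
  qed simp
  then have near: "\<forall>\<^sub>F t in at t0. near t"
    using g(2) unfolding near_def eventually_at_filter
    by eventually_elim auto
  have step: "\<exists>s. \<bar>s - a k\<bar> \<le> \<bar>g t k - a k\<bar> \<and>
      f (z (Suc k) t) - f (z k t) = partial_deriv k f ((z k t)(k := s)) * (g t k - a k)"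
    if "near t" "k < n" for t k
  proof -
    have inV: "(z k t)(k := s) \<in> V" if "\<bar>s - a k\<bar> \<le> \<bar>g t k - a k\<bar>" for s
      using \<open>near t\<close> \<open>k < n\<close> that am e(1) unfolding near_def z_def
      by (intro e(2)) (auto intro: le_less_trans)
    have D: "((\<lambda>s. f ((z k t)(k := s))) has_real_derivative partial_deriv k f ((z k t)(k := s))) (at s)"
      if "\<bar>s - a k\<bar> \<le> \<bar>g t k - a k\<bar>" for s
      using f(1)[OF \<open>k < n\<close> inV[OF that]] by simp
    have z1: "z (Suc k) t = (z k t)(k := g t k)" by (auto simp: z_def fun_eq_iff less_Suc_eq)
    have z0: "z k t = (z k t)(k := a k)" by (auto simp: z_def)
    consider "g t k = a k" | "a k < g t k" | "g t k < a k" by linarith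
    then show ?thesis
    proof cases
      case 1
      then show ?thesis using z0 z1 by (intro exI[of _ "a k"]) auto
    next
      case 2
      obtain s where "a k < s" "s < g t k" "f ((z k t)(k := g t k)) - f ((z k t)(k := a k))
          = (g t k - a k) * partial_deriv k f ((z k t)(k := s))"
        using MVT2[OF 2, of "\<lambda>s. f ((z k t)(k := s))" "\<lambda>s. partial_deriv k f ((z k t)(k := s))"] D
        by auto
      then show ?thesis using z0 z1 by (intro exI[of _ s]) (auto simp: mult.commute)
    next
      case 3
      obtain s where "g t k < s" "s < a k" "f ((z k t)(k := a k)) - f ((z k t)(k := g t k))
          = (a k - g t k) * partial_deriv k f ((z k t)(k := s))"
        using MVT2[OF 3, of "\<lambda>s. f ((z k t)(k := s))" "\<lambda>s. partial_deriv k f ((z k t)(k := s))"] D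
        by auto
      then show ?thesis using z0 z1
        by (intro exI[of _ s]) (auto simp: algebra_simps)
    qed
  qed
  then obtain s where s: "\<And>t k. near t \<Longrightarrow> k < n \<Longrightarrow> \<bar>s t k - a k\<bar> \<le> \<bar>g t k - a k\<bar> \<and>
      f (z (Suc k) t) - f (z k t) = partial_deriv k f ((z k t)(k := s t k)) * (g t k - a k)"
    by metis
  have tele: "f (g t) - f a = (\<Sum>k<n. partial_deriv k f ((z k t)(k := s t k)) * (g t k - a k))"
    if "near t" for t
  proof -
    have "z n t = g t" using that am by (auto simp: z_def near_def fun_eq_iff)
    moreover have "z 0 t = a" by (auto simp: z_def)
    ultimately have "f (g t) - f a = (\<Sum>k<n. f (z (Suc k) t) - f (z k t))"
      using sum_lessThan_telescope[of "\<lambda>k. f (z k t)" n] by simp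
    also have "\<dots> = (\<Sum>k<n. partial_deriv k f ((z k t)(k := s t k)) * (g t k - a k))"
      using s[OF that] by (intro sum.cong) auto
    finally show ?thesis .
  qed
  have lim: "((\<lambda>t. partial_deriv k f ((z k t)(k := s t k))) \<longlongrightarrow> partial_deriv k f a) (at t0)"
    if k: "k < n" for k
  proof (rule continuous_on_tendsto_compose[OF f(2)[OF k]])
    show "a \<in> V" using g(1) a_def by simp
    show "\<forall>\<^sub>F t in at t0. (z k t)(k := s t k) \<in> V"
      using near
    proof eventually_elim
      case (elim t)
      then show ?case
        using s[OF elim k] am k e(1) unfolding near_def z_def
        by (intro e(2)) (auto intro: le_less_trans)
    qed
    have "((\<lambda>t. ((z k t)(k := s t k)) i) \<longlongrightarrow> a i) (at t0)" for i
    proof (cases "i = k")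
      case True
      have "((\<lambda>t. \<bar>g t k - a k\<bar>) \<longlongrightarrow> 0) (at t0)"
        using gi[OF k] by (metis LIM_zero_iff tendsto_rabs_zero)
      then have "((\<lambda>t. s t k - a k) \<longlongrightarrow> 0) (at t0)"
      proof (rule Lim_null_comparison[rotated])
        show "\<forall>\<^sub>F t in at t0. norm (s t k - a k) \<le> \<bar>g t k - a k\<bar>"
          using near by eventually_elim (use s k in auto)
      qed
      then show ?thesis using True by (simp add: LIM_zero_iff)
    next
      case False
      then show ?thesis
        using gi k by (cases "i < k") (auto simp: z_def)
    qed
    then show "((\<lambda>t. (z k t)(k := s t k)) \<longlongrightarrow> a) (at t0)"
      using limitin_componentwise[of "\<lambda>i. euclideanreal" UNIV "\<lambda>t. (z k t)(k := s t k)" a "at t0"]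
      by (simp add: euclidean_product_topology)
  qed
  have "((\<lambda>t. \<Sum>k<n. partial_deriv k f ((z k t)(k := s t k)) * ((g t k - a k) / (t - t0)))
      \<longlongrightarrow> (\<Sum>k<n. partial_deriv k f a * g' k)) (at t0)"
    using g(3) by (intro tendsto_sum tendsto_mult lim) (auto simp: has_field_derivative_iff a_def)
  moreover have "\<forall>\<^sub>F t in at t0. (\<Sum>k<n. partial_deriv k f ((z k t)(k := s t k)) * ((g t k - a k) / (t - t0)))
      = (f (g t) - f (g t0)) / (t - t0)"
    using near by eventually_elim (simp add: tele sum_divide_distrib flip: a_def)
  ultimately show ?thesis
    unfolding has_field_derivative_iff a_def by (rule Lim_transform_eventually)
qed

text \<open>
  The functions \<open>t \<mapsto> P(1/t) exp(-1/t)\<close> for \<open>t > 0\<close>, extended by \<open>0\<close>; this family contains the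
  derivatives of its members, hence consists of smooth functions.
\<close>

definition flat_exp :: "real poly \<Rightarrow> real \<Rightarrow> real" where
  "flat_exp P t = (if t > 0 then poly P (1 / t) * exp (- (1 / t)) else 0)"

lemma poly_times_exp_tendsto_0:
  "((\<lambda>x::real. poly P x * exp (- x)) \<longlongrightarrow> 0) at_top"
proof -
  have eq: "(\<lambda>x::real. poly P x * exp (- x)) = (\<lambda>x. \<Sum>i\<le>degree P. coeff P i * (x ^ i / exp x))"
    by (simp add: fun_eq_iff poly_altdef sum_distrib_right exp_minus divide_inverse mult.assoc)
  have "((\<lambda>x::real. \<Sum>i\<le>degree P. coeff P i * (x ^ i / exp x)) \<longlongrightarrow> (\<Sum>i\<le>degree P. coeff P i * 0)) at_top"
    by (intro tendsto_sum tendsto_mult tendsto_const tendsto_power_div_exp_0)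
  then show ?thesis unfolding eq by simp
qed

lemma flat_exp_derivative:
  "(flat_exp P has_real_derivative flat_exp ([:0, 0, 1:] * (P - pderiv P)) t) (at t)"
proof -
  consider "t > 0" | "t < 0" | "t = 0" by linarith
  then show ?thesis
  proof cases
    case 1
    have inv: "((\<lambda>t. 1 / t) has_real_derivative - (1 / t\<^sup>2)) (at t)"
      using DERIV_inverse[of t UNIV] 1 by (simp add: divide_inverse power2_eq_square)
    have "((\<lambda>t. poly P (1 / t)) has_real_derivative poly (pderiv P) (1 / t) * - (1 / t\<^sup>2)) (at t)"
      by (rule DERIV_chain2[OF poly_DERIV inv])
    moreover have "((\<lambda>t. exp (- (1 / t))) has_real_derivative exp (- (1 / t)) * - (- (1 / t\<^sup>2))) (at t)"
      by (rule DERIV_chain2[OF DERIV_exp DERIV_minus[OF inv]])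
    ultimately have "((\<lambda>t. poly P (1 / t) * exp (- (1 / t))) has_real_derivative
        poly (pderiv P) (1 / t) * - (1 / t\<^sup>2) * exp (- (1 / t))
        + exp (- (1 / t)) * - (- (1 / t\<^sup>2)) * poly P (1 / t)) (at t)"
      by (rule DERIV_mult)
    also have "poly (pderiv P) (1 / t) * - (1 / t\<^sup>2) * exp (- (1 / t))
        + exp (- (1 / t)) * - (- (1 / t\<^sup>2)) * poly P (1 / t)
        = flat_exp ([:0, 0, 1:] * (P - pderiv P)) t"
      using 1 by (simp add: flat_exp_def power2_eq_square algebra_simps)
    finally have "((\<lambda>t. poly P (1 / t) * exp (- (1 / t))) has_real_derivative
        flat_exp ([:0, 0, 1:] * (P - pderiv P)) t) (at t)" .
    moreover have "\<forall>\<^sub>F s in nhds t. flat_exp P s = poly P (1 / s) * exp (- (1 / s))"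
      using eventually_nhds_in_open[of "{0<..}" t] 1 by (auto elim!: eventually_mono simp: flat_exp_def)
    ultimately show ?thesis by (rule DERIV_cong_ev[OF refl _ refl, THEN iffD2, rotated])
  next
    case 2
    have "((\<lambda>t::real. 0::real) has_real_derivative 0) (at t)" by simp
    moreover have "\<forall>\<^sub>F s in nhds t. flat_exp P s = 0"
      using eventually_nhds_in_open[of "{..<0}" t] 2 by (auto elim!: eventually_mono simp: flat_exp_def)
    ultimately have "(flat_exp P has_real_derivative 0) (at t)"
      by (rule DERIV_cong_ev[OF refl _ refl, THEN iffD2, rotated])
    then show ?thesis using 2 by (simp add: flat_exp_def)
  next
    case 3
    have "((\<lambda>s. poly ([:0, 1:] * P) s * exp (- s)) \<longlongrightarrow> 0) at_top"
      by (rule poly_times_exp_tendsto_0)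
    then have "((\<lambda>s. poly ([:0, 1:] * P) (1 / s) * exp (- (1 / s))) \<longlongrightarrow> 0) (at_right 0)"
      by (rule filterlim_compose) (simp add: filterlim_inverse_at_top_right flip: inverse_eq_divide)
    then have R: "((\<lambda>s. flat_exp P s / s) \<longlongrightarrow> 0) (at_right 0)"
    proof (rule Lim_transform_eventually)
      show "\<forall>\<^sub>F s in at_right 0. poly ([:0, 1:] * P) (1 / s) * exp (- (1 / s)) = flat_exp P s / s"
        by (auto simp: eventually_at_filter flat_exp_def)
    qed
    have L: "((\<lambda>s. flat_exp P s / s) \<longlongrightarrow> 0) (at_left 0)"
      by (rule Lim_transform_eventually[of "\<lambda>_. 0"]) (auto simp: eventually_at_filter flat_exp_def)
    show ?thesis
      using filterlim_split_at[OF L R] 3 by (simp add: has_field_derivative_iff flat_exp_def)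
  qed
qed

section \<open>The algebra of polynomials in odd generators\<close>

notation gmult (infixl "\<otimes>" 70)
notation gscale (infixr "*\<^sub>g" 75)

definition gmono :: "nat set \<Rightarrow> gpoly" where
  "gmono J = (\<lambda>JK. if JK = (J, {#}) then 1 else 0)"

definition ginv :: "gpoly \<Rightarrow> gpoly" where
  "ginv f = (\<lambda>(J, K). (-1) ^ card J * f (J, K))"

definition ext_poly :: "nat set \<Rightarrow> gpoly set" where
  "ext_poly S = {f. \<forall>J K. f (J, K) \<noteq> 0 \<longrightarrow> K = {#} \<and> J \<subseteq> S \<and> finite J}"

lemma gone_eq_gmono: "gone = gmono {}" by (simp add: gone_def gmono_def)
lemma godd_eq_gmono: "godd j = gmono {j}" by (simp add: godd_def gmono_def)

lemma fun_sum_apply: "(\<Sum>i\<in>A. F i) x = (\<Sum>i\<in>A. F i x)" for F :: "'i \<Rightarrow> 'b \<Rightarrow> 'c::comm_monoid_add"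
  by (induction A rule: infinite_finite_induct) auto

lemma gscale_apply: "(s *\<^sub>g f) x = s * f x" by (simp add: gscale_def)
lemma gscale_add [simp]: "s *\<^sub>g (f + g) = s *\<^sub>g f + s *\<^sub>g g"
  by (simp add: gscale_def fun_eq_iff algebra_simps)
lemma gscale_diff [simp]: "s *\<^sub>g (f - g) = s *\<^sub>g f - s *\<^sub>g g"
  by (simp add: gscale_def fun_eq_iff algebra_simps)
lemma gscale_minus [simp]: "s *\<^sub>g (- f) = - (s *\<^sub>g f)" by (simp add: gscale_def fun_eq_iff)
lemma gscale_minus_left [simp]: "(- s) *\<^sub>g f = - (s *\<^sub>g f)" by (simp add: gscale_def fun_eq_iff)
lemma gscale_gscale [simp]: "s *\<^sub>g t *\<^sub>g f = (s * t) *\<^sub>g f" by (simp add: gscale_def fun_eq_iff)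
lemma gscale_1 [simp]: "1 *\<^sub>g f = f" by (simp add: gscale_def)
lemma gscale_0_left [simp]: "0 *\<^sub>g f = 0" by (simp add: gscale_def fun_eq_iff)
lemma gscale_0 [simp]: "s *\<^sub>g 0 = 0" by (simp add: gscale_def fun_eq_iff)
lemma gscale_add_left: "(s + t) *\<^sub>g f = s *\<^sub>g f + t *\<^sub>g f"
  by (simp add: gscale_def fun_eq_iff algebra_simps)
lemma gscale_sum: "s *\<^sub>g (\<Sum>i\<in>A. F i) = (\<Sum>i\<in>A. s *\<^sub>g F i)"
  by (simp add: fun_eq_iff gscale_apply fun_sum_apply sum_distrib_left)
lemma gscale_sum_left: "(\<Sum>i\<in>A. s i) *\<^sub>g f = (\<Sum>i\<in>A. s i *\<^sub>g f)"
  by (simp add: fun_eq_iff gscale_apply fun_sum_apply sum_distrib_right)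

lemma gmult_add_left [simp]: "(f + f') \<otimes> g = f \<otimes> g + f' \<otimes> g"
  by (simp add: gmult_def fun_eq_iff algebra_simps sum.distrib)
lemma gmult_add_right [simp]: "f \<otimes> (g + g') = f \<otimes> g + f \<otimes> g'"
  by (simp add: gmult_def fun_eq_iff algebra_simps sum.distrib)
lemma gmult_scale_left [simp]: "(s *\<^sub>g f) \<otimes> g = s *\<^sub>g (f \<otimes> g)"
  by (simp add: gmult_def fun_eq_iff algebra_simps sum_distrib_left gscale_apply)
lemma gmult_scale_right [simp]: "f \<otimes> (s *\<^sub>g g) = s *\<^sub>g (f \<otimes> g)"
  by (simp add: gmult_def fun_eq_iff algebra_simps sum_distrib_left gscale_apply)
lemma gmult_0_left [simp]: "0 \<otimes> g = 0" by (simp add: gmult_def fun_eq_iff)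
lemma gmult_0_right [simp]: "g \<otimes> 0 = 0" by (simp add: gmult_def fun_eq_iff)
lemma gmult_minus_left [simp]: "(- f) \<otimes> g = - (f \<otimes> g)"
  by (simp add: gmult_def fun_eq_iff sum_negf)
lemma gmult_minus_right [simp]: "f \<otimes> (- g) = - (f \<otimes> g)"
  by (simp add: gmult_def fun_eq_iff sum_negf)
lemma gmult_diff_left [simp]: "(f - f') \<otimes> g = f \<otimes> g - f' \<otimes> g"
  using gmult_add_left[of f "- f'" g] by simp
lemma gmult_diff_right [simp]: "f \<otimes> (g - g') = f \<otimes> g - f \<otimes> g'"
  using gmult_add_right[of f g "- g'"] by simp
lemma gmult_sum_left: "(\<Sum>i\<in>A. F i) \<otimes> g = (\<Sum>i\<in>A. F i \<otimes> g)"
  by (induction A rule: infinite_finite_induct) (simp_all del: zero_fun_apply plus_fun_apply)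
lemma gmult_sum_right: "g \<otimes> (\<Sum>i\<in>A. F i) = (\<Sum>i\<in>A. g \<otimes> F i)"
  by (induction A rule: infinite_finite_induct) (simp_all del: zero_fun_apply plus_fun_apply)

lemma ext_polyD: "f \<in> ext_poly S \<Longrightarrow> f (J, K) \<noteq> 0 \<Longrightarrow> K = {#} \<and> J \<subseteq> S \<and> finite J"
  by (simp add: ext_poly_def)

lemma ext_poly_mono: "f \<in> ext_poly S \<Longrightarrow> S \<subseteq> T \<Longrightarrow> f \<in> ext_poly T"
  by (fastforce simp: ext_poly_def)

lemma ext_poly_0 [simp]: "0 \<in> ext_poly S" by (simp add: ext_poly_def)
lemma ext_poly_add [simp]: "f \<in> ext_poly S \<Longrightarrow> g \<in> ext_poly S \<Longrightarrow> f + g \<in> ext_poly S"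
  by (simp add: ext_poly_def) (metis add.right_neutral)
lemma ext_poly_scale [simp]: "f \<in> ext_poly S \<Longrightarrow> s *\<^sub>g f \<in> ext_poly S"
  unfolding ext_poly_def gscale_apply by simp blast
lemma ext_poly_minus [simp]: "f \<in> ext_poly S \<Longrightarrow> - f \<in> ext_poly S"
  by (simp add: ext_poly_def)
lemma ext_poly_diff [simp]: "f \<in> ext_poly S \<Longrightarrow> g \<in> ext_poly S \<Longrightarrow> f - g \<in> ext_poly S"
  using ext_poly_add[of f S "- g"] by simp
lemma ext_poly_sum [simp]: "(\<And>i. i \<in> A \<Longrightarrow> F i \<in> ext_poly S) \<Longrightarrow> (\<Sum>i\<in>A. F i) \<in> ext_poly S"
  by (induction A rule: infinite_finite_induct) (simp_all del: zero_fun_apply plus_fun_apply)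
lemma ext_poly_gmono: "J \<subseteq> S \<Longrightarrow> finite J \<Longrightarrow> gmono J \<in> ext_poly S"
  by (simp add: ext_poly_def gmono_def)
lemma ext_poly_gone [simp]: "gone \<in> ext_poly S"
  by (simp add: gone_eq_gmono ext_poly_gmono)
lemma ext_poly_godd [simp]: "j \<in> S \<Longrightarrow> godd j \<in> ext_poly S"
  by (simp add: godd_eq_gmono ext_poly_gmono)
lemma ext_poly_ginv [simp]: "f \<in> ext_poly S \<Longrightarrow> ginv f \<in> ext_poly S"
  by (simp add: ext_poly_def ginv_def)

text \<open>
  Polynomials are functions, but from here on they are treated as elements of a module: the pointwise
  evaluation rules would tear sums apart.
\<close>

lemmas fun_app = plus_fun_apply zero_fun_apply minus_apply uminus_apply
declare fun_app [simp del]

subsection \<open>Signs\<close>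

lemma finite_inversions: "finite J \<Longrightarrow> finite L \<Longrightarrow> finite {(a, b). a \<in> J \<and> b \<in> L \<and> b < (a::nat)}"
  by (rule finite_subset[of _ "J \<times> L"]) auto

lemma osign_empty [simp]: "osign {} L = 1" "osign J {} = 1"
  by (simp_all add: osign_def)

lemma osign_singletons: "osign {a} {b} = (if b < a then - 1 else 1)"
proof -
  have "{(x, y). x \<in> {a} \<and> y \<in> {b} \<and> y < x} = (if b < a then {(a, b)} else {})" by auto
  then show ?thesis by (simp add: osign_def)
qed

lemma osign_square [simp]: "osign A B * osign A B = 1" "osign A B * (osign A B * s) = s"
  by (simp_all add: osign_def flip: power_add mult.assoc)

lemma osign_Un_left:
  assumes "finite A" "finite B" "finite C" "A \<inter> B = {}"
  shows "osign (A \<union> B) C = osign A C * osign B C"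
proof -
  have "{(a, b). a \<in> A \<union> B \<and> b \<in> C \<and> b < a} =
      {(a, b). a \<in> A \<and> b \<in> C \<and> b < a} \<union> {(a, b). a \<in> B \<and> b \<in> C \<and> b < a}" by auto
  then show ?thesis
    unfolding osign_def power_add[symmetric] using assms
    by (subst card_Un_disjoint[symmetric]) (auto intro: finite_inversions)
qed

lemma osign_Un_right:
  assumes "finite A" "finite B" "finite C" "B \<inter> C = {}"
  shows "osign A (B \<union> C) = osign A B * osign A C"
proof -
  have "{(a, b). a \<in> A \<and> b \<in> B \<union> C \<and> b < a} =
      {(a, b). a \<in> A \<and> b \<in> B \<and> b < a} \<union> {(a, b). a \<in> A \<and> b \<in> C \<and> b < a}" by auto
  then show ?thesis
    unfolding osign_def power_add[symmetric] using assms
    by (subst card_Un_disjoint[symmetric]) (auto intro: finite_inversions)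
qed

lemma osign_insert_right:
  "finite A \<Longrightarrow> finite B \<Longrightarrow> b \<notin> B \<Longrightarrow> osign A (insert b B) = osign A {b} * osign A B"
  using osign_Un_right[of A "{b}" B] by simp

lemma osign_insert_left:
  "finite A \<Longrightarrow> finite B \<Longrightarrow> a \<notin> A \<Longrightarrow> osign (insert a A) B = osign {a} B * osign A B"
  using osign_Un_left[of "{a}" A B] by simp

lemma osign_swap:
  assumes "finite A" "finite B" "A \<inter> B = {}"
  shows "osign A B = (-1) ^ (card A * card B) * osign B A"
proof -
  have "A \<times> B = {(a, b). a \<in> A \<and> b \<in> B \<and> b < a} \<union> prod.swap ` {(b, a). b \<in> B \<and> a \<in> A \<and> a < b}"
  proof -
    have "x < y \<or> y < x" if "x \<in> A" "y \<in> B" for x y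
      using that assms(3) by (metis disjoint_iff nat_neq_iff)
    then show ?thesis by (auto simp: image_iff) blast
  qed
  then have "card A * card B = card {(a, b). a \<in> A \<and> b \<in> B \<and> b < a}
      + card (prod.swap ` {(b, a). b \<in> B \<and> a \<in> A \<and> a < b})"
    using assms by (subst card_cartesian_product[symmetric], simp, intro card_Un_disjoint)
      (auto intro: finite_inversions)
  also have "card (prod.swap ` {(b, a). b \<in> B \<and> a \<in> A \<and> a < b}) = card {(b, a). b \<in> B \<and> a \<in> A \<and> a < b}"
    by (rule card_image) (auto simp: inj_on_def)
  finally have e: "card A * card B = card {(a, b). a \<in> A \<and> b \<in> B \<and> b < a}
      + card {(b, a). b \<in> B \<and> a \<in> A \<and> a < b}" .
  have s: "(-1::real) ^ k * (-1) ^ k = 1" for k :: nat by (simp flip: power_add)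
  show ?thesis unfolding e osign_def power_add by (simp add: s mult.assoc)
qed

subsection \<open>Associativity and commutativity\<close>

lemma finite_submultisets: "finite {K'. K' \<subseteq># (K :: 'x multiset)}"
proof (rule finite_subset)
  show "{K'. K' \<subseteq># K} \<subseteq> mset ` {xs. set xs \<subseteq> set_mset K \<and> length xs \<le> size K}"
  proof
    fix L assume "L \<in> {K'. K' \<subseteq># K}"
    moreover obtain xs where "L = mset xs" using ex_mset by metis
    ultimately show "L \<in> mset ` {xs. set xs \<subseteq> set_mset K \<and> length xs \<le> size K}"
      using set_mset_mono[of L K] size_mset_mono[of L K] by auto
  qed
  show "finite (mset ` {xs. set xs \<subseteq> set_mset K \<and> length xs \<le> size K})"
    by (intro finite_imageI finite_lists_length_le) simp
qed

lemma gmult_ext_apply: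
  assumes "f \<in> ext_poly S"
  shows "(f \<otimes> g) (J, K) = (\<Sum>J'\<in>Pow J. osign J' (J - J') * f (J', {#}) * g (J - J', K))"
proof -
  have "(\<Sum>K'\<in>{K'. K' \<subseteq># K}. osign J' (J - J') * f (J', K') * g (J - J', K - K'))
      = osign J' (J - J') * f (J', {#}) * g (J - J', K)" for J'
  proof -
    have "(\<Sum>K'\<in>{K'. K' \<subseteq># K}. osign J' (J - J') * f (J', K') * g (J - J', K - K'))
        = (\<Sum>K'\<in>{{#}}. osign J' (J - J') * f (J', K') * g (J - J', K - K'))"
      using assms by (intro sum.mono_neutral_right finite_submultisets) (auto dest: ext_polyD)
    then show ?thesis by simp
  qed
  then show ?thesis unfolding gmult_def by simp
qed

lemma ext_poly_gmult [simp]: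
  assumes "f \<in> ext_poly S" "g \<in> ext_poly S"
  shows "f \<otimes> g \<in> ext_poly S"
  unfolding ext_poly_def mem_Collect_eq
proof (intro allI impI)
  fix J K assume "(f \<otimes> g) (J, K) \<noteq> 0"
  then obtain J' where J': "J' \<in> Pow J" "osign J' (J - J') * f (J', {#}) * g (J - J', K) \<noteq> 0"
    unfolding gmult_ext_apply[OF assms(1)] by (rule sum.not_neutral_contains_not_neutral)
  then have "f (J', {#}) \<noteq> 0" "g (J - J', K) \<noteq> 0" by auto
  from ext_polyD[OF assms(1) this(1)] ext_polyD[OF assms(2) this(2)] J'(1)
  show "K = {#} \<and> J \<subseteq> S \<and> finite J" by auto
qed

text \<open>
  Both sides sum over the ordered partitions of \<open>J\<close> into three parts; the signs agree since \<open>osign\<close>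
  is multiplicative in each argument.
\<close>

lemma gmult_assoc:
  assumes f: "f \<in> ext_poly S" and g: "g \<in> ext_poly T"
  shows "f \<otimes> g \<otimes> h = f \<otimes> (g \<otimes> h)"
proof (rule ext, clarify)
  fix J and K :: "nat multiset"
  have f': "f \<in> ext_poly (S \<union> T)" and g': "g \<in> ext_poly (S \<union> T)"
    using f g by (auto intro: ext_poly_mono)
  show "(f \<otimes> g \<otimes> h) (J, K) = (f \<otimes> (g \<otimes> h)) (J, K)"
  proof (cases "finite J")
    case False
    then show ?thesis using f' g' by (simp add: gmult_ext_apply[OF ext_poly_gmult] gmult_ext_apply[OF f'])
  next
    case True
    have "(f \<otimes> g \<otimes> h) (J, K) = (\<Sum>M\<in>Pow J. \<Sum>L\<in>Pow M.
        osign M (J - M) * (osign L (M - L) * f (L, {#}) * g (M - L, {#})) * h (J - M, K))"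
      by (simp add: gmult_ext_apply[OF ext_poly_gmult[OF f' g']] gmult_ext_apply[OF f']
          sum_distrib_left sum_distrib_right)
    also have "\<dots> = (\<Sum>(M, L)\<in>Sigma (Pow J) Pow.
        osign M (J - M) * (osign L (M - L) * f (L, {#}) * g (M - L, {#})) * h (J - M, K))"
      using True by (intro sum.Sigma) (auto intro: finite_subset)
    also have "\<dots> = (\<Sum>(L, N)\<in>Sigma (Pow J) (\<lambda>L. Pow (J - L)).
        osign L (J - L) * f (L, {#}) * (osign N (J - L - N) * g (N, {#}) * h (J - L - N, K)))"
    proof (rule sum.reindex_bij_witness[of _ "\<lambda>(L, N). (L \<union> N, L)" "\<lambda>(M, L). (L, M - L)"])
      fix p assume p: "p \<in> Sigma (Pow J) Pow"
      obtain M L where pe: "p = (M, L)" by force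
      have fin: "finite L" "finite (M - L)" "finite (J - M)"
        using p True unfolding pe by (auto intro: finite_subset)
      have M: "M = L \<union> (M - L)" and JL: "J - L = (M - L) \<union> (J - M)" and d: "J - L - (M - L) = J - M"
        using p unfolding pe by auto
      have "osign M (J - M) = osign L (J - M) * osign (M - L) (J - M)"
        by (subst M, rule osign_Un_left) (use fin in auto)
      moreover have "osign L (J - L) = osign L (M - L) * osign L (J - M)"
        by (subst JL, rule osign_Un_right) (use fin in auto)
      ultimately show "(case case p of (M, L) \<Rightarrow> (L, M - L) of (L, N) \<Rightarrow>
          osign L (J - L) * f (L, {#}) * (osign N (J - L - N) * g (N, {#}) * h (J - L - N, K))) =
        (case p of (M, L) \<Rightarrow> osign M (J - M) * (osign L (M - L) * f (L, {#}) * g (M - L, {#})) * h (J - M, K))"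
        unfolding pe by (simp add: d)
    qed auto
    also have "\<dots> = (\<Sum>L\<in>Pow J. \<Sum>N\<in>Pow (J - L).
        osign L (J - L) * f (L, {#}) * (osign N (J - L - N) * g (N, {#}) * h (J - L - N, K)))"
      using True by (intro sum.Sigma[symmetric]) auto
    also have "\<dots> = (f \<otimes> (g \<otimes> h)) (J, K)"
      by (simp add: gmult_ext_apply[OF f] gmult_ext_apply[OF g] sum_distrib_left)
    finally show ?thesis .
  qed
qed

lemma gmult_commute_aux:
  assumes f: "f \<in> ext_poly S" and g: "g \<in> ext_poly T"
    and s: "\<And>J L. finite J \<Longrightarrow> finite L \<Longrightarrow> f (J, {#}) * g (L, {#}) * (-1) ^ (card J * card L) = s L * (f (J, {#}) * g (L, {#}))"
  shows "f \<otimes> g = (\<lambda>(L, K). s L * g (L, K)) \<otimes> f"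
proof (rule ext, clarify)
  fix J and K :: "nat multiset"
  have g': "(\<lambda>(L, K). s L * g (L, K)) \<in> ext_poly T"
    using g unfolding ext_poly_def by simp blast
  show "(f \<otimes> g) (J, K) = ((\<lambda>(L, K). s L * g (L, K)) \<otimes> f) (J, K)"
  proof (cases "finite J \<and> K = {#}")
    case False
    have "f \<in> ext_poly (S \<union> T)" "(\<lambda>(L, K). s L * g (L, K)) \<in> ext_poly (S \<union> T)" "g \<in> ext_poly (S \<union> T)"
      using f g g' by (auto intro: ext_poly_mono)
    then have "f \<otimes> g \<in> ext_poly (S \<union> T)" "(\<lambda>(L, K). s L * g (L, K)) \<otimes> f \<in> ext_poly (S \<union> T)"
      by simp_all
    then have "(f \<otimes> g) (J, K) = 0" "((\<lambda>(L, K). s L * g (L, K)) \<otimes> f) (J, K) = 0"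
      using ext_polyD False by blast+
    then show ?thesis by simp
  next
    case True
    show ?thesis
      unfolding gmult_ext_apply[OF f] gmult_ext_apply[OF g']
    proof (rule sum.reindex_bij_witness[of _ "\<lambda>L. J - L" "\<lambda>L. J - L"])
      fix L assume L: "L \<in> Pow J"
      then have fin: "finite L" "finite (J - L)" using True by (auto intro: finite_subset)
      have JJ: "J - (J - L) = L" using L by auto
      show "osign (J - L) (J - (J - L)) * (case (J - L, {#}) of (L, K) \<Rightarrow> s L * g (L, K)) * f (J - (J - L), K)
          = osign L (J - L) * f (L, {#}) * g (J - L, K)"
      proof -
        have "osign L (J - L) * f (L, {#}) * g (J - L, {#})
            = osign (J - L) L * (f (L, {#}) * g (J - L, {#}) * (-1) ^ (card L * card (J - L)))"
          using osign_swap[OF fin] by simp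
        also have "\<dots> = osign (J - L) L * (s (J - L) * (f (L, {#}) * g (J - L, {#})))"
          by (simp only: s[OF fin])
        finally show ?thesis using True by (auto simp: JJ)
      qed
    qed auto
  qed
qed

lemma gmult_even_commute:
  assumes "f \<in> ext_poly S" "g \<in> ext_poly T" "ginv f = f"
  shows "f \<otimes> g = g \<otimes> f"
proof -
  have c: "f (J, {#}) * (-1) ^ (card J * card L) = f (J, {#})" for J L
    using fun_cong[OF assms(3), of "(J, {#})"]
    by (cases "even (card J)") (auto simp: ginv_def)
  have "f \<otimes> g = (\<lambda>(L, K). 1 * g (L, K)) \<otimes> f"
    by (intro gmult_commute_aux[OF assms(1,2)]) (simp only: mult.commute[of _ "g _"] mult.assoc mult_1 c)
  then show ?thesis by simp
qed

lemma gmult_odd_commute: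
  assumes "f \<in> ext_poly S" "g \<in> ext_poly T" "ginv f = - f"
  shows "f \<otimes> g = ginv g \<otimes> f"
proof -
  have c: "f (J, {#}) * (-1) ^ (card J * card L) = (-1) ^ card L * f (J, {#})" for J L
    using fun_cong[OF assms(3), of "(J, {#})"]
    by (cases "even (card J)") (auto simp: ginv_def power_mult fun_app)
  have "f \<otimes> g = (\<lambda>(L, K). (-1) ^ card L * g (L, K)) \<otimes> f"
    by (intro gmult_commute_aux[OF assms(1,2)]) (simp only: mult.commute[of _ "g _"] mult.assoc mult.left_commute[of _ "g _"] c)
  then show ?thesis by (simp add: ginv_def)
qed

lemma gmult_gone_left [simp]:
  assumes "\<And>J K. g (J, K) \<noteq> 0 \<Longrightarrow> finite J"
  shows "gone \<otimes> g = g"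
proof (rule ext, clarify)
  fix J and K :: "nat multiset"
  have e: "gone \<in> ext_poly {}" by simp
  show "(gone \<otimes> g) (J, K) = g (J, K)"
  proof (cases "finite J")
    case True
    have "(gone \<otimes> g) (J, K) = (\<Sum>J'\<in>{{}}. osign J' (J - J') * gone (J', {#}) * g (J - J', K))"
      unfolding gmult_ext_apply[OF e] using True
      by (intro sum.mono_neutral_right) (auto simp: gone_def)
    then show ?thesis by (simp add: gone_def)
  next
    case False
    then show ?thesis using assms[of J K] by (auto simp: gmult_ext_apply[OF e])
  qed
qed

lemma ginv_gone [simp]: "ginv gone = gone"
  by (auto simp: ginv_def gone_def fun_eq_iff fun_app)
lemma ginv_godd [simp]: "ginv (godd k) = - godd k"
  by (auto simp: ginv_def godd_def fun_eq_iff fun_app)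
lemma ginv_add [simp]: "ginv (f + g) = ginv f + ginv g" by (simp add: ginv_def fun_eq_iff fun_app algebra_simps)
lemma ginv_diff [simp]: "ginv (f - g) = ginv f - ginv g" by (simp add: ginv_def fun_eq_iff fun_app algebra_simps)
lemma ginv_minus [simp]: "ginv (- f) = - ginv f" by (simp add: ginv_def fun_eq_iff fun_app)
lemma ginv_scale [simp]: "ginv (s *\<^sub>g f) = s *\<^sub>g ginv f" by (simp add: ginv_def gscale_def fun_eq_iff fun_app)
lemma ginv_0 [simp]: "ginv 0 = 0" by (simp add: ginv_def fun_eq_iff fun_app)
lemma ginv_ginv [simp]: "ginv (ginv f) = f"
  by (simp add: ginv_def fun_eq_iff fun_app flip: power_add mult.assoc)
lemma ginv_sum: "ginv (\<Sum>i\<in>A. F i) = (\<Sum>i\<in>A. ginv (F i))"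
  by (induction A rule: infinite_finite_induct) simp_all

lemma gmult_gone_right [simp]: "g \<in> ext_poly S \<Longrightarrow> g \<otimes> gone = g"
  using gmult_even_commute[of gone S g S] gmult_gone_left[of g] ext_polyD[of g S] by simp

lemma gmult_gone_left_ext [simp]: "g \<in> ext_poly S \<Longrightarrow> gone \<otimes> g = g"
  using gmult_gone_left[of g] ext_polyD[of g S] by blast

lemma gmult_gone_right_finite:
  assumes "\<And>J K. f (J, K) \<noteq> 0 \<Longrightarrow> finite J"
  shows "f \<otimes> gone = f"
proof (rule ext, clarify)
  fix J and K :: "nat multiset"
  show "(f \<otimes> gone) (J, K) = f (J, K)"
  proof (cases "finite J")
    case False
    then show ?thesis using assms[of J K] by (auto simp: gmult_def)
  next
    case True
    have inner: "(\<Sum>K'\<in>{K'. K' \<subseteq># K}. osign J' (J - J') * f (J', K') * gone (J - J', K - K'))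
        = (if J' = J then f (J, K) else 0)" if "J' \<in> Pow J" for J'
    proof -
      have "(\<Sum>K'\<in>{K'. K' \<subseteq># K}. osign J' (J - J') * f (J', K') * gone (J - J', K - K'))
        = (\<Sum>K'\<in>{K'. K' \<subseteq># K}. if K' = K then (if J' = J then f (J, K) else 0) else 0)"
        using that by (intro sum.cong) (auto simp: gone_def Diff_eq_empty_iff_mset subset_mset.antisym_conv)
      also have "\<dots> = (if J' = J then f (J, K) else 0)"
        by (subst sum.delta[OF finite_submultisets]) simp
      finally show ?thesis .
    qed
    show ?thesis
      unfolding gmult_def using True by (simp add: inner)
  qed
qed

lemma ginv_gmult:
  assumes "f \<in> ext_poly S"
  shows "ginv (f \<otimes> g) = ginv f \<otimes> ginv g"
proof (rule ext, clarify)
  fix J and K :: "nat multiset"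
  show "ginv (f \<otimes> g) (J, K) = (ginv f \<otimes> ginv g) (J, K)"
  proof (cases "finite J")
    case False
    then show ?thesis
      by (simp add: gmult_ext_apply[OF assms] gmult_ext_apply[OF ext_poly_ginv[OF assms]] ginv_def[of "f \<otimes> g"])
  next
    case True
    have "ginv (f \<otimes> g) (J, K) = (\<Sum>J'\<in>Pow J. (-1) ^ card J * (osign J' (J - J') * f (J', {#}) * g (J - J', K)))"
      by (simp add: ginv_def gmult_ext_apply[OF assms] sum_distrib_left)
    also have "\<dots> = (\<Sum>J'\<in>Pow J. osign J' (J - J') * ginv f (J', {#}) * ginv g (J - J', K))"
    proof (rule sum.cong[OF refl])
      fix J' assume "J' \<in> Pow J"
      then have "card J = card J' + card (J - J')"
        using True by (metis PowD card_Diff_subset card_mono finite_subset le_add_diff_inverse)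
      then show "(-1) ^ card J * (osign J' (J - J') * f (J', {#}) * g (J - J', K))
          = osign J' (J - J') * ginv f (J', {#}) * ginv g (J - J', K)"
        by (simp add: ginv_def power_add)
    qed
    finally show ?thesis by (simp add: gmult_ext_apply[OF ext_poly_ginv[OF assms]])
  qed
qed

subsection \<open>Induction over exterior polynomials\<close>

lemma godd_mult_apply:
  "(godd k \<otimes> g) (J, K) = (if k \<in> J \<and> finite J then osign {k} (J - {k}) * g (J - {k}, K) else 0)"
proof -
  have e: "godd k \<in> ext_poly {k}" by simp
  show ?thesis
  proof (cases "finite J")
    case True
    have "(godd k \<otimes> g) (J, K) = (\<Sum>J'\<in>Pow J \<inter> {{k}}. osign J' (J - J') * godd k (J', {#}) * g (J - J', K))"
      unfolding gmult_ext_apply[OF e] using True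
      by (intro sum.mono_neutral_right) (auto simp: godd_def)
    also have "Pow J \<inter> {{k}} = (if k \<in> J then {{k}} else {})" by auto
    finally show ?thesis using True by (simp add: godd_def)
  qed (simp add: gmult_ext_apply[OF e])
qed

lemma godd_mult_gmono:
  assumes "finite J"
  shows "godd k \<otimes> gmono J = (if k \<in> J then 0 else osign {k} J *\<^sub>g gmono (insert k J))"
  using assms by (auto simp: fun_eq_iff fun_app godd_mult_apply gmono_def gscale_apply)

lemma ext_poly_expand:
  assumes "finite S" "f \<in> ext_poly S"
  shows "f = (\<Sum>J\<in>Pow S. f (J, {#}) *\<^sub>g gmono J)"
proof (rule ext, clarify)
  fix J and K :: "nat multiset"
  have "(\<Sum>J'\<in>Pow S. f (J', {#}) * (if (J, K) = (J', {#}) then 1 else 0)) =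
      (\<Sum>J'\<in>Pow S. if J' = J then (if K = {#} then f (J, {#}) else 0) else 0)"
    by (rule sum.cong) auto
  also have "\<dots> = f (J, K)"
    using assms ext_polyD[OF assms(2), of J K] by (auto simp: finite_Pow_iff)
  finally show "f (J, K) = (\<Sum>J\<in>Pow S. f (J, {#}) *\<^sub>g gmono J) (J, K)"
    by (simp add: fun_sum_apply gscale_apply gmono_def)
qed

lemma ext_poly_induct [consumes 2, case_names gone godd add scale]:
  assumes S: "finite S" and f: "f \<in> ext_poly S"
    and gone: "P gone"
    and godd: "\<And>k g. k \<in> S \<Longrightarrow> g \<in> ext_poly S \<Longrightarrow> P g \<Longrightarrow> P (godd k \<otimes> g)"
    and add: "\<And>f g. f \<in> ext_poly S \<Longrightarrow> g \<in> ext_poly S \<Longrightarrow> P f \<Longrightarrow> P g \<Longrightarrow> P (f + g)"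
    and scale: "\<And>s g. g \<in> ext_poly S \<Longrightarrow> P g \<Longrightarrow> P (s *\<^sub>g g)"
  shows "P f"
proof -
  have mono: "P (gmono J)" if "J \<subseteq> S" for J
  proof -
    have "finite J" using that S by (rule finite_subset)
    then show ?thesis using that
    proof (induction J rule: finite_linorder_min_induct)
      case empty
      then show ?case using gone by (simp add: gone_eq_gmono)
    next
      case (insert b A)
      have "{(x, y). x \<in> {b} \<and> y \<in> A \<and> y < x} = {}" using insert(2) by auto
      then have "osign {b} A = 1" unfolding osign_def by (metis card.empty power_0)
      then have "gmono (insert b A) = godd b \<otimes> gmono A"
        using insert(1,2) by (auto simp: godd_mult_gmono)
      then show ?case using insert godd ext_poly_gmono by auto
    qed
  qed
  have "P (\<Sum>J\<in>\<J>. f (J, {#}) *\<^sub>g gmono J)" if "finite \<J>" "\<J> \<subseteq> Pow S" for \<J>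
    using that
  proof (induction \<J>)
    case empty
    then show ?case using scale[OF ext_poly_gone gone, of 0] by simp
  next
    case (insert J \<J>)
    have J: "finite L" "L \<subseteq> S" if "L \<in> insert J \<J>" for L
      using that insert(4) S finite_subset by auto
    have "P (f (J, {#}) *\<^sub>g gmono J + (\<Sum>J\<in>\<J>. f (J, {#}) *\<^sub>g gmono J))"
      by (intro add scale mono ext_poly_scale ext_poly_gmono ext_poly_sum insert(3) J)
        (use insert(4) in auto)
    then show ?case by (simp only: sum.insert[OF insert(1,2)])
  qed
  then have "P (\<Sum>J\<in>Pow S. f (J, {#}) *\<^sub>g gmono J)" using S by auto
  then show ?thesis using ext_poly_expand[OF S f] by simp
qed

subsection \<open>Derivatives\<close>

lemma lderiv_add [simp]: "lderiv j (f + g) = lderiv j f + lderiv j g"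
  by (simp add: lderiv_def fun_eq_iff fun_app algebra_simps)
lemma lderiv_diff [simp]: "lderiv j (f - g) = lderiv j f - lderiv j g"
  by (simp add: lderiv_def fun_eq_iff fun_app algebra_simps)
lemma lderiv_minus [simp]: "lderiv j (- f) = - lderiv j f"
  by (simp add: lderiv_def fun_eq_iff fun_app)
lemma lderiv_scale [simp]: "lderiv j (s *\<^sub>g f) = s *\<^sub>g lderiv j f"
  by (simp add: lderiv_def fun_eq_iff fun_app gscale_apply)
lemma lderiv_0 [simp]: "lderiv j 0 = 0" by (simp add: lderiv_def fun_eq_iff fun_app)
lemma lderiv_sum: "lderiv j (\<Sum>i\<in>A. F i) = (\<Sum>i\<in>A. lderiv j (F i))"
  by (induction A rule: infinite_finite_induct) simp_all
lemma lderiv_gone [simp]: "lderiv j gone = 0" by (auto simp: lderiv_def gone_def fun_eq_iff fun_app)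
lemma lderiv_godd: "lderiv j (godd k) = (if j = k then gone else 0)"
  by (auto simp: lderiv_def godd_def gone_def fun_eq_iff fun_app)

lemma ext_poly_lderiv [simp]: "f \<in> ext_poly S \<Longrightarrow> lderiv j f \<in> ext_poly S"
  by (auto simp: ext_poly_def lderiv_def split: if_splits) fastforce+

lemma ginv_lderiv:
  assumes "f \<in> ext_poly S"
  shows "ginv (lderiv j f) = - lderiv j (ginv f)"
proof (rule ext, clarify)
  fix J and K :: "nat multiset"
  have "finite J" if "f (insert j J, K) \<noteq> 0" using ext_polyD[OF assms that] by simp
  then show "ginv (lderiv j f) (J, K) = (- lderiv j (ginv f)) (J, K)"
    by (cases "f (insert j J, K) = 0") (auto simp: ginv_def lderiv_def fun_app)
qed

lemma finite_below: "finite {(a, b). a \<in> {j} \<and> b \<in> J \<and> b < (a::nat)}"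
  by (rule finite_subset[of _ "{j} \<times> {..<j}"]) auto

lemma osign_singleton_insert:
  assumes "k \<notin> J"
  shows "osign {j} (insert k J) = osign {j} {k} * osign {j} J"
proof -
  have e: "{(a, b). a \<in> {j} \<and> b \<in> insert k J \<and> b < a} =
      {(a, b). a \<in> {j} \<and> b \<in> {k} \<and> b < a} \<union> {(a, b). a \<in> {j} \<and> b \<in> J \<and> b < a}" by blast
  have d: "{(a, b). a \<in> {j} \<and> b \<in> {k} \<and> b < a} \<inter> {(a, b). a \<in> {j} \<and> b \<in> J \<and> b < a} = {}"
    using assms by blast
  show ?thesis
    unfolding osign_def power_add[symmetric] e card_Un_disjoint[OF finite_below finite_below d] ..
qed

lemma lderiv_anticommute: "lderiv j (lderiv k f) = - lderiv k (lderiv j f)"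
proof (rule ext, clarify)
  fix J and K :: "nat multiset"
  show "lderiv j (lderiv k f) (J, K) = (- lderiv k (lderiv j f)) (J, K)"
  proof (cases "j \<in> J \<or> k \<in> J \<or> j = k")
    case True
    then show ?thesis by (auto simp: lderiv_def fun_app)
  next
    case False
    have s: "osign {j} {k} = - osign {k} {j}" using False by (auto simp: osign_singletons)
    show ?thesis
      using False osign_singleton_insert[of j J k] osign_singleton_insert[of k J j]
      by (simp add: lderiv_def fun_app s insert_commute[of k j])
  qed
qed

lemma lderiv_godd_mult:
  assumes "\<And>J K. g (J, K) \<noteq> 0 \<Longrightarrow> finite J"
  shows "lderiv j (godd k \<otimes> g) = (if j = k then g else 0) - godd k \<otimes> lderiv j g"
proof (rule ext, clarify)
  fix J and K :: "nat multiset"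
  show "lderiv j (godd k \<otimes> g) (J, K) = ((if j = k then g else 0) - godd k \<otimes> lderiv j g) (J, K)"
  proof (cases "finite J")
    case False
    then show ?thesis using assms[of J K] by (auto simp: lderiv_def fun_app godd_mult_apply)
  next
    case True
    show ?thesis
    proof (cases "j = k")
      case True
      then show ?thesis using \<open>finite J\<close>
        by (auto simp: lderiv_def fun_app godd_mult_apply insert_absorb)
    next
      case False
      show ?thesis
      proof (cases "k \<in> J \<and> j \<notin> J")
        case True
        then have kJ: "J = insert k (J - {k})" by auto
        have 1: "osign {j} J = osign {j} {k} * osign {j} (J - {k})"
          by (subst kJ, rule osign_singleton_insert) simp
        have 2: "insert j J - {k} = insert j (J - {k})" using False by auto
        have 3: "osign {k} (insert j (J - {k})) = osign {k} {j} * osign {k} (J - {k})"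
          using True by (intro osign_singleton_insert) auto
        have 4: "osign {j} {k} * osign {k} {j} = - 1" using False by (auto simp: osign_singletons)
        have "lderiv j (godd k \<otimes> g) (J, K) =
          osign {j} {k} * osign {k} {j} * osign {j} (J - {k}) * osign {k} (J - {k}) * g (insert j (J - {k}), K)"
          using True \<open>finite J\<close> False by (simp add: lderiv_def fun_app godd_mult_apply 1 2 3)
        also have "\<dots> = - (osign {k} (J - {k}) * osign {j} (J - {k}) * g (insert j (J - {k}), K))"
          by (simp add: 4)
        also have "\<dots> = ((if j = k then g else 0) - godd k \<otimes> lderiv j g) (J, K)"
          using True \<open>finite J\<close> False by (simp add: lderiv_def fun_app godd_mult_apply)
        finally show ?thesis .
      qed (use False in \<open>auto simp: lderiv_def fun_app godd_mult_apply\<close>)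
    qed
  qed
qed

lemma lderiv_gmult:
  assumes S: "finite S" and f: "f \<in> ext_poly S" and g: "\<And>J K. g (J, K) \<noteq> 0 \<Longrightarrow> finite J"
  shows "lderiv j (f \<otimes> g) = lderiv j f \<otimes> g + ginv f \<otimes> lderiv j g"
  using S f
proof (induction rule: ext_poly_induct)
  case gone
  have "finite J" if "lderiv j g (J, K) \<noteq> 0" for J K
  proof -
    have "g (insert j J, K) \<noteq> 0" using that by (auto simp: lderiv_def split: if_splits)
    then show ?thesis using g by fastforce
  qed
  then show ?case
    by (simp only: gmult_gone_left[of g, OF g] gmult_gone_left[of "lderiv j g"] lderiv_gone ginv_gone
        gmult_0_left add_0)
next
  case (add f f')
  then show ?case by (simp only: gmult_add_left lderiv_add ginv_add algebra_simps)
next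
  case (scale s f)
  then show ?case by (simp only: gmult_scale_left lderiv_scale ginv_scale gscale_add)
next
  case (godd k f)
  have fin: "finite J" if "(f \<otimes> g) (J, K) \<noteq> 0" for J K
  proof (rule ccontr)
    assume "infinite J"
    then show False using that unfolding gmult_ext_apply[OF godd(2)] by simp
  qed
  have k: "godd k \<in> ext_poly {k}" by simp
  have f: "\<And>J K. f (J, K) \<noteq> 0 \<Longrightarrow> finite J" using ext_polyD[OF godd(2)] by blast
  have "lderiv j (godd k \<otimes> f \<otimes> g) = (if j = k then f \<otimes> g else 0) - godd k \<otimes> lderiv j (f \<otimes> g)"
    unfolding gmult_assoc[OF k godd(2)] using fin by (rule lderiv_godd_mult)
  also have "\<dots> = (if j = k then f else 0) \<otimes> g - godd k \<otimes> lderiv j f \<otimes> g + (- godd k) \<otimes> ginv f \<otimes> lderiv j g"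
    unfolding godd(3) gmult_minus_left gmult_assoc[OF k ext_poly_lderiv[OF godd(2)]]
      gmult_assoc[OF k ext_poly_ginv[OF godd(2)]]
    by simp
  also have "\<dots> = lderiv j (godd k \<otimes> f) \<otimes> g + ginv (godd k \<otimes> f) \<otimes> lderiv j g"
    using lderiv_godd_mult[of f j k] f by (simp add: ginv_gmult[OF k])
  finally show ?case .
qed

lemma rderiv_eq_ginv_lderiv:
  assumes "\<And>J K. f (J, K) \<noteq> 0 \<Longrightarrow> finite J"
  shows "rderiv j f = ginv (lderiv j f)"
proof (rule ext, clarify)
  fix J and K :: "nat multiset"
  show "rderiv j f (J, K) = ginv (lderiv j f) (J, K)"
  proof (cases "finite J \<and> j \<notin> J")
    case True
    then show ?thesis using osign_swap[of J "{j}"] by (simp add: rderiv_def lderiv_def ginv_def)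
  next
    case False
    then show ?thesis using assms[of "insert j J" K] by (auto simp: rderiv_def lderiv_def ginv_def)
  qed
qed

subsection \<open>Homogeneous components\<close>

definition homogeneous :: "nat \<Rightarrow> gpoly \<Rightarrow> gpoly" where
  "homogeneous k f = (\<lambda>(J, K). if card J = k then f (J, K) else 0)"

lemma homogeneous_add: "homogeneous k (f + g) = homogeneous k f + homogeneous k g"
  by (auto simp: homogeneous_def fun_eq_iff fun_app)
lemma homogeneous_scale: "homogeneous k (s *\<^sub>g f) = s *\<^sub>g homogeneous k f"
  by (auto simp: homogeneous_def fun_eq_iff gscale_apply)
lemma homogeneous_0 [simp]: "homogeneous k 0 = 0"
  by (auto simp: homogeneous_def fun_eq_iff fun_app)
lemma homogeneous_sum: "homogeneous k (\<Sum>i\<in>A. F i) = (\<Sum>i\<in>A. homogeneous k (F i))"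
  by (induction A rule: infinite_finite_induct) (simp_all add: homogeneous_add)
lemma homogeneous_gone: "homogeneous k gone = (if k = 0 then gone else 0)"
  by (auto simp: homogeneous_def fun_eq_iff fun_app gone_def)
lemma homogeneous_godd: "homogeneous k (godd j) = (if k = 1 then godd j else 0)"
  by (auto simp: homogeneous_def fun_eq_iff fun_app godd_def)
lemma ext_poly_homogeneous [simp]: "f \<in> ext_poly S \<Longrightarrow> homogeneous k f \<in> ext_poly S"
  by (auto simp: ext_poly_def homogeneous_def)

lemma homogeneous_mult_linear:
  assumes f: "f \<in> ext_poly S" and 1: "homogeneous 1 f = f"
  shows "homogeneous k (f \<otimes> g) = (case k of 0 \<Rightarrow> 0 | Suc l \<Rightarrow> f \<otimes> homogeneous l g)"
proof (rule ext, clarify)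
  fix J and K :: "nat multiset"
  have f1: "f (L, {#}) = 0" if "card L \<noteq> 1" for L
    using fun_cong[OF 1, of "(L, {#})"] that by (simp add: homogeneous_def)
  have card: "card J = Suc (card (J - L))" if "L \<in> Pow J" "f (L, {#}) \<noteq> 0" "finite J" for L
  proof -
    have L: "card L = 1" using f1 that(2) by blast
    have "card (J - L) = card J - card L"
      using that by (intro card_Diff_subset) (auto intro: finite_subset)
    moreover have "card L \<le> card J" using that by (intro card_mono) auto
    ultimately show ?thesis using L by simp
  qed
  show "homogeneous k (f \<otimes> g) (J, K) = (case k of 0 \<Rightarrow> 0 | Suc l \<Rightarrow> f \<otimes> homogeneous l g) (J, K)"
  proof (cases "finite J")
    case False
    then show ?thesis by (auto simp: homogeneous_def gmult_ext_apply[OF f] zero_fun_apply split: nat.split)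
  next
    case True
    show ?thesis
    proof (cases k)
      case 0
      have "(f \<otimes> g) (J, K) = 0" if "card J = 0"
        unfolding gmult_ext_apply[OF f] using card True that by (intro sum.neutral) fastforce
      then show ?thesis using 0 by (simp add: homogeneous_def zero_fun_apply)
    next
      case (Suc l)
      have "(if card J = Suc l then \<Sum>L\<in>Pow J. osign L (J - L) * f (L, {#}) * g (J - L, K) else 0) =
         (\<Sum>L\<in>Pow J. osign L (J - L) * f (L, {#}) * homogeneous l g (J - L, K))"
      proof (cases "card J = Suc l")
        case True
        show ?thesis unfolding if_P[OF True]
        proof (rule sum.cong[OF refl])
          fix L assume "L \<in> Pow J"
          then show "osign L (J - L) * f (L, {#}) * g (J - L, K)
              = osign L (J - L) * f (L, {#}) * homogeneous l g (J - L, K)"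
            using card[of L] \<open>finite J\<close> True by (auto simp: homogeneous_def)
        qed
      next
        case False
        show ?thesis unfolding if_not_P[OF False]
        proof (rule sum.neutral[symmetric], intro ballI)
          fix L assume "L \<in> Pow J"
          then show "osign L (J - L) * f (L, {#}) * homogeneous l g (J - L, K) = 0"
            using card[of L] \<open>finite J\<close> False by (auto simp: homogeneous_def)
        qed
      qed
      then show ?thesis
        unfolding Suc homogeneous_def[of "Suc l" "f \<otimes> g"]
        by (simp only: prod.case nat.case gmult_ext_apply[OF f])
    qed
  qed
qed

subsection \<open>Ordered products of anticommuting operators\<close>

text \<open>
  Both the interior product and the substitution of odd elements for the generators apply, monomial
  by monomial, a sorted product of anticommuting operators; moving one more operator into its place
  produces the sign \<open>osign\<close>.
\<close>

lemma anticommuting_sorted_foldr: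
  fixes X :: "nat \<Rightarrow> gpoly \<Rightarrow> gpoly"
  assumes lin: "\<And>k s f. X k (s *\<^sub>g f) = s *\<^sub>g X k f"
    and anti: "\<And>k l f. X k (X l f) = - X l (X k f)"
    and "finite J"
  shows "X k (foldr X (sorted_list_of_set J) v) =
    (if k \<in> J then 0 else osign {k} J *\<^sub>g foldr X (sorted_list_of_set (insert k J)) v)"
  using assms(3)
proof (induction J arbitrary: k rule: finite_linorder_min_induct)
  case empty
  then show ?case by simp
next
  case (insert b A)
  have min: "sorted_list_of_set (insert b A) = b # sorted_list_of_set A"
    if "finite A" "\<forall>a\<in>A. b < a" for b and A :: "nat set"
    using that by (subst sorted_list_of_set_insert_remove) (auto simp: insort_is_Cons less_imp_le)
  have X0: "X k 0 = 0" for k using lin[of k 0 0] by simp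
  have neg: "X k (- f) = - X k f" for k f using lin[of k "-1" f] by simp
  have sorted_insert: "foldr X (sorted_list_of_set (insert b A)) v = X b (foldr X (sorted_list_of_set A) v)"
    using min insert(1,2) by simp
  consider "k = b" | "k < b" | "b < k" by linarith
  then show ?case
  proof cases
    case 1
    have "X b (X b g) = 0" for g
    proof -
      have "X b (X b g) = - X b (X b g)" by (rule anti)
      then show ?thesis by (simp add: fun_eq_iff fun_app)
    qed
    then show ?thesis unfolding sorted_insert using 1 by simp
  next
    case 2
    have "{(x, y). x \<in> {k} \<and> y \<in> insert b A \<and> y < x} = {}" using insert(2) 2 by fastforce
    then have "osign {k} (insert b A) = 1" unfolding osign_def by (metis card.empty power_0)
    moreover have "k \<notin> insert b A" using insert(2) 2 by auto
    moreover have "sorted_list_of_set (insert k (insert b A)) = k # sorted_list_of_set (insert b A)"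
      using insert(1,2) 2 by (intro min) auto
    ultimately show ?thesis by simp
  next
    case 3
    have bA: "b \<notin> A" using insert(2) by auto
    have e: "X k (foldr X (sorted_list_of_set (insert b A)) v) = - X b (X k (foldr X (sorted_list_of_set A) v))"
      unfolding sorted_insert by (rule anti)
    show ?thesis
    proof (cases "k \<in> A")
      case True
      then show ?thesis unfolding e insert(3) using X0 by simp
    next
      case False
      have s: "osign {k} (insert b A) = - osign {k} A"
        using osign_singleton_insert[OF bA, of k] 3 by (simp add: osign_singletons)
      have "sorted_list_of_set (insert k (insert b A)) = b # sorted_list_of_set (insert k A)"
        using insert(1,2) 3 by (subst insert_commute, intro min) auto
      then show ?thesis unfolding e insert(3) using False 3 by (simp add: lin s)
    qed
  qed
qed

subsection \<open>Interior products\<close>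

lemma gint_0 [simp]: "gint 0 g = 0" by (simp add: gint_def zero_fun_apply)

lemma gint_ext_eq:
  assumes "finite S" "f \<in> ext_poly S"
  shows "gint f g = (\<Sum>J\<in>Pow S. f (J, {#}) *\<^sub>g foldr (\<lambda>j. lderiv (oconj j)) (sorted_list_of_set J) g)"
proof -
  have "{J. f (J, {#}) \<noteq> 0} \<subseteq> Pow S" using ext_polyD[OF assms(2)] by blast
  then show ?thesis
    unfolding gint_def using assms(1) by (intro sum.mono_neutral_left) (auto)
qed

lemma gint_add_left:
  assumes "finite S" "f \<in> ext_poly S" "f' \<in> ext_poly S"
  shows "gint (f + f') g = gint f g + gint f' g"
  unfolding gint_ext_eq[OF assms(1,2)] gint_ext_eq[OF assms(1,3)] gint_ext_eq[OF assms(1) ext_poly_add[OF assms(2,3)]]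
  by (simp add: gscale_add_left sum.distrib fun_app)

lemma gint_scale_left:
  assumes "finite S" "f \<in> ext_poly S"
  shows "gint (s *\<^sub>g f) g = s *\<^sub>g gint f g"
  unfolding gint_ext_eq[OF assms] gint_ext_eq[OF assms(1) ext_poly_scale[OF assms(2)]] gscale_sum
  by (simp add: gscale_apply)

lemma gint_minus_left:
  assumes "finite S" "f \<in> ext_poly S"
  shows "gint (- f) g = - gint f g"
  using gint_scale_left[OF assms, of "-1"] by simp

lemma gint_gmono: "finite J \<Longrightarrow> gint (gmono J) g = foldr (\<lambda>j. lderiv (oconj j)) (sorted_list_of_set J) g"
proof -
  have "{L. gmono J (L, {#}) \<noteq> 0} = {J}" by (auto simp: gmono_def)
  then show ?thesis by (simp add: gint_def gmono_def)
qed

lemma gint_gone [simp]: "gint gone g = g"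
  using gint_gmono[of "{}" g] by (simp add: gone_eq_gmono)

lemma gint_godd: "gint (godd k) g = lderiv (oconj k) g"
  using gint_gmono[of "{k}" g] by (simp add: godd_eq_gmono)

lemma gint_sum_left:
  assumes "finite S" "\<And>i. i \<in> A \<Longrightarrow> F i \<in> ext_poly S"
  shows "gint (\<Sum>i\<in>A. F i) g = (\<Sum>i\<in>A. gint (F i) g)"
  using assms(2)
proof (induction A rule: infinite_finite_induct)
  case (insert x A)
  have "gint (F x + sum F A) g = gint (F x) g + gint (sum F A) g"
    using insert by (intro gint_add_left[OF assms(1)] ext_poly_sum) auto
  then show ?case using insert by simp
qed simp_all

lemma gint_godd_mult:
  assumes "finite S" "f \<in> ext_poly S" "k \<in> S"
  shows "gint (godd k \<otimes> f) g = lderiv (oconj k) (gint f g)"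
proof -
  have mono: "gint (godd k \<otimes> gmono J) g = lderiv (oconj k) (gint (gmono J) g)" if "J \<subseteq> S" for J
  proof -
    have J: "finite J" using that assms(1) finite_subset by blast
    have "lderiv (oconj k) (foldr (\<lambda>j. lderiv (oconj j)) (sorted_list_of_set J) g) =
      (if k \<in> J then 0 else osign {k} J *\<^sub>g foldr (\<lambda>j. lderiv (oconj j)) (sorted_list_of_set (insert k J)) g)"
      using J by (intro anticommuting_sorted_foldr) (simp_all add: lderiv_anticommute[symmetric])
    then show ?thesis
      using J gint_scale_left[of "insert k J" "gmono (insert k J)"]
      by (simp add: godd_mult_gmono gint_gmono ext_poly_gmono)
  qed
  have m: "gmono J \<in> ext_poly S" if "J \<in> Pow S" for J
    using that assms(1) by (auto intro: ext_poly_gmono finite_subset)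
  have k: "godd k \<in> ext_poly S" using assms(3) by simp
  have "gint (godd k \<otimes> f) g = gint (\<Sum>J\<in>Pow S. f (J, {#}) *\<^sub>g (godd k \<otimes> gmono J)) g"
    by (subst ext_poly_expand[OF assms(1,2)]) (simp add: gmult_sum_right)
  also have "\<dots> = (\<Sum>J\<in>Pow S. f (J, {#}) *\<^sub>g gint (godd k \<otimes> gmono J) g)"
    using k m gint_scale_left[OF assms(1) ext_poly_gmult[OF k m]]
    by (subst gint_sum_left[OF assms(1)]) (simp_all del: gmult_scale_right)
  also have "\<dots> = lderiv (oconj k) (\<Sum>J\<in>Pow S. f (J, {#}) *\<^sub>g gint (gmono J) g)"
    by (simp add: lderiv_sum mono)
  also have "\<dots> = lderiv (oconj k) (gint (\<Sum>J\<in>Pow S. f (J, {#}) *\<^sub>g gmono J) g)"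
    using m gint_scale_left[OF assms(1) m] by (subst gint_sum_left[OF assms(1)]) simp_all
  finally show ?thesis using ext_poly_expand[OF assms(1,2)] by simp
qed

lemma gint_linear_right:
  assumes "finite S" "f \<in> ext_poly S"
  shows "gint f (g + h) = gint f g + gint f h" "gint f (s *\<^sub>g g) = s *\<^sub>g gint f g"
proof -
  have "foldr (\<lambda>j. lderiv (oconj j)) L (g + h) =
      foldr (\<lambda>j. lderiv (oconj j)) L g + foldr (\<lambda>j. lderiv (oconj j)) L h" for L
    by (induction L) simp_all
  moreover have "foldr (\<lambda>j. lderiv (oconj j)) L (s *\<^sub>g g) = s *\<^sub>g foldr (\<lambda>j. lderiv (oconj j)) L g" for L
    by (induction L) simp_all
  ultimately show "gint f (g + h) = gint f g + gint f h" "gint f (s *\<^sub>g g) = s *\<^sub>g gint f g"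
    unfolding gint_ext_eq[OF assms] by (simp_all add: gscale_sum sum.distrib mult.commute)
qed

lemma gint_minus_right:
  assumes "finite S" "f \<in> ext_poly S"
  shows "gint f (- g) = - gint f g"
  using gint_linear_right(2)[OF assms, of "-1" g] by simp

lemma gint_0_right [simp]: "gint f 0 = 0"
proof -
  have "foldr (\<lambda>j. lderiv (oconj j)) L 0 = 0" for L
    by (induction L) simp_all
  then show ?thesis unfolding gint_def by simp
qed

lemma gint_gmult:
  assumes S: "finite S" and f: "f \<in> ext_poly S" and g: "g \<in> ext_poly S"
  shows "gint (f \<otimes> g) h = gint f (gint g h)"
  using S f
proof (induction rule: ext_poly_induct)
  case gone
  then show ?case using g by simp
next
  case (godd k f)
  have "gint (godd k \<otimes> f \<otimes> g) h = gint (godd k \<otimes> (f \<otimes> g)) h"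
    using gmult_assoc[of "godd k" "{k}" f S g] godd by simp
  then show ?case
    using godd g by (simp add: gint_godd_mult[OF S])
next
  case (add f f')
  then show ?case using g by (simp add: gint_add_left[OF S])
next
  case (scale s f)
  then show ?case using g by (simp add: gint_scale_left[OF S])
qed

lemma ext_poly_gint:
  assumes S: "finite S" and f: "f \<in> ext_poly S" and g: "g \<in> ext_poly T"
  shows "gint f g \<in> ext_poly T"
  using S f
proof (induction rule: ext_poly_induct)
  case (add f f')
  then show ?case using g by (simp add: gint_add_left[OF S])
next
  case (scale s f)
  then show ?case using g by (simp add: gint_scale_left[OF S])
qed (simp_all add: g gint_godd_mult[OF S])

subsection \<open>Substitution\<close>

definition subst_mono :: "(nat \<Rightarrow> gpoly) \<Rightarrow> nat set \<Rightarrow> gpoly" where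
  "subst_mono s J = gprod (map s (sorted_list_of_set J))"

lemma subst_mono_foldr: "subst_mono s J = foldr (\<lambda>j. gmult (s j)) (sorted_list_of_set J) gone"
  by (simp add: subst_mono_def gprod_def foldr_map comp_def)

lemma gsubst_eq_sum:
  assumes "finite T" "{JK. f JK \<noteq> 0} \<subseteq> T"
  shows "gsubst s t f = (\<Sum>(J, K)\<in>T. f (J, K) *\<^sub>g
    (subst_mono s J \<otimes> gprod (map t (sorted_list_of_multiset K))))"
  unfolding gsubst_def subst_mono_def
  using assms by (intro sum.mono_neutral_left) (auto)

lemma gsubst_add:
  assumes "finite {JK. f JK \<noteq> 0}" "finite {JK. g JK \<noteq> 0}"
  shows "gsubst s t (f + g) = gsubst s t f + gsubst s t g"
proof -
  let ?T = "{JK. f JK \<noteq> 0} \<union> {JK. g JK \<noteq> 0}"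
  have T: "finite ?T" using assms by simp
  have sub: "{JK. f JK \<noteq> 0} \<subseteq> ?T" "{JK. g JK \<noteq> 0} \<subseteq> ?T" "{JK. (f + g) JK \<noteq> 0} \<subseteq> ?T"
    by (auto simp: plus_fun_apply)
  show ?thesis
    unfolding gsubst_eq_sum[OF T sub(1)] gsubst_eq_sum[OF T sub(2)] gsubst_eq_sum[OF T sub(3)]
    by (simp add: gscale_add_left sum.distrib split_def plus_fun_apply)
qed

lemma gsubst_0 [simp]: "gsubst s t 0 = 0"
proof -
  have "{JK. (0 :: gpoly) JK \<noteq> 0} = {}" by (simp add: zero_fun_apply)
  then show ?thesis by (simp add: gsubst_def)
qed

lemma gsubst_sum:
  assumes "\<And>i. i \<in> A \<Longrightarrow> finite {JK. F i JK \<noteq> 0}"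
  shows "gsubst s t (\<Sum>i\<in>A. F i) = (\<Sum>i\<in>A. gsubst s t (F i))"
proof (cases "finite A")
  case True
  then show ?thesis using assms
  proof (induction A)
    case empty
    then show ?case by simp
  next
    case (insert x A)
    have "{JK. sum F A JK \<noteq> 0} \<subseteq> (\<Union>i\<in>A. {JK. F i JK \<noteq> 0})"
      by (auto simp: fun_sum_apply dest: sum.not_neutral_contains_not_neutral)
    then have "finite {JK. sum F A JK \<noteq> 0}"
      by (rule finite_subset) (use insert in auto)
    then have "gsubst s t (F x + sum F A) = gsubst s t (F x) + gsubst s t (sum F A)"
      using insert by (intro gsubst_add) auto
    then show ?case using insert by simp
  qed
qed simp

text \<open>
  The conditions under which substitution is a homomorphism on exterior polynomials: the elements
  substituted for the odd generators are themselves combinations of odd generators, so that they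
  anticommute.
\<close>

locale linear_substitution =
  fixes N :: "nat set" and M :: "nat \<Rightarrow> nat \<Rightarrow> real"
    and s t :: "nat \<Rightarrow> gpoly" and S :: "nat set"
  assumes finite_N: "finite N" and finite_S: "finite S"
    and s_eq: "\<And>k. s k = (\<Sum>j\<in>N. M k j *\<^sub>g godd j)"
begin

abbreviation "h \<equiv> gsubst s t"

lemma ext_poly_s: "s k \<in> ext_poly N"
  unfolding s_eq by (intro ext_poly_sum ext_poly_scale ext_poly_godd)

lemma ginv_s: "ginv (s k) = - s k"
  unfolding s_eq ginv_sum by (simp add: sum_negf)

lemma s_anticommute: "s k \<otimes> (s l \<otimes> f) = - (s l \<otimes> (s k \<otimes> f))"
  using gmult_odd_commute[OF ext_poly_s[of k] ext_poly_s[of l] ginv_s]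
  by (simp add: ginv_s flip: gmult_assoc[OF ext_poly_s ext_poly_s])

lemma ext_poly_subst_mono: "subst_mono s J \<in> ext_poly N"
proof -
  have "foldr (\<lambda>j. gmult (s j)) L gone \<in> ext_poly N" for L
    by (induction L) (simp_all add: ext_poly_s)
  then show ?thesis by (simp add: subst_mono_foldr)
qed

lemma s_mult_subst_mono:
  "finite J \<Longrightarrow> s k \<otimes> subst_mono s J = (if k \<in> J then 0 else osign {k} J *\<^sub>g subst_mono s (insert k J))"
  unfolding subst_mono_foldr
  by (rule anticommuting_sorted_foldr[of "\<lambda>k. gmult (s k)"]) (simp, rule s_anticommute)

lemma h_ext_eq:
  assumes "f \<in> ext_poly S"
  shows "h f = (\<Sum>J\<in>Pow S. f (J, {#}) *\<^sub>g subst_mono s J)"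
proof -
  have "h f = (\<Sum>(J, K)\<in>Pow S \<times> {{#}}. f (J, K) *\<^sub>g
    (subst_mono s J \<otimes> gprod (map t (sorted_list_of_multiset K))))"
    using finite_S ext_polyD[OF assms] by (intro gsubst_eq_sum) auto
  also have "\<dots> = (\<Sum>J\<in>Pow S. f (J, {#}) *\<^sub>g (subst_mono s J \<otimes> gone))"
    unfolding sum.cartesian_product[symmetric] by (simp add: gprod_def)
  finally show ?thesis by (simp add: gmult_gone_right[OF ext_poly_subst_mono])
qed

lemma ext_poly_h: "f \<in> ext_poly S \<Longrightarrow> h f \<in> ext_poly N"
  by (simp add: h_ext_eq ext_poly_subst_mono)

lemma h_add: "f \<in> ext_poly S \<Longrightarrow> g \<in> ext_poly S \<Longrightarrow> h (f + g) = h f + h g"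
  by (simp add: h_ext_eq gscale_add_left sum.distrib plus_fun_apply)

lemma h_scale: "f \<in> ext_poly S \<Longrightarrow> h (c *\<^sub>g f) = c *\<^sub>g h f"
  by (simp add: h_ext_eq gscale_sum gscale_apply)

lemma h_minus: "f \<in> ext_poly S \<Longrightarrow> h (- f) = - h f"
  using h_scale[of f "-1"] by simp

lemma h_sum: "(\<And>i. i \<in> A \<Longrightarrow> F i \<in> ext_poly S) \<Longrightarrow> h (\<Sum>i\<in>A. F i) = (\<Sum>i\<in>A. h (F i))"
proof (induction A rule: infinite_finite_induct)
  case (insert x A)
  have "h (F x + sum F A) = h (F x) + h (sum F A)"
    using insert by (intro h_add ext_poly_sum) auto
  then show ?case using insert by simp
qed simp_all

lemma h_gmono: "J \<subseteq> S \<Longrightarrow> h (gmono J) = subst_mono s J"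
proof -
  assume J: "J \<subseteq> S"
  have "gmono J \<in> ext_poly S" using J finite_S finite_subset by (blast intro: ext_poly_gmono)
  moreover have "(\<Sum>L\<in>Pow S. gmono J (L, {#}) *\<^sub>g subst_mono s L) = (\<Sum>L\<in>{J}. gmono J (L, {#}) *\<^sub>g subst_mono s L)"
    using J finite_S by (intro sum.mono_neutral_right) (auto simp: gmono_def)
  ultimately show ?thesis by (simp add: h_ext_eq gmono_def)
qed

lemma h_gone [simp]: "h gone = gone"
  using h_gmono[of "{}"] by (simp add: gone_eq_gmono subst_mono_foldr)

lemma h_godd_mult:
  assumes k: "k \<in> S" and f: "f \<in> ext_poly S"
  shows "h (godd k \<otimes> f) = s k \<otimes> h f"
proof -
  have m: "gmono J \<in> ext_poly S" if "J \<in> Pow S" for J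
    using that finite_S by (auto intro: ext_poly_gmono finite_subset)
  have "godd k \<otimes> f = (\<Sum>J\<in>Pow S. f (J, {#}) *\<^sub>g (godd k \<otimes> gmono J))"
    by (subst ext_poly_expand[OF finite_S f]) (simp add: gmult_sum_right)
  then have "h (godd k \<otimes> f) = (\<Sum>J\<in>Pow S. f (J, {#}) *\<^sub>g h (godd k \<otimes> gmono J))"
    using m k by (simp only: h_sum[OF ext_poly_scale[OF ext_poly_gmult]] ext_poly_godd)
      (intro sum.cong refl h_scale ext_poly_gmult ext_poly_godd)
  also have "\<dots> = (\<Sum>J\<in>Pow S. f (J, {#}) *\<^sub>g (s k \<otimes> subst_mono s J))"
  proof (rule sum.cong[OF refl])
    fix J assume J: "J \<in> Pow S"
    then have "finite J" using finite_S finite_subset by auto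
    moreover have "gmono (insert k J) \<in> ext_poly S" using J k m by auto
    ultimately have "h (godd k \<otimes> gmono J) = s k \<otimes> subst_mono s J"
      using J k by (simp add: godd_mult_gmono s_mult_subst_mono h_scale h_gmono)
    then show "f (J, {#}) *\<^sub>g h (godd k \<otimes> gmono J) = f (J, {#}) *\<^sub>g (s k \<otimes> subst_mono s J)" by simp
  qed
  also have "\<dots> = s k \<otimes> h f" by (simp add: h_ext_eq[OF f] gmult_sum_right)
  finally show ?thesis .
qed

lemma h_godd: "k \<in> S \<Longrightarrow> h (godd k) = s k"
  using h_godd_mult[of k gone] gmult_gone_right[OF ext_poly_s] gmult_gone_right[of "godd k" "{k}"] by simp

lemma h_gmult:
  assumes f: "f \<in> ext_poly S" and g: "g \<in> ext_poly S"
  shows "h (f \<otimes> g) = h f \<otimes> h g"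
  using finite_S f
proof (induction rule: ext_poly_induct)
  case gone
  then show ?case using g ext_poly_h[OF g] by simp
next
  case (godd k f)
  have "h (godd k \<otimes> f \<otimes> g) = h (godd k \<otimes> (f \<otimes> g))"
    using gmult_assoc[of "godd k" "{k}" f S g] godd by simp
  also have "\<dots> = s k \<otimes> (h f \<otimes> h g)" using godd g by (simp add: h_godd_mult)
  also have "\<dots> = h (godd k \<otimes> f) \<otimes> h g"
    using godd by (simp add: h_godd_mult gmult_assoc[OF ext_poly_s ext_poly_h])
  finally show ?case .
next
  case (add f f')
  then show ?case using g by (simp only: gmult_add_left h_add ext_poly_gmult)
next
  case (scale c f)
  then show ?case using g by (simp only: gmult_scale_left h_scale ext_poly_gmult)
qed

lemma ginv_h:
  assumes f: "f \<in> ext_poly S"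
  shows "ginv (h f) = h (ginv f)"
  using finite_S f
proof (induction rule: ext_poly_induct)
  case (godd k f)
  have "ginv (godd k \<otimes> f) = - (godd k \<otimes> ginv f)"
    using ginv_gmult[of "godd k" "{k}" f] by simp
  then show ?case
    using godd by (simp add: h_godd_mult ginv_gmult[OF ext_poly_s] ginv_s h_minus)
next
  case (add f f')
  then show ?case by (simp only: h_add ginv_add ext_poly_ginv)
next
  case (scale c f)
  then show ?case by (simp only: h_scale ginv_scale ext_poly_ginv)
qed simp

lemma ext_poly_h_restrict:
  assumes "\<And>k. k \<in> S' \<Longrightarrow> s k \<in> ext_poly T" "S' \<subseteq> S" and f: "f \<in> ext_poly S'"
  shows "h f \<in> ext_poly T"
  using finite_subset[OF assms(2) finite_S] f
proof (induction rule: ext_poly_induct)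
  case (godd k f)
  then show ?case
    using assms(1,2) ext_poly_mono[OF godd(2) assms(2)] by (auto simp: h_godd_mult)
next
  case (add f f')
  then show ?case using ext_poly_mono[OF _ assms(2)] by (simp add: h_add)
next
  case (scale c f)
  then show ?case using ext_poly_mono[OF _ assms(2)] by (simp add: h_scale)
qed simp

lemma homogeneous_h:
  assumes f: "f \<in> ext_poly S"
  shows "homogeneous k (h f) = h (homogeneous k f)"
  using finite_S f
proof (induction arbitrary: k rule: ext_poly_induct)
  case gone
  then show ?case by (simp add: homogeneous_gone)
next
  case (godd j f)
  have s1: "homogeneous 1 (s j) = s j" "homogeneous 1 (godd j) = godd j"
    unfolding s_eq homogeneous_sum homogeneous_scale homogeneous_godd by simp_all
  have "godd j \<in> ext_poly {j}" by simp
  note mult = homogeneous_mult_linear[OF this s1(2)] homogeneous_mult_linear[OF ext_poly_s s1(1)]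
  show ?case
    using godd by (cases k) (simp_all add: h_godd_mult mult)
next
  case (add f f')
  then show ?case by (simp add: h_add homogeneous_add)
next
  case (scale c f)
  then show ?case by (simp add: h_scale homogeneous_scale)
qed

lemma lderiv_h:
  assumes j: "j \<in> N" and f: "f \<in> ext_poly S"
  shows "lderiv j (h f) = (\<Sum>k\<in>S. M k j *\<^sub>g h (lderiv k f))"
  using finite_S f
proof (induction rule: ext_poly_induct)
  case gone
  then show ?case by simp
next
  case (godd l f)
  have fin: "\<And>J K. f (J, K) \<noteq> 0 \<Longrightarrow> finite J" using ext_polyD[OF godd(2)] by blast
  have hf: "\<And>J K. h f (J, K) \<noteq> 0 \<Longrightarrow> finite J" using ext_polyD[OF ext_poly_h[OF godd(2)]] by blast
  have sl: "lderiv j (s l) = M l j *\<^sub>g gone"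
  proof -
    have "lderiv j (s l) = (\<Sum>i\<in>N. if i = j then M l i *\<^sub>g gone else 0)"
      unfolding s_eq lderiv_sum lderiv_scale lderiv_godd by (rule sum.cong) simp_all
    then show ?thesis using j finite_N by simp
  qed
  have "lderiv j (h (godd l \<otimes> f)) = lderiv j (s l \<otimes> h f)" using godd by (simp add: h_godd_mult)
  also have "\<dots> = M l j *\<^sub>g h f - s l \<otimes> lderiv j (h f)"
    using gmult_gone_left_ext[OF ext_poly_h[OF godd(2)]]
    by (simp add: lderiv_gmult[OF finite_N ext_poly_s hf] sl ginv_s)
  also have "\<dots> = (\<Sum>k\<in>S. if k = l then M l j *\<^sub>g h f else 0) - (\<Sum>k\<in>S. M k j *\<^sub>g (s l \<otimes> h (lderiv k f)))"
    using finite_S godd(1,3) by (simp add: gmult_sum_right)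
  also have "\<dots> = (\<Sum>k\<in>S. M k j *\<^sub>g h (lderiv k (godd l \<otimes> f)))"
    unfolding sum_subtractf[symmetric]
  proof (rule sum.cong[OF refl])
    fix k assume "k \<in> S"
    have "h (lderiv k (godd l \<otimes> f)) = h ((if k = l then f else 0) + - (godd l \<otimes> lderiv k f))"
      using lderiv_godd_mult[of f k l] fin by simp
    also have "\<dots> = (if k = l then h f else 0) - s l \<otimes> h (lderiv k f)"
      using godd by (subst h_add) (simp_all add: h_minus h_godd_mult)
    finally show "(if k = l then M l j *\<^sub>g h f else 0) - M k j *\<^sub>g (s l \<otimes> h (lderiv k f))
        = M k j *\<^sub>g h (lderiv k (godd l \<otimes> f))"
      using lderiv_godd_mult[of f k l] fin by simp
  qed
  finally show ?case .
next
  case (add f f')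
  have "lderiv k f \<in> ext_poly S" "lderiv k f' \<in> ext_poly S" for k using add by simp_all
  then show ?case using add by (simp only: h_add lderiv_add gscale_add sum.distrib)
next
  case (scale c f)
  have "lderiv k f \<in> ext_poly S" for k using scale by simp
  then show ?case using scale
    by (simp only: h_scale lderiv_scale gscale_sum gscale_gscale mult.commute[of c])
qed

end

section \<open>Calculus in the charts of a vector bundle\<close>

abbreviation has_cderiv :: "('m, 'a) vb_chart \<Rightarrow> nat \<Rightarrow> ('m \<Rightarrow> real) \<Rightarrow> 'm \<Rightarrow> real \<Rightarrow> bool" where
  "has_cderiv c i h m D \<equiv> has_partial i (in_coords c h) (bcoord c m) D"

lemma has_cderiv_imp_cderiv: "has_cderiv c i h m D \<Longrightarrow> cderiv c i h m = D"
  unfolding cderiv_def by (rule has_partial_imp_partial_deriv)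

lemma in_coords_algebra:
  "in_coords c (\<lambda>m. h m + g m) = (\<lambda>y. in_coords c h y + in_coords c g y)"
  "in_coords c (\<lambda>m. h m * g m) = (\<lambda>y. in_coords c h y * in_coords c g y)"
  "in_coords c (\<lambda>m. s) = (\<lambda>y. s)"
  by (simp_all add: in_coords_def comp_def)

locale smooth_bundle =
  fixes B :: "('m, 'a) vbundle"
  assumes vector_bundle: "vector_bundle B"
begin

abbreviation "n \<equiv> bdim B"
abbreviation "r \<equiv> rank B"

definition chart_open :: "('m, 'a) vb_chart \<Rightarrow> 'm set \<Rightarrow> bool" where
  "chart_open c W \<longleftrightarrow> c \<in> atlas B \<and> openin (base B) W \<and> W \<subseteq> cdom c"

lemma chartD:
  assumes "c \<in> atlas B"
  shows "openin (base B) (cdom c)" "openin (Euclidean_space n) (bcoord c ` cdom c)"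
    "homeomorphic_map (subtopology (base B) (cdom c))
      (subtopology (Euclidean_space n) (bcoord c ` cdom c)) (bcoord c)"
    "m \<in> cdom c \<Longrightarrow> bij_betw (fcoord c) (fibre B m) (topspace (Euclidean_space r))"
  using vector_bundle assms unfolding vector_bundle_def by blast+

lemma transitionD:
  assumes "c \<in> atlas B" "d \<in> atlas B"
  shows "i < n \<Longrightarrow> smooth_in B c (cdom c \<inter> cdom d) (\<lambda>m. bcoord d m i)"
    "m \<in> cdom c \<Longrightarrow> m \<in> cdom d \<Longrightarrow> e \<in> fibre B m \<Longrightarrow> a < r \<Longrightarrow>
      fcoord d e a = (\<Sum>b<r. trans_mat B c d a b m * fcoord c e b)"
    "a < r \<Longrightarrow> b < r \<Longrightarrow> smooth_in B c (cdom c \<inter> cdom d) (trans_mat B c d a b)"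
  using vector_bundle assms unfolding vector_bundle_def by blast+

lemma chart_open_cdom: "c \<in> atlas B \<Longrightarrow> chart_open c (cdom c)"
  by (simp add: chart_open_def chartD)

lemma chart_open_Int: "chart_open c W \<Longrightarrow> chart_open d X \<Longrightarrow> chart_open c (W \<inter> X)"
  by (auto simp: chart_open_def)

lemma chart_open_overlap: "c \<in> atlas B \<Longrightarrow> d \<in> atlas B \<Longrightarrow> chart_open c (cdom c \<inter> cdom d)"
  using chart_open_Int[OF chart_open_cdom chart_open_cdom] .

lemma inj_on_bcoord: "c \<in> atlas B \<Longrightarrow> inj_on (bcoord c) (cdom c)"
proof -
  assume c: "c \<in> atlas B"
  have "cdom c \<subseteq> topspace (base B)" using chartD(1)[OF c] openin_subset by blast
  then have "topspace (subtopology (base B) (cdom c)) = cdom c" by auto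
  then show ?thesis
    using homeomorphic_imp_injective_map[OF chartD(3)[OF c]] by simp
qed

lemma inv_bcoord: "c \<in> atlas B \<Longrightarrow> m \<in> cdom c \<Longrightarrow> inv_into (cdom c) (bcoord c) (bcoord c m) = m"
  by (rule inv_into_f_f[OF inj_on_bcoord])

lemma in_coords_bcoord: "c \<in> atlas B \<Longrightarrow> m \<in> cdom c \<Longrightarrow> in_coords c h (bcoord c m) = h m"
  by (simp add: in_coords_def inv_bcoord)

lemma openin_bcoord_image:
  assumes "chart_open c W"
  shows "openin (Euclidean_space n) (bcoord c ` W)"
proof -
  have c: "c \<in> atlas B" and W: "openin (base B) W" "W \<subseteq> cdom c"
    using assms by (auto simp: chart_open_def)
  have "openin (subtopology (base B) (cdom c)) W"
    using W chartD(1)[OF c] openin_open_subtopology by blast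
  then have "openin (subtopology (Euclidean_space n) (bcoord c ` cdom c)) (bcoord c ` W)"
    using homeomorphic_imp_open_map[OF chartD(3)[OF c]] unfolding open_map_def by blast
  then show ?thesis
    using chartD(2)[OF c] openin_trans_full by blast
qed

lemma smooth_in_iff_Ck:
  "chart_open c W \<Longrightarrow> smooth_in B c W h \<longleftrightarrow> (\<forall>k. Ck k n (bcoord c ` W) (in_coords c h))"
  unfolding smooth_in_def by (rule smooth_on_iff_Ck[OF openin_bcoord_image])

lemma smooth_in_const [intro]: "chart_open c W \<Longrightarrow> smooth_in B c W (\<lambda>m. s)"
  by (simp add: smooth_in_iff_Ck in_coords_algebra Ck_const openin_bcoord_image)

lemma smooth_in_add [intro]:
  "chart_open c W \<Longrightarrow> smooth_in B c W h \<Longrightarrow> smooth_in B c W g \<Longrightarrow> smooth_in B c W (\<lambda>m. h m + g m)"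
  by (simp add: smooth_in_iff_Ck in_coords_algebra Ck_add openin_bcoord_image)

lemma smooth_in_mult [intro]:
  "chart_open c W \<Longrightarrow> smooth_in B c W h \<Longrightarrow> smooth_in B c W g \<Longrightarrow> smooth_in B c W (\<lambda>m. h m * g m)"
  by (simp add: smooth_in_iff_Ck in_coords_algebra Ck_mult openin_bcoord_image)

lemma smooth_in_sum [intro]:
  "chart_open c W \<Longrightarrow> (\<And>i. i \<in> A \<Longrightarrow> smooth_in B c W (h i)) \<Longrightarrow> smooth_in B c W (\<lambda>m. \<Sum>i\<in>A. h i m)"
  by (induction A rule: infinite_finite_induct) auto

lemma smooth_in_prod [intro]:
  "chart_open c W \<Longrightarrow> (\<And>i. i \<in> A \<Longrightarrow> smooth_in B c W (h i)) \<Longrightarrow> smooth_in B c W (\<lambda>m. \<Prod>i\<in>A. h i m)"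
  by (induction A rule: infinite_finite_induct) auto

lemma smooth_in_cong:
  assumes W: "chart_open c W" and eq: "\<And>m. m \<in> W \<Longrightarrow> h m = g m" and h: "smooth_in B c W h"
  shows "smooth_in B c W g"
proof -
  have c: "c \<in> atlas B" "W \<subseteq> cdom c" using W by (auto simp: chart_open_def)
  have "in_coords c h y = in_coords c g y" if "y \<in> bcoord c ` W" for y
    using that eq c by (auto simp: in_coords_bcoord subset_iff)
  then show ?thesis
    using h Ck_cong[OF openin_bcoord_image[OF W]] unfolding smooth_in_iff_Ck[OF W] by blast
qed

lemma smooth_in_subset:
  assumes "chart_open c W" "smooth_in B c W h" "openin (base B) X" "X \<subseteq> W"
  shows "smooth_in B c X h"
proof -
  have X: "chart_open c X" using assms by (auto simp: chart_open_def)
  show ?thesis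
    using assms(2,4) unfolding smooth_in_iff_Ck[OF X] smooth_in_iff_Ck[OF assms(1)]
    by (meson Ck_subset image_mono)
qed

lemma smooth_in_Un:
  assumes W: "chart_open c W" "smooth_in B c W h" and X: "chart_open c X" "smooth_in B c X h"
  shows "smooth_in B c (W \<union> X) h"
proof -
  have U: "chart_open c (W \<union> X)" using W(1) X(1) by (auto simp: chart_open_def)
  show ?thesis
    using W(2) X(2) Ck_Un[OF openin_bcoord_image[OF W(1)] openin_bcoord_image[OF X(1)]]
    unfolding smooth_in_iff_Ck[OF U] smooth_in_iff_Ck[OF W(1)] smooth_in_iff_Ck[OF X(1)]
    by (simp add: image_Un)
qed

lemma smooth_in_cderiv:
  assumes W: "chart_open c W" and h: "smooth_in B c W h" and i: "i < n"
  shows "smooth_in B c W (cderiv c i h)"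
proof -
  have c: "c \<in> atlas B" "W \<subseteq> cdom c" using W by (auto simp: chart_open_def)
  have "smooth_on n (bcoord c ` W) (partial_deriv i (in_coords c h))"
    using h i unfolding smooth_in_def by (rule smooth_on_partial_deriv)
  then have "Ck k n (bcoord c ` W) (partial_deriv i (in_coords c h))" for k
    using smooth_on_iff_Ck[OF openin_bcoord_image[OF W]] by blast
  moreover have "partial_deriv i (in_coords c h) y = in_coords c (cderiv c i h) y" if "y \<in> bcoord c ` W" for y
    using that c by (auto simp: in_coords_bcoord subset_iff cderiv_def)
  ultimately show ?thesis
    unfolding smooth_in_iff_Ck[OF W] using Ck_cong[OF openin_bcoord_image[OF W]] by blast
qed

lemma smooth_in_has_cderiv:
  assumes "chart_open c W" "smooth_in B c W h" "i < n" "m \<in> W"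
  shows "has_cderiv c i h m (cderiv c i h m)"
  unfolding cderiv_def
  using smooth_on_has_partial[OF openin_bcoord_image[OF assms(1)] assms(2)[unfolded smooth_in_def] assms(3)]
    assms(4) by blast

lemma has_cderiv_add:
  "has_cderiv c i h m D \<Longrightarrow> has_cderiv c i g m E \<Longrightarrow> has_cderiv c i (\<lambda>m. h m + g m) m (D + E)"
  unfolding in_coords_algebra by (rule DERIV_add)

lemma has_cderiv_mult:
  assumes "c \<in> atlas B" "m \<in> cdom c" "has_cderiv c i h m D" "has_cderiv c i g m E"
  shows "has_cderiv c i (\<lambda>m. h m * g m) m (D * g m + h m * E)"
proof -
  have "has_partial i (\<lambda>y. in_coords c h y * in_coords c g y) (bcoord c m)
      (D * in_coords c g ((bcoord c m)(i := bcoord c m i)) + E * in_coords c h ((bcoord c m)(i := bcoord c m i)))"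
    by (rule DERIV_mult[OF assms(3,4)])
  then show ?thesis
    unfolding in_coords_algebra by (simp add: in_coords_bcoord[OF assms(1,2)] mult.commute)
qed

lemma has_cderiv_const: "has_cderiv c i (\<lambda>m. s) m 0"
  unfolding in_coords_algebra by simp

lemma has_cderiv_sum:
  "(\<And>k. k \<in> A \<Longrightarrow> has_cderiv c i (h k) m (D k)) \<Longrightarrow> has_cderiv c i (\<lambda>m. \<Sum>k\<in>A. h k m) m (\<Sum>k\<in>A. D k)"
  by (induction A rule: infinite_finite_induct) (simp_all add: has_cderiv_const has_cderiv_add)

lemma has_cderiv_cmult:
  "has_cderiv c i h m D \<Longrightarrow> has_cderiv c i (\<lambda>m. s * h m) m (s * D)"
  unfolding in_coords_algebra by (rule DERIV_cmult)

lemma cderiv_cong: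
  assumes W: "chart_open c W" and m: "m \<in> W" and i: "i < n" and eq: "\<And>m. m \<in> W \<Longrightarrow> h m = g m"
  shows "cderiv c i h m = cderiv c i g m"
proof -
  have c: "c \<in> atlas B" "W \<subseteq> cdom c" using W by (auto simp: chart_open_def)
  have "in_coords c h y = in_coords c g y" if "y \<in> bcoord c ` W" for y
    using that eq c by (auto simp: in_coords_bcoord subset_iff)
  then show ?thesis
    unfolding cderiv_def
    using m i by (intro partial_deriv_cong[OF openin_bcoord_image[OF W]]) auto
qed

text \<open>
  The change of coordinates: along a coordinate line of \<open>d\<close>, the coordinates of \<open>c\<close> form a
  differentiable curve.
\<close>

lemma has_cderiv_change_chart:
  assumes W: "chart_open c W" and h: "smooth_in B c W h" and d: "d \<in> atlas B"
    and m: "m \<in> W" "m \<in> cdom d" and i: "i < n"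
  shows "has_cderiv d i h m (\<Sum>j<n. cderiv d i (\<lambda>m. bcoord c m j) m * cderiv c j h m)"
proof -
  have c: "c \<in> atlas B" "W \<subseteq> cdom c" using W by (auto simp: chart_open_def)
  define X where "X = W \<inter> cdom d"
  have X: "chart_open c X" "chart_open d X"
    using W chart_open_cdom[OF d] unfolding X_def chart_open_def by auto
  have mX: "m \<in> X" using m X_def by auto
  have hX: "smooth_in B c X h"
    using smooth_in_subset[OF W h] X unfolding chart_open_def X_def by auto
  define g where "g t = bcoord c (inv_into (cdom d) (bcoord d) ((bcoord d m)(i := t)))" for t
  let ?t0 = "bcoord d m i"
  have ev: "\<forall>\<^sub>F t in nhds ?t0. (bcoord d m)(i := t) \<in> bcoord d ` X"
    using eventually_coordinate_line[OF openin_bcoord_image[OF X(2)] _ i] mX by blast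
  have gX: "inv_into (cdom d) (bcoord d) y \<in> X" if "y \<in> bcoord d ` X" for y
    using that X d unfolding chart_open_def by (auto simp: inv_bcoord subset_iff)
  have "((\<lambda>t. in_coords c h (g t)) has_real_derivative
      (\<Sum>j<n. partial_deriv j (in_coords c h) (g ?t0) * cderiv d i (\<lambda>m. bcoord c m j) m)) (at ?t0)"
  proof (rule chain_rule_along_curve[OF openin_bcoord_image[OF X(1)]])
    show "has_partial j (in_coords c h) x (partial_deriv j (in_coords c h) x)"
      if "j < n" "x \<in> bcoord c ` X" for j x
      using smooth_on_has_partial[OF openin_bcoord_image[OF X(1)] hX[unfolded smooth_in_def] that] .
    show "continuous_on (bcoord c ` X) (partial_deriv j (in_coords c h))" if "j < n" for j
      using smooth_on_continuous[OF openin_bcoord_image[OF X(1)] smooth_on_partial_deriv[OF hX[unfolded smooth_in_def] that]] .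
    show "g ?t0 \<in> bcoord c ` X"
      unfolding g_def using mX m(2) d by (simp add: inv_bcoord)
    show "\<forall>\<^sub>F t in nhds ?t0. g t \<in> model_space n"
      using ev
    proof eventually_elim
      case (elim t)
      then have "g t \<in> bcoord c ` X" unfolding g_def using gX by blast
      then show ?case using openin_Euclidean_space_subset[OF openin_bcoord_image[OF X(1)]] by blast
    qed
    show "((\<lambda>t. g t j) has_real_derivative cderiv d i (\<lambda>m. bcoord c m j) m) (at ?t0)" if "j < n" for j
    proof -
      have "smooth_in B d (cdom d \<inter> cdom c) (\<lambda>m. bcoord c m j)" using transitionD(1)[OF d c(1) that] .
      then have "has_cderiv d i (\<lambda>m. bcoord c m j) m (cderiv d i (\<lambda>m. bcoord c m j) m)"
        using smooth_in_has_cderiv[OF chart_open_overlap[OF d c(1)] _ i] m c(2) by blast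
      then show ?thesis by (simp add: g_def in_coords_def)
    qed
  qed
  moreover have "in_coords c h (g t) = in_coords d h ((bcoord d m)(i := t))"
    if "(bcoord d m)(i := t) \<in> bcoord d ` X" for t
    using gX[OF that] c X unfolding g_def chart_open_def by (auto simp: in_coords_bcoord in_coords_def inv_bcoord subset_iff)
  ultimately have "has_partial i (in_coords d h) (bcoord d m)
      (\<Sum>j<n. partial_deriv j (in_coords c h) (g ?t0) * cderiv d i (\<lambda>m. bcoord c m j) m)"
    using ev by (subst DERIV_cong_ev[OF refl _ refl, of _ "\<lambda>t. in_coords c h (g t)"]) (auto elim!: eventually_mono)
  moreover have "g ?t0 = bcoord c m" unfolding g_def using m(2) d by (simp add: inv_bcoord)
  ultimately show ?thesis by (simp add: cderiv_def mult.commute)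
qed

lemmas cderiv_change_chart = has_cderiv_imp_cderiv[OF has_cderiv_change_chart]

lemma smooth_in_change_chart:
  assumes W: "chart_open c W" "chart_open d W" and h: "smooth_in B c W h"
  shows "smooth_in B d W h"
proof -
  have c: "c \<in> atlas B" "W \<subseteq> cdom c" and d: "d \<in> atlas B" "W \<subseteq> cdom d"
    using W by (auto simp: chart_open_def)
  have coord: "smooth_in B d W (\<lambda>m. bcoord c m j)" if "j < n" for j
    using smooth_in_subset[OF chart_open_overlap[OF d(1) c(1)] transitionD(1)[OF d(1) c(1) that]] W c d
    by (auto simp: chart_open_def)
  have inv: "inv_into (cdom d) (bcoord d) y \<in> W" if "y \<in> bcoord d ` W" for y
    using that d by (auto simp: inv_bcoord subset_iff)
  have "continuous_on (bcoord d ` W) (\<lambda>y. bcoord c (inv_into (cdom d) (bcoord d) y) j)" for j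
  proof (cases "j < n")
    case True
    then show ?thesis
      using Ck_continuous[OF coord[OF True, unfolded smooth_in_iff_Ck[OF W(2)], rule_format]]
      by (simp add: in_coords_def comp_def)
  next
    case False
    have "bcoord c (inv_into (cdom d) (bcoord d) y) j = 0" if "y \<in> bcoord d ` W" for y
      using inv[OF that] openin_Euclidean_space_subset[OF openin_bcoord_image[OF W(1)]] False by fastforce
    then show ?thesis by (intro continuous_on_eq[OF continuous_on_const[of _ 0]]) simp
  qed
  then have trans_cont: "continuous_on (bcoord d ` W) (\<lambda>y. bcoord c (inv_into (cdom d) (bcoord d) y))"
    by (rule continuous_on_coordinatewise_then_product)
  have eq: "in_coords d g y = in_coords c g (bcoord c (inv_into (cdom d) (bcoord d) y))"
    if "y \<in> bcoord d ` W" for g :: "'m \<Rightarrow> real" and y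
  proof -
    have "in_coords c g (bcoord c (inv_into (cdom d) (bcoord d) y)) = g (inv_into (cdom d) (bcoord d) y)"
      by (rule in_coords_bcoord[OF c(1)]) (use inv[OF that] c(2) in blast)
    then show ?thesis by (simp add: in_coords_def)
  qed
  have cont: "continuous_on (bcoord d ` W) (in_coords d g)" if g: "smooth_in B c W g" for g
  proof -
    have "continuous_on (bcoord c ` W) (in_coords c g)"
      using g Ck_continuous unfolding smooth_in_iff_Ck[OF W(1)] by blast
    then have "continuous_on (bcoord d ` W) (\<lambda>y. in_coords c g (bcoord c (inv_into (cdom d) (bcoord d) y)))"
      by (rule continuous_on_compose2[OF _ trans_cont]) (use inv in auto)
    then show ?thesis by (rule continuous_on_eq) (rule eq[symmetric])
  qed
  have "Ck k n (bcoord d ` W) (in_coords d h)" for k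
    using h
  proof (induction k arbitrary: h)
    case 0
    then show ?case using cont by simp
  next
    case (Suc k)
    show ?case
    proof (rule Ck_SucI[where g = "\<lambda>i. in_coords d (\<lambda>m. \<Sum>j<n. cderiv d i (\<lambda>m. bcoord c m j) m * cderiv c j h m)",
          OF openin_bcoord_image[OF W(2)] cont[OF Suc.prems]])
      fix i assume i: "i < n"
      have part: "has_partial i (in_coords d h) y
          (in_coords d (\<lambda>m. \<Sum>j<n. cderiv d i (\<lambda>m. bcoord c m j) m * cderiv c j h m) y)"
        if y: "y \<in> bcoord d ` W" for y
      proof -
        obtain m where m: "m \<in> W" "y = bcoord d m" using y by blast
        then show ?thesis
          using has_cderiv_change_chart[OF W(1) Suc.prems d(1) m(1) _ i] d by (auto simp: in_coords_bcoord)
      qed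
      have summand: "Ck k n (bcoord d ` W) (in_coords d (\<lambda>m. cderiv d i (\<lambda>m. bcoord c m j) m * cderiv c j h m))"
        if "j < n" for j
        unfolding in_coords_algebra
        using smooth_in_cderiv[OF W(2) coord[OF that] i] Suc.IH[OF smooth_in_cderiv[OF W(1) Suc.prems that]]
        by (intro Ck_mult openin_bcoord_image W) (auto simp: smooth_in_iff_Ck[OF W(2)])
      have sum: "Ck k n (bcoord d ` W) (in_coords d (\<lambda>m. \<Sum>j\<in>A. F j m))"
        if "\<And>j. j \<in> A \<Longrightarrow> Ck k n (bcoord d ` W) (in_coords d (F j))" for A :: "nat set" and F
        using that
      proof (induction A rule: infinite_finite_induct)
        case (insert x A)
        then show ?case
          by (simp add: in_coords_algebra Ck_add[OF openin_bcoord_image[OF W(2)]])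
      qed (simp_all add: in_coords_algebra Ck_const[OF openin_bcoord_image[OF W(2)]])
      show "Ck k n (bcoord d ` W) (in_coords d (\<lambda>m. \<Sum>j<n. cderiv d i (\<lambda>m. bcoord c m j) m * cderiv c j h m)) \<and>
        (\<forall>y\<in>bcoord d ` W. has_partial i (in_coords d h) y
          (in_coords d (\<lambda>m. \<Sum>j<n. cderiv d i (\<lambda>m. bcoord c m j) m * cderiv c j h m) y))"
        by (intro conjI ballI part) (rule sum, rule summand, simp)
    qed
  qed
  then show ?thesis unfolding smooth_in_iff_Ck[OF W(2)] by blast
qed

lemma fcoord_frame:
  assumes "c \<in> atlas B" "m \<in> cdom c" "b < r"
  defines "e \<equiv> inv_into (fibre B m) (fcoord c) (\<lambda>j. if j = b then 1 else 0)"
  shows "e \<in> fibre B m" "fcoord c e = (\<lambda>j. if j = b then 1 else 0)"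
proof -
  have "(\<lambda>j. if j = b then 1 else 0) \<in> fcoord c ` fibre B m"
    using chartD(4)[OF assms(1,2)] assms(3) unfolding bij_betw_def by (auto simp: topspace_Euclidean_space)
  then show "e \<in> fibre B m" "fcoord c e = (\<lambda>j. if j = b then 1 else 0)"
    unfolding e_def by (rule inv_into_into, rule f_inv_into_f)
qed

lemma trans_mat_self:
  assumes "c \<in> atlas B" "m \<in> cdom c" "a < r" "b < r"
  shows "trans_mat B c c a b m = (if a = b then 1 else 0)"
  unfolding trans_mat_def fcoord_frame(2)[OF assms(1,2,4)] by simp

lemma trans_mat_cocycle:
  assumes "c \<in> atlas B" "d \<in> atlas B" "e \<in> atlas B" "m \<in> cdom c" "m \<in> cdom d" "m \<in> cdom e"
    and "a < r" "b < r"
  shows "(\<Sum>k<r. trans_mat B d e a k m * trans_mat B c d k b m) = trans_mat B c e a b m"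
  using transitionD(2)[OF assms(2,3,5,6) fcoord_frame(1)[OF assms(1,4,8)] assms(7)]
  unfolding trans_mat_def[of B c] by simp

lemma trans_mat_inverse:
  assumes "c \<in> atlas B" "d \<in> atlas B" "m \<in> cdom c" "m \<in> cdom d" "a < r" "b < r"
  shows "(\<Sum>k<r. trans_mat B d c a k m * trans_mat B c d k b m) = (if a = b then 1 else 0)"
  using trans_mat_cocycle[of c d c m a b] trans_mat_self assms by simp

end

section \<open>Forms and the operators acting on them\<close>

subsection \<open>The variables of the two exterior algebras\<close>

abbreviation xi_vars :: "nat \<Rightarrow> nat set" where "xi_vars k \<equiv> xi ` {..<k}"
abbreviation theta_vars :: "nat \<Rightarrow> nat set" where "theta_vars k \<equiv> theta ` {..<k}"

lemma sum_lessThan_double: "(\<Sum>j<2 * k. F j) = (\<Sum>b<k. F (xi b)) + (\<Sum>b<k. F (theta b))"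
  for F :: "nat \<Rightarrow> 'x::comm_monoid_add"
  by (induction k) (simp_all add: ac_simps)

lemma lessThan_double: "{..<2 * k} = xi_vars k \<union> theta_vars k"
proof -
  have "j \<in> xi_vars k \<union> theta_vars k" if "j < 2 * k" for j
  proof (cases "even j")
    case True
    then show ?thesis using that by (auto elim!: evenE)
  next
    case False
    then show ?thesis using that by (auto elim!: oddE)
  qed
  then show ?thesis by auto
qed

lemma xi_vars_subset: "xi_vars k \<subseteq> {..<2 * k}" and theta_vars_subset: "theta_vars k \<subseteq> {..<2 * k}"
  by (auto simp: lessThan_double)

lemma lderiv_eq_0:
  assumes "f \<in> ext_poly S" "j \<notin> S"
  shows "lderiv j f = 0"
proof (rule ext, clarify)
  fix J and K :: "nat multiset"
  have "f (insert j J, K) = 0" using assms ext_polyD[OF assms(1), of "insert j J" K] by blast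
  then show "lderiv j f (J, K) = (0 :: gpoly) (J, K)" by (simp add: lderiv_def zero_fun_apply)
qed

lemma theta_notin_xi_vars [simp]: "Suc (2 * a) \<notin> xi_vars k" and xi_notin_theta_vars [simp]: "2 * a \<notin> theta_vars k"
  by (auto, presburger+)

context smooth_bundle
begin

lemma linear_substitution_odd_trans:
  "linear_substitution {..<2 * r}
    (\<lambda>k j. if even k \<and> even j then trans_mat B c d (k div 2) (j div 2) m
      else if odd k \<and> odd j then trans_mat B d c (j div 2) (k div 2) m else 0)
    (odd_trans B c d m) {..<2 * r}"
  by unfold_locales (auto simp: odd_trans_def sum_lessThan_double Let_def)

sublocale L: linear_substitution "{..<2 * r}"
  "\<lambda>k j. if even k \<and> even j then trans_mat B c d (k div 2) (j div 2) m
      else if odd k \<and> odd j then trans_mat B d c (j div 2) (k div 2) m else 0"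
  "odd_trans B c d m" "mom_trans B c d m" "{..<2 * r}" for c d m
  by (rule linear_substitution_odd_trans)

abbreviation hh where "hh c d m \<equiv> gsubst (odd_trans B c d m) (mom_trans B c d m)"

lemma odd_trans_xi: "odd_trans B c d m (xi a) = (\<Sum>b<r. trans_mat B c d a b m *\<^sub>g godd (xi b))"
  and odd_trans_theta: "odd_trans B c d m (theta a) = (\<Sum>b<r. trans_mat B d c b a m *\<^sub>g godd (theta b))"
  by (simp_all add: odd_trans_def)

lemma ext_xi [simp]: "f \<in> ext_poly (xi_vars r) \<Longrightarrow> f \<in> ext_poly {..<2 * r}"
  and ext_theta [simp]: "f \<in> ext_poly (theta_vars r) \<Longrightarrow> f \<in> ext_poly {..<2 * r}"
  by (auto intro: ext_poly_mono[OF _ xi_vars_subset] ext_poly_mono[OF _ theta_vars_subset])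

lemma ext_odd_trans_xi: "odd_trans B c d m (xi a) \<in> ext_poly (xi_vars r)"
  and ext_odd_trans_theta: "odd_trans B c d m (theta a) \<in> ext_poly (theta_vars r)"
  unfolding odd_trans_xi odd_trans_theta by (intro ext_poly_sum ext_poly_scale ext_poly_godd, blast)+

lemma ext_hh_xi [simp]: "f \<in> ext_poly (xi_vars r) \<Longrightarrow> hh c d m f \<in> ext_poly (xi_vars r)"
  by (rule L.ext_poly_h_restrict[OF _ xi_vars_subset]) (auto intro: ext_odd_trans_xi)

lemma ext_hh_theta [simp]: "f \<in> ext_poly (theta_vars r) \<Longrightarrow> hh c d m f \<in> ext_poly (theta_vars r)"
  by (rule L.ext_poly_h_restrict[OF _ theta_vars_subset]) (auto intro: ext_odd_trans_theta[unfolded One_nat_def add_Suc_right add_0_right])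

lemma lderiv_xi_hh:
  assumes "b < r" "f \<in> ext_poly {..<2 * r}"
  shows "lderiv (xi b) (hh c d m f) = (\<Sum>a<r. trans_mat B c d a b m *\<^sub>g hh c d m (lderiv (xi a) f))"
  using assms by (subst L.lderiv_h) (simp_all add: sum_lessThan_double)

lemma lderiv_theta_hh:
  assumes "b < r" "f \<in> ext_poly {..<2 * r}"
  shows "lderiv (theta b) (hh c d m f) = (\<Sum>a<r. trans_mat B d c b a m *\<^sub>g hh c d m (lderiv (theta a) f))"
  using assms by (subst L.lderiv_h) (simp_all add: sum_lessThan_double)

lemma sum_delta_scale:
  "finite A \<Longrightarrow> (\<Sum>k\<in>A. (if a = k then 1 else 0) *\<^sub>g F k) = (if a \<in> A then F a else 0)"
  "finite A \<Longrightarrow> (\<Sum>k\<in>A. (if k = a then 1 else 0) *\<^sub>g F k) = (if a \<in> A then F a else 0)"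
proof -
  have e: "(if a = k then 1 else 0) *\<^sub>g F k = (if a = k then F k else 0)"
    "(if k = a then 1 else 0) *\<^sub>g F k = (if k = a then F k else 0)" for k by simp_all
  show "finite A \<Longrightarrow> (\<Sum>k\<in>A. (if a = k then 1 else 0) *\<^sub>g F k) = (if a \<in> A then F a else 0)"
    "finite A \<Longrightarrow> (\<Sum>k\<in>A. (if k = a then 1 else 0) *\<^sub>g F k) = (if a \<in> A then F a else 0)"
    unfolding e by simp_all
qed

lemma hh_compose:
  assumes "c \<in> atlas B" "d \<in> atlas B" "e \<in> atlas B" "m \<in> cdom c" "m \<in> cdom d" "m \<in> cdom e"
    and f: "f \<in> ext_poly (xi_vars r)"
  shows "hh c d m (hh d e m f) = hh c e m f"
  using finite_imageI[OF finite_lessThan] f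
proof (induction rule: ext_poly_induct)
  case (godd k f)
  obtain a where a: "k = xi a" "a < r" using godd(1) by auto
  have "hh c d m (odd_trans B d e m (xi a)) =
      (\<Sum>b<r. trans_mat B d e a b m *\<^sub>g odd_trans B c d m (xi b))"
    unfolding odd_trans_xi[of d e]
    by (subst L.h_sum) (auto simp: L.h_scale L.h_godd intro!: ext_poly_scale ext_poly_godd)
  also have "\<dots> = (\<Sum>k<r. (\<Sum>b<r. trans_mat B d e a b m * trans_mat B c d b k m) *\<^sub>g godd (xi k))"
    unfolding odd_trans_xi gscale_sum gscale_sum_left gscale_gscale by (rule sum.swap)
  also have "\<dots> = odd_trans B c e m (xi a)"
    unfolding odd_trans_xi using trans_mat_cocycle[OF assms(1-6) a(2)] by simp
  finally have s: "hh c d m (odd_trans B d e m (xi a)) = odd_trans B c e m (xi a)" .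
  have "k < 2 * r" using a by simp
  then show ?case
    using godd(2,3) s[folded a(1)] L.h_gmult[OF L.ext_poly_s L.ext_poly_h]
    by (simp add: L.h_godd_mult)
next
  case (add f g)
  then show ?case by (simp add: L.h_add L.ext_poly_h)
next
  case (scale t f)
  then show ?case by (simp add: L.h_scale L.ext_poly_h)
qed simp

lemma hh_self:
  assumes "c \<in> atlas B" "m \<in> cdom c" and f: "f \<in> ext_poly (xi_vars r)"
  shows "hh c c m f = f"
  using finite_imageI[OF finite_lessThan] f
proof (induction rule: ext_poly_induct)
  case (godd k f)
  obtain a where a: "k = xi a" "a < r" using godd(1) by auto
  have "odd_trans B c c m (xi a) = (\<Sum>b<r. (if a = b then 1 else 0) *\<^sub>g godd (xi b))"
    unfolding odd_trans_xi using trans_mat_self[OF assms(1,2) a(2)] by simp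
  then have s: "odd_trans B c c m (xi a) = godd (xi a)" using a by (simp add: sum_delta_scale)
  have "k < 2 * r" using a by simp
  then show ?case using godd(2,3) by (simp add: L.h_godd_mult) (simp add: a s)
next
  case (add f g)
  then show ?case by (simp add: L.h_add)
next
  case (scale t f)
  then show ?case by (simp add: L.h_scale)
qed simp

text \<open>
  Interior products are compatible with changes of chart because the matrices by which the
  \<open>\<theta>\<^sub>a\<close> and the derivatives with respect to the \<open>\<xi>\<^sup>a\<close> transform are inverse to each other.
\<close>

lemma gint_hh:
  assumes c: "c \<in> atlas B" and d: "d \<in> atlas B" and m: "m \<in> cdom c" "m \<in> cdom d"
    and X: "X \<in> ext_poly (theta_vars r)" and u: "u \<in> ext_poly (xi_vars r)"
  shows "gint (hh c d m X) (hh c d m u) = hh c d m (gint X u)"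
  using finite_imageI[OF finite_lessThan] X
proof (induction rule: ext_poly_induct)
  case (godd k X)
  obtain a where a: "k = theta a" "a < r" using godd(1) by auto
  have k: "k < 2 * r" using a by simp
  let ?v = "gint X u"
  have v: "?v \<in> ext_poly (xi_vars r)"
    using ext_poly_gint[OF finite_lessThan ext_theta[OF godd(2)] u] .
  have "gint (odd_trans B c d m (theta a)) (hh c d m ?v) =
      (\<Sum>b<r. trans_mat B d c b a m *\<^sub>g lderiv (xi b) (hh c d m ?v))"
    unfolding odd_trans_theta
    by (subst gint_sum_left[of "theta_vars r"])
      (auto simp: gint_scale_left[of "theta_vars r"] gint_godd oconj_def intro!: sum.cong)
  also have "\<dots> = (\<Sum>b<r. \<Sum>a'<r. (trans_mat B d c b a m * trans_mat B c d a' b m) *\<^sub>g hh c d m (lderiv (xi a') ?v))"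
    using v by (intro sum.cong) (simp_all add: lderiv_xi_hh gscale_sum)
  also have "\<dots> = (\<Sum>a'<r. (\<Sum>b<r. trans_mat B c d a' b m * trans_mat B d c b a m) *\<^sub>g hh c d m (lderiv (xi a') ?v))"
    unfolding gscale_sum_left by (subst sum.swap) (simp add: mult.commute)
  also have "\<dots> = (\<Sum>a'<r. (if a' = a then 1 else 0) *\<^sub>g hh c d m (lderiv (xi a') ?v))"
    using trans_mat_inverse[OF d c m(2,1) _ a(2)] by (intro sum.cong) auto
  also have "\<dots> = hh c d m (lderiv (xi a) ?v)" using a by (simp add: sum_delta_scale)
  finally have s: "gint (odd_trans B c d m k) (hh c d m ?v) = hh c d m (lderiv (xi a) ?v)"
    unfolding a(1) .
  have "gint (hh c d m (godd k \<otimes> X)) (hh c d m u) = gint (odd_trans B c d m k) (gint (hh c d m X) (hh c d m u))"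
    using godd(2) k L.ext_poly_s L.ext_poly_h
    by (simp add: L.h_godd_mult gint_gmult[of "{..<2 * r}"])
  also have "\<dots> = hh c d m (gint (godd k \<otimes> X) u)"
    unfolding godd(3) s using godd(2) k by (simp add: gint_godd_mult[of "{..<2 * r}"]) (simp add: a oconj_def)
  finally show ?case .
next
  case (add X Y)
  have "gint X u \<in> ext_poly {..<2 * r}" "gint Y u \<in> ext_poly {..<2 * r}"
    using ext_poly_gint[OF finite_lessThan ext_theta[OF add(1)] ext_xi[OF u]]
      ext_poly_gint[OF finite_lessThan ext_theta[OF add(2)] ext_xi[OF u]] .
  then show ?case using add
    by (simp add: L.h_add gint_add_left[of "{..<2 * r}"] L.ext_poly_h)
next
  case (scale t X)
  have "gint X u \<in> ext_poly {..<2 * r}"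
    using ext_poly_gint[OF finite_lessThan ext_theta[OF scale(1)] ext_xi[OF u]] .
  then show ?case using scale
    by (simp add: L.h_scale gint_scale_left[of "{..<2 * r}"] L.ext_poly_h)
qed simp

subsection \<open>Smooth families of polynomials\<close>

definition smooth_poly :: "('m, 'a) vb_chart \<Rightarrow> 'm set \<Rightarrow> ('m \<Rightarrow> gpoly) \<Rightarrow> bool" where
  "smooth_poly c W F \<longleftrightarrow> (\<forall>JK. smooth_in B c W (\<lambda>m. F m JK))"

lemma smooth_poly_const: "chart_open c W \<Longrightarrow> smooth_poly c W (\<lambda>m. f)"
  unfolding smooth_poly_def by (intro allI smooth_in_const)

lemma smooth_poly_add:
  "chart_open c W \<Longrightarrow> smooth_poly c W F \<Longrightarrow> smooth_poly c W G \<Longrightarrow> smooth_poly c W (\<lambda>m. F m + G m)"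
  unfolding smooth_poly_def plus_fun_apply by (intro allI smooth_in_add) auto

lemma smooth_poly_fscale:
  "chart_open c W \<Longrightarrow> smooth_in B c W h \<Longrightarrow> smooth_poly c W G \<Longrightarrow> smooth_poly c W (\<lambda>m. h m *\<^sub>g G m)"
  unfolding smooth_poly_def gscale_apply by (intro allI smooth_in_mult) auto

lemma smooth_poly_scale:
  "chart_open c W \<Longrightarrow> smooth_poly c W G \<Longrightarrow> smooth_poly c W (\<lambda>m. s *\<^sub>g G m)"
  by (intro smooth_poly_fscale smooth_in_const)

lemma smooth_poly_sum:
  "chart_open c W \<Longrightarrow> (\<And>i. i \<in> A \<Longrightarrow> smooth_poly c W (F i)) \<Longrightarrow> smooth_poly c W (\<lambda>m. \<Sum>i\<in>A. F i m)"
  unfolding smooth_poly_def fun_sum_apply by (intro allI smooth_in_sum) auto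

lemma smooth_poly_gmult:
  "chart_open c W \<Longrightarrow> smooth_poly c W F \<Longrightarrow> smooth_poly c W G \<Longrightarrow> smooth_poly c W (\<lambda>m. F m \<otimes> G m)"
  unfolding smooth_poly_def gmult_def split_paired_all split_paired_All prod.case
  by (intro allI smooth_in_sum smooth_in_mult smooth_in_const) auto

lemma smooth_poly_coeffwise:
  assumes "chart_open c W" "smooth_poly c W F" "\<And>f J K. P f (J, K) = s J K * f (\<sigma> J K)"
  shows "smooth_poly c W (\<lambda>m. P (F m))"
  unfolding smooth_poly_def split_paired_All assms(3)
  by (intro allI smooth_in_mult smooth_in_const assms(1) assms(2)[unfolded smooth_poly_def, rule_format])

lemma smooth_poly_lderiv: "chart_open c W \<Longrightarrow> smooth_poly c W F \<Longrightarrow> smooth_poly c W (\<lambda>m. lderiv j (F m))"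
  by (rule smooth_poly_coeffwise[where s = "\<lambda>J K. if j \<in> J then 0 else osign {j} J" and \<sigma> = "\<lambda>J K. (insert j J, K)"])
    (simp_all add: lderiv_def)

lemma smooth_poly_rderiv: "chart_open c W \<Longrightarrow> smooth_poly c W F \<Longrightarrow> smooth_poly c W (\<lambda>m. rderiv j (F m))"
  by (rule smooth_poly_coeffwise[where s = "\<lambda>J K. if j \<in> J then 0 else osign J {j}" and \<sigma> = "\<lambda>J K. (insert j J, K)"])
    (simp_all add: rderiv_def)

lemma smooth_poly_pderiv_mom: "chart_open c W \<Longrightarrow> smooth_poly c W F \<Longrightarrow> smooth_poly c W (\<lambda>m. pderiv_mom j (F m))"
  by (rule smooth_poly_coeffwise[where s = "\<lambda>J K. real (count K j + 1)" and \<sigma> = "\<lambda>J K. (J, K + {#j#})"])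
    (simp_all add: pderiv_mom_def)

lemma smooth_poly_ginv: "chart_open c W \<Longrightarrow> smooth_poly c W F \<Longrightarrow> smooth_poly c W (\<lambda>m. ginv (F m))"
  by (rule smooth_poly_coeffwise[where s = "\<lambda>J K. (-1) ^ card J" and \<sigma> = "\<lambda>J K. (J, K)"])
    (simp_all add: ginv_def)

lemma smooth_poly_homogeneous: "chart_open c W \<Longrightarrow> smooth_poly c W F \<Longrightarrow> smooth_poly c W (\<lambda>m. homogeneous k (F m))"
  by (rule smooth_poly_coeffwise[where s = "\<lambda>J K. if card J = k then 1 else 0" and \<sigma> = "\<lambda>J K. (J, K)"])
    (simp_all add: homogeneous_def)

lemma smooth_poly_gint:
  assumes W: "chart_open c W" and S: "finite S" "\<And>m. X m \<in> ext_poly S"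
    and X: "smooth_poly c W X" and F: "smooth_poly c W F"
  shows "smooth_poly c W (\<lambda>m. gint (X m) (F m))"
proof -
  have "smooth_poly c W (\<lambda>m. foldr (\<lambda>j. lderiv (oconj j)) js (F m))" for js
    by (induction js) (auto intro: F smooth_poly_lderiv[OF W])
  then show ?thesis
    unfolding gint_ext_eq[OF S] using X
    by (intro smooth_poly_sum smooth_poly_fscale W) (auto simp: smooth_poly_def)
qed

definition dpoly :: "('m, 'a) vb_chart \<Rightarrow> nat \<Rightarrow> ('m \<Rightarrow> gpoly) \<Rightarrow> 'm \<Rightarrow> gpoly" where
  "dpoly c i F m = (\<lambda>JK. cderiv c i (\<lambda>m'. F m' JK) m)"

lemma dbase_eq_dpoly: "dbase c i F m = dpoly c i (F c) m"
  by (simp add: dbase_def dpoly_def)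

lemma smooth_poly_dpoly:
  "chart_open c W \<Longrightarrow> smooth_poly c W F \<Longrightarrow> i < n \<Longrightarrow> smooth_poly c W (dpoly c i F)"
  unfolding smooth_poly_def dpoly_def by (intro allI smooth_in_cderiv) auto

lemma ext_poly_dpoly:
  assumes "\<And>m. F m \<in> ext_poly S"
  shows "dpoly c i F m \<in> ext_poly S"
proof -
  have "dpoly c i F m (J, K) = 0" if "\<not> (K = {#} \<and> J \<subseteq> S \<and> finite J)" for J K
  proof -
    have "(\<lambda>m'. F m' (J, K)) = (\<lambda>m'. 0)" using ext_polyD[OF assms, of _ J K] that by blast
    then show ?thesis unfolding dpoly_def using has_cderiv_imp_cderiv[OF has_cderiv_const] by metis
  qed
  then show ?thesis unfolding ext_poly_def by blast
qed

definition has_dpoly :: "('m, 'a) vb_chart \<Rightarrow> nat \<Rightarrow> ('m \<Rightarrow> gpoly) \<Rightarrow> 'm \<Rightarrow> gpoly \<Rightarrow> bool" where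
  "has_dpoly c i F m D \<longleftrightarrow> (\<forall>JK. has_cderiv c i (\<lambda>m'. F m' JK) m (D JK))"

lemma has_dpoly_imp_dpoly: "has_dpoly c i F m D \<Longrightarrow> dpoly c i F m = D"
  unfolding has_dpoly_def dpoly_def by (blast intro: ext has_cderiv_imp_cderiv)

lemma smooth_poly_has_dpoly:
  "chart_open c W \<Longrightarrow> smooth_poly c W F \<Longrightarrow> i < n \<Longrightarrow> m \<in> W \<Longrightarrow> has_dpoly c i F m (dpoly c i F m)"
  unfolding has_dpoly_def dpoly_def smooth_poly_def by (blast intro: smooth_in_has_cderiv)

lemma has_dpoly_const: "has_dpoly c i (\<lambda>m. f) m 0"
  unfolding has_dpoly_def zero_fun_apply by (blast intro: has_cderiv_const)

lemma has_dpoly_add: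
  "has_dpoly c i F m D \<Longrightarrow> has_dpoly c i G m E \<Longrightarrow> has_dpoly c i (\<lambda>m. F m + G m) m (D + E)"
  unfolding has_dpoly_def plus_fun_apply by (intro allI has_cderiv_add) blast+

lemma has_dpoly_sum:
  "(\<And>k. k \<in> A \<Longrightarrow> has_dpoly c i (F k) m (D k)) \<Longrightarrow> has_dpoly c i (\<lambda>m. \<Sum>k\<in>A. F k m) m (\<Sum>k\<in>A. D k)"
  unfolding has_dpoly_def fun_sum_apply by (intro allI has_cderiv_sum) blast

lemma has_dpoly_fscale:
  assumes "c \<in> atlas B" "m \<in> cdom c" "has_cderiv c i h m D" "has_dpoly c i F m E"
  shows "has_dpoly c i (\<lambda>m. h m *\<^sub>g F m) m (D *\<^sub>g F m + h m *\<^sub>g E)"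
  using assms(4) unfolding has_dpoly_def plus_fun_apply gscale_apply
  by (intro allI has_cderiv_mult[OF assms(1-3)]) blast

lemma has_dpoly_scale:
  "has_dpoly c i F m E \<Longrightarrow> has_dpoly c i (\<lambda>m. s *\<^sub>g F m) m (s *\<^sub>g E)"
  unfolding has_dpoly_def gscale_apply by (intro allI has_cderiv_cmult) blast

lemma has_dpoly_gmult:
  assumes c: "c \<in> atlas B" "m \<in> cdom c" and F: "has_dpoly c i F m D" and G: "has_dpoly c i G m E"
  shows "has_dpoly c i (\<lambda>m. F m \<otimes> G m) m (D \<otimes> G m + F m \<otimes> E)"
  unfolding has_dpoly_def
proof (intro allI)
  fix JK :: "nat set \<times> nat multiset"
  obtain J K where JK: "JK = (J, K)" by force
  have "has_cderiv c i (\<lambda>m. \<Sum>J'\<in>Pow J. \<Sum>K'\<in>{K'. K' \<subseteq># K}.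
      osign J' (J - J') * (F m (J', K') * G m (J - J', K - K'))) m
    (\<Sum>J'\<in>Pow J. \<Sum>K'\<in>{K'. K' \<subseteq># K}. osign J' (J - J') *
      (D (J', K') * G m (J - J', K - K') + F m (J', K') * E (J - J', K - K')))"
    using F G unfolding has_dpoly_def
    by (intro has_cderiv_sum has_cderiv_cmult has_cderiv_mult[OF c]) blast+
  then show "has_cderiv c i (\<lambda>m. (F m \<otimes> G m) JK) m ((D \<otimes> G m + F m \<otimes> E) JK)"
    unfolding JK gmult_def plus_fun_apply
    by (simp add: distrib_left sum.distrib mult.assoc)
qed

end

context smooth_bundle
begin

subsection \<open>Membership in the spaces of forms and multivectors\<close>

lemma subset_xi_vars: "J \<subseteq> {..<2 * k} \<Longrightarrow> J \<subseteq> range xi \<Longrightarrow> J \<subseteq> xi_vars k"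
  and subset_theta_vars: "J \<subseteq> {..<2 * k} \<Longrightarrow> J \<subseteq> range theta \<Longrightarrow> J \<subseteq> theta_vars k"
  by (force, force)

lemma sfunctionsD:
  assumes "F \<in> sfunctions B"
  shows "c \<notin> atlas B \<or> m \<notin> cdom c \<Longrightarrow> F c m = 0"
    and "F c m (J, K) \<noteq> 0 \<Longrightarrow> J \<subseteq> {..<2 * r}"
    and "F c m (J, K) \<noteq> 0 \<Longrightarrow> set_mset K \<subseteq> {..<n}"
    and "c \<in> atlas B \<Longrightarrow> smooth_poly c (cdom c) (F c)"
    and "c \<in> atlas B \<Longrightarrow> d \<in> atlas B \<Longrightarrow> m \<in> cdom c \<Longrightarrow> m \<in> cdom d \<Longrightarrow> F c m = hh c d m (F d m)"
proof -
  note S = assms[unfolded sfunctions_def mem_Collect_eq]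
  note 1 = S[THEN conjunct1] and S2 = S[THEN conjunct2]
  note 2 = S2[THEN conjunct1] and S3 = S2[THEN conjunct2, THEN conjunct2]
  note 3 = S3[THEN conjunct1] and 4 = S3[THEN conjunct2]
  show "c \<notin> atlas B \<or> m \<notin> cdom c \<Longrightarrow> F c m = 0" by (rule 1[rule_format])
  show "F c m (J, K) \<noteq> 0 \<Longrightarrow> J \<subseteq> {..<2 * r}" by (rule 2[rule_format, THEN conjunct1])
  show "F c m (J, K) \<noteq> 0 \<Longrightarrow> set_mset K \<subseteq> {..<n}" by (rule 2[rule_format, THEN conjunct2])
  show "c \<in> atlas B \<Longrightarrow> smooth_poly c (cdom c) (F c)"
    unfolding smooth_poly_def by (intro allI 3[rule_format])
  show "c \<in> atlas B \<Longrightarrow> d \<in> atlas B \<Longrightarrow> m \<in> cdom c \<Longrightarrow> m \<in> cdom d \<Longrightarrow> F c m = hh c d m (F d m)"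
    by (intro 4[rule_format] IntI)
qed

lemma formsD:
  assumes "F \<in> forms B"
  shows "c \<notin> atlas B \<or> m \<notin> cdom c \<Longrightarrow> F c m = 0"
    and "F c m \<in> ext_poly (xi_vars r)"
    and "c \<in> atlas B \<Longrightarrow> smooth_poly c (cdom c) (F c)"
    and "c \<in> atlas B \<Longrightarrow> d \<in> atlas B \<Longrightarrow> m \<in> cdom c \<Longrightarrow> m \<in> cdom d \<Longrightarrow> F c m = hh c d m (F d m)"
proof -
  have F: "F \<in> sfunctions B" and vars: "\<forall>c m J K. F c m (J, K) \<noteq> 0 \<longrightarrow> K = {#} \<and> J \<subseteq> range xi"
    using assms unfolding forms_def by simp_all
  have "K = {#} \<and> J \<subseteq> xi_vars r \<and> finite J" if nz: "F c m (J, K) \<noteq> 0" for J K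
  proof -
    have J: "J \<subseteq> {..<2 * r}" by (rule sfunctionsD(2)[OF F nz])
    have K: "K = {#}" "J \<subseteq> range xi" using vars nz by simp_all
    have "finite J" by (rule finite_subset[OF J]) simp
    then show ?thesis using subset_xi_vars[OF J K(2)] K(1) by simp
  qed
  then show "F c m \<in> ext_poly (xi_vars r)" unfolding ext_poly_def by simp
  show "c \<notin> atlas B \<or> m \<notin> cdom c \<Longrightarrow> F c m = 0"
    "c \<in> atlas B \<Longrightarrow> smooth_poly c (cdom c) (F c)"
    "c \<in> atlas B \<Longrightarrow> d \<in> atlas B \<Longrightarrow> m \<in> cdom c \<Longrightarrow> m \<in> cdom d \<Longrightarrow> F c m = hh c d m (F d m)"
    by (rule sfunctionsD[OF F]; assumption)+
qed

lemma formsI: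
  assumes zero: "\<And>c m. c \<notin> atlas B \<or> m \<notin> cdom c \<Longrightarrow> F c m = 0"
    and ext: "\<And>c m. c \<in> atlas B \<Longrightarrow> m \<in> cdom c \<Longrightarrow> F c m \<in> ext_poly (xi_vars r)"
    and smooth: "\<And>c. c \<in> atlas B \<Longrightarrow> smooth_poly c (cdom c) (F c)"
    and trans: "\<And>c d m. c \<in> atlas B \<Longrightarrow> d \<in> atlas B \<Longrightarrow> m \<in> cdom c \<Longrightarrow> m \<in> cdom d \<Longrightarrow> F c m = hh c d m (F d m)"
  shows "F \<in> forms B"
proof -
  have E: "F c m \<in> ext_poly (xi_vars r)" for c m
    using ext[of c m] zero[of c m] by (cases "c \<in> atlas B \<and> m \<in> cdom c") auto
  have supp: "K = {#}" "J \<subseteq> xi_vars r" if "F c m (J, K) \<noteq> 0" for c m J K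
    using ext_polyD[OF E that] by simp_all
  have "card J + 2 * size K \<le> r" if nz: "F c m (J, K) \<noteq> 0" for c m J K
  proof -
    have "card J \<le> card (xi_vars r)" by (rule card_mono[OF _ supp(2)[OF nz]]) simp
    also have "\<dots> \<le> r" using card_image_le[of "{..<r}" xi] by simp
    finally show ?thesis using supp(1)[OF nz] by simp
  qed
  then have bound: "\<exists>N. \<forall>c m J K. F c m (J, K) \<noteq> 0 \<longrightarrow> card J + 2 * size K \<le> N"
    by (intro exI[of _ r] allI impI)
  have s1: "J \<subseteq> {..<2 * r} \<and> set_mset K \<subseteq> {..<n}" if "F c m (J, K) \<noteq> 0" for c m J K
    using supp[OF that] subset_trans[OF supp(2)[OF that] xi_vars_subset] by simp
  have s2: "K = {#} \<and> J \<subseteq> range xi" if "F c m (J, K) \<noteq> 0" for c m J K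
    using supp[OF that] by auto
  have "F \<in> sfunctions B"
    unfolding sfunctions_def
  proof (rule CollectI, intro conjI)
    show "\<forall>c m. c \<notin> atlas B \<or> m \<notin> cdom c \<longrightarrow> F c m = 0" using zero by simp
    show "\<forall>c m J K. F c m (J, K) \<noteq> 0 \<longrightarrow> J \<subseteq> {..<2 * r} \<and> set_mset K \<subseteq> {..<n}" using s1 by simp
    show "\<exists>N. \<forall>c m J K. F c m (J, K) \<noteq> 0 \<longrightarrow> card J + 2 * size K \<le> N" by (rule bound)
    show "\<forall>c\<in>atlas B. \<forall>JK. smooth_in B c (cdom c) (\<lambda>m. F c m JK)"
      using smooth unfolding smooth_poly_def by simp
    show "\<forall>c\<in>atlas B. \<forall>d\<in>atlas B. \<forall>m\<in>cdom c \<inter> cdom d. F c m = hh c d m (F d m)"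
      by (intro ballI, erule IntE, rule trans)
  qed
  then show ?thesis using s2 unfolding forms_def by simp
qed

lemma multivectorsD:
  assumes "F \<in> multivectors B"
  shows "c \<notin> atlas B \<or> m \<notin> cdom c \<Longrightarrow> F c m = 0"
    and "F c m \<in> ext_poly (theta_vars r)"
    and "c \<in> atlas B \<Longrightarrow> smooth_poly c (cdom c) (F c)"
    and "c \<in> atlas B \<Longrightarrow> d \<in> atlas B \<Longrightarrow> m \<in> cdom c \<Longrightarrow> m \<in> cdom d \<Longrightarrow> F c m = hh c d m (F d m)"
proof -
  have F: "F \<in> sfunctions B" and vars: "\<forall>c m J K. F c m (J, K) \<noteq> 0 \<longrightarrow> K = {#} \<and> J \<subseteq> range theta"
    using assms unfolding multivectors_def by simp_all
  have "K = {#} \<and> J \<subseteq> theta_vars r \<and> finite J" if nz: "F c m (J, K) \<noteq> 0" for J K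
  proof -
    have J: "J \<subseteq> {..<2 * r}" by (rule sfunctionsD(2)[OF F nz])
    have K: "K = {#}" "J \<subseteq> range theta" using vars nz by simp_all
    have "finite J" by (rule finite_subset[OF J]) simp
    then show ?thesis using subset_theta_vars[OF J K(2)] K(1) by simp
  qed
  then show "F c m \<in> ext_poly (theta_vars r)" unfolding ext_poly_def by simp
  show "c \<notin> atlas B \<or> m \<notin> cdom c \<Longrightarrow> F c m = 0"
    "c \<in> atlas B \<Longrightarrow> smooth_poly c (cdom c) (F c)"
    "c \<in> atlas B \<Longrightarrow> d \<in> atlas B \<Longrightarrow> m \<in> cdom c \<Longrightarrow> m \<in> cdom d \<Longrightarrow> F c m = hh c d m (F d m)"
    by (rule sfunctionsD[OF F]; assumption)+
qed

lemma forms_ext [simp]: "F \<in> forms B \<Longrightarrow> F c m \<in> ext_poly {..<2 * r}"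
  and multivectors_ext [simp]: "X \<in> multivectors B \<Longrightarrow> X c m \<in> ext_poly {..<2 * r}"
  using formsD(2) multivectorsD(2) by auto

lemma sfield_eqI:
  assumes "\<And>c m. c \<notin> atlas B \<or> m \<notin> cdom c \<Longrightarrow> F c m = 0" "\<And>c m. c \<notin> atlas B \<or> m \<notin> cdom c \<Longrightarrow> G c m = 0"
    and "\<And>c m. c \<in> atlas B \<Longrightarrow> m \<in> cdom c \<Longrightarrow> F c m = G c m"
  shows "F = G"
  by (intro ext) (metis assms)

lemma forms_0 [simp]: "0 \<in> forms B"
proof (rule formsI)
  show "c \<in> atlas B \<Longrightarrow> smooth_poly c (cdom c) (0 c)" for c :: "('m, 'a) vb_chart"
    using smooth_poly_const[OF chart_open_cdom[of c], of 0] by (simp add: zero_fun_def)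
qed (simp_all add: zero_fun_apply)

lemma forms_add [simp]: "u \<in> forms B \<Longrightarrow> v \<in> forms B \<Longrightarrow> u + v \<in> forms B"
proof (rule formsI)
  assume u: "u \<in> forms B" and v: "v \<in> forms B"
  fix c d m
  show "c \<notin> atlas B \<or> m \<notin> cdom c \<Longrightarrow> (u + v) c m = 0"
    using u v by (simp add: plus_fun_apply formsD(1))
  show "c \<in> atlas B \<Longrightarrow> smooth_poly c (cdom c) ((u + v) c)"
    unfolding plus_fun_def using u v by (intro smooth_poly_add[unfolded plus_fun_def] chart_open_cdom formsD(3))
  show "(u + v) c m \<in> ext_poly (xi_vars r)"
    using u v by (simp add: plus_fun_apply formsD(2))
  show "(u + v) c m = hh c d m ((u + v) d m)"
    if "c \<in> atlas B" "d \<in> atlas B" "m \<in> cdom c" "m \<in> cdom d"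
    using formsD(4)[OF u that] formsD(4)[OF v that] u v by (simp add: plus_fun_apply L.h_add)
qed

lemma forms_scale [simp]: "u \<in> forms B \<Longrightarrow> s *\<^sub>s u \<in> forms B"
proof (rule formsI)
  assume u: "u \<in> forms B"
  fix c d m
  show "c \<notin> atlas B \<or> m \<notin> cdom c \<Longrightarrow> (s *\<^sub>s u) c m = 0"
    using u by (simp add: sscale_def formsD(1))
  show "c \<in> atlas B \<Longrightarrow> smooth_poly c (cdom c) ((s *\<^sub>s u) c)"
    unfolding sscale_def using u by (intro smooth_poly_scale chart_open_cdom formsD(3))
  show "(s *\<^sub>s u) c m \<in> ext_poly (xi_vars r)"
    using u by (simp add: sscale_def formsD(2))
  show "(s *\<^sub>s u) c m = hh c d m ((s *\<^sub>s u) d m)"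
    if "c \<in> atlas B" "d \<in> atlas B" "m \<in> cdom c" "m \<in> cdom d"
    using formsD(4)[OF u that] u by (simp add: sscale_def L.h_scale)
qed

lemma sscale_minus_one: "(-1) *\<^sub>s u = - u"
  by (simp add: sscale_def fun_eq_iff fun_app gscale_apply)

lemma forms_minus [simp]: "u \<in> forms B \<Longrightarrow> - u \<in> forms B"
  using forms_scale[of u "-1"] by (simp add: sscale_minus_one)

lemma forms_diff [simp]: "u \<in> forms B \<Longrightarrow> v \<in> forms B \<Longrightarrow> u - v \<in> forms B"
  using forms_add[of u "- v"] by simp

lemma forms_sum: "(\<And>i. i \<in> A \<Longrightarrow> F i \<in> forms B) \<Longrightarrow> (\<Sum>i\<in>A. F i) \<in> forms B"
  by (induction A rule: infinite_finite_induct) simp_all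

lemma forms_mult [simp]: "u \<in> forms B \<Longrightarrow> v \<in> forms B \<Longrightarrow> u \<odot> v \<in> forms B"
proof (rule formsI)
  assume u: "u \<in> forms B" and v: "v \<in> forms B"
  fix c d m
  show "c \<notin> atlas B \<or> m \<notin> cdom c \<Longrightarrow> (u \<odot> v) c m = 0"
    using u v by (simp add: smult_def formsD(1))
  show "c \<in> atlas B \<Longrightarrow> smooth_poly c (cdom c) ((u \<odot> v) c)"
    unfolding smult_def using u v by (intro smooth_poly_gmult chart_open_cdom formsD(3))
  show "(u \<odot> v) c m \<in> ext_poly (xi_vars r)"
    using u v by (simp add: smult_def formsD(2))
  show "(u \<odot> v) c m = hh c d m ((u \<odot> v) d m)"
    if "c \<in> atlas B" "d \<in> atlas B" "m \<in> cdom c" "m \<in> cdom d"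
    using formsD(4)[OF u that] formsD(4)[OF v that] u v by (simp add: smult_def L.h_gmult)
qed

lemma grading_inv_apply: "grading_inv F c m = ginv (F c m)"
  by (simp add: grading_inv_def ginv_def)

lemma forms_grading_inv [simp]: "u \<in> forms B \<Longrightarrow> grading_inv u \<in> forms B"
proof (rule formsI)
  assume u: "u \<in> forms B"
  fix c d m
  show "c \<notin> atlas B \<or> m \<notin> cdom c \<Longrightarrow> grading_inv u c m = 0"
    using u by (simp add: grading_inv_apply formsD(1))
  show "c \<in> atlas B \<Longrightarrow> smooth_poly c (cdom c) (grading_inv u c)"
    using smooth_poly_ginv[OF chart_open_cdom formsD(3)[OF u]] by (simp add: grading_inv_apply[abs_def])
  show "grading_inv u c m \<in> ext_poly (xi_vars r)"
    using u by (simp add: grading_inv_apply formsD(2))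
  show "grading_inv u c m = hh c d m (grading_inv u d m)"
    if "c \<in> atlas B" "d \<in> atlas B" "m \<in> cdom c" "m \<in> cdom d"
    using formsD(4)[OF u that] u by (simp add: grading_inv_apply L.ginv_h)
qed

definition shom :: "nat \<Rightarrow> ('m, 'a) sfield \<Rightarrow> ('m, 'a) sfield" where
  "shom k F = (\<lambda>c m. homogeneous k (F c m))"

lemma forms_deg_shom: "u \<in> forms B \<Longrightarrow> shom k u \<in> forms_deg B k"
proof -
  assume u: "u \<in> forms B"
  have f: "shom k u \<in> forms B"
  proof (rule formsI)
    fix c d m
    show "c \<notin> atlas B \<or> m \<notin> cdom c \<Longrightarrow> shom k u c m = 0"
      using u by (simp add: shom_def formsD(1))
    show "c \<in> atlas B \<Longrightarrow> smooth_poly c (cdom c) (shom k u c)"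
      unfolding shom_def using u by (intro smooth_poly_homogeneous chart_open_cdom formsD(3))
    show "shom k u c m \<in> ext_poly (xi_vars r)"
      using u by (simp add: shom_def formsD(2))
    show "shom k u c m = hh c d m (shom k u d m)"
      if "c \<in> atlas B" "d \<in> atlas B" "m \<in> cdom c" "m \<in> cdom d"
      using formsD(4)[OF u that] u by (simp add: shom_def L.homogeneous_h)
  qed
  then have "shom k u \<in> sfunctions B" by (simp add: forms_def)
  moreover have "card J + 2 * size K = k" if "shom k u c m (J, K) \<noteq> 0" for c m J K
    using ext_polyD[OF forms_ext[OF f] that] that by (auto simp: shom_def homogeneous_def split: if_splits)
  ultimately show ?thesis using f by (auto simp: forms_deg_def sfunctions_deg_def)
qed

lemma forms_eq_sum_shom:
  assumes "u \<in> forms B"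
  shows "u = (\<Sum>k\<le>r. shom k u)"
proof (intro ext, clarify)
  fix c m J and K :: "nat multiset"
  show "u c m (J, K) = (\<Sum>k\<le>r. shom k u) c m (J, K)"
  proof (cases "u c m (J, K) = 0")
    case True
    then show ?thesis by (auto simp: fun_sum_apply shom_def homogeneous_def intro!: sum.neutral)
  next
    case False
    then have "J \<subseteq> xi_vars r" using ext_polyD[OF formsD(2)[OF assms]] by blast
    then have "card J \<le> card (xi_vars r)" by (intro card_mono) auto
    also have "\<dots> \<le> r" using card_image_le[of "{..<r}" xi] by simp
    finally have "card J \<le> r" .
    then show ?thesis by (simp add: fun_sum_apply shom_def homogeneous_def)
  qed
qed

lemma forms_iprod [simp]: "X \<in> multivectors B \<Longrightarrow> u \<in> forms B \<Longrightarrow> iprod X u \<in> forms B"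
proof (rule formsI)
  assume X: "X \<in> multivectors B" and u: "u \<in> forms B"
  fix c d m
  show "c \<notin> atlas B \<or> m \<notin> cdom c \<Longrightarrow> iprod X u c m = 0"
    using u by (simp add: iprod_def formsD(1))
  show "c \<in> atlas B \<Longrightarrow> smooth_poly c (cdom c) (iprod X u c)"
    unfolding iprod_def using X u
    by (intro smooth_poly_gint[OF _ _ multivectorsD(2)] chart_open_cdom formsD(3) multivectorsD(3)) auto
  show "iprod X u c m \<in> ext_poly (xi_vars r)"
    using ext_poly_gint[OF finite_lessThan multivectors_ext[OF X] formsD(2)[OF u]] by (simp add: iprod_def)
  show "iprod X u c m = hh c d m (iprod X u d m)"
    if "c \<in> atlas B" "d \<in> atlas B" "m \<in> cdom c" "m \<in> cdom d"
    using formsD(4)[OF u that] multivectorsD(4)[OF X that] gint_hh[OF that multivectorsD(2)[OF X] formsD(2)[OF u]]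
    by (simp add: iprod_def)
qed

subsection \<open>Quasi-differentials in coordinates\<close>

text \<open>
  The roles of the \<open>\<xi>\<^sup>a\<close> and the \<open>\<theta>\<^sub>a\<close> are interchanged between \<open>\<mu>\<close> and \<open>\<gamma>\<close>; the coordinate
  computations are done once, for either choice of the variables \<open>p\<close> of the forms and their
  conjugates \<open>q\<close>.
\<close>

definition dual_vars :: "(nat \<Rightarrow> nat) \<Rightarrow> (nat \<Rightarrow> nat) \<Rightarrow> bool" where
  "dual_vars p q \<longleftrightarrow> (p = (\<lambda>a. xi a) \<and> q = (\<lambda>a. theta a)) \<or> (p = (\<lambda>a. theta a) \<and> q = (\<lambda>a. xi a))"

lemma dual_varsD:
  assumes "dual_vars p q"
  shows "p a \<noteq> q b" "q b \<noteq> p a" "p a = p b \<longleftrightarrow> a = b" "q a = q b \<longleftrightarrow> a = b"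
    "oconj (p a) = q a" "oconj (q a) = p a" "inj p" "inj q"
    "p ` {..<k} \<subseteq> {..<2 * k}" "q ` {..<k} \<subseteq> {..<2 * k}" "dual_vars q p"
  using assms unfolding dual_vars_def oconj_def by (auto simp: inj_def, presburger+)

text \<open>The functions of the type of \<open>\<mu>\<close>: sums of terms of type \<open>p\<close> times momentum and \<open>p p q\<close>.\<close>

definition anchor_bracket_type :: "(nat \<Rightarrow> nat) \<Rightarrow> (nat \<Rightarrow> nat) \<Rightarrow> gpoly \<Rightarrow> bool" where
  "anchor_bracket_type p q f \<longleftrightarrow> (\<forall>J K. f (J, K) \<noteq> 0 \<longrightarrow>
     (\<exists>a<r. \<exists>i<n. J = {p a} \<and> K = {#i#}) \<or>
     (\<exists>a<r. \<exists>b<r. \<exists>k<r. a \<noteq> b \<and> J = {p a, p b, q k} \<and> K = {#}))"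

lemma pderiv_mom_ext [simp]: "f \<in> ext_poly S \<Longrightarrow> pderiv_mom i f = 0"
proof (rule ext, clarify)
  fix J and K :: "nat multiset"
  assume f: "f \<in> ext_poly S"
  have "f (J, add_mset i K) = 0" using ext_polyD[OF f, of J "add_mset i K"] by auto
  then show "pderiv_mom i f (J, K) = (0 :: gpoly) (J, K)" by (simp add: pderiv_mom_def zero_fun_apply)
qed

lemma anchor_bracket_finite: "anchor_bracket_type p q f \<Longrightarrow> f (J, K) \<noteq> 0 \<Longrightarrow> finite J"
  unfolding anchor_bracket_type_def by (metis finite.emptyI finite.insertI)

lemma anchor_eq:
  assumes "dual_vars p q" "anchor_bracket_type p q f"
  shows "pderiv_mom i f (J, K) = (if K = {#} \<and> (\<exists>a<r. J = {p a}) then f (J, {#i#}) else 0)"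
proof (cases "f (J, K + {#i#}) = 0")
  case True
  then show ?thesis
    by (cases "K = {#}") (auto simp: pderiv_mom_def)
next
  case False
  then obtain a i' where "a < r" "J = {p a}" "K + {#i#} = {#i'#}"
    using assms(2) unfolding anchor_bracket_type_def by (metis empty_not_add_mset add_mset_add_single)
  then show ?thesis by (auto simp: pderiv_mom_def)
qed

lemma ext_anchor:
  assumes "dual_vars p q" "anchor_bracket_type p q f"
  shows "pderiv_mom i f \<in> ext_poly (p ` {..<r})"
  unfolding ext_poly_def using anchor_eq[OF assms] by (auto split: if_splits)

lemma bracket_nonzero:
  assumes "dual_vars p q" "anchor_bracket_type p q f" "rderiv (q k) f (J, K) \<noteq> 0"
  shows "K = {#} \<and> (\<exists>a<r. \<exists>b<r. a \<noteq> b \<and> J = {p a, p b})"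
proof -
  have f: "f (insert (q k) J, K) \<noteq> 0" "q k \<notin> J"
    using assms(3) by (auto simp: rderiv_def split: if_splits)
  then consider a where "insert (q k) J = {p a}"
    | a b k' where "a < r" "b < r" "a \<noteq> b" "insert (q k) J = {p a, p b, q k'}" "K = {#}"
    using assms(2) unfolding anchor_bracket_type_def by blast
  then show ?thesis
  proof cases
    case 1
    then have "q k = p a" by blast
    then show ?thesis using dual_varsD(2)[OF assms(1)] by blast
  next
    case 2
    have "q k \<in> {p a, p b, q k'}" using 2(4) by blast
    then have "q k = q k'" using dual_varsD(2)[OF assms(1)] by simp
    moreover have "J = insert (q k) J - {q k}" using f(2) by simp
    ultimately have "J = {p a, p b}"
      unfolding 2(4) using dual_varsD(1)[OF assms(1)] by auto
    then show ?thesis using 2(1-3,5) by blast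
  qed
qed

lemma ext_bracket:
  assumes "dual_vars p q" "anchor_bracket_type p q f"
  shows "rderiv (q k) f \<in> ext_poly (p ` {..<r})"
proof -
  have "K = {#} \<and> J \<subseteq> p ` {..<r} \<and> finite J" if "rderiv (q k) f (J, K) \<noteq> 0" for J K
    using bracket_nonzero[OF assms that] by auto
  then show ?thesis unfolding ext_poly_def by simp
qed

lemma poisson_zero: "F c m = 0 \<Longrightarrow> G c m = 0 \<Longrightarrow> poisson B F G c m = 0"
proof -
  have "pderiv_mom i 0 = 0" "rderiv j 0 = 0" for i j
    by (simp_all add: pderiv_mom_def rderiv_def fun_eq_iff zero_fun_apply)
  then show "F c m = 0 \<Longrightarrow> G c m = 0 \<Longrightarrow> poisson B F G c m = 0"
    by (simp add: poisson_def)
qed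

lemma poisson_coords:
  assumes "dual_vars p q"
  shows "poisson B F G c m =
    (\<Sum>i<n. pderiv_mom i (F c m) \<otimes> dbase c i G m - dbase c i F m \<otimes> pderiv_mom i (G c m)) +
    (\<Sum>a<r. rderiv (q a) (F c m) \<otimes> lderiv (p a) (G c m) + rderiv (p a) (F c m) \<otimes> lderiv (q a) (G c m))"
  using assms unfolding dual_vars_def poisson_def
  by (elim disjE conjE) (simp_all only: add.commute)

lemma quasi_diff_coords:
  assumes pq: "dual_vars p q" and u: "u c m \<in> ext_poly (p ` {..<r})"
  shows "quasi_diff B \<Theta> u c m =
    (\<Sum>i<n. pderiv_mom i (\<Theta> c m) \<otimes> dpoly c i (u c) m) + (\<Sum>a<r. rderiv (q a) (\<Theta> c m) \<otimes> lderiv (p a) (u c m))"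
proof -
  have q: "q a \<notin> p ` {..<r}" for a using dual_varsD(1)[OF pq] by (auto simp: eq_commute)
  have 0: "lderiv (q a) (u c m) = 0" for a by (rule lderiv_eq_0[OF u q])
  have P: "pderiv_mom i (u c m) = 0" for i by (rule pderiv_mom_ext[OF u])
  show ?thesis
    unfolding quasi_diff_def poisson_coords[OF pq] P 0 gmult_0_right diff_zero add_0_right dbase_eq_dpoly ..
qed

lemma hh_diff: "f \<in> ext_poly {..<2 * r} \<Longrightarrow> g \<in> ext_poly {..<2 * r} \<Longrightarrow> hh c d m (f - g) = hh c d m f - hh c d m g"
  using L.h_add[of f "- g"] by (simp add: L.h_minus)

lemma subst_mono_insert_min:
  assumes "finite A" "\<forall>a\<in>A. b < a"
  shows "subst_mono s (insert b A) = s b \<otimes> subst_mono s A"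
proof -
  have "sorted_list_of_set (insert b A) = b # sorted_list_of_set A"
    using assms by (subst sorted_list_of_set_insert_remove) (auto simp: insort_is_Cons less_imp_le)
  then show ?thesis by (simp add: subst_mono_foldr)
qed

lemma gmono_insert_min:
  assumes "finite A" "\<forall>a\<in>A. b < a"
  shows "gmono (insert b A) = godd b \<otimes> gmono A"
proof -
  have "{(x, y). x \<in> {b} \<and> y \<in> A \<and> y < x} = {}" using assms(2) by auto
  then have "osign {b} A = 1" unfolding osign_def by (metis card.empty power_0)
  then show ?thesis using assms by (auto simp: godd_mult_gmono)
qed

lemma has_dpoly_odd_trans_xi:
  assumes c: "c \<in> atlas B" "d \<in> atlas B" "m \<in> cdom c" "m \<in> cdom d" and j: "j < n" and a: "a < r"
  shows "has_dpoly c j (\<lambda>m. odd_trans B c d m (xi a)) m (\<Sum>b<r. cderiv c j (trans_mat B c d a b) m *\<^sub>g godd (xi b))"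
  unfolding odd_trans_xi
proof (rule has_dpoly_sum)
  fix b assume b: "b \<in> {..<r}"
  have "has_cderiv c j (trans_mat B c d a b) m (cderiv c j (trans_mat B c d a b) m)"
    using b c j a by (intro smooth_in_has_cderiv[OF chart_open_overlap[OF c(1,2)] transitionD(3)]) auto
  from has_dpoly_fscale[OF c(1,3) this has_dpoly_const]
  show "has_dpoly c j (\<lambda>m. trans_mat B c d a b m *\<^sub>g godd (xi b)) m (cderiv c j (trans_mat B c d a b) m *\<^sub>g godd (xi b))"
    by simp
qed

lemma has_dpoly_subst_mono:
  assumes c: "c \<in> atlas B" "d \<in> atlas B" "m \<in> cdom c" "m \<in> cdom d" and j: "j < n"
    and "finite J" "J \<subseteq> xi_vars r"
  shows "has_dpoly c j (\<lambda>m. subst_mono (odd_trans B c d m) J) m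
    (\<Sum>a<r. (\<Sum>b<r. cderiv c j (trans_mat B c d a b) m *\<^sub>g godd (xi b)) \<otimes> hh c d m (lderiv (xi a) (gmono J)))"
  using assms(6,7)
proof (induction J rule: finite_linorder_min_induct)
  case empty
  show ?case
    using has_dpoly_const[of c j gone m] by (simp add: subst_mono_foldr flip: gone_eq_gmono)
next
  case (insert k A)
  obtain a where a: "k = xi a" "a < r" using insert(4) by auto
  let ?T = "\<lambda>a. \<Sum>b<r. cderiv c j (trans_mat B c d a b) m *\<^sub>g godd (xi b)"
  have T: "?T a \<in> ext_poly (xi_vars r)" "ginv (?T a) = - ?T a" for a
    by (intro ext_poly_sum ext_poly_scale ext_poly_godd, blast) (simp add: ginv_sum sum_negf)
  have A: "gmono A \<in> ext_poly (xi_vars r)" using insert by (intro ext_poly_gmono) auto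
  have s: "odd_trans B c d m k \<in> ext_poly (xi_vars r)" "ginv (odd_trans B c d m k) = - odd_trans B c d m k"
    using ext_odd_trans_xi L.ginv_s unfolding a(1) by auto
  have fin: "\<And>J K. gmono A (J, K) \<noteq> 0 \<Longrightarrow> finite J" using ext_polyD[OF A] by blast
  have kr: "k \<in> {..<2 * r}" using a by simp
  have term_eq: "?T a' \<otimes> hh c d m (lderiv (xi a') (gmono (insert k A))) =
      (if a' = a then ?T a' \<otimes> hh c d m (gmono A) else 0)
      + odd_trans B c d m k \<otimes> (?T a' \<otimes> hh c d m (lderiv (xi a') (gmono A)))" for a'
  proof -
    let ?g = "lderiv (xi a') (gmono A)"
    have "lderiv (xi a') (gmono (insert k A)) = (if a' = a then gmono A else 0) + - (godd k \<otimes> ?g)"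
      unfolding gmono_insert_min[OF insert(1,2)] using lderiv_godd_mult[of "gmono A" "xi a'" k, OF fin] a by simp
    then have "hh c d m (lderiv (xi a') (gmono (insert k A))) =
        hh c d m ((if a' = a then gmono A else 0) + - (godd k \<otimes> ?g))" by (rule arg_cong)
    also have "\<dots> = (if a' = a then hh c d m (gmono A) else 0) - odd_trans B c d m k \<otimes> hh c d m ?g"
      using A kr by (simp add: hh_diff L.h_minus L.h_godd_mult)
    finally have "hh c d m (lderiv (xi a') (gmono (insert k A))) =
        (if a' = a then hh c d m (gmono A) else 0) - odd_trans B c d m k \<otimes> hh c d m ?g" .
    moreover have "?T a' \<otimes> (odd_trans B c d m k \<otimes> hh c d m ?g)
        = - (odd_trans B c d m k \<otimes> (?T a' \<otimes> hh c d m ?g))"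
      using gmult_odd_commute[OF T(1)[of a'] s(1) T(2)] s(2)
      by (simp flip: gmult_assoc[OF T(1) s(1)] gmult_assoc[OF s(1) T(1)])
    ultimately show ?thesis by simp
  qed
  have "has_dpoly c j (\<lambda>m. odd_trans B c d m k \<otimes> subst_mono (odd_trans B c d m) A) m
     (?T a \<otimes> subst_mono (odd_trans B c d m) A + odd_trans B c d m k \<otimes>
       (\<Sum>a'<r. ?T a' \<otimes> hh c d m (lderiv (xi a') (gmono A))))"
    unfolding a(1)
    by (rule has_dpoly_gmult[OF c(1,3) has_dpoly_odd_trans_xi[OF c j a(2)] insert(3)])
      (use insert(4) in auto)
  moreover have "?T a \<otimes> subst_mono (odd_trans B c d m) A + odd_trans B c d m k \<otimes>
       (\<Sum>a'<r. ?T a' \<otimes> hh c d m (lderiv (xi a') (gmono A))) =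
     (\<Sum>a'<r. ?T a' \<otimes> hh c d m (lderiv (xi a') (gmono (insert k A))))"
  proof -
    have "hh c d m (gmono A) = subst_mono (odd_trans B c d m) A"
      using insert(4) xi_vars_subset by (intro L.h_gmono) blast
    then show ?thesis
      unfolding term_eq sum.distrib using a(2) by (simp add: gmult_sum_right)
  qed
  ultimately show ?case by (simp add: subst_mono_insert_min[OF insert(1,2)])
qed

lemma hh_xi_eq:
  assumes "f \<in> ext_poly (xi_vars r)"
  shows "hh c d m f = (\<Sum>J\<in>Pow (xi_vars r). f (J, {#}) *\<^sub>g subst_mono (odd_trans B c d m) J)"
proof -
  have "f (J, {#}) = 0" if "J \<notin> Pow (xi_vars r)" for J
    using ext_polyD[OF assms, of J "{#}"] that by blast
  then show ?thesis
    unfolding L.h_ext_eq[OF ext_xi[OF assms]]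
    by (intro sum.mono_neutral_right) (use xi_vars_subset[of r] in auto)
qed

lemma dpoly_hh:
  assumes c: "c \<in> atlas B" "d \<in> atlas B" "m \<in> cdom c" "m \<in> cdom d" and j: "j < n"
    and u: "\<And>m. u m \<in> ext_poly (xi_vars r)" "smooth_poly d (cdom d) u"
  shows "dpoly c j (\<lambda>m. hh c d m (u m)) m = hh c d m (dpoly c j u m) +
    (\<Sum>a<r. (\<Sum>b<r. cderiv c j (trans_mat B c d a b) m *\<^sub>g godd (xi b)) \<otimes> hh c d m (lderiv (xi a) (u m)))"
proof -
  let ?T = "\<lambda>a. \<Sum>b<r. cderiv c j (trans_mat B c d a b) m *\<^sub>g godd (xi b)"
  have uc: "has_cderiv c j (\<lambda>m. u m JK) m (dpoly c j u m JK)" for JK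
  proof -
    note D = has_cderiv_change_chart[OF chart_open_cdom[OF c(2)] u(2)[unfolded smooth_poly_def, rule_format] c(1,4,3) j]
    show ?thesis
      unfolding dpoly_def has_cderiv_imp_cderiv[OF D] by (rule D)
  qed
  have "has_dpoly c j (\<lambda>m. \<Sum>J\<in>Pow (xi_vars r). u m (J, {#}) *\<^sub>g subst_mono (odd_trans B c d m) J) m
    (\<Sum>J\<in>Pow (xi_vars r). dpoly c j u m (J, {#}) *\<^sub>g subst_mono (odd_trans B c d m) J +
      u m (J, {#}) *\<^sub>g (\<Sum>a<r. ?T a \<otimes> hh c d m (lderiv (xi a) (gmono J))))"
    by (intro has_dpoly_sum has_dpoly_fscale[OF c(1,3) uc] has_dpoly_subst_mono[OF c j])
      (auto intro: finite_subset)
  then have "dpoly c j (\<lambda>m. hh c d m (u m)) m =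
    (\<Sum>J\<in>Pow (xi_vars r). dpoly c j u m (J, {#}) *\<^sub>g subst_mono (odd_trans B c d m) J +
      u m (J, {#}) *\<^sub>g (\<Sum>a<r. ?T a \<otimes> hh c d m (lderiv (xi a) (gmono J))))"
    unfolding hh_xi_eq[OF u(1)] by (rule has_dpoly_imp_dpoly)
  also have "\<dots> = hh c d m (dpoly c j u m) +
     (\<Sum>J\<in>Pow (xi_vars r). u m (J, {#}) *\<^sub>g (\<Sum>a<r. ?T a \<otimes> hh c d m (lderiv (xi a) (gmono J))))"
    unfolding hh_xi_eq[OF ext_poly_dpoly[OF u(1)]] by (rule sum.distrib)
  also have "(\<Sum>J\<in>Pow (xi_vars r). u m (J, {#}) *\<^sub>g (\<Sum>a<r. ?T a \<otimes> hh c d m (lderiv (xi a) (gmono J)))) =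
     (\<Sum>a<r. ?T a \<otimes> (\<Sum>J\<in>Pow (xi_vars r). u m (J, {#}) *\<^sub>g hh c d m (lderiv (xi a) (gmono J))))"
    unfolding gscale_sum gmult_sum_right gmult_scale_right by (rule sum.swap)
  also have "\<dots> = (\<Sum>a<r. ?T a \<otimes> hh c d m (lderiv (xi a) (u m)))"
  proof (intro sum.cong refl arg_cong[of _ _ "gmult _"])
    fix a
    have g: "gmono J \<in> ext_poly {..<2 * r}" if "J \<in> Pow (xi_vars r)" for J
      using that xi_vars_subset[of r] finite_subset[of J "xi_vars r"] by (intro ext_poly_gmono) auto
    have "lderiv (xi a) (u m) = lderiv (xi a) (\<Sum>J\<in>Pow (xi_vars r). u m (J, {#}) *\<^sub>g gmono J)"
      by (rule arg_cong[OF ext_poly_expand[OF _ u(1)]]) simp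
    then have "hh c d m (lderiv (xi a) (u m)) =
        hh c d m (\<Sum>J\<in>Pow (xi_vars r). u m (J, {#}) *\<^sub>g lderiv (xi a) (gmono J))"
      unfolding lderiv_sum lderiv_scale by (rule arg_cong)
    also have "\<dots> = (\<Sum>J\<in>Pow (xi_vars r). hh c d m (u m (J, {#}) *\<^sub>g lderiv (xi a) (gmono J)))"
      by (intro L.h_sum ext_poly_scale ext_poly_lderiv g)
    also have "\<dots> = (\<Sum>J\<in>Pow (xi_vars r). u m (J, {#}) *\<^sub>g hh c d m (lderiv (xi a) (gmono J)))"
      by (intro sum.cong refl L.h_scale ext_poly_lderiv g)
    finally show "(\<Sum>J\<in>Pow (xi_vars r). u m (J, {#}) *\<^sub>g hh c d m (lderiv (xi a) (gmono J)))
      = hh c d m (lderiv (xi a) (u m))" by (rule sym)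
  qed
  finally show ?thesis .
qed

end

context smooth_bundle
begin

subsection \<open>Covariance of quasi-differentials\<close>

lemma gmult_gmom:
  assumes "f \<in> ext_poly S"
  shows "(f \<otimes> gmom i) (J, K) = (if K = {#i#} then f (J, {#}) else 0)"
proof (cases "finite J")
  case False
  then have "f (J, {#}) = 0" using ext_polyD[OF assms, of J "{#}"] by blast
  then show ?thesis using False by (simp add: gmult_ext_apply[OF assms])
next
  case True
  have "(f \<otimes> gmom i) (J, K) = (\<Sum>J'\<in>Pow J. if J' = J then (if K = {#i#} then f (J, {#}) else 0) else 0)"
    unfolding gmult_ext_apply[OF assms] by (rule sum.cong) (auto simp: gmom_def)
  also have "\<dots> = (if K = {#i#} then f (J, {#}) else 0)"
    using True by simp
  finally show ?thesis .
qed

lemma pderiv_mom_add: "pderiv_mom i (f + g) = pderiv_mom i f + pderiv_mom i g"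
  by (simp add: pderiv_mom_def fun_eq_iff fun_app algebra_simps)

lemma pderiv_mom_diff: "pderiv_mom i (f - g) = pderiv_mom i f - pderiv_mom i g"
  by (simp add: pderiv_mom_def fun_eq_iff fun_app algebra_simps)

lemma pderiv_mom_scale: "pderiv_mom i (s *\<^sub>g f) = s *\<^sub>g pderiv_mom i f"
  by (simp add: pderiv_mom_def fun_eq_iff gscale_apply)

lemma pderiv_mom_sum: "pderiv_mom i (\<Sum>k\<in>A. F k) = (\<Sum>k\<in>A. pderiv_mom i (F k))"
  by (induction A rule: infinite_finite_induct) (simp_all add: pderiv_mom_add)

lemma pderiv_mom_gmom: "pderiv_mom i (gmom k) = (if i = k then gone else 0)"
proof (rule ext, clarify)
  fix J and K :: "nat multiset"
  show "pderiv_mom i (gmom k) (J, K) = (if i = k then gone else 0) (J, K)"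
    by (cases "K = {#}") (auto simp: pderiv_mom_def gmom_def gone_def zero_fun_apply)
qed

lemma pderiv_mom_gmult:
  assumes "f \<in> ext_poly S"
  shows "pderiv_mom i (f \<otimes> g) = f \<otimes> pderiv_mom i g"
proof (rule ext, clarify)
  fix J and K :: "nat multiset"
  show "pderiv_mom i (f \<otimes> g) (J, K) = (f \<otimes> pderiv_mom i g) (J, K)"
    unfolding gmult_ext_apply[OF assms] pderiv_mom_def prod.case sum_distrib_left
    by (intro sum.cong refl) (simp only: mult_ac)
qed

lemma finite_support_ext: "finite S \<Longrightarrow> f \<in> ext_poly S \<Longrightarrow> finite {JK. f JK \<noteq> 0}"
proof (rule finite_subset)
  assume "f \<in> ext_poly S"
  then show "{JK. f JK \<noteq> 0} \<subseteq> Pow S \<times> {{#}}" using ext_polyD by fastforce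
qed auto

lemma finite_support_gmom: "finite S \<Longrightarrow> f \<in> ext_poly S \<Longrightarrow> finite {JK. (f \<otimes> gmom i) JK \<noteq> 0}"
proof (rule finite_subset)
  assume f: "f \<in> ext_poly S"
  show "{JK. (f \<otimes> gmom i) JK \<noteq> 0} \<subseteq> Pow S \<times> {{#i#}}"
    using ext_polyD[OF f] by (auto simp: gmult_gmom[OF f] split: if_splits) blast
qed auto

lemma mom_trans_finite: "mom_trans B c d m i (J, K) \<noteq> 0 \<Longrightarrow> finite J"
proof (rule ccontr)
  assume "infinite J" and nz: "mom_trans B c d m i (J, K) \<noteq> 0"
  then have "gmom j (J, K) = 0" "(godd k \<otimes> godd l) (J, K) = 0" for j k l
    by (auto simp: gmom_def godd_mult_apply)
  then show False using nz by (simp add: mom_trans_def fun_app fun_sum_apply gscale_apply)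
qed

lemma hh_gmult_gmom:
  assumes f: "f \<in> ext_poly {..<2 * r}"
  shows "hh c d m (f \<otimes> gmom i) = hh c d m f \<otimes> mom_trans B c d m i"
proof -
  have "{JK. (f \<otimes> gmom i) JK \<noteq> 0} \<subseteq> Pow {..<2 * r} \<times> {{#i#}}"
    using ext_polyD[OF f] by (auto simp: gmult_gmom[OF f] split: if_splits) blast
  then have "hh c d m (f \<otimes> gmom i) = (\<Sum>(J, K)\<in>Pow {..<2 * r} \<times> {{#i#}}. (f \<otimes> gmom i) (J, K) *\<^sub>g
    (subst_mono (odd_trans B c d m) J \<otimes> gprod (map (mom_trans B c d m) (sorted_list_of_multiset K))))"
    by (intro gsubst_eq_sum) auto
  also have "\<dots> = (\<Sum>J\<in>Pow {..<2 * r}. f (J, {#}) *\<^sub>g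
    (subst_mono (odd_trans B c d m) J \<otimes> (mom_trans B c d m i \<otimes> gone)))"
    unfolding sum.cartesian_product[symmetric]
    by (simp add: gprod_def gmult_gmom[OF f] sorted_list_of_multiset_singleton)
  also have "mom_trans B c d m i \<otimes> gone = mom_trans B c d m i"
    by (rule gmult_gone_right_finite) (rule mom_trans_finite)
  finally show ?thesis by (simp add: L.h_ext_eq[OF f] gmult_sum_left)
qed

definition momentum_free :: "gpoly \<Rightarrow> gpoly" where
  "momentum_free f = (\<lambda>(J, K). if K = {#} then f (J, K) else 0)"

lemma anchor_bracket_decompose:
  assumes pq: "dual_vars p q" and f: "anchor_bracket_type p q f"
  shows "f = (\<Sum>i<n. pderiv_mom i f \<otimes> gmom i) + momentum_free f"
    and "momentum_free f \<in> ext_poly {..<2 * r}"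
proof -
  note E = ext_anchor[OF pq f]
  show "f = (\<Sum>i<n. pderiv_mom i f \<otimes> gmom i) + momentum_free f"
  proof (rule ext, clarify)
    fix J and K :: "nat multiset"
    have A: "pderiv_mom i f (J, {#}) = f (J, {#i#})" for i
      by (simp add: pderiv_mom_def)
    have S: "(\<Sum>i<n. pderiv_mom i f \<otimes> gmom i) (J, K) = (\<Sum>i<n. if K = {#i#} then f (J, K) else 0)"
      unfolding fun_sum_apply by (intro sum.cong refl) (auto simp: gmult_gmom[OF E] A)
    show "f (J, K) = ((\<Sum>i<n. pderiv_mom i f \<otimes> gmom i) + momentum_free f) (J, K)"
    proof (cases "\<exists>i<n. K = {#i#}")
      case True
      then obtain i where i: "i < n" "K = {#i#}" by blast
      have "(\<Sum>k<n. if K = {#k#} then f (J, K) else 0) = (\<Sum>k<n. if k = i then f (J, K) else 0)"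
        using i by (intro sum.cong) auto
      then show ?thesis unfolding plus_fun_apply S momentum_free_def using i by simp
    next
      case False
      have "(\<Sum>k<n. if K = {#k#} then f (J, K) else 0) = 0"
        by (rule sum.neutral) (use False in simp)
      moreover have "f (J, K) = 0" if K: "K \<noteq> {#}"
      proof (rule ccontr)
        assume "f (J, K) \<noteq> 0"
        from f[unfolded anchor_bracket_type_def, rule_format, OF this] show False
          using False K by (simp, blast)
      qed
      ultimately show ?thesis unfolding plus_fun_apply S momentum_free_def by simp
    qed
  qed
  have "J \<subseteq> {..<2 * r} \<and> finite J" if "f (J, {#}) \<noteq> 0" for J
  proof -
    have "\<exists>a<r. \<exists>b<r. \<exists>k<r. a \<noteq> b \<and> J = {p a, p b, q k}"
      using f[unfolded anchor_bracket_type_def, rule_format, OF that] by simp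
    then obtain a b k where "a < r" "b < r" "k < r" "J = {p a, p b, q k}" by (elim exE conjE)
    moreover have "p i < 2 * r" "q i < 2 * r" if "i < r" for i
      using dual_varsD(9,10)[OF pq, of r] that by (meson image_subset_iff lessThan_iff)+
    ultimately show ?thesis by simp
  qed
  then show "momentum_free f \<in> ext_poly {..<2 * r}"
    unfolding ext_poly_def momentum_free_def by simp
qed

lemma pderiv_mom_mom_trans:
  assumes "j < n"
  shows "pderiv_mom j (mom_trans B c d m i) = cderiv d i (\<lambda>m'. bcoord c m' j) m *\<^sub>g gone"
proof -
  have "godd (xi b) \<otimes> godd (theta k) \<in> ext_poly UNIV" for b k by simp
  then have "pderiv_mom j (godd (xi b) \<otimes> godd (theta k)) = 0" for b k by (rule pderiv_mom_ext)
  then have "pderiv_mom j (mom_trans B c d m i) =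
      (\<Sum>k<n. cderiv d i (\<lambda>m'. bcoord c m' k) m *\<^sub>g (if j = k then gone else 0))"
    unfolding mom_trans_def pderiv_mom_diff pderiv_mom_sum pderiv_mom_scale pderiv_mom_gmom by simp
  also have "\<dots> = (\<Sum>k<n. if j = k then cderiv d i (\<lambda>m'. bcoord c m' k) m *\<^sub>g gone else 0)"
    by (intro sum.cong) auto
  finally show ?thesis using assms by simp
qed

lemma lderiv_theta_mom_trans:
  assumes "b < r"
  shows "lderiv (theta b) (mom_trans B c d m i) =
    (\<Sum>a<r. trans_mat B d c b a m *\<^sub>g (\<Sum>b'<r. cderiv d i (trans_mat B c d a b') m *\<^sub>g godd (xi b')))"
proof -
  have 1: "lderiv (theta b) (gmom k) = 0" for k
    by (auto simp: lderiv_def gmom_def fun_eq_iff zero_fun_apply)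
  have ne: "theta b \<noteq> xi b'" for b' by presburger
  have 2: "lderiv (theta b) (godd (xi b') \<otimes> godd (theta k)) = (if b = k then - godd (xi b') else 0)" for b' k
  proof -
    have "lderiv (theta b) (godd (xi b') \<otimes> godd (theta k)) = - (godd (xi b') \<otimes> lderiv (theta b) (godd (theta k)))"
      using lderiv_godd_mult[of "godd (theta k)" "theta b" "xi b'"] ne[of b']
      by (auto simp: godd_def split: if_splits)
    then show ?thesis
      using gmult_gone_right[of "godd (xi b')" "{xi b'}"] by (auto simp: lderiv_godd)
  qed
  have "lderiv (theta b) (mom_trans B c d m i) =
      - (\<Sum>a<r. \<Sum>b'<r. \<Sum>k<r. (trans_mat B d c k a m * cderiv d i (trans_mat B c d a b') m) *\<^sub>g
          (if b = k then - godd (xi b') else 0))"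
    unfolding mom_trans_def lderiv_diff lderiv_sum lderiv_scale 1 2 by simp
  also have "\<dots> = - (\<Sum>a<r. \<Sum>b'<r. \<Sum>k<r. if b = k then
          - ((trans_mat B d c k a m * cderiv d i (trans_mat B c d a b') m) *\<^sub>g godd (xi b')) else 0)"
    by (intro arg_cong[of _ _ uminus] sum.cong refl) auto
  also have "\<dots> = (\<Sum>a<r. trans_mat B d c b a m *\<^sub>g (\<Sum>b'<r. cderiv d i (trans_mat B c d a b') m *\<^sub>g godd (xi b')))"
    using assms by (simp add: sum_negf gscale_sum)
  finally show ?thesis .
qed

text \<open>
  In another chart the momenta become \<open>p'\<^sub>i = (\<partial>x\<^sup>j/\<partial>x'\<^sup>i) p\<^sub>j - S\<^sup>c\<^sub>a (\<partial>T\<^sup>a\<^sub>b/\<partial>x'\<^sup>i) \<xi>\<^sup>b \<theta>\<^sub>c\<close>. The second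
  term contributes to the derivatives with respect to the \<open>\<theta>\<^sub>c\<close> exactly what cancels the derivatives
  of the transition matrices that appear when the coefficients of the form are differentiated.
\<close>

lemma quasi_diff_hh:
  assumes c: "c \<in> atlas B" "d \<in> atlas B" "m \<in> cdom c" "m \<in> cdom d"
    and tp: "anchor_bracket_type (\<lambda>a. xi a) (\<lambda>a. theta a) (\<Theta> c m)"
      "anchor_bracket_type (\<lambda>a. xi a) (\<lambda>a. theta a) (\<Theta> d m)"
    and \<Theta>: "\<Theta> c m = hh c d m (\<Theta> d m)" and u: "u \<in> forms B"
  shows "quasi_diff B \<Theta> u c m = hh c d m (quasi_diff B \<Theta> u d m)"
proof -
  let ?h = "hh c d m"
  have pq: "dual_vars (\<lambda>a. xi a) (\<lambda>a. theta a)" by (simp add: dual_vars_def)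
  define A where "A i = pderiv_mom i (\<Theta> d m)" for i
  define R where "R a = rderiv (theta a) (\<Theta> d m)" for a
  define f0 where "f0 = momentum_free (\<Theta> d m)"
  define I where "I a = lderiv (xi a) (u d m)" for a
  define DT where "DT j a = (\<Sum>b<r. cderiv c j (trans_mat B c d a b) m *\<^sub>g godd (xi b))" for j a
  define DT' where "DT' i a = (\<Sum>b<r. cderiv d i (trans_mat B c d a b) m *\<^sub>g godd (xi b))" for i a
  define DX where "DX j i = cderiv d i (\<lambda>m'. bcoord c m' j) m" for j i
  have A: "A i \<in> ext_poly (xi_vars r)" for i unfolding A_def by (rule ext_anchor[OF pq tp(2)])
  have R: "R a \<in> ext_poly (xi_vars r)" for a unfolding R_def by (rule ext_bracket[OF pq tp(2)])
  have f0: "f0 \<in> ext_poly {..<2 * r}" unfolding f0_def by (rule anchor_bracket_decompose(2)[OF pq tp(2)])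
  have ud: "u d m \<in> ext_poly (xi_vars r)" for m by (rule formsD(2)[OF u])
  have I: "I a \<in> ext_poly (xi_vars r)" for a unfolding I_def using ud by simp
  have DT: "DT j a \<in> ext_poly (xi_vars r)" "DT' j a \<in> ext_poly (xi_vars r)" for j a
    unfolding DT_def DT'_def by (intro ext_poly_sum ext_poly_scale ext_poly_godd, blast)+
  have hA: "?h (A i) \<in> ext_poly (xi_vars r)" for i using A by simp
  have Afin: "\<And>J K. A i (J, K) \<noteq> 0 \<Longrightarrow> finite J" for i using ext_polyD[OF A] by blast
  have Ainv: "ginv (A i) = - A i" for i
  proof -
    have z: "A i (J, K) = 0" if "even (card J)" for J K
      using that unfolding A_def anchor_eq[OF pq tp(2)] by auto
    have "ginv (A i) (J, K) = (- A i) (J, K)" for J K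
      using z[of J K] by (cases "even (card J)") (simp_all add: ginv_def fun_app)
    then show ?thesis by (intro ext) (metis surj_pair)
  qed
  have hAinv: "ginv (?h (A i)) = - ?h (A i)" for i
    using L.ginv_h[OF ext_xi[OF A]] A by (simp add: Ainv L.h_minus)
  \<comment> \<open>The function itself in the chart \<open>c\<close>.\<close>
  have Thc: "\<Theta> c m = (\<Sum>i<n. ?h (A i) \<otimes> mom_trans B c d m i) + ?h f0"
  proof -
    have fin: "finite {JK. (A i \<otimes> gmom i) JK \<noteq> 0}" for i
      by (rule finite_support_gmom[OF finite_lessThan ext_xi[OF A]])
    have fs: "finite {JK. (\<Sum>i<n. A i \<otimes> gmom i) JK \<noteq> 0}"
    proof (rule finite_subset)
      show "{JK. (\<Sum>i<n. A i \<otimes> gmom i) JK \<noteq> 0} \<subseteq> (\<Union>i<n. {JK. (A i \<otimes> gmom i) JK \<noteq> 0})"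
        unfolding fun_sum_apply by (auto dest: sum.not_neutral_contains_not_neutral)
    qed (use fin in auto)
    have "\<Theta> c m = ?h ((\<Sum>i<n. A i \<otimes> gmom i) + f0)"
      unfolding \<Theta> A_def f0_def by (rule arg_cong[OF anchor_bracket_decompose(1)[OF pq tp(2)]])
    also have "\<dots> = ?h (\<Sum>i<n. A i \<otimes> gmom i) + ?h f0"
      by (rule gsubst_add[OF fs finite_support_ext[OF finite_lessThan f0]])
    also have "?h (\<Sum>i<n. A i \<otimes> gmom i) = (\<Sum>i<n. ?h (A i \<otimes> gmom i))"
      by (rule gsubst_sum) (rule fin)
    also have "\<dots> = (\<Sum>i<n. ?h (A i) \<otimes> mom_trans B c d m i)"
      by (intro sum.cong refl hh_gmult_gmom ext_xi A)
    finally show ?thesis .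
  qed
  have anchor: "pderiv_mom j (\<Theta> c m) = (\<Sum>i<n. DX j i *\<^sub>g ?h (A i))" if "j < n" for j
    unfolding Thc pderiv_mom_add pderiv_mom_sum pderiv_mom_gmult[OF hA] pderiv_mom_mom_trans[OF that]
    using gmult_gone_right[OF hA] pderiv_mom_ext[OF L.ext_poly_h[OF f0]]
    by (simp add: DX_def)
  have bracket: "rderiv (theta b) (\<Theta> c m) =
      (\<Sum>a<r. trans_mat B d c b a m *\<^sub>g (?h (R a) - (\<Sum>i<n. ?h (A i) \<otimes> DT' i a)))" if b: "b < r" for b
  proof -
    have fin: "\<And>J K. \<Theta> c m (J, K) \<noteq> 0 \<Longrightarrow> finite J" "\<And>J K. \<Theta> d m (J, K) \<noteq> 0 \<Longrightarrow> finite J"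
      using anchor_bracket_finite[OF tp(1)] anchor_bracket_finite[OF tp(2)] by blast+
    have 0: "lderiv (theta b) (?h (A i)) = 0" for i
      by (rule lderiv_eq_0[OF hA]) simp
    have R0: "R a = ginv (lderiv (theta a) f0)" for a
    proof -
      have "lderiv (theta a) (A i \<otimes> gmom i) = 0" for i
      proof -
        have "lderiv (theta a) (A i) = 0" by (rule lderiv_eq_0[OF A]) simp
        moreover have "lderiv (theta a) (gmom i) = 0"
          by (auto simp: lderiv_def gmom_def fun_eq_iff zero_fun_apply)
        ultimately show ?thesis
          by (subst lderiv_gmult[OF _ A]) (auto simp: gmom_def split: if_splits)
      qed
      then have "lderiv (theta a) (\<Theta> d m) = lderiv (theta a) f0"
        unfolding f0_def A_def by (subst anchor_bracket_decompose(1)[OF pq tp(2)]) (simp add: lderiv_sum)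
      then show ?thesis unfolding R_def by (simp add: rderiv_eq_ginv_lderiv[OF fin(2)])
    qed
    have "lderiv (theta b) (?h (A i) \<otimes> mom_trans B c d m i) =
        - (?h (A i) \<otimes> (\<Sum>a<r. trans_mat B d c b a m *\<^sub>g DT' i a))" for i
      using lderiv_gmult[OF _ hA, of "mom_trans B c d m i" "theta b"] mom_trans_finite
      by (simp add: 0[simplified] hAinv lderiv_theta_mom_trans[OF b, simplified] DT'_def)
    then have "lderiv (theta b) (\<Theta> c m) =
        - (\<Sum>i<n. ?h (A i) \<otimes> (\<Sum>a<r. trans_mat B d c b a m *\<^sub>g DT' i a)) + lderiv (theta b) (?h f0)"
      unfolding Thc lderiv_add lderiv_sum by (simp add: sum_negf)
    also have "lderiv (theta b) (?h f0) = (\<Sum>a<r. trans_mat B d c b a m *\<^sub>g ?h (lderiv (theta a) f0))"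
      by (rule lderiv_theta_hh[OF b f0])
    finally have L: "lderiv (theta b) (\<Theta> c m) =
        - (\<Sum>i<n. ?h (A i) \<otimes> (\<Sum>a<r. trans_mat B d c b a m *\<^sub>g DT' i a))
        + (\<Sum>a<r. trans_mat B d c b a m *\<^sub>g ?h (lderiv (theta a) f0))" .
    have "rderiv (theta b) (\<Theta> c m) = ginv (lderiv (theta b) (\<Theta> c m))"
      by (rule rderiv_eq_ginv_lderiv) (rule fin(1))
    also have "\<dots> =
        - (\<Sum>i<n. ginv (?h (A i)) \<otimes> (\<Sum>a<r. trans_mat B d c b a m *\<^sub>g ginv (DT' i a)))
        + (\<Sum>a<r. trans_mat B d c b a m *\<^sub>g ginv (?h (lderiv (theta a) f0)))"
      unfolding L ginv_add ginv_minus ginv_sum ginv_scale ginv_gmult[OF hA] ..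
    also have "(\<Sum>a<r. trans_mat B d c b a m *\<^sub>g ginv (?h (lderiv (theta a) f0))) =
        (\<Sum>a<r. trans_mat B d c b a m *\<^sub>g ?h (R a))"
      using L.ginv_h[OF ext_poly_lderiv[OF f0]] by (simp add: R0)
    also have "(\<Sum>i<n. ginv (?h (A i)) \<otimes> (\<Sum>a<r. trans_mat B d c b a m *\<^sub>g ginv (DT' i a))) =
        (\<Sum>i<n. \<Sum>a<r. trans_mat B d c b a m *\<^sub>g (?h (A i) \<otimes> DT' i a))"
      by (simp add: hAinv DT'_def ginv_sum sum_negf gmult_sum_right)
    also have "\<dots> = (\<Sum>a<r. trans_mat B d c b a m *\<^sub>g (\<Sum>i<n. ?h (A i) \<otimes> DT' i a))"
      unfolding gscale_sum by (rule sum.swap)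
    finally show ?thesis by (simp add: sum_subtractf)
  qed
  have uc: "dpoly c j (u c) m = ?h (dpoly c j (u d) m) + (\<Sum>a<r. DT j a \<otimes> ?h (I a))" if j: "j < n" for j
  proof -
    have "dpoly c j (u c) m = dpoly c j (\<lambda>m. hh c d m (u d m)) m"
      unfolding dpoly_def
      by (intro ext cderiv_cong[OF chart_open_overlap[OF c(1,2)] _ j])
        (use c formsD(4)[OF u c(1,2)] in auto)
    also have "\<dots> = ?h (dpoly c j (u d) m) + (\<Sum>a<r. DT j a \<otimes> ?h (I a))"
      unfolding DT_def I_def by (rule dpoly_hh[OF c j ud formsD(3)[OF u c(2)]])
    finally show ?thesis .
  qed
  have chain_u: "(\<Sum>j<n. DX j i *\<^sub>g dpoly c j (u d) m) = dpoly d i (u d) m" if i: "i < n" for i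
  proof (rule ext)
    fix JK
    have sm: "smooth_in B d (cdom c \<inter> cdom d) (\<lambda>m. u d m JK)"
      by (rule smooth_in_subset[OF chart_open_cdom[OF c(2)] formsD(3)[OF u c(2), unfolded smooth_poly_def, rule_format]])
        (use chart_open_overlap[OF c(1,2)] in \<open>auto simp: chart_open_def\<close>)
    have W: "chart_open c (cdom c \<inter> cdom d)" "chart_open d (cdom c \<inter> cdom d)"
      using chart_open_overlap[OF c(1,2)] chart_open_overlap[OF c(2,1)] by (simp_all add: Int_commute)
    have "cderiv d i (\<lambda>m. u d m JK) m = (\<Sum>j<n. DX j i * cderiv c j (\<lambda>m. u d m JK) m)"
      unfolding DX_def
      using cderiv_change_chart[OF W(1) smooth_in_change_chart[OF W(2,1) sm] c(2) _ c(4) i] c by simp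
    then show "(\<Sum>j<n. DX j i *\<^sub>g dpoly c j (u d) m) JK = dpoly d i (u d) m JK"
      by (simp add: fun_sum_apply gscale_apply dpoly_def)
  qed
  have chain_T: "(\<Sum>j<n. DX j i *\<^sub>g DT j a) = DT' i a" if i: "i < n" and a: "a < r" for i a
  proof -
    have "cderiv d i (trans_mat B c d a b) m = (\<Sum>j<n. DX j i * cderiv c j (trans_mat B c d a b) m)"
      if "b < r" for b
      unfolding DX_def
      using cderiv_change_chart[OF chart_open_overlap[OF c(1,2)] transitionD(3)[OF c(1,2) a that] c(2) _ c(4) i] c
      by simp
    then have "DT' i a = (\<Sum>b<r. \<Sum>j<n. (DX j i * cderiv c j (trans_mat B c d a b) m) *\<^sub>g godd (xi b))"
      unfolding DT'_def by (simp add: gscale_sum_left)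
    also have "\<dots> = (\<Sum>j<n. DX j i *\<^sub>g DT j a)"
      unfolding DT_def gscale_sum gscale_gscale by (rule sum.swap)
    finally show ?thesis by simp
  qed
  have first: "(\<Sum>j<n. pderiv_mom j (\<Theta> c m) \<otimes> dpoly c j (u c) m) =
      (\<Sum>i<n. ?h (A i) \<otimes> ?h (dpoly d i (u d) m)) + (\<Sum>i<n. \<Sum>a<r. ?h (A i) \<otimes> (DT' i a \<otimes> ?h (I a)))"
  proof -
    have "(\<Sum>j<n. pderiv_mom j (\<Theta> c m) \<otimes> dpoly c j (u c) m) =
        (\<Sum>j<n. \<Sum>i<n. ?h (A i) \<otimes> (DX j i *\<^sub>g (?h (dpoly c j (u d) m) + (\<Sum>a<r. DT j a \<otimes> ?h (I a)))))"
      by (intro sum.cong refl) (simp only: lessThan_iff anchor uc gmult_sum_left gmult_scale_left gmult_scale_right)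
    also have "\<dots> = (\<Sum>i<n. \<Sum>j<n. ?h (A i) \<otimes> (DX j i *\<^sub>g (?h (dpoly c j (u d) m) + (\<Sum>a<r. DT j a \<otimes> ?h (I a)))))"
      by (rule sum.swap)
    also have "\<dots> = (\<Sum>i<n. ?h (A i) \<otimes> (?h (dpoly d i (u d) m) + (\<Sum>a<r. DT' i a \<otimes> ?h (I a))))"
    proof (intro sum.cong refl)
      fix i assume "i \<in> {..<n}"
      then have i: "i < n" by simp
      have D: "dpoly c j (u d) m \<in> ext_poly {..<2 * r}" for j
        using ext_poly_dpoly[OF ud] by simp
      have "(\<Sum>j<n. DX j i *\<^sub>g (?h (dpoly c j (u d) m) + (\<Sum>a<r. DT j a \<otimes> ?h (I a)))) =
          (\<Sum>j<n. ?h (DX j i *\<^sub>g dpoly c j (u d) m)) + (\<Sum>j<n. \<Sum>a<r. (DX j i *\<^sub>g DT j a) \<otimes> ?h (I a))"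
        by (simp add: sum.distrib gscale_sum L.h_scale[OF D])
      also have "(\<Sum>j<n. ?h (DX j i *\<^sub>g dpoly c j (u d) m)) = ?h (dpoly d i (u d) m)"
        unfolding chain_u[OF i, symmetric] by (intro L.h_sum[symmetric] ext_poly_scale D)
      also have "(\<Sum>j<n. \<Sum>a<r. (DX j i *\<^sub>g DT j a) \<otimes> ?h (I a)) = (\<Sum>a<r. (\<Sum>j<n. DX j i *\<^sub>g DT j a) \<otimes> ?h (I a))"
        unfolding gmult_sum_left by (rule sum.swap)
      also have "\<dots> = (\<Sum>a<r. DT' i a \<otimes> ?h (I a))"
        by (intro sum.cong refl) (simp add: chain_T[OF i])
      finally show "(\<Sum>j<n. ?h (A i) \<otimes> (DX j i *\<^sub>g (?h (dpoly c j (u d) m) + (\<Sum>a<r. DT j a \<otimes> ?h (I a))))) =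
          ?h (A i) \<otimes> (?h (dpoly d i (u d) m) + (\<Sum>a<r. DT' i a \<otimes> ?h (I a)))"
        unfolding gmult_sum_right[symmetric] by (rule arg_cong)
    qed
    finally show ?thesis by (simp add: sum.distrib gmult_sum_right)
  qed
  have second: "(\<Sum>b<r. rderiv (theta b) (\<Theta> c m) \<otimes> lderiv (xi b) (u c m)) =
      (\<Sum>a<r. ?h (R a) \<otimes> ?h (I a)) - (\<Sum>i<n. \<Sum>a<r. ?h (A i) \<otimes> (DT' i a \<otimes> ?h (I a)))"
  proof -
    let ?E = "\<lambda>a. ?h (R a) - (\<Sum>i<n. ?h (A i) \<otimes> DT' i a)"
    have "lderiv (xi b) (u c m) = (\<Sum>a<r. trans_mat B c d a b m *\<^sub>g ?h (I a))" if "b < r" for b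
      unfolding formsD(4)[OF u c] I_def by (rule lderiv_xi_hh[OF that]) (simp add: u)
    then have "(\<Sum>b<r. rderiv (theta b) (\<Theta> c m) \<otimes> lderiv (xi b) (u c m)) =
        (\<Sum>b<r. (\<Sum>a<r. trans_mat B d c b a m *\<^sub>g ?E a) \<otimes> (\<Sum>a'<r. trans_mat B c d a' b m *\<^sub>g ?h (I a')))"
      by (intro sum.cong refl) (simp only: bracket lessThan_iff)
    also have "\<dots> = (\<Sum>b<r. \<Sum>a<r. \<Sum>a'<r. (trans_mat B c d a' b m * trans_mat B d c b a m) *\<^sub>g (?E a \<otimes> ?h (I a')))"
      by (intro sum.cong refl, subst gmult_sum_left, intro sum.cong refl)
        (simp only: gmult_sum_right gmult_scale_left gmult_scale_right gscale_gscale gscale_sum mult.commute)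
    also have "\<dots> = (\<Sum>a<r. \<Sum>b<r. \<Sum>a'<r. (trans_mat B c d a' b m * trans_mat B d c b a m) *\<^sub>g (?E a \<otimes> ?h (I a')))"
      by (rule sum.swap)
    also have "\<dots> = (\<Sum>a<r. \<Sum>a'<r. \<Sum>b<r. (trans_mat B c d a' b m * trans_mat B d c b a m) *\<^sub>g (?E a \<otimes> ?h (I a')))"
      by (intro sum.cong refl sum.swap)
    also have "\<dots> = (\<Sum>a<r. \<Sum>a'<r. (if a' = a then 1 else 0) *\<^sub>g (?E a \<otimes> ?h (I a')))"
      unfolding gscale_sum_left[symmetric]
      by (intro sum.cong refl) (simp only: trans_mat_inverse[OF c(2,1,4,3)] lessThan_iff)
    also have "\<dots> = (\<Sum>a<r. ?E a \<otimes> ?h (I a))"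
      by (intro sum.cong refl) (simp only: sum_delta_scale(2)[OF finite_lessThan] if_True)
    also have "\<dots> = (\<Sum>a<r. ?h (R a) \<otimes> ?h (I a)) - (\<Sum>a<r. \<Sum>i<n. ?h (A i) \<otimes> (DT' i a \<otimes> ?h (I a)))"
      by (simp add: sum_subtractf gmult_sum_left gmult_assoc[OF hA DT(2)])
    also have "(\<Sum>a<r. \<Sum>i<n. ?h (A i) \<otimes> (DT' i a \<otimes> ?h (I a))) = (\<Sum>i<n. \<Sum>a<r. ?h (A i) \<otimes> (DT' i a \<otimes> ?h (I a)))"
      by (rule sum.swap)
    finally show ?thesis .
  qed
  have "quasi_diff B \<Theta> u c m = (\<Sum>i<n. ?h (A i) \<otimes> ?h (dpoly d i (u d) m)) + (\<Sum>a<r. ?h (R a) \<otimes> ?h (I a))"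
    unfolding quasi_diff_coords[OF pq, of u c m, OF formsD(2)[OF u]] first second by simp
  also have "\<dots> = ?h ((\<Sum>i<n. A i \<otimes> dpoly d i (u d) m) + (\<Sum>a<r. R a \<otimes> I a))"
    using ext_xi[OF A] ext_xi[OF R] ext_xi[OF I] ext_xi[OF ext_poly_dpoly[OF ud]]
    by (simp add: L.h_add L.h_sum L.h_gmult)
  also have "(\<Sum>i<n. A i \<otimes> dpoly d i (u d) m) + (\<Sum>a<r. R a \<otimes> I a) = quasi_diff B \<Theta> u d m"
    unfolding A_def R_def I_def by (rule quasi_diff_coords[OF pq formsD(2)[OF u], symmetric])
  finally show ?thesis .
qed

end

context smooth_bundle
begin

lemma forms_quasi_diff:
  assumes \<Theta>: "\<Theta> \<in> sfunctions B" and tp: "\<And>c m. anchor_bracket_type (\<lambda>a. xi a) (\<lambda>a. theta a) (\<Theta> c m)"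
    and u: "u \<in> forms B"
  shows "quasi_diff B \<Theta> u \<in> forms B"
proof -
  have pq: "dual_vars (\<lambda>a. xi a) (\<lambda>a. theta a)" by (simp add: dual_vars_def)
  note coords = quasi_diff_coords[OF pq formsD(2)[OF u]]
  show ?thesis
  proof (rule formsI)
    fix c d m
    show "c \<notin> atlas B \<or> m \<notin> cdom c \<Longrightarrow> quasi_diff B \<Theta> u c m = 0"
      unfolding quasi_diff_def by (rule poisson_zero) (rule sfunctionsD(1)[OF \<Theta>] formsD(1)[OF u], assumption)+
    show "quasi_diff B \<Theta> u c m \<in> ext_poly (xi_vars r)"
      unfolding coords
      by (intro ext_poly_add ext_poly_sum ext_poly_gmult ext_anchor[OF pq tp] ext_bracket[OF pq tp]
          ext_poly_dpoly formsD(2)[OF u] ext_poly_lderiv)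
    show "quasi_diff B \<Theta> u c m = hh c d m (quasi_diff B \<Theta> u d m)"
      if "c \<in> atlas B" "d \<in> atlas B" "m \<in> cdom c" "m \<in> cdom d"
      by (rule quasi_diff_hh[where \<Theta> = \<Theta>, OF that tp tp sfunctionsD(5)[OF \<Theta> that] u])
    assume c: "c \<in> atlas B"
    have eq: "quasi_diff B \<Theta> u c = (\<lambda>m. (\<Sum>i<n. pderiv_mom i (\<Theta> c m) \<otimes> dpoly c i (u c) m)
        + (\<Sum>a<r. rderiv (theta a) (\<Theta> c m) \<otimes> lderiv (xi a) (u c m)))"
      by (rule ext) (rule coords)
    show "smooth_poly c (cdom c) (quasi_diff B \<Theta> u c)"
      unfolding eq
      by (intro smooth_poly_add smooth_poly_sum smooth_poly_gmult smooth_poly_pderiv_mom smooth_poly_rderiv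
          smooth_poly_lderiv smooth_poly_dpoly chart_open_cdom[OF c] sfunctionsD(4)[OF \<Theta> c] formsD(3)[OF u c]) simp
  qed
qed

section \<open>Locality\<close>

subsection \<open>Bump functions\<close>

lemma smooth_in_flat_exp:
  assumes W: "chart_open c W" and h: "smooth_in B c W h"
  shows "smooth_in B c W (\<lambda>m. flat_exp P (h m))"
proof -
  have eq: "in_coords c (\<lambda>m. flat_exp P (h m)) = (\<lambda>y. flat_exp P (in_coords c h y))"
    by (simp add: in_coords_def comp_def)
  have H: "\<exists>f'\<in>range flat_exp. \<forall>t. (f has_real_derivative f' t) (at t)" if f: "f \<in> range flat_exp" for f
  proof -
    obtain R where "f = flat_exp R" using f by blast
    then show ?thesis
      using flat_exp_derivative[of R] by (intro bexI[of _ "flat_exp ([:0, 0, 1:] * (R - pderiv R))"]) simp_all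
  qed
  have "Ck k n (bcoord c ` W) (\<lambda>y. flat_exp P (in_coords c h y))" for k
    by (rule Ck_compose_real[OF openin_bcoord_image[OF W] H rangeI])
      (assumption, rule h[unfolded smooth_in_iff_Ck[OF W], rule_format])
  then show ?thesis unfolding smooth_in_iff_Ck[OF W] eq by (intro allI)
qed

lemma compactin_Euclidean_space_cube:
  assumes "y0 \<in> model_space n'"
  shows "compactin (Euclidean_space n') {y \<in> model_space n'. \<forall>i<n'. \<bar>y i - y0 i\<bar> \<le> e}"
proof -
  define S where "S i = (if i < n' then {y0 i - e..y0 i + e} else {0})" for i
  have S: "compact (S i)" for i unfolding S_def by simp
  have eq: "{y \<in> model_space n'. \<forall>i<n'. \<bar>y i - y0 i\<bar> \<le> e} = Pi\<^sub>E UNIV S"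
  proof -
    have S_iff: "y i \<in> S i \<longleftrightarrow> (if i < n' then \<bar>y i - y0 i\<bar> \<le> e else y i = 0)" for y i
      unfolding S_def by (simp add: abs_le_iff) linarith
    have "(y \<in> model_space n' \<and> (\<forall>i<n'. \<bar>y i - y0 i\<bar> \<le> e)) \<longleftrightarrow> (\<forall>i. y i \<in> S i)" for y
    proof
      assume L: "y \<in> model_space n' \<and> (\<forall>i<n'. \<bar>y i - y0 i\<bar> \<le> e)"
      show "\<forall>i. y i \<in> S i"
      proof
        fix i show "y i \<in> S i" unfolding S_iff using L by (cases "i < n'") simp_all
      qed
    next
      assume R: "\<forall>i. y i \<in> S i"
      have "y i = 0" if "n' \<le> i" for i using R[rule_format, of i] that unfolding S_iff by simp
      moreover have "\<bar>y i - y0 i\<bar> \<le> e" if "i < n'" for i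
        using R[rule_format, of i] that unfolding S_iff by simp
      ultimately show "y \<in> model_space n' \<and> (\<forall>i<n'. \<bar>y i - y0 i\<bar> \<le> e)" by simp
    qed
    then show ?thesis unfolding set_eq_iff PiE_iff by simp
  qed
  have "compactin (powertop_real UNIV) (Pi\<^sub>E UNIV S)"
    unfolding compactin_PiE using S by simp
  moreover have "Pi\<^sub>E UNIV S \<subseteq> model_space n'" unfolding eq[symmetric] by blast
  ultimately show ?thesis
    unfolding Euclidean_space_def compactin_subtopology eq by (rule conjI)
qed

text \<open>
  Closedness in the whole base is what permits extension by zero. It holds because a closed cube in the
  coordinates is compact and the base is a Hausdorff space.
\<close>

lemma exists_bump:
  assumes c: "c \<in> atlas B" and m0: "m0 \<in> cdom c"
  shows "\<exists>\<beta> C. smooth_in B c (cdom c) \<beta> \<and> \<beta> m0 = 1 \<and> closedin (base B) C \<and> C \<subseteq> cdom c \<and>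
    (\<forall>m. m \<notin> C \<longrightarrow> \<beta> m = 0)"
proof -
  define y0 where "y0 = bcoord c m0"
  note V = openin_bcoord_image[OF chart_open_cdom[OF c]]
  have y0V: "y0 \<in> bcoord c ` cdom c" using m0 y0_def by blast
  have y0: "y0 \<in> model_space n" using openin_Euclidean_space_subset[OF V] y0V by blast
  obtain e where e: "e > 0" "\<And>y. y \<in> model_space n \<Longrightarrow> (\<And>i. i < n \<Longrightarrow> \<bar>y i - y0 i\<bar> < e) \<Longrightarrow> y \<in> bcoord c ` cdom c"
    using openin_Euclidean_space_cube[OF V y0V] by blast
  define \<epsilon> where "\<epsilon> = e / 2"
  have \<epsilon>: "\<epsilon> > 0" "\<epsilon> < e" using e(1) by (auto simp: \<epsilon>_def)
  define Q where "Q = {y \<in> model_space n. \<forall>i<n. \<bar>y i - y0 i\<bar> \<le> \<epsilon>}"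
  have QV: "Q \<subseteq> bcoord c ` cdom c"
  proof
    fix y assume y: "y \<in> Q"
    show "y \<in> bcoord c ` cdom c"
    proof (rule e(2))
      show "y \<in> model_space n" using y unfolding Q_def by blast
      show "\<bar>y i - y0 i\<bar> < e" if "i < n" for i
        using y that \<epsilon>(2) unfolding Q_def by (blast intro: le_less_trans)
    qed
  qed
  define C where "C = {m \<in> cdom c. bcoord c m \<in> Q}"
  have img: "bcoord c ` C = Q" unfolding C_def using QV by blast
  have "compactin (subtopology (Euclidean_space n) (bcoord c ` cdom c)) Q"
    unfolding compactin_subtopology Q_def using compactin_Euclidean_space_cube[OF y0] QV Q_def by simp
  moreover have "cdom c \<subseteq> topspace (base B)" using chartD(1)[OF c] openin_subset by blast
  ultimately have "compactin (subtopology (base B) (cdom c)) C"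
    using homeomorphic_map_compactness_eq[OF chartD(3)[OF c], of C] img unfolding C_def by auto
  then have "compactin (base B) C" by (simp add: compactin_subtopology)
  moreover have "Hausdorff_space (base B)" using vector_bundle unfolding vector_bundle_def by blast
  ultimately have closed: "closedin (base B) C" by (rule compactin_imp_closedin[rotated])
  define P where "P = (\<lambda>t. flat_exp 1 t)"
  define b where "b m = (\<Prod>i<n. P (\<epsilon> + (bcoord c m i - y0 i)) * P (\<epsilon> - (bcoord c m i - y0 i)))" for m
  define \<beta> where "\<beta> m = (if m \<in> cdom c then b m / b m0 else 0)" for m
  have coord: "smooth_in B c (cdom c) (\<lambda>m. bcoord c m i)" if "i < n" for i
    using transitionD(1)[OF c c that] by simp
  have lin: "smooth_in B c (cdom c) (\<lambda>m. t + s * bcoord c m i)" if "i < n" for i s t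
    by (intro smooth_in_add smooth_in_mult smooth_in_const chart_open_cdom[OF c] coord[OF that])
  have "smooth_in B c (cdom c) (\<lambda>m. P (\<epsilon> + (bcoord c m i - y0 i)) * P (\<epsilon> - (bcoord c m i - y0 i)))"
    if "i < n" for i
    using smooth_in_mult[OF chart_open_cdom[OF c]
        smooth_in_flat_exp[OF chart_open_cdom[OF c] lin[OF that, of "\<epsilon> - y0 i" 1]]
        smooth_in_flat_exp[OF chart_open_cdom[OF c] lin[OF that, of "\<epsilon> + y0 i" "-1"]], of 1 1]
    by (simp add: P_def algebra_simps)
  then have "smooth_in B c (cdom c) b"
    unfolding b_def[abs_def] by (intro smooth_in_prod chart_open_cdom[OF c]) simp
  then have "smooth_in B c (cdom c) (\<lambda>m. (1 / b m0) * b m)"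
    by (intro smooth_in_mult smooth_in_const chart_open_cdom[OF c])
  then have s: "smooth_in B c (cdom c) \<beta>"
    by (rule smooth_in_cong[OF chart_open_cdom[OF c], rotated]) (simp add: \<beta>_def)
  have "b m0 \<noteq> 0" using \<epsilon> by (simp add: b_def P_def y0_def flat_exp_def)
  then have one: "\<beta> m0 = 1" using m0 by (simp add: \<beta>_def)
  have zero: "\<beta> m = 0" if "m \<notin> C" for m
  proof (cases "m \<in> cdom c")
    case True
    have "bcoord c m \<in> model_space n" using openin_Euclidean_space_subset[OF V] True by blast
    moreover have "bcoord c m \<notin> Q" using True that unfolding C_def by blast
    ultimately obtain i where i: "i < n" "\<epsilon> < \<bar>bcoord c m i - y0 i\<bar>"
      unfolding Q_def by (auto simp: not_le)
    have "P (\<epsilon> + (bcoord c m i - y0 i)) * P (\<epsilon> - (bcoord c m i - y0 i)) = 0"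
    proof (cases "bcoord c m i - y0 i < 0")
      case True
      then have "P (\<epsilon> + (bcoord c m i - y0 i)) = 0" using i(2) by (simp add: P_def flat_exp_def)
      then show ?thesis by simp
    next
      case False
      then have "P (\<epsilon> - (bcoord c m i - y0 i)) = 0" using i(2) by (simp add: P_def flat_exp_def)
      then show ?thesis by simp
    qed
    then have "b m = 0" unfolding b_def using i(1) by (intro prod_zero) auto
    then show ?thesis by (simp add: \<beta>_def)
  qed (simp add: \<beta>_def)
  have "C \<subseteq> cdom c" unfolding C_def by blast
  then show ?thesis using s one closed zero by blast
qed

subsection \<open>Extension of local forms\<close>

lemma homogeneous_forms_deg: "u \<in> forms_deg B k \<Longrightarrow> homogeneous k (u c m) = u c m"
proof (rule ext, clarify)
  fix J and K :: "nat multiset"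
  assume u: "u \<in> forms_deg B k"
  then have F: "u \<in> forms B" by (simp add: forms_deg_def)
  show "homogeneous k (u c m) (J, K) = u c m (J, K)"
  proof (cases "u c m (J, K) = 0")
    case False
    then have "card J + 2 * size K = k" "K = {#}"
      using u ext_polyD[OF formsD(2)[OF F]] unfolding forms_deg_def sfunctions_deg_def by auto
    then show ?thesis by (simp add: homogeneous_def)
  qed (simp add: homogeneous_def)
qed

lemma forms_degI:
  assumes u: "u \<in> forms B" and h: "\<And>c m. homogeneous k (u c m) = u c m"
  shows "u \<in> forms_deg B k"
proof -
  have "shom k u = u" by (simp add: shom_def h)
  then show ?thesis using forms_deg_shom[OF u, of k] by simp
qed

lemma forms_deg_forms: "u \<in> forms_deg B k \<Longrightarrow> u \<in> forms B"
  by (simp add: forms_deg_def)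

lemma smooth_poly_odd_trans_xi:
  assumes "c \<in> atlas B" "d \<in> atlas B" "a < r"
  shows "smooth_poly c (cdom c \<inter> cdom d) (\<lambda>m. odd_trans B c d m (xi a))"
  unfolding odd_trans_xi
  using transitionD(3)[OF assms(1,2,3)] chart_open_overlap[OF assms(1,2)]
  by (intro smooth_poly_sum smooth_poly_fscale smooth_poly_const) auto

lemma smooth_poly_subst_mono:
  assumes c: "c \<in> atlas B" "d \<in> atlas B" and J: "J \<subseteq> xi_vars r"
  shows "smooth_poly c (cdom c \<inter> cdom d) (\<lambda>m. subst_mono (odd_trans B c d m) J)"
proof -
  have "smooth_poly c (cdom c \<inter> cdom d) (\<lambda>m. foldr (\<lambda>j. gmult (odd_trans B c d m j)) js gone)"
    if "set js \<subseteq> xi_vars r" for js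
    using that
  proof (induction js)
    case Nil
    then show ?case using smooth_poly_const[OF chart_open_overlap[OF c]] by simp
  next
    case (Cons j js)
    obtain a where "j = xi a" "a < r" using Cons.prems by auto
    then show ?case
      using Cons smooth_poly_gmult[OF chart_open_overlap[OF c] smooth_poly_odd_trans_xi[OF c]] by auto
  qed
  moreover have "finite J" using J by (rule finite_subset) simp
  ultimately show ?thesis using J by (simp add: subst_mono_foldr)
qed

lemma extend_local_form:
  assumes c: "c \<in> atlas B" and \<beta>: "smooth_in B c (cdom c) \<beta>" and C: "closedin (base B) C" "C \<subseteq> cdom c"
    and 0: "\<And>m. m \<notin> C \<Longrightarrow> \<beta> m = 0"
    and f: "\<And>m. f m \<in> ext_poly (xi_vars r)" "smooth_poly c (cdom c) f" "\<And>m. homogeneous k (f m) = f m"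
  shows "\<exists>F\<in>forms_deg B k. (\<forall>m\<in>cdom c. F c m = \<beta> m *\<^sub>g f m) \<and> (\<forall>d m. m \<notin> cdom c \<longrightarrow> F d m = 0)"
proof -
  define F where "F d m = (if d \<in> atlas B \<and> m \<in> cdom d \<and> m \<in> cdom c then \<beta> m *\<^sub>g hh d c m (f m) else 0)" for d m
  have Fc: "F c m = \<beta> m *\<^sub>g f m" if "m \<in> cdom c" for m
    using that c by (simp add: F_def hh_self f(1))
  have F: "F \<in> forms B"
  proof (rule formsI)
    fix d e m
    show "d \<notin> atlas B \<or> m \<notin> cdom d \<Longrightarrow> F d m = 0" by (auto simp: F_def)
    show "F d m \<in> ext_poly (xi_vars r)" using f(1) by (auto simp: F_def)
    show "F d m = hh d e m (F e m)"
      if d: "d \<in> atlas B" "e \<in> atlas B" "m \<in> cdom d" "m \<in> cdom e"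
    proof (cases "m \<in> cdom c")
      case True
      then show ?thesis
        using d hh_compose[OF d(1,2) c d(3,4) True f(1)] f(1)
        by (simp add: F_def L.h_scale)
    qed (simp add: F_def)
    assume d: "d \<in> atlas B"
    have W: "chart_open d (cdom d \<inter> cdom c)" "chart_open c (cdom d \<inter> cdom c)"
      using chart_open_overlap[OF d c] chart_open_overlap[OF c d] by (simp_all add: Int_commute)
    have to_d: "smooth_in B d (cdom d \<inter> cdom c) h" if "smooth_in B c (cdom c) h" for h
    proof (rule smooth_in_change_chart[OF W(2,1)])
      show "smooth_in B c (cdom d \<inter> cdom c) h"
        by (rule smooth_in_subset[OF chart_open_cdom[OF c] that]) (use W in \<open>auto simp: chart_open_def\<close>)
    qed
    have W1: "smooth_poly d (cdom d \<inter> cdom c) (\<lambda>m. \<beta> m *\<^sub>g hh d c m (f m))"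
      unfolding hh_xi_eq[OF f(1)] using f(2) \<beta>
      by (intro smooth_poly_fscale smooth_poly_sum smooth_poly_subst_mono[OF d c] W(1) to_d)
        (auto simp: smooth_poly_def)
    have V: "chart_open d (cdom d - C)"
      unfolding chart_open_def using d openin_diff[OF chartD(1)[OF d] C(1)] by blast
    have U: "cdom d = (cdom d \<inter> cdom c) \<union> (cdom d - C)" using C(2) by blast
    show "smooth_poly d (cdom d) (F d)"
      unfolding smooth_poly_def
    proof
      fix JK
      have "smooth_in B d (cdom d \<inter> cdom c) (\<lambda>m. F d m JK)"
        by (rule smooth_in_cong[OF W(1) _ W1[unfolded smooth_poly_def, rule_format]]) (simp add: F_def d)
      moreover have "smooth_in B d (cdom d - C) (\<lambda>m. F d m JK)"
        by (rule smooth_in_cong[OF V _ smooth_in_const[OF V, of 0]]) (auto simp: F_def 0 zero_fun_apply)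
      ultimately have "smooth_in B d ((cdom d \<inter> cdom c) \<union> (cdom d - C)) (\<lambda>m. F d m JK)"
        by (rule smooth_in_Un[OF W(1) _ V])
      then show "smooth_in B d (cdom d) (\<lambda>m. F d m JK)" using U by simp
    qed
  qed
  have "homogeneous k (F d m) = F d m" for d m
    using f(1,3) by (auto simp: F_def homogeneous_scale L.homogeneous_h)
  then have "F \<in> forms_deg B k" by (rule forms_degI[OF F])
  then show ?thesis using Fc by (intro bexI[of _ F]) (auto simp: F_def)
qed

lemma sfield_sum_apply: "(\<Sum>i\<in>A. F i) c m = (\<Sum>i\<in>A. F i c m)" for F :: "'i \<Rightarrow> ('m, 'a) sfield"
  by (induction A rule: infinite_finite_induct) (simp_all add: fun_app)

lemma gmult_function: "(h *\<^sub>g gone) \<otimes> f = h *\<^sub>g f" if "f \<in> ext_poly S"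
  using that by simp

text \<open>
  Multiplied by a power of a bump function, a form becomes a finite sum of products of a function
  and of one-forms defined on the whole base. Operators that commute with functions are therefore
  determined by what they do on functions and how they pass one-forms.
\<close>

theorem operator_vanishes_locally:
  fixes D :: "('m, 'a) soperator"
  assumes poly: "\<And>u c m. u \<in> forms B \<Longrightarrow> D u c m \<in> ext_poly {..<2 * r}"
    and off: "\<And>u c m. u \<in> forms B \<Longrightarrow> c \<notin> atlas B \<or> m \<notin> cdom c \<Longrightarrow> D u c m = 0"
    and add: "\<And>u v. u \<in> forms B \<Longrightarrow> v \<in> forms B \<Longrightarrow> D (u + v) = D u + D v"
    and fn: "\<And>f u. f \<in> forms_deg B 0 \<Longrightarrow> u \<in> forms B \<Longrightarrow> D (f \<odot> u) = f \<odot> D u"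
    and deg0: "\<And>f. f \<in> forms_deg B 0 \<Longrightarrow> D f = 0"
    and deg1: "\<And>\<xi> u. \<xi> \<in> forms_deg B 1 \<Longrightarrow> u \<in> forms B \<Longrightarrow> D u = 0 \<Longrightarrow> D (\<xi> \<odot> u) = 0"
    and u: "u \<in> forms B"
  shows "D u = 0"
proof (rule sfield_eqI)
  show "D u c m = 0" if "c \<notin> atlas B \<or> m \<notin> cdom c" for c m using off[OF u that] .
  show "(0 :: ('m, 'a) sfield) c m = 0" for c m by (simp add: zero_fun_apply)
  fix c m0 assume c: "c \<in> atlas B" and m0: "m0 \<in> cdom c"
  obtain \<beta> C where \<beta>: "smooth_in B c (cdom c) \<beta>" "\<beta> m0 = 1" and C: "closedin (base B) C" "C \<subseteq> cdom c"
    and 0: "\<And>m. m \<notin> C \<Longrightarrow> \<beta> m = 0"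
    using exists_bump[OF c m0] by blast
  note extend = extend_local_form[OF c \<beta>(1) C 0]
  have "\<exists>F\<in>forms_deg B 0. (\<forall>m\<in>cdom c. F c m = \<beta> m *\<^sub>g gone) \<and> (\<forall>d m. m \<notin> cdom c \<longrightarrow> F d m = 0)"
    by (rule extend) (simp_all add: smooth_poly_const chart_open_cdom[OF c] homogeneous_gone)
  then obtain X where X: "X \<in> forms_deg B 0" "\<And>m. m \<in> cdom c \<Longrightarrow> X c m = \<beta> m *\<^sub>g gone"
    "\<And>d m. m \<notin> cdom c \<Longrightarrow> X d m = 0" by blast
  have "\<exists>F. F \<in> forms_deg B 1 \<and> (\<forall>m\<in>cdom c. F c m = \<beta> m *\<^sub>g godd (xi a))" if a: "a \<in> {..<r}" for a
  proof -
    have "\<exists>F\<in>forms_deg B 1. (\<forall>m\<in>cdom c. F c m = \<beta> m *\<^sub>g godd (xi a)) \<and> (\<forall>d m. m \<notin> cdom c \<longrightarrow> F d m = 0)"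
      by (rule extend) (use a in \<open>simp_all add: smooth_poly_const chart_open_cdom[OF c] homogeneous_godd\<close>)
    then show ?thesis by (elim bexE conjE) (intro exI conjI)
  qed
  then have "\<forall>a\<in>{..<r}. \<exists>F. F \<in> forms_deg B 1 \<and> (\<forall>m\<in>cdom c. F c m = \<beta> m *\<^sub>g godd (xi a))"
    by (intro ballI)
  from bchoice[OF this] obtain E where
    "\<forall>a\<in>{..<r}. E a \<in> forms_deg B 1 \<and> (\<forall>m\<in>cdom c. E a c m = \<beta> m *\<^sub>g godd (xi a))"
    by blast
  then have E: "\<And>a. a < r \<Longrightarrow> E a \<in> forms_deg B 1"
    "\<And>a m. a < r \<Longrightarrow> m \<in> cdom c \<Longrightarrow> E a c m = \<beta> m *\<^sub>g godd (xi a)" by simp_all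
  have "\<exists>F\<in>forms_deg B 0. (\<forall>m\<in>cdom c. F c m = \<beta> m *\<^sub>g (u c m (J, {#}) *\<^sub>g gone)) \<and> (\<forall>d m. m \<notin> cdom c \<longrightarrow> F d m = 0)" for J
  proof (rule extend)
    show "smooth_poly c (cdom c) (\<lambda>m. u c m (J, {#}) *\<^sub>g gone)"
      using formsD(3)[OF u c]
      by (intro smooth_poly_fscale smooth_poly_const chart_open_cdom[OF c]) (auto simp: smooth_poly_def)
  qed (simp_all add: homogeneous_scale homogeneous_gone)
  then have "\<forall>J. \<exists>F. F \<in> forms_deg B 0 \<and> (\<forall>m\<in>cdom c. F c m = \<beta> m *\<^sub>g (u c m (J, {#}) *\<^sub>g gone)) \<and> (\<forall>d m. m \<notin> cdom c \<longrightarrow> F d m = 0)"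
    unfolding Bex_def by (intro allI)
  from choice[OF this] obtain g where
    "\<forall>J. g J \<in> forms_deg B 0 \<and> (\<forall>m\<in>cdom c. g J c m = \<beta> m *\<^sub>g (u c m (J, {#}) *\<^sub>g gone)) \<and> (\<forall>d m. m \<notin> cdom c \<longrightarrow> g J d m = 0)"
    by blast
  then have g: "\<And>J. g J \<in> forms_deg B 0" "\<And>J m. m \<in> cdom c \<Longrightarrow> g J c m = \<beta> m *\<^sub>g (u c m (J, {#}) *\<^sub>g gone)"
    "\<And>J d m. m \<notin> cdom c \<Longrightarrow> g J d m = 0" by simp_all
  have Xf: "X \<in> forms B" and Ef: "\<And>a. a < r \<Longrightarrow> E a \<in> forms B" and gf: "\<And>J. g J \<in> forms B"
    using X(1) E(1) g(1) forms_deg_forms by auto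
  have product: "\<exists>V\<in>forms B. D V = 0 \<and> (\<forall>d m. m \<notin> cdom c \<longrightarrow> V d m = 0) \<and>
      (\<forall>m\<in>cdom c. V c m = (\<beta> m ^ Suc k * u c m (J, {#})) *\<^sub>g gmono (J \<inter> xi ` {r - k..<r}))"
    if "k \<le> r" "J \<subseteq> xi_vars r" for k J
    using that(1)
  proof (induction k)
    case 0
    show ?case
      using gf deg0[OF g(1)] g(2,3) by (intro bexI[of _ "g J"]) (auto simp: gone_eq_gmono)
  next
    case (Suc k)
    have "k \<le> r" using Suc.prems by simp
    from Suc.IH[OF this] obtain V where V: "V \<in> forms B" "D V = 0" "\<And>d m. m \<notin> cdom c \<Longrightarrow> V d m = 0"
      "\<And>m. m \<in> cdom c \<Longrightarrow> V c m = (\<beta> m ^ Suc k * u c m (J, {#})) *\<^sub>g gmono (J \<inter> xi ` {r - k..<r})"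
      by blast
    define a where "a = r - Suc k"
    have a: "a < r" "{r - Suc k..<r} = insert a {r - k..<r}" using Suc.prems by (auto simp: a_def)
    let ?A = "J \<inter> xi ` {r - k..<r}"
    have A: "finite ?A" "\<forall>j\<in>?A. xi a < j" using a_def Suc.prems by auto
    have Aext: "gmono ?A \<in> ext_poly {..<2 * r}" by (intro ext_poly_gmono) auto
    show ?case
    proof (cases "xi a \<in> J")
      case True
      have J: "J \<inter> xi ` {r - Suc k..<r} = insert (xi a) ?A" using True a(2) by auto
      show ?thesis
        unfolding J
      proof (intro bexI[of _ "E a \<odot> V"] conjI allI impI ballI)
        show "E a \<odot> V \<in> forms B" "D (E a \<odot> V) = 0" using Ef[OF a(1)] V deg1[OF E(1)[OF a(1)]] by auto
        show "(E a \<odot> V) d m = 0" if "m \<notin> cdom c" for d m using V(3)[OF that] by (simp add: smult_def)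
        show "(E a \<odot> V) c m = (\<beta> m ^ Suc (Suc k) * u c m (J, {#})) *\<^sub>g gmono (insert (xi a) ?A)"
          if "m \<in> cdom c" for m
          using V(4)[OF that] E(2)[OF a(1) that] gmono_insert_min[OF A] by (simp add: smult_def mult_ac)
      qed
    next
      case False
      have J: "J \<inter> xi ` {r - Suc k..<r} = ?A" using False a(2) by auto
      show ?thesis
        unfolding J
      proof (intro bexI[of _ "X \<odot> V"] conjI allI impI ballI)
        have "X \<odot> 0 = 0" by (intro ext) (simp add: smult_def zero_fun_apply)
        then show "D (X \<odot> V) = 0" using fn[OF X(1) V(1)] V(2) by simp
        show "X \<odot> V \<in> forms B" using Xf V by simp
        show "(X \<odot> V) d m = 0" if "m \<notin> cdom c" for d m using V(3)[OF that] by (simp add: smult_def)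
        show "(X \<odot> V) c m = (\<beta> m ^ Suc (Suc k) * u c m (J, {#})) *\<^sub>g gmono ?A"
          if "m \<in> cdom c" for m
          using V(4)[OF that] X(2)[OF that] gmult_gone_left_ext[OF Aext] by (simp add: smult_def mult_ac)
      qed
    qed
  qed
  have "\<exists>V. V \<in> forms B \<and> D V = 0 \<and> (\<forall>d m. m \<notin> cdom c \<longrightarrow> V d m = 0) \<and>
      (\<forall>m\<in>cdom c. V c m = (\<beta> m ^ Suc r * u c m (J, {#})) *\<^sub>g gmono J)" if J: "J \<in> Pow (xi_vars r)" for J
  proof -
    have eq: "J \<inter> xi ` {r - r..<r} = J" using J by (auto simp: atLeast0LessThan)
    show ?thesis
      using product[OF order_refl, of J, unfolded eq Bex_def] J by simp
  qed
  then have "\<forall>J\<in>Pow (xi_vars r). \<exists>V. V \<in> forms B \<and> D V = 0 \<and> (\<forall>d m. m \<notin> cdom c \<longrightarrow> V d m = 0) \<and>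
      (\<forall>m\<in>cdom c. V c m = (\<beta> m ^ Suc r * u c m (J, {#})) *\<^sub>g gmono J)"
    by (intro ballI)
  from bchoice[OF this] obtain V where
    "\<forall>J\<in>Pow (xi_vars r). V J \<in> forms B \<and> D (V J) = 0 \<and> (\<forall>d m. m \<notin> cdom c \<longrightarrow> V J d m = 0) \<and>
      (\<forall>m\<in>cdom c. V J c m = (\<beta> m ^ Suc r * u c m (J, {#})) *\<^sub>g gmono J)"
    by blast
  then have V: "\<And>J. J \<in> Pow (xi_vars r) \<Longrightarrow> V J \<in> forms B"
    "\<And>J. J \<in> Pow (xi_vars r) \<Longrightarrow> D (V J) = 0"
    "\<And>J d m. J \<in> Pow (xi_vars r) \<Longrightarrow> m \<notin> cdom c \<Longrightarrow> V J d m = 0"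
    "\<And>J m. J \<in> Pow (xi_vars r) \<Longrightarrow> m \<in> cdom c \<Longrightarrow> V J c m = (\<beta> m ^ Suc r * u c m (J, {#})) *\<^sub>g gmono J"
    by simp_all
  define U where "U k = ((\<lambda>v. X \<odot> v) ^^ k) u" for k
  have U: "U k \<in> forms B" for k unfolding U_def by (induction k) (simp_all add: u Xf)
  have Uc: "U k c m = \<beta> m ^ k *\<^sub>g u c m" if "m \<in> cdom c" for k m
    unfolding U_def by (induction k) (simp_all add: smult_def X(2)[OF that] gmult_gone_left_ext[OF forms_ext[OF u]] mult.commute)
  have D0: "D 0 = 0" by (rule deg0, rule forms_degI) (simp_all add: zero_fun_apply)
  have "U (Suc r) = (\<Sum>J\<in>Pow (xi_vars r). V J)"
  proof (intro ext)
    fix d m JK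
    have S: "(\<Sum>J\<in>Pow (xi_vars r). V J) \<in> forms B" by (rule forms_sum) (rule V(1))
    have "U (Suc r) d m = (\<Sum>J\<in>Pow (xi_vars r). V J) d m"
    proof (cases "d \<in> atlas B \<and> m \<in> cdom d")
      case False
      then show ?thesis using formsD(1)[OF U, of d m] formsD(1)[OF S, of d m] by simp
    next
      case d: True
      show ?thesis
      proof (cases "m \<in> cdom c")
        case True
        have "U (Suc r) c m = (\<Sum>J\<in>Pow (xi_vars r). V J) c m"
        proof -
          have "(\<Sum>J\<in>Pow (xi_vars r). V J) c m = (\<Sum>J\<in>Pow (xi_vars r). \<beta> m ^ Suc r *\<^sub>g (u c m (J, {#}) *\<^sub>g gmono J))"
            unfolding sfield_sum_apply by (rule sum.cong) (simp_all add: V(4)[OF _ True])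
          also have "\<dots> = \<beta> m ^ Suc r *\<^sub>g u c m"
            unfolding gscale_sum[symmetric] by (rule arg_cong[OF ext_poly_expand[OF _ formsD(2)[OF u], symmetric]]) simp
          finally show ?thesis using Uc[OF True] by simp
        qed
        then show ?thesis
          unfolding formsD(4)[OF U d[THEN conjunct1] c d[THEN conjunct2] True]
            formsD(4)[OF S d[THEN conjunct1] c d[THEN conjunct2] True] by (rule arg_cong)
      next
        case False
        then show ?thesis
          using X(3)[OF False] V(3)[OF _ False] unfolding sfield_sum_apply U_def
          by (simp add: smult_def)
      qed
    qed
    then show "U (Suc r) d m JK = (\<Sum>J\<in>Pow (xi_vars r). V J) d m JK" by simp
  qed
  moreover have "D (\<Sum>J\<in>\<J>. V J) = 0" if "finite \<J>" "\<J> \<subseteq> Pow (xi_vars r)" for \<J>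
    using that
  proof (induction \<J>)
    case (insert J \<J>)
    have "D (V J + (\<Sum>J\<in>\<J>. V J)) = D (V J) + D (\<Sum>J\<in>\<J>. V J)"
      using insert.prems by (intro add forms_sum V(1)) auto
    then show ?case using insert V(2) by simp
  qed (simp add: D0)
  ultimately have DU: "D (U (Suc r)) = 0" by simp
  have "D (U k) c m0 = D u c m0" for k
  proof (induction k)
    case (Suc k)
    have "D (U (Suc k)) = X \<odot> D (U k)" using fn[OF X(1) U] by (simp add: U_def)
    then show ?case
      using Suc X(2)[OF m0] \<beta>(2) gmult_gone_left_ext[OF poly[OF u]] by (simp add: smult_def)
  qed (simp add: U_def)
  from this[of "Suc r"] show "D u c m0 = (0 :: ('m, 'a) sfield) c m0"
    unfolding DU by simp
qed

end

section \<open>Derived brackets in coordinates\<close>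

context smooth_bundle
begin

subsection \<open>Elements of degree one\<close>

lemma sum_gscale_godd_apply:
  assumes inj: "inj q" and c: "c < r"
  shows "(\<Sum>a<r. X a *\<^sub>g godd (q a)) ({q c}, {#}) = X c"
proof -
  have "(\<Sum>a<r. X a *\<^sub>g godd (q a)) ({q c}, {#}) = (\<Sum>a<r. if a = c then X a else 0)"
    unfolding fun_sum_apply gscale_apply by (intro sum.cong refl) (auto simp: godd_def inj_eq[OF inj])
  then show ?thesis using c by simp
qed

lemma degree_one_expand:
  assumes inj: "inj q" and f: "f \<in> ext_poly (q ` {..<r})" and h: "homogeneous 1 f = f"
  shows "f = (\<Sum>a<r. f ({q a}, {#}) *\<^sub>g godd (q a))"
proof (rule ext, clarify)
  fix J and K :: "nat multiset"
  show "f (J, K) = (\<Sum>a<r. f ({q a}, {#}) *\<^sub>g godd (q a)) (J, K)"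
  proof (cases "\<exists>c<r. J = {q c} \<and> K = {#}")
    case True
    then obtain c where "c < r" "J = {q c}" "K = {#}" by blast
    then show ?thesis using sum_gscale_godd_apply[OF inj, of c "\<lambda>a. f ({q a}, {#})"] by simp
  next
    case False
    have "f (J, K) = 0"
    proof (rule ccontr)
      assume nz: "f (J, K) \<noteq> 0"
      then have "card J = 1" using fun_cong[OF h, of "(J, K)"] by (auto simp: homogeneous_def split: if_splits)
      then obtain j where "J = {j}" by (rule card_1_singletonE)
      then show False using ext_polyD[OF f nz] False by auto
    qed
    moreover have "(\<Sum>a<r. f ({q a}, {#}) *\<^sub>g godd (q a)) (J, K) = 0"
      unfolding fun_sum_apply gscale_apply using False by (intro sum.neutral) (auto simp: godd_def)
    ultimately show ?thesis by simp
  qed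
qed

lemma degree_zero_expand:
  assumes f: "f \<in> ext_poly S" and h: "homogeneous 0 f = f"
  shows "f = f ({}, {#}) *\<^sub>g gone"
proof (rule ext, clarify)
  fix J and K :: "nat multiset"
  show "f (J, K) = (f ({}, {#}) *\<^sub>g gone) (J, K)"
  proof (cases "f (J, K) = 0")
    case True
    then show ?thesis by (auto simp: gscale_apply gone_def)
  next
    case False
    then have "card J = 0" using fun_cong[OF h, of "(J, K)"] by (auto simp: homogeneous_def split: if_splits)
    then show ?thesis using ext_polyD[OF f False] by (auto simp: gscale_apply gone_def)
  qed
qed

lemma gint_degree_one:
  assumes pq: "dual_vars p q" and X: "X = (\<Sum>a<r. x a *\<^sub>g godd (q a))"
  shows "gint X u = (\<Sum>a<r. x a *\<^sub>g lderiv (p a) u)"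
proof -
  have "gint X u = (\<Sum>a<r. gint (x a *\<^sub>g godd (q a)) u)"
    unfolding X by (rule gint_sum_left[of "q ` {..<r}"]) auto
  also have "\<dots> = (\<Sum>a<r. x a *\<^sub>g lderiv (p a) u)"
    by (intro sum.cong refl, subst gint_scale_left[of "q ` {..<r}"]) (auto simp: gint_godd dual_varsD(6)[OF pq])
  finally show ?thesis .
qed

lemma gint_degree_one_one:
  assumes pq: "dual_vars p q"
  shows "gint (\<Sum>a<r. x a *\<^sub>g godd (q a)) (\<Sum>a<r. y a *\<^sub>g godd (p a)) = (\<Sum>a<r. x a * y a) *\<^sub>g gone"
proof -
  have "lderiv (p a) (\<Sum>b<r. y b *\<^sub>g godd (p b)) = y a *\<^sub>g gone" if "a < r" for a
  proof -
    have "lderiv (p a) (\<Sum>b<r. y b *\<^sub>g godd (p b)) = (\<Sum>b<r. if b = a then y b *\<^sub>g gone else 0)"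
      unfolding lderiv_sum lderiv_scale lderiv_godd
      by (intro sum.cong refl) (auto simp: dual_varsD(3)[OF pq])
    then show ?thesis using that by simp
  qed
  then show ?thesis
    unfolding gint_degree_one[OF pq refl] by (simp add: gscale_sum_left)
qed

lemma ext_degree_one: "(\<Sum>a<r. x a *\<^sub>g godd (q a)) \<in> ext_poly (q ` {..<r})"
  by (intro ext_poly_sum ext_poly_scale ext_poly_godd) simp

lemma poisson_section_eq:
  assumes pq: "dual_vars p q" and tp: "anchor_bracket_type p q (\<Theta> c m)"
    and X: "X c m = (\<Sum>a<r. x a *\<^sub>g godd (q a))"
    and dX: "\<And>i. i < n \<Longrightarrow> dbase c i X m = (\<Sum>a<r. dx i a *\<^sub>g godd (q a))"
  shows "poisson B X \<Theta> c m = (\<Sum>a<r. x a *\<^sub>g lderiv (p a) (\<Theta> c m))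
      - (\<Sum>i<n. (\<Sum>b<r. dx i b *\<^sub>g godd (q b)) \<otimes> pderiv_mom i (\<Theta> c m))"
proof -
  let ?T = "\<Theta> c m"
  have pX: "pderiv_mom i (X c m) = 0" for i unfolding X by (rule pderiv_mom_ext[OF ext_degree_one])
  have gfin: "\<And>J K. godd (q b) (J, K) \<noteq> 0 \<Longrightarrow> finite J" for b by (auto simp: godd_def split: if_splits)
  have r0: "rderiv (p a) (godd (q b)) = 0" "rderiv (q a) (godd (q b)) = (if a = b then gone else 0)" for a b
    using dual_varsD(1,4)[OF pq] by (simp_all add: rderiv_eq_ginv_lderiv[OF gfin] lderiv_godd)
  have rlin: "rderiv j (\<Sum>a<r. F a *\<^sub>g godd (q a)) = (\<Sum>a<r. F a *\<^sub>g rderiv j (godd (q a)))" for j F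
  proof (rule ext, clarify)
    fix J and K :: "nat multiset"
    show "rderiv j (\<Sum>a<r. F a *\<^sub>g godd (q a)) (J, K) = (\<Sum>a<r. F a *\<^sub>g rderiv j (godd (q a))) (J, K)"
      unfolding rderiv_def prod.case fun_sum_apply gscale_apply
      by (cases "j \<in> J") (simp_all add: sum_distrib_left mult_ac)
  qed
  have rX: "rderiv (p a) (X c m) = 0" "a < r \<Longrightarrow> rderiv (q a) (X c m) = x a *\<^sub>g gone" for a
  proof -
    show "rderiv (p a) (X c m) = 0" unfolding X rlin r0 by simp
    have "rderiv (q a) (X c m) = (\<Sum>b<r. if b = a then x b *\<^sub>g gone else 0)"
      unfolding X rlin r0 by (intro sum.cong refl) auto
    then show "a < r \<Longrightarrow> rderiv (q a) (X c m) = x a *\<^sub>g gone" by simp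
  qed
  have gone_fin: "gone \<otimes> lderiv j ?T = lderiv j ?T" for j
  proof (rule gmult_gone_left)
    fix J K assume "lderiv j ?T (J, K) \<noteq> 0"
    then have "?T (insert j J, K) \<noteq> 0" by (auto simp: lderiv_def split: if_splits)
    from anchor_bracket_finite[OF tp this] show "finite J" by simp
  qed
  have "poisson B X \<Theta> c m = (\<Sum>i<n. - ((\<Sum>b<r. dx i b *\<^sub>g godd (q b)) \<otimes> pderiv_mom i ?T))
      + (\<Sum>a<r. x a *\<^sub>g lderiv (p a) ?T)"
    unfolding poisson_coords[OF pq] pX
    by (intro arg_cong2[of _ _ _ _ "(+)"] sum.cong refl) (simp_all add: rX gone_fin dX)
  then show ?thesis by (simp add: sum_negf)
qed

lemma pderiv_poisson_section:
  assumes pq: "dual_vars p q" and tp: "anchor_bracket_type p q (\<Theta> c m)"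
    and X: "X c m = (\<Sum>a<r. x a *\<^sub>g godd (q a))"
    and dX: "\<And>i. i < n \<Longrightarrow> dbase c i X m = (\<Sum>a<r. dx i a *\<^sub>g godd (q a))"
  shows "pderiv_mom j (poisson B X \<Theta> c m) = (\<Sum>a<r. x a * pderiv_mom j (\<Theta> c m) ({p a}, {#})) *\<^sub>g gone"
proof -
  let ?T = "\<Theta> c m"
  have z: "pderiv_mom j (pderiv_mom i ?T) = 0" for i
    by (rule pderiv_mom_ext[OF ext_anchor[OF pq tp]])
  have swap: "pderiv_mom j (lderiv l ?T) = lderiv l (pderiv_mom j ?T)" for l
    by (rule ext, clarify) (simp add: pderiv_mom_def lderiv_def)
  have l: "lderiv (p a) (pderiv_mom j ?T) = pderiv_mom j ?T ({p a}, {#}) *\<^sub>g gone" for a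
  proof (rule ext, clarify)
    fix J and K :: "nat multiset"
    show "lderiv (p a) (pderiv_mom j ?T) (J, K) = (pderiv_mom j ?T ({p a}, {#}) *\<^sub>g gone) (J, K)"
    proof (cases "p a \<in> J \<or> (J = {} \<and> K = {#})")
      case True
      then show ?thesis by (auto simp: lderiv_def gscale_apply gone_def)
    next
      case False
      have "pderiv_mom j ?T (insert (p a) J, K) = 0"
      proof (rule ccontr)
        assume nz: "pderiv_mom j ?T (insert (p a) J, K) \<noteq> 0"
        then obtain b where "insert (p a) J = {p b}" "K = {#}"
          unfolding anchor_eq[OF pq tp] by (auto split: if_splits)
        then show False using False by (metis insert_eq_iff insert_iff singletonD subsetI subset_antisym empty_iff)
      qed
      then show ?thesis using False by (auto simp: lderiv_def gscale_apply gone_def)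
    qed
  qed
  have S: "poisson B X \<Theta> c m = (\<Sum>a<r. x a *\<^sub>g lderiv (p a) ?T)
      - (\<Sum>i<n. (\<Sum>b<r. dx i b *\<^sub>g godd (q b)) \<otimes> pderiv_mom i ?T)"
    by (rule poisson_section_eq[where \<Theta> = \<Theta> and X = X, OF pq tp X dX])
  show ?thesis
    unfolding S pderiv_mom_diff pderiv_mom_sum pderiv_mom_scale
      pderiv_mom_gmult[OF ext_degree_one] z swap l
    by (simp add: gscale_sum_left)
qed

text \<open>
  The bracket of two sections in terms of the anchor and bracket parts of the function that defines
  it. Here \<open>x\<close>, \<open>y\<close> are the components of the sections, \<open>dx i\<close>, \<open>dy i\<close> their derivatives.
\<close>

lemma derived_bracket_coords:
  assumes pq: "dual_vars p q" and tp: "anchor_bracket_type p q (\<Theta> c m)"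
    and X: "X c m = (\<Sum>a<r. x a *\<^sub>g godd (q a))"
    and dX: "\<And>i. i < n \<Longrightarrow> dbase c i X m = (\<Sum>a<r. dx i a *\<^sub>g godd (q a))"
    and Y: "Y c m = (\<Sum>a<r. y a *\<^sub>g godd (q a))"
    and dY: "\<And>i. i < n \<Longrightarrow> dbase c i Y m = (\<Sum>a<r. dy i a *\<^sub>g godd (q a))"
    and k: "k < r"
  shows "derived_bracket B \<Theta> X Y c m ({q k}, {#}) =
    (\<Sum>i<n. (\<Sum>a<r. x a * pderiv_mom i (\<Theta> c m) ({p a}, {#})) * dy i k
          - (\<Sum>a<r. y a * pderiv_mom i (\<Theta> c m) ({p a}, {#})) * dx i k)
    - (\<Sum>a<r. \<Sum>b<r. y a * x b * lderiv (p a) (lderiv (p b) (rderiv (q k) (\<Theta> c m))) ({}, {#}))"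
proof -
  let ?T = "\<Theta> c m"
  define Q where "Q = poisson B X \<Theta> c m"
  have ye: "Y c m \<in> ext_poly (q ` {..<r})" unfolding Y by (rule ext_degree_one)
  have lY: "lderiv (p a) (Y c m) = 0" "a < r \<Longrightarrow> lderiv (q a) (Y c m) = y a *\<^sub>g gone" for a
  proof -
    show "lderiv (p a) (Y c m) = 0"
      by (rule lderiv_eq_0[OF ye]) (use dual_varsD(1)[OF pq] in auto)
    have "lderiv (q a) (Y c m) = (\<Sum>b<r. if b = a then y b *\<^sub>g gone else 0)"
      unfolding Y lderiv_sum lderiv_scale lderiv_godd by (intro sum.cong refl) (auto simp: dual_varsD(4)[OF pq])
    then show "a < r \<Longrightarrow> lderiv (q a) (Y c m) = y a *\<^sub>g gone" by simp
  qed
  have Q: "Q = (\<Sum>a<r. x a *\<^sub>g lderiv (p a) ?T)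
      - (\<Sum>i<n. (\<Sum>b<r. dx i b *\<^sub>g godd (q b)) \<otimes> pderiv_mom i ?T)"
    unfolding Q_def by (rule poisson_section_eq[where \<Theta> = \<Theta> and X = X, OF pq tp X dX])
  have Amom: "pderiv_mom j Q = (\<Sum>a<r. x a * pderiv_mom j ?T ({p a}, {#})) *\<^sub>g gone" for j
    unfolding Q_def by (rule pderiv_poisson_section[where \<Theta> = \<Theta> and X = X, OF pq tp X dX])
  have pY: "pderiv_mom i (Y c m) = 0" for i by (rule pderiv_mom_ext[OF ye])
  have "derived_bracket B \<Theta> X Y c m = (\<Sum>i<n. pderiv_mom i Q \<otimes> dbase c i Y m)
      + (\<Sum>a<r. rderiv (p a) Q \<otimes> (y a *\<^sub>g gone))"
    unfolding derived_bracket_def poisson_coords[OF pq, of "poisson B X \<Theta>"] pY Q_def[symmetric]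
    by (simp add: lY)
  then have D: "derived_bracket B \<Theta> X Y c m ({q k}, {#}) =
      (\<Sum>i<n. (pderiv_mom i Q \<otimes> dbase c i Y m) ({q k}, {#})) + (\<Sum>a<r. (rderiv (p a) Q \<otimes> (y a *\<^sub>g gone)) ({q k}, {#}))"
    by (simp add: plus_fun_apply fun_sum_apply)
  have first: "(pderiv_mom i Q \<otimes> dbase c i Y m) ({q k}, {#}) =
      (\<Sum>a<r. x a * pderiv_mom i ?T ({p a}, {#})) * dy i k" if i: "i < n" for i
  proof -
    have "pderiv_mom i Q \<otimes> dbase c i Y m = (\<Sum>a<r. x a * pderiv_mom i ?T ({p a}, {#})) *\<^sub>g (\<Sum>b<r. dy i b *\<^sub>g godd (q b))"
      unfolding Amom dY[OF i] by (rule gmult_function[OF ext_degree_one])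
    then show ?thesis
      using sum_gscale_godd_apply[OF dual_varsD(8)[OF pq] k] by (simp add: gscale_apply)
  qed
  have Qfin: "Q (J, K) = 0" if "infinite J" for J K
  proof -
    have "lderiv (p a) ?T (J, K) = 0" for a
      using anchor_bracket_finite[OF tp, of "insert (p a) J" K] that by (auto simp: lderiv_def)
    moreover have "((\<Sum>b<r. dx i b *\<^sub>g godd (q b)) \<otimes> pderiv_mom i ?T) (J, K) = 0" for i
      using that by (simp add: gmult_def)
    ultimately show ?thesis unfolding Q by (simp add: minus_apply fun_sum_apply gscale_apply)
  qed
  have second: "(rderiv (p a) Q \<otimes> (y a *\<^sub>g gone)) ({q k}, {#}) =
      - (\<Sum>i<n. y a * pderiv_mom i ?T ({p a}, {#}) * dx i k)
      - (\<Sum>b<r. y a * x b * lderiv (p a) (lderiv (p b) (rderiv (q k) ?T)) ({}, {#}))" if a: "a < r" for a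
  proof -
    have ne: "p a \<noteq> q k" "q k \<noteq> p a" using dual_varsD(1,2)[OF pq] by auto
    have diff: "{p a, q k} - {q k} = {p a}" using ne by auto
    have "rderiv (p a) Q \<otimes> (y a *\<^sub>g gone) = y a *\<^sub>g rderiv (p a) Q"
      unfolding gmult_scale_right
    proof (subst gmult_gone_right_finite)
      fix J K assume "rderiv (p a) Q (J, K) \<noteq> 0"
      then have "Q (insert (p a) J, K) \<noteq> 0" by (auto simp: rderiv_def split: if_splits)
      then show "finite J" using Qfin[of "insert (p a) J" K] by auto
    qed simp
    then have "(rderiv (p a) Q \<otimes> (y a *\<^sub>g gone)) ({q k}, {#}) = y a * (osign {q k} {p a} * Q ({p a, q k}, {#}))"
      using ne by (simp add: gscale_apply rderiv_def)
    moreover have "((\<Sum>b<r. dx i b *\<^sub>g godd (q b)) \<otimes> pderiv_mom i ?T) ({p a, q k}, {#}) =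
        osign {q k} {p a} * dx i k * pderiv_mom i ?T ({p a}, {#})" for i
    proof -
      have s: "(dx i b *\<^sub>g godd (q b) \<otimes> pderiv_mom i ?T) ({p a, q k}, {#}) =
          (if b = k then osign {q k} {p a} * dx i k * pderiv_mom i ?T ({p a}, {#}) else 0)" for b
        using ne dual_varsD(2,4)[OF pq] by (simp add: gscale_apply godd_mult_apply diff)
      show ?thesis
        unfolding gmult_sum_left fun_sum_apply s using k by simp
    qed
    moreover have "lderiv (p b) ?T ({p a, q k}, {#}) =
        - osign {q k} {p a} * lderiv (p a) (lderiv (p b) (rderiv (q k) ?T)) ({}, {#})" for b
    proof (cases "a = b")
      case True
      then show ?thesis by (simp add: lderiv_def)
    next
      case False
      then have ab: "p a \<noteq> p b" "p b \<noteq> p a" using dual_varsD(3)[OF pq] by auto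
      have nb: "p b \<noteq> q k" "q k \<noteq> p b" using dual_varsD(1,2)[OF pq] by auto
      have s1: "osign {p b} {p a, q k} = osign {p b} {p a} * osign {p b} {q k}"
        using osign_insert_right[of "{p b}" "{q k}" "p a"] ne by simp
      have s2: "osign {p b, p a} {q k} = osign {p b} {q k} * osign {p a} {q k}"
        using osign_insert_left[of "{p a}" "{q k}" "p b"] ab by simp
      have s3: "osign {q k} {p a} * osign {p a} {q k} = - 1" using ne by (auto simp: osign_singletons)
      have "- osign {q k} {p a} * lderiv (p a) (lderiv (p b) (rderiv (q k) ?T)) ({}, {#})
          = - (osign {q k} {p a} * osign {p a} {q k}) * osign {p b} {p a} * osign {p b} {q k} * ?T ({q k, p b, p a}, {#})"
        using ab nb ne by (simp add: lderiv_def rderiv_def s2)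
      also have "\<dots> = lderiv (p b) ?T ({p a, q k}, {#})"
        using ab nb ne unfolding s3 by (simp add: lderiv_def s1 insert_commute)
      finally show ?thesis by simp
    qed
    moreover have "Q ({p a, q k}, {#}) = (\<Sum>b<r. x b * lderiv (p b) ?T ({p a, q k}, {#}))
        - (\<Sum>i<n. ((\<Sum>b<r. dx i b *\<^sub>g godd (q b)) \<otimes> pderiv_mom i ?T) ({p a, q k}, {#}))"
    proof -
      define W where "W i = (\<Sum>b<r. dx i b *\<^sub>g godd (q b)) \<otimes> pderiv_mom i ?T" for i
      have "Q = (\<Sum>a<r. x a *\<^sub>g lderiv (p a) ?T) - (\<Sum>i<n. W i)" unfolding W_def by (rule Q)
      then have "Q ({p a, q k}, {#}) = (\<Sum>b<r. x b * lderiv (p b) ?T ({p a, q k}, {#})) - (\<Sum>i<n. W i ({p a, q k}, {#}))"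
        by (simp add: minus_apply fun_sum_apply gscale_apply)
      then show ?thesis unfolding W_def .
    qed
    ultimately have "(rderiv (p a) Q \<otimes> (y a *\<^sub>g gone)) ({q k}, {#}) = y a * (osign {q k} {p a} *
        ((\<Sum>b<r. x b * (- osign {q k} {p a} * lderiv (p a) (lderiv (p b) (rderiv (q k) ?T)) ({}, {#})))
        - (\<Sum>i<n. osign {q k} {p a} * dx i k * pderiv_mom i ?T ({p a}, {#}))))"
      by (simp only:)
    also have "\<dots> = - (\<Sum>i<n. y a * pderiv_mom i ?T ({p a}, {#}) * dx i k)
      - (\<Sum>b<r. y a * x b * lderiv (p a) (lderiv (p b) (rderiv (q k) ?T)) ({}, {#}))"
      unfolding right_diff_distrib sum_distrib_left by (simp add: sum_negf mult_ac)
    finally show ?thesis .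
  qed
  show ?thesis
    unfolding D using first second
    by (simp add: sum_subtractf sum_negf sum_distrib_right sum_distrib_left sum.swap[of _ "{..<n}" "{..<r}"] mult_ac)
qed

lemma derived_bracket_function:
  assumes pq: "dual_vars p q" and tp: "anchor_bracket_type p q (\<Theta> c m)"
    and X: "X c m = (\<Sum>a<r. x a *\<^sub>g godd (q a))"
    and dX: "\<And>i. i < n \<Longrightarrow> dbase c i X m = (\<Sum>a<r. dx i a *\<^sub>g godd (q a))"
    and f: "f c m = s *\<^sub>g gone"
    and df: "\<And>i. i < n \<Longrightarrow> dbase c i f m = df i *\<^sub>g gone"
  shows "derived_bracket B \<Theta> X f c m = (\<Sum>i<n. (\<Sum>a<r. x a * pderiv_mom i (\<Theta> c m) ({p a}, {#})) * df i) *\<^sub>g gone"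
proof -
  have "f c m \<in> ext_poly {}" unfolding f by simp
  then have 0: "pderiv_mom i (f c m) = 0" "lderiv j (f c m) = 0" for i j
    by (auto intro: lderiv_eq_0)
  have "derived_bracket B \<Theta> X f c m = (\<Sum>i<n. pderiv_mom i (poisson B X \<Theta> c m) \<otimes> dbase c i f m)"
    unfolding derived_bracket_def poisson_coords[OF pq, of "poisson B X \<Theta>"] 0 by simp
  also have "\<dots> = (\<Sum>i<n. ((\<Sum>a<r. x a * pderiv_mom i (\<Theta> c m) ({p a}, {#})) * df i) *\<^sub>g gone)"
  proof (intro sum.cong refl)
    fix i assume "i \<in> {..<n}"
    then have i: "i < n" by simp
    have P: "pderiv_mom i (poisson B X \<Theta> c m) = (\<Sum>a<r. x a * pderiv_mom i (\<Theta> c m) ({p a}, {#})) *\<^sub>g gone"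
      by (rule pderiv_poisson_section[where \<Theta> = \<Theta> and X = X, OF pq tp X dX])
    show "pderiv_mom i (poisson B X \<Theta> c m) \<otimes> dbase c i f m
        = ((\<Sum>a<r. x a * pderiv_mom i (\<Theta> c m) ({p a}, {#})) * df i) *\<^sub>g gone"
      unfolding P df[OF i] using gmult_function[of gone UNIV] by (simp add: mult.commute)
  qed
  finally show ?thesis by (simp add: gscale_sum_left)
qed

lemma derived_bracket_support:
  assumes pq: "dual_vars p q" and tp: "anchor_bracket_type p q (\<Theta> c m)"
    and X: "X c m = (\<Sum>a<r. x a *\<^sub>g godd (q a))"
    and dX: "\<And>i. i < n \<Longrightarrow> dbase c i X m = (\<Sum>a<r. dx i a *\<^sub>g godd (q a))"
    and Y: "Y c m = (\<Sum>a<r. y a *\<^sub>g godd (q a))"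
    and dY: "\<And>i. i < n \<Longrightarrow> dbase c i Y m = (\<Sum>a<r. dy i a *\<^sub>g godd (q a))"
    and nz: "derived_bracket B \<Theta> X Y c m (J, {#}) \<noteq> 0"
  shows "\<exists>k<r. J = {q k}"
proof (rule ccontr)
  assume no: "\<not> (\<exists>k<r. J = {q k})"
  let ?T = "\<Theta> c m"
  define Q where "Q = poisson B X \<Theta> c m"
  have Q: "Q = (\<Sum>a<r. x a *\<^sub>g lderiv (p a) ?T)
      - (\<Sum>i<n. (\<Sum>b<r. dx i b *\<^sub>g godd (q b)) \<otimes> pderiv_mom i ?T)"
    unfolding Q_def by (rule poisson_section_eq[where \<Theta> = \<Theta> and X = X, OF pq tp X dX])
  have z: "(\<Sum>b<r. F b *\<^sub>g godd (q b)) (J, K) = 0" for F K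
    unfolding fun_sum_apply gscale_apply using no by (intro sum.neutral) (auto simp: godd_def)
  have ye: "Y c m \<in> ext_poly (q ` {..<r})" unfolding Y by (rule ext_degree_one)
  have pY: "pderiv_mom i (Y c m) = 0" for i by (rule pderiv_mom_ext[OF ye])
  have lY: "lderiv (p a) (Y c m) = 0" for a
    by (rule lderiv_eq_0[OF ye]) (use dual_varsD(1)[OF pq] in auto)
  have lY': "lderiv (q a) (Y c m) = y a *\<^sub>g gone" if "a < r" for a
  proof -
    have "lderiv (q a) (Y c m) = (\<Sum>b<r. if b = a then y b *\<^sub>g gone else 0)"
      unfolding Y lderiv_sum lderiv_scale lderiv_godd by (intro sum.cong refl) (auto simp: dual_varsD(4)[OF pq])
    then show ?thesis using that by simp
  qed
  have first: "(pderiv_mom i Q \<otimes> dbase c i Y m) (J, {#}) = 0" if "i < n" for i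
  proof -
    have P: "pderiv_mom i Q = (\<Sum>a<r. x a * pderiv_mom i ?T ({p a}, {#})) *\<^sub>g gone"
      unfolding Q_def by (rule pderiv_poisson_section[where \<Theta> = \<Theta> and X = X, OF pq tp X dX])
    show ?thesis
      unfolding P dY[OF that] gmult_function[OF ext_degree_one] by (simp add: gscale_apply z)
  qed
  have second: "(rderiv (p a) Q \<otimes> gone) (J, {#}) = 0" for a
  proof -
    have "Q (insert (p a) J, {#}) = 0" if pa: "p a \<notin> J"
    proof -
      have "lderiv (p b) ?T (insert (p a) J, {#}) = 0" for b
      proof (rule ccontr)
        assume "lderiv (p b) ?T (insert (p a) J, {#}) \<noteq> 0"
        then have T: "?T (insert (p b) (insert (p a) J), {#}) \<noteq> 0" and pb: "p b \<notin> insert (p a) J"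
          by (auto simp: lderiv_def split: if_splits)
        have "\<exists>a'<r. \<exists>b'<r. \<exists>k<r. a' \<noteq> b' \<and> insert (p b) (insert (p a) J) = {p a', p b', q k}"
          using tp[unfolded anchor_bracket_type_def, rule_format, OF T] by simp
        then obtain a' b' k where k: "k < r" "insert (p b) (insert (p a) J) = {p a', p b', q k}" by blast
        have "p b \<in> {p a', p b', q k}" "p a \<in> {p a', p b', q k}" using k(2) by blast+
        then have "p b \<in> {p a', p b'}" "p a \<in> {p a', p b'}" using dual_varsD(1)[OF pq] by auto
        moreover have "p a \<noteq> p b" using pb by auto
        ultimately
        have "{p a', p b'} = {p a, p b}" by auto
        then have e: "insert (p b) (insert (p a) J) = insert (q k) {p a, p b}" using k(2) by blast
        have "J = insert (p b) (insert (p a) J) - {p a, p b}" using pa pb by blast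
        also have "\<dots> = {q k}" unfolding e using dual_varsD(1)[OF pq, of a k] dual_varsD(1)[OF pq, of b k] by auto
        finally have "J = {q k}" .
        then show False using no k(1) by blast
      qed
      moreover have "((\<Sum>b<r. dx i b *\<^sub>g godd (q b)) \<otimes> pderiv_mom i ?T) (insert (p a) J, {#}) = 0" for i
      proof -
        have "(godd (q b) \<otimes> pderiv_mom i ?T) (insert (p a) J, {#}) = 0" if b: "b < r" for b
        proof (rule ccontr)
          assume "(godd (q b) \<otimes> pderiv_mom i ?T) (insert (p a) J, {#}) \<noteq> 0"
          then have qb: "q b \<in> insert (p a) J" and A: "pderiv_mom i ?T (insert (p a) J - {q b}, {#}) \<noteq> 0"
            by (auto simp: godd_mult_apply split: if_splits)
          obtain a' where "insert (p a) J - {q b} = {p a'}"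
            using A unfolding anchor_eq[OF pq tp] by (auto split: if_splits)
          then have e: "insert (p a) J = {q b, p a'}" using qb by blast
          then have "p a \<in> {q b, p a'}" by blast
          then have "p a' = p a" using dual_varsD(1)[OF pq] by auto
          have "J = insert (p a) J - {p a}" using pa by blast
          also have "\<dots> = {q b}" unfolding e \<open>p a' = p a\<close> using dual_varsD(1)[OF pq, of a b] by auto
          finally have "J = {q b}" .
          then show False using no b by blast
        qed
        then show ?thesis unfolding gmult_sum_left fun_sum_apply gmult_scale_left gscale_apply by simp
      qed
      ultimately show ?thesis
      proof -
        assume 1: "\<And>b. lderiv (p b) ?T (insert (p a) J, {#}) = 0"
          and 2: "\<And>i. ((\<Sum>b<r. dx i b *\<^sub>g godd (q b)) \<otimes> pderiv_mom i ?T) (insert (p a) J, {#}) = 0"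
        define W where "W i = (\<Sum>b<r. dx i b *\<^sub>g godd (q b)) \<otimes> pderiv_mom i ?T" for i
        have "Q = (\<Sum>a<r. x a *\<^sub>g lderiv (p a) ?T) - (\<Sum>i<n. W i)" unfolding W_def by (rule Q)
        then show ?thesis using 1 2[folded W_def] by (simp add: minus_apply fun_sum_apply gscale_apply)
      qed
    qed
    then have "rderiv (p a) Q (J, {#}) = 0" by (auto simp: rderiv_def)
    moreover have "(rderiv (p a) Q \<otimes> gone) (J, {#}) = (if finite J then rderiv (p a) Q (J, {#}) else 0)"
    proof (cases "finite J")
      case False
      then show ?thesis by (simp add: gmult_def)
    next
      case True
      have "(\<Sum>K'\<in>{K'. K' \<subseteq># {#}}. osign J' (J - J') * rderiv (p a) Q (J', K') * gone (J - J', {#} - K')) =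
          (if J' = J then rderiv (p a) Q (J, {#}) else 0)" if "J' \<in> Pow J" for J'
      proof -
        have "{K'. K' \<subseteq># {#}} = {{#} :: nat multiset}" by auto
        then show ?thesis using that by (auto simp: gone_def)
      qed
      then show ?thesis using True by (simp add: gmult_def)
    qed
    ultimately show ?thesis by simp
  qed
  have "derived_bracket B \<Theta> X Y c m = (\<Sum>i<n. pderiv_mom i Q \<otimes> dbase c i Y m)
      + (\<Sum>a<r. rderiv (p a) Q \<otimes> lderiv (q a) (Y c m))"
    unfolding derived_bracket_def poisson_coords[OF pq, of "poisson B X \<Theta>"] pY Q_def[symmetric]
    by (simp add: lY)
  also have "(\<Sum>a<r. rderiv (p a) Q \<otimes> lderiv (q a) (Y c m)) = (\<Sum>a<r. y a *\<^sub>g (rderiv (p a) Q \<otimes> gone))"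
    by (intro sum.cong refl) (simp add: lY')
  finally have "derived_bracket B \<Theta> X Y c m (J, {#}) = 0"
    by (simp add: plus_fun_apply fun_sum_apply gscale_apply first second)
  then show False using nz by simp
qed

end

context smooth_bundle
begin

subsection \<open>Sections and the Cartan formula\<close>

definition linear_in :: "(nat \<Rightarrow> nat) \<Rightarrow> gpoly \<Rightarrow> bool" where
  "linear_in q f \<longleftrightarrow> f \<in> ext_poly (q ` {..<r}) \<and> homogeneous 1 f = f"

definition section_in :: "(nat \<Rightarrow> nat) \<Rightarrow> ('m, 'a) sfield \<Rightarrow> bool" where
  "section_in q X \<longleftrightarrow> (\<forall>c m. linear_in q (X c m)) \<and> (\<forall>c\<in>atlas B. smooth_poly c (cdom c) (X c))"

abbreviation comp_in :: "(nat \<Rightarrow> nat) \<Rightarrow> gpoly \<Rightarrow> nat \<Rightarrow> real" where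
  "comp_in q f a \<equiv> f ({q a}, {#})"

lemma linear_in_expand: "dual_vars p q \<Longrightarrow> linear_in q f \<Longrightarrow> f = (\<Sum>a<r. comp_in q f a *\<^sub>g godd (q a))"
  unfolding linear_in_def using degree_one_expand[OF dual_varsD(8)] by blast

lemma homogeneous_dpoly:
  assumes "\<And>m. homogeneous k (F m) = F m"
  shows "homogeneous k (dpoly c i F m) = dpoly c i F m"
proof (rule ext, clarify)
  fix J and K :: "nat multiset"
  show "homogeneous k (dpoly c i F m) (J, K) = dpoly c i F m (J, K)"
  proof (cases "card J = k")
    case False
    have "(\<lambda>m'. F m' (J, K)) = (\<lambda>m'. 0)"
    proof
      fix m' show "F m' (J, K) = 0" using fun_cong[OF assms[of m'], of "(J, K)"] False by (simp add: homogeneous_def)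
    qed
    then show ?thesis using False has_cderiv_imp_cderiv[OF has_cderiv_const] by (simp add: homogeneous_def dpoly_def)
  qed (simp add: homogeneous_def)
qed

lemma linear_in_dbase: "section_in q X \<Longrightarrow> linear_in q (dbase c i X m)"
  unfolding linear_in_def section_in_def dbase_eq_dpoly by (simp add: ext_poly_dpoly homogeneous_dpoly)

lemma pairing:
  assumes pq: "dual_vars p q" and X: "linear_in q X" and E: "linear_in p E"
  shows "gint X E = (\<Sum>a<r. comp_in q X a * comp_in p E a) *\<^sub>g gone"
proof -
  have "gint X E = gint (\<Sum>a<r. comp_in q X a *\<^sub>g godd (q a)) (\<Sum>a<r. comp_in p E a *\<^sub>g godd (p a))"
    by (rule arg_cong2[OF linear_in_expand[OF pq X] linear_in_expand[OF dual_varsD(11)[OF pq] E]])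
  then show ?thesis by (simp add: gint_degree_one_one[OF pq])
qed

lemma pairing_commute:
  assumes "dual_vars p q" "linear_in q X" "linear_in p E"
  shows "gint X E = gint E X"
  using pairing[OF assms] pairing[OF dual_varsD(11)[OF assms(1)] assms(3,2)] by (simp add: mult.commute)

lemma dbase_pairing:
  assumes pq: "dual_vars p q" and X: "section_in q X" and E: "section_in p E"
    and c: "c \<in> atlas B" "m \<in> cdom c" and i: "i < n"
  shows "dbase c i (iprod X E) m = (\<Sum>a<r. comp_in q (dbase c i X m) a * comp_in p (E c m) a
      + comp_in q (X c m) a * comp_in p (dbase c i E m) a) *\<^sub>g gone"
proof -
  have eq: "iprod X E c = (\<lambda>m. (\<Sum>a<r. comp_in q (X c m) a * comp_in p (E c m) a) *\<^sub>g gone)"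
    by (rule ext) (use X E in \<open>simp add: iprod_def pairing[OF pq] section_in_def\<close>)
  have D: "has_cderiv c i (\<lambda>m. F c m JK) m (dbase c i F m JK)" if "section_in q' F" for F q' JK
    using smooth_poly_has_dpoly[OF chart_open_cdom[OF c(1)] _ i c(2), of "F c"] that c(1)
    unfolding section_in_def has_dpoly_def dbase_eq_dpoly by blast
  have "has_dpoly c i (iprod X E c) m ((\<Sum>a<r. comp_in q (dbase c i X m) a * comp_in p (E c m) a
      + comp_in q (X c m) a * comp_in p (dbase c i E m) a) *\<^sub>g gone + (\<Sum>a<r. comp_in q (X c m) a * comp_in p (E c m) a) *\<^sub>g 0)"
    unfolding eq
    by (intro has_dpoly_fscale[OF c _ has_dpoly_const] has_cderiv_sum has_cderiv_mult[OF c] D[OF X] D[OF E])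
  then show ?thesis unfolding dbase_eq_dpoly[of c i "iprod X E"] by (simp add: has_dpoly_imp_dpoly)
qed

lemma derived_bracket_pairing:
  assumes pq: "dual_vars p q" and tp: "anchor_bracket_type p q (\<Theta> c m)"
    and Z: "section_in q Z" and X: "section_in q X" and E: "section_in p E"
    and c: "c \<in> atlas B" "m \<in> cdom c"
  shows "derived_bracket B \<Theta> Z (iprod X E) c m =
    (\<Sum>i<n. (\<Sum>a<r. comp_in q (Z c m) a * pderiv_mom i (\<Theta> c m) ({p a}, {#})) *
      (\<Sum>a<r. comp_in q (dbase c i X m) a * comp_in p (E c m) a + comp_in q (X c m) a * comp_in p (dbase c i E m) a)) *\<^sub>g gone"
proof (rule derived_bracket_function[where X = Z and \<Theta> = \<Theta> and f = "iprod X E", OF pq tp])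
  show "Z c m = (\<Sum>a<r. comp_in q (Z c m) a *\<^sub>g godd (q a))"
    by (rule linear_in_expand[OF pq]) (use Z in \<open>simp add: section_in_def\<close>)
  show "dbase c i Z m = (\<Sum>a<r. comp_in q (dbase c i Z m) a *\<^sub>g godd (q a))" for i
    by (rule linear_in_expand[OF pq linear_in_dbase[OF Z]])
  show "iprod X E c m = (\<Sum>a<r. comp_in q (X c m) a * comp_in p (E c m) a) *\<^sub>g gone"
    using X E by (simp add: iprod_def pairing[OF pq] section_in_def)
qed (rule dbase_pairing[OF pq X E c])

lemma gint_derivation:
  assumes pq: "dual_vars p q" and X: "linear_in q X" and u: "u \<in> ext_poly S" "finite S" and v: "v \<in> ext_poly S'"
  shows "gint X (u \<otimes> v) = gint X u \<otimes> v + ginv u \<otimes> gint X v"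
proof -
  note g = gint_degree_one[OF pq linear_in_expand[OF pq X]]
  have vf: "\<And>J K. v (J, K) \<noteq> 0 \<Longrightarrow> finite J" using ext_polyD[OF v] by blast
  have l: "lderiv j (u \<otimes> v) = lderiv j u \<otimes> v + ginv u \<otimes> lderiv j v" for j
    by (rule lderiv_gmult[OF u(2,1)]) (rule vf)
  show ?thesis
    unfolding g l by (simp add: sum.distrib gmult_sum_left gmult_sum_right)
qed

text \<open>
  Everything is evaluated in components. The derivatives of the sections match by the product rule for the
  pairing, and what is left is the bracket part of the function, which enters both sides in the same way.
\<close>

lemma Cartan_formula:
  assumes pq: "dual_vars p q" and tp: "anchor_bracket_type p q (\<Theta> c m)"
    and X: "section_in q X" and Y: "section_in q Y" and E: "section_in p E"
    and c: "c \<in> atlas B" "m \<in> cdom c"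
  shows "gint (derived_bracket B \<Theta> X Y c m) (E c m) =
    derived_bracket B \<Theta> X (iprod Y E) c m - derived_bracket B \<Theta> Y (iprod X E) c m
      - iprod Y (iprod X (quasi_diff B \<Theta> E)) c m"
proof -
  define x y e where "x = comp_in q (X c m)" and "y = comp_in q (Y c m)" and "e = comp_in p (E c m)"
  define dx dy de where "dx i = comp_in q (dbase c i X m)" and "dy i = comp_in q (dbase c i Y m)"
    and "de i = comp_in p (dbase c i E m)" for i
  define A where "A i = pderiv_mom i (\<Theta> c m)" for i
  define R where "R k = rderiv (q k) (\<Theta> c m)" for k
  define \<rho> where "\<rho> k = (\<Sum>a<r. \<Sum>b<r. y a * x b * lderiv (p a) (lderiv (p b) (R k)) ({}, {#}))" for k
  define \<alpha>x \<alpha>y where "\<alpha>x i = (\<Sum>a<r. x a * A i ({p a}, {#}))" and "\<alpha>y i = (\<Sum>a<r. y a * A i ({p a}, {#}))" for i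
  have lin: "linear_in q (X c m)" "linear_in q (Y c m)" "linear_in p (E c m)"
    using X Y E by (simp_all add: section_in_def)
  note Xe = linear_in_expand[OF pq lin(1)] and Ye = linear_in_expand[OF pq lin(2)]
    and Ee = linear_in_expand[OF dual_varsD(11)[OF pq] lin(3)]
  note dXe = linear_in_expand[OF pq linear_in_dbase[OF X, of c _ m]]
    and dYe = linear_in_expand[OF pq linear_in_dbase[OF Y, of c _ m]]
  have w: "derived_bracket B \<Theta> X Y c m ({q k}, {#}) = (\<Sum>i<n. \<alpha>x i * dy i k - \<alpha>y i * dx i k) - \<rho> k"
    if "k < r" for k
    unfolding \<alpha>x_def \<alpha>y_def A_def x_def y_def dx_def dy_def \<rho>_def R_def
    by (rule derived_bracket_coords[where X = X and Y = Y and \<Theta> = \<Theta>, OF pq tp Xe dXe Ye dYe that])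
  let ?W = "derived_bracket B \<Theta> X Y c m"
  have lE: "lderiv (p k) (E c m) = e k *\<^sub>g gone" if "k < r" for k
  proof -
    have "lderiv (p k) (E c m) = lderiv (p k) (\<Sum>a<r. e a *\<^sub>g godd (p a))"
      unfolding e_def by (rule arg_cong[OF Ee])
    also have "\<dots> = (\<Sum>a<r. if a = k then e a *\<^sub>g gone else 0)"
      unfolding lderiv_sum lderiv_scale lderiv_godd by (intro sum.cong refl) (auto simp: dual_varsD(3)[OF pq])
    finally show ?thesis using that by simp
  qed
  have "gint ?W (E c m) = (\<Sum>J\<in>(\<lambda>k. {q k}) ` {..<r}. ?W (J, {#}) *\<^sub>g
      foldr (\<lambda>j. lderiv (oconj j)) (sorted_list_of_set J) (E c m))"
    unfolding gint_def
  proof (rule sum.mono_neutral_left)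
    have "J \<in> (\<lambda>k. {q k}) ` {..<r}" if "?W (J, {#}) \<noteq> 0" for J
      using derived_bracket_support[where X = X and Y = Y and \<Theta> = \<Theta>, OF pq tp Xe dXe Ye dYe that] by auto
    then show "{J. ?W (J, {#}) \<noteq> 0} \<subseteq> (\<lambda>k. {q k}) ` {..<r}" by blast
  qed auto
  also have "\<dots> = (\<Sum>k<r. ?W ({q k}, {#}) *\<^sub>g lderiv (p k) (E c m))"
    by (subst sum.reindex) (auto simp: inj_on_def dual_varsD(4)[OF pq] dual_varsD(6)[OF pq])
  also have "\<dots> = (\<Sum>k<r. ((\<Sum>i<n. \<alpha>x i * dy i k - \<alpha>y i * dx i k) - \<rho> k) * e k) *\<^sub>g gone"
    unfolding gscale_sum_left by (intro sum.cong refl) (simp add: w lE)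
  finally have lhs: "gint ?W (E c m) = (\<Sum>k<r. ((\<Sum>i<n. \<alpha>x i * dy i k - \<alpha>y i * dx i k) - \<rho> k) * e k) *\<^sub>g gone" .
  have Aext: "A i \<in> ext_poly (p ` {..<r})" for i unfolding A_def by (rule ext_anchor[OF pq tp])
  have Alin: "linear_in p (A i)" for i
  proof -
    have "homogeneous 1 (A i) (J, K) = A i (J, K)" for J K
      unfolding A_def anchor_eq[OF pq tp] homogeneous_def by auto
    then show ?thesis unfolding linear_in_def using Aext by (auto intro!: ext)
  qed
  have Rext: "R k \<in> ext_poly (p ` {..<r})" for k unfolding R_def by (rule ext_bracket[OF pq tp])
  have dE: "linear_in p (dbase c i E m)" for i by (rule linear_in_dbase[OF E])
  have Ainv: "ginv (A i) = - A i" for i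
  proof -
    have z: "A i (J, K) = 0" if "even (card J)" for J K
      using that unfolding A_def anchor_eq[OF pq tp] by auto
    have "ginv (A i) (J, K) = (- A i) (J, K)" for J K
      using z[of J K] by (cases "even (card J)") (simp_all add: ginv_def fun_app)
    then show ?thesis by (auto intro!: ext)
  qed
  have fin: "finite (p ` {..<r})" by simp
  have dEx: "dbase c i E m \<in> ext_poly (p ` {..<r})" for i using dE unfolding linear_in_def by blast
  have gXA: "gint (X c m) (A i) = \<alpha>x i *\<^sub>g gone" "gint (Y c m) (A i) = \<alpha>y i *\<^sub>g gone"
    "gint (X c m) (dbase c i E m) = (\<Sum>a<r. x a * de i a) *\<^sub>g gone"
    "gint (Y c m) (dbase c i E m) = (\<Sum>a<r. y a * de i a) *\<^sub>g gone" for i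
    using pairing[OF pq lin(1) Alin] pairing[OF pq lin(2) Alin] pairing[OF pq lin(1) dE] pairing[OF pq lin(2) dE]
    by (simp_all add: \<alpha>x_def \<alpha>y_def x_def y_def de_def)
  have Sx: "X c m \<in> ext_poly (q ` {..<r})" "Y c m \<in> ext_poly (q ` {..<r})" "finite (q ` {..<r})"
    using lin unfolding linear_in_def by auto
  have gsum: "gint (Z c m) (\<Sum>k\<in>K. F k) = (\<Sum>k\<in>K. gint (Z c m) (F k))"
    if "Z c m \<in> ext_poly (q ` {..<r})" for Z :: "('m, 'a) sfield" and K :: "nat set" and F
    by (induction K rule: infinite_finite_induct) (simp_all add: gint_linear_right(1)[OF Sx(3) that])
  have "quasi_diff B \<Theta> E c m = (\<Sum>i<n. A i \<otimes> dbase c i E m) + (\<Sum>k<r. R k \<otimes> lderiv (p k) (E c m))"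
    unfolding A_def R_def dbase_eq_dpoly by (rule quasi_diff_coords[OF pq]) (use lin(3) in \<open>simp add: linear_in_def\<close>)
  also have "(\<Sum>k<r. R k \<otimes> lderiv (p k) (E c m)) = (\<Sum>k<r. e k *\<^sub>g R k)"
    by (intro sum.cong refl) (simp add: lE gmult_gone_right[OF Rext])
  finally have qd: "quasi_diff B \<Theta> E c m = (\<Sum>i<n. A i \<otimes> dbase c i E m) + (\<Sum>k<r. e k *\<^sub>g R k)" .
  have iA: "gint (Y c m) (gint (X c m) (A i \<otimes> dbase c i E m)) =
      (\<alpha>x i * (\<Sum>a<r. y a * de i a) - \<alpha>y i * (\<Sum>a<r. x a * de i a)) *\<^sub>g gone" for i
  proof -
    have "gint (X c m) (A i \<otimes> dbase c i E m) = \<alpha>x i *\<^sub>g dbase c i E m + (- (\<Sum>a<r. x a * de i a)) *\<^sub>g A i"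
      unfolding gint_derivation[OF pq lin(1) Aext fin dEx] gXA Ainv
      using gmult_gone_left_ext[OF dEx] gmult_gone_right[OF Aext] by simp
    moreover have "gint (Y c m) (f - g) = gint (Y c m) f - gint (Y c m) g" for f g
      using gint_linear_right(1)[OF Sx(3,2), of f "- g"] gint_minus_right[OF Sx(3,2), of g] by simp
    moreover have "(s - t) *\<^sub>g gone = s *\<^sub>g gone - t *\<^sub>g gone" for s t
      using gscale_add_left[of s "- t" gone] by simp
    ultimately show ?thesis
      by (simp add: gint_linear_right(2)[OF Sx(3,2)] gXA mult.commute)
  qed
  have iR: "gint (Y c m) (gint (X c m) (R k)) = \<rho> k *\<^sub>g gone" for k
  proof -
    have "gint (Y c m) (gint (X c m) (R k)) = (\<Sum>a<r. \<Sum>b<r. (y a * x b) *\<^sub>g lderiv (p a) (lderiv (p b) (R k)))"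
      unfolding gint_degree_one[OF pq Xe] gint_degree_one[OF pq Ye] lderiv_sum lderiv_scale gscale_sum gscale_gscale x_def y_def ..
    also have "\<dots> = \<rho> k *\<^sub>g gone"
      unfolding \<rho>_def gscale_sum_left
    proof (intro sum.cong refl)
      fix a b
      have "lderiv (p a) (lderiv (p b) (R k)) (J, K) = 0" if "J \<noteq> {}" for J K
      proof (rule ccontr)
        assume "lderiv (p a) (lderiv (p b) (R k)) (J, K) \<noteq> 0"
        then have nz: "R k (insert (p b) (insert (p a) J), K) \<noteq> 0" and "p a \<notin> J" "p b \<notin> insert (p a) J"
          by (auto simp: lderiv_def split: if_splits)
        moreover obtain a' b' where "insert (p b) (insert (p a) J) = {p a', p b'}"
          using bracket_nonzero[OF pq tp nz[unfolded R_def]] by blast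
        ultimately show False using that by (metis card_2_iff card.infinite card_insert_disjoint finite.emptyI finite_insert insert_absorb2 singleton_insert_inj_eq doubleton_eq_iff insertI1 insert_iff empty_iff all_not_in_conv)
      qed
      then have "homogeneous 0 (lderiv (p a) (lderiv (p b) (R k))) (J, K) = lderiv (p a) (lderiv (p b) (R k)) (J, K)" for J K
        by (cases "J = {}") (auto simp: homogeneous_def)
      then have h: "homogeneous 0 (lderiv (p a) (lderiv (p b) (R k))) = lderiv (p a) (lderiv (p b) (R k))"
        by (auto intro!: ext)
      have "lderiv (p a) (lderiv (p b) (R k)) = lderiv (p a) (lderiv (p b) (R k)) ({}, {#}) *\<^sub>g gone"
        by (rule degree_zero_expand[OF _ h, of "p ` {..<r}"]) (simp add: Rext)
      from arg_cong[OF this, of "\<lambda>f. (y a * x b) *\<^sub>g f"]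
      show "(y a * x b) *\<^sub>g lderiv (p a) (lderiv (p b) (R k)) = (y a * x b * lderiv (p a) (lderiv (p b) (R k)) ({}, {#})) *\<^sub>g gone"
        by simp
    qed
    finally show ?thesis .
  qed
  have rhs: "iprod Y (iprod X (quasi_diff B \<Theta> E)) c m =
      ((\<Sum>i<n. \<alpha>x i * (\<Sum>a<r. y a * de i a) - \<alpha>y i * (\<Sum>a<r. x a * de i a)) + (\<Sum>k<r. e k * \<rho> k)) *\<^sub>g gone"
    unfolding iprod_def qd
    by (simp add: gint_linear_right[OF Sx(3,1)] gint_linear_right[OF Sx(3,2)] gsum[of X] gsum[of Y] Sx iA iR
        gscale_add_left gscale_sum_left)
  have "(\<Sum>k<r. ((\<Sum>i<n. \<alpha>x i * dy i k - \<alpha>y i * dx i k) - \<rho> k) * e k) =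
      (\<Sum>i<n. \<alpha>x i * (\<Sum>a<r. dy i a * e a) - \<alpha>y i * (\<Sum>a<r. dx i a * e a)) - (\<Sum>k<r. e k * \<rho> k)"
  proof -
    have "(\<Sum>k<r. ((\<Sum>i<n. \<alpha>x i * dy i k - \<alpha>y i * dx i k) - \<rho> k) * e k) =
        (\<Sum>k<r. \<Sum>i<n. \<alpha>x i * (dy i k * e k) - \<alpha>y i * (dx i k * e k)) - (\<Sum>k<r. e k * \<rho> k)"
      by (simp add: sum_subtractf left_diff_distrib right_diff_distrib sum_distrib_left sum_distrib_right mult_ac)
    then show ?thesis
      by (subst (asm) sum.swap) (simp add: sum_subtractf sum_distrib_left)
  qed
  note scalar = this
  have dbY: "derived_bracket B \<Theta> X (iprod Y E) c m = (\<Sum>i<n. \<alpha>x i * (\<Sum>a<r. dy i a * e a + y a * de i a)) *\<^sub>g gone"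
    unfolding \<alpha>x_def A_def x_def y_def e_def dy_def de_def
    by (rule derived_bracket_pairing[where \<Theta> = \<Theta>, OF pq tp X Y E c])
  have dbX: "derived_bracket B \<Theta> Y (iprod X E) c m = (\<Sum>i<n. \<alpha>y i * (\<Sum>a<r. dx i a * e a + x a * de i a)) *\<^sub>g gone"
    unfolding \<alpha>y_def A_def x_def y_def e_def dx_def de_def
    by (rule derived_bracket_pairing[where \<Theta> = \<Theta>, OF pq tp Y X E c])
  have gd: "(s - t) *\<^sub>g gone = s *\<^sub>g gone - t *\<^sub>g gone" for s t
    using gscale_add_left[of s "- t" gone] by simp
  show ?thesis
    unfolding lhs rhs dbY dbX gd[symmetric] scalar
    by (rule arg_cong[of _ _ "\<lambda>s. s *\<^sub>g gone"]) (simp add: sum.distrib distrib_left sum_subtractf algebra_simps)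
qed

end

section \<open>Derivations of the algebra of forms\<close>

lemma sfield_ext: "(\<And>c m. F c m = G c m) \<Longrightarrow> F = G" for F G :: "('m, 'a) sfield"
  by (rule HOL.ext, rule HOL.ext)

lemma smult_linear [simp]:
  "(u + v) \<odot> w = u \<odot> w + v \<odot> w" "w \<odot> (u + v) = w \<odot> u + w \<odot> v"
  "(u - v) \<odot> w = u \<odot> w - v \<odot> w" "w \<odot> (u - v) = w \<odot> u - w \<odot> v"
  "(- u) \<odot> w = - (u \<odot> w)" "w \<odot> (- u) = - (w \<odot> u)" "0 \<odot> w = 0" "w \<odot> 0 = 0"
  by (rule sfield_ext, simp add: smult_def fun_app)+

lemma grading_inv_linear [simp]:
  "grading_inv (u + v) = grading_inv u + grading_inv v" "grading_inv (u - v) = grading_inv u - grading_inv v"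
  "grading_inv (- u) = - grading_inv u" "grading_inv 0 = 0"
  by (rule sfield_ext, simp add: grading_inv_def fun_app fun_eq_iff algebra_simps)+

lemma grading_inv_eq: "grading_inv u = (\<lambda>c m. ginv (u c m))"
  by (rule sfield_ext) (simp add: grading_inv_def ginv_def)

lemma grading_inv_grading_inv [simp]: "grading_inv (grading_inv u) = u"
  by (simp add: grading_inv_eq)

lemma sscale_half: "(1/2) *\<^sub>s (2 * u) = u" "s *\<^sub>s 0 = 0"
proof -
  show "(1/2) *\<^sub>s (2 * u) = u"
    unfolding mult_2 by (intro HOL.ext, simp only: sscale_def gscale_def plus_fun_apply) simp
qed (rule sfield_ext, simp add: sscale_def fun_app)

lemma gcomm_odd_odd:
  assumes "grading_inv (P (grading_inv u)) = - P u" "grading_inv (Q (grading_inv (P u))) = - Q (P u)" "Q 0 = 0"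
  shows "gcomm P Q u = P (Q u) + Q (P u)"
  by (simp add: gcomm_def even_part_def odd_part_def assms sscale_half)

lemma gcomm_even_odd:
  assumes "grading_inv (P (grading_inv u)) = P u" "grading_inv (Q (grading_inv (P u))) = - Q (P u)" "Q 0 = 0"
  shows "gcomm P Q u = P (Q u) - Q (P u)"
  by (simp add: gcomm_def even_part_def odd_part_def assms sscale_half)

lemma ginv_homogeneous:
  assumes "homogeneous k f = f"
  shows "ginv f = (-1) ^ k *\<^sub>g f"
proof (rule HOL.ext, clarify)
  fix J and K :: "nat multiset"
  show "ginv f (J, K) = ((-1) ^ k *\<^sub>g f) (J, K)"
    using fun_cong[OF assms, of "(J, K)"] by (auto simp: ginv_def gscale_apply homogeneous_def split: if_splits)
qed

context smooth_bundle
begin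

lemma smult_assoc: "u \<in> forms B \<Longrightarrow> v \<in> forms B \<Longrightarrow> u \<odot> v \<odot> w = u \<odot> (v \<odot> w)"
  unfolding smult_def by (simp add: gmult_assoc[OF formsD(2) formsD(2)])

lemma grading_inv_smult: "u \<in> forms B \<Longrightarrow> grading_inv (u \<odot> v) = grading_inv u \<odot> grading_inv v"
  unfolding smult_def grading_inv_eq by (simp add: ginv_gmult[OF formsD(2)])

lemma grading_inv_forms_deg: "u \<in> forms_deg B k \<Longrightarrow> grading_inv u = (if even k then u else - u)"
  by (rule sfield_ext) (auto simp: grading_inv_eq ginv_homogeneous[OF homogeneous_forms_deg] fun_app)

lemma smult_commute_even:
  assumes "u \<in> forms B" "v \<in> forms B" "grading_inv u = u"
  shows "u \<odot> v = v \<odot> u"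
  using fun_cong[OF fun_cong[OF assms(3)]] unfolding smult_def grading_inv_eq
  by (auto intro!: sfield_ext gmult_even_commute[OF formsD(2)[OF assms(1)] formsD(2)[OF assms(2)]])

lemma smult_commute_odd:
  assumes "u \<in> forms B" "v \<in> forms B" "grading_inv u = - u"
  shows "u \<odot> v = grading_inv v \<odot> u"
  using fun_cong[OF fun_cong[OF assms(3)]] unfolding smult_def grading_inv_eq
  by (auto simp: fun_app intro!: sfield_ext gmult_odd_commute[OF formsD(2)[OF assms(1)] formsD(2)[OF assms(2)]])

definition derivation :: "bool \<Rightarrow> ('m, 'a) soperator \<Rightarrow> bool" where
  "derivation od D \<longleftrightarrow>
     (\<forall>u\<in>forms B. \<forall>v\<in>forms B. D (u + v) = D u + D v) \<and>
     (\<forall>u\<in>forms B. \<forall>v\<in>forms B. D (u \<odot> v) = D u \<odot> v + (if od then grading_inv u else u) \<odot> D v) \<and>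
     (\<forall>u\<in>forms B. \<forall>c m. D u c m \<in> ext_poly {..<2 * r}) \<and>
     (\<forall>u\<in>forms B. \<forall>c m. c \<notin> atlas B \<or> m \<notin> cdom c \<longrightarrow> D u c m = 0)"

definition odd_op :: "('m, 'a) soperator \<Rightarrow> bool" where
  "odd_op D \<longleftrightarrow> (\<forall>u\<in>forms B. D u \<in> forms B \<and> grading_inv (D u) = - D (grading_inv u)) \<and>
     (\<forall>u\<in>forms B. \<forall>v\<in>forms B. D (u + v) = D u + D v)"

definition odd_derivation :: "('m, 'a) soperator \<Rightarrow> bool" where
  "odd_derivation D \<longleftrightarrow> odd_op D \<and>
     (\<forall>u\<in>forms B. \<forall>v\<in>forms B. D (u \<odot> v) = D u \<odot> v + grading_inv u \<odot> D v)"

definition even_derivation :: "('m, 'a) soperator \<Rightarrow> bool" where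
  "even_derivation D \<longleftrightarrow>
     (\<forall>u\<in>forms B. D u \<in> forms B \<and> grading_inv (D u) = D (grading_inv u)) \<and>
     (\<forall>u\<in>forms B. \<forall>v\<in>forms B. D (u + v) = D u + D v) \<and>
     (\<forall>u\<in>forms B. \<forall>v\<in>forms B. D (u \<odot> v) = D u \<odot> v + u \<odot> D v)"

lemma odd_opD:
  assumes "odd_op D"
  shows "u \<in> forms B \<Longrightarrow> D u \<in> forms B" "u \<in> forms B \<Longrightarrow> grading_inv (D u) = - D (grading_inv u)"
    "u \<in> forms B \<Longrightarrow> v \<in> forms B \<Longrightarrow> D (u + v) = D u + D v" "D 0 = 0"
    "u \<in> forms B \<Longrightarrow> D (- u) = - D u" "u \<in> forms B \<Longrightarrow> v \<in> forms B \<Longrightarrow> D (u - v) = D u - D v"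
proof -
  show a: "D (u + v) = D u + D v" if "u \<in> forms B" "v \<in> forms B" for u v
    using assms that by (simp add: odd_op_def)
  show 0: "D 0 = 0" using a[of 0 0] by simp
  show m: "D (- u) = - D u" if "u \<in> forms B" for u
    using a[of u "- u"] that 0 by (simp add: eq_neg_iff_add_eq_0 add.commute)
  show "D (u - v) = D u - D v" if "u \<in> forms B" "v \<in> forms B"
    using a[of u "- v"] m[of v] that by simp
qed (use assms in \<open>simp_all add: odd_op_def\<close>)

lemma odd_derivationD: 
  assumes "odd_derivation D"
  shows "odd_op D" "u \<in> forms B \<Longrightarrow> v \<in> forms B \<Longrightarrow> D (u \<odot> v) = D u \<odot> v + grading_inv u \<odot> D v"
  using assms by (simp_all add: odd_derivation_def)

lemma even_derivationD:
  assumes "even_derivation D"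
  shows "u \<in> forms B \<Longrightarrow> D u \<in> forms B" "u \<in> forms B \<Longrightarrow> grading_inv (D u) = D (grading_inv u)"
    "u \<in> forms B \<Longrightarrow> v \<in> forms B \<Longrightarrow> D (u + v) = D u + D v"
    "u \<in> forms B \<Longrightarrow> v \<in> forms B \<Longrightarrow> D (u \<odot> v) = D u \<odot> v + u \<odot> D v"
    "u \<in> forms B \<Longrightarrow> D (- u) = - D u"
proof -
  show a: "D (u + v) = D u + D v" if "u \<in> forms B" "v \<in> forms B" for u v
    using assms that by (simp add: even_derivation_def)
  have 0: "D 0 = 0" using a[of 0 0] by simp
  show "D (- u) = - D u" if "u \<in> forms B"
    using a[of u "- u"] that 0 by (simp add: eq_neg_iff_add_eq_0 add.commute)
qed (use assms in \<open>simp_all add: even_derivation_def\<close>)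

lemma derivation_odd: "odd_derivation D \<Longrightarrow> derivation True D"
  unfolding derivation_def odd_derivation_def odd_op_def using formsD(1) forms_ext by simp

lemma odd_derivation_commutator:
  assumes D: "odd_derivation D" and E: "odd_derivation E"
  shows "even_derivation (\<lambda>u. D (E u) + E (D u))"
  unfolding even_derivation_def
  using odd_opD[OF odd_derivationD(1)[OF D]] odd_opD[OF odd_derivationD(1)[OF E]]
  by (simp add: odd_derivationD(2)[OF D] odd_derivationD(2)[OF E] algebra_simps)

lemma even_odd_derivation_commutator:
  assumes D: "even_derivation D" and E: "odd_derivation E"
  shows "odd_derivation (\<lambda>u. D (E u) - E (D u))"
  unfolding odd_derivation_def odd_op_def
  using even_derivationD[OF D] odd_opD[OF odd_derivationD(1)[OF E]]
  by (simp add: odd_derivationD(2)[OF E] algebra_simps)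

lemma odd_derivation_add: "odd_derivation D \<Longrightarrow> odd_derivation E \<Longrightarrow> odd_derivation (\<lambda>u. D u + E u)"
  unfolding odd_derivation_def odd_op_def by (simp add: algebra_simps)

text \<open>
  The difference of two such derivations commutes with functions, and it passes one-forms up to sign, so it
  vanishes locally.
\<close>

lemma derivation_eqI:
  assumes D: "derivation od D" and E: "derivation od E"
    and 0: "\<And>f. f \<in> forms_deg B 0 \<Longrightarrow> D f = 0" "\<And>f. f \<in> forms_deg B 0 \<Longrightarrow> E f = 0"
    and 1: "\<And>\<xi>. \<xi> \<in> forms_deg B 1 \<Longrightarrow> D \<xi> = E \<xi>" and u: "u \<in> forms B"
  shows "D u = E u"
proof -
  let ?C = "\<lambda>u. D u - E u"
  have "?C u = 0"
  proof (rule operator_vanishes_locally[OF _ _ _ _ _ _ u])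
    fix v w f \<xi> c m
    show "v \<in> forms B \<Longrightarrow> ?C v c m \<in> ext_poly {..<2 * r}"
      using D E by (simp add: derivation_def fun_app)
    show "v \<in> forms B \<Longrightarrow> c \<notin> atlas B \<or> m \<notin> cdom c \<Longrightarrow> ?C v c m = 0"
      using D E by (simp add: derivation_def fun_app)
    show "v \<in> forms B \<Longrightarrow> w \<in> forms B \<Longrightarrow> ?C (v + w) = ?C v + ?C w"
      using D E by (simp add: derivation_def)
    show "f \<in> forms_deg B 0 \<Longrightarrow> v \<in> forms B \<Longrightarrow> ?C (f \<odot> v) = f \<odot> ?C v"
      using D E 0 by (simp add: derivation_def forms_deg_forms grading_inv_forms_deg)
    show "f \<in> forms_deg B 0 \<Longrightarrow> ?C f = 0" using 0 by simp
    show "?C (\<xi> \<odot> v) = 0" if "\<xi> \<in> forms_deg B 1" "v \<in> forms B" "?C v = 0"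
    proof -
      have "D v = E v" using that(3) by simp
      then show ?thesis
        using D E 1[OF that(1)] that(1,2) by (simp add: derivation_def forms_deg_forms)
    qed
  qed
  then show ?thesis by simp
qed

text \<open>
  The decomposition into even and odd parts collapses, since all the operators involved have a definite parity.
\<close>

lemma gcomm_gcomm:
  assumes P: "odd_op P" and D: "odd_op D" and Q: "odd_op Q" and u: "u \<in> forms B"
  shows "gcomm (gcomm P D) Q u = P (D (Q u)) + D (P (Q u)) - Q (P (D u)) - Q (D (P u))"
proof -
  note p = odd_opD[OF P] and d = odd_opD[OF D] and q = odd_opD[OF Q]
  have inner: "gcomm P D v = P (D v) + D (P v)" if "v \<in> forms B" for v
    using that p d by (intro gcomm_odd_odd) simp_all
  have "gcomm (gcomm P D) Q u = gcomm P D (Q u) - Q (gcomm P D u)"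
    using u p d q by (intro gcomm_even_odd) (simp_all add: inner)
  then show ?thesis using u p d q by (simp add: inner algebra_simps)
qed

end

section \<open>Interior products, exterior products and quasi-differentials\<close>

lemma gmult_odd_swap:
  assumes "f \<in> ext_poly S" "g \<in> ext_poly T" "ginv f = - f"
  shows "f \<otimes> (g \<otimes> h) = ginv g \<otimes> (f \<otimes> h)"
  using gmult_assoc[OF assms(1,2), of h] gmult_odd_commute[OF assms]
    gmult_assoc[OF ext_poly_ginv[OF assms(2)] assms(1), of h] by simp

lemma gmult_even_swap:
  assumes "f \<in> ext_poly S" "g \<in> ext_poly T" "ginv f = f"
  shows "f \<otimes> (g \<otimes> h) = g \<otimes> (f \<otimes> h)"
  using gmult_assoc[OF assms(1,2), of h] gmult_even_commute[OF assms]
    gmult_assoc[OF assms(2,1), of h] by simp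

lemma ginv_gint:
  assumes S: "finite S" and f: "f \<in> ext_poly S" and u: "u \<in> ext_poly T"
  shows "ginv (gint f u) = gint (ginv f) (ginv u)"
  using S f
proof (induction f rule: ext_poly_induct)
  case (godd k g)
  have e: "gint g u \<in> ext_poly T" by (rule ext_poly_gint[OF S godd(2) u])
  show ?case
    using godd ginv_gmult[OF ext_poly_godd[OF godd(1)], of g]
    by (simp add: gint_godd_mult[OF S] ginv_lderiv[OF e] gint_minus_left[OF S, of "godd k \<otimes> ginv g"])
qed (simp_all add: gint_add_left[OF S] gint_scale_left[OF S])

lemma gint_odd_commute:
  assumes S: "finite S" and f: "f \<in> ext_poly S" "ginv f = - f" and g: "g \<in> ext_poly S"
  shows "gint f (gint g u) = gint (ginv g) (gint f u)"
  using gint_gmult[OF S f(1) g, of u] gint_gmult[OF S ext_poly_ginv[OF g] f(1), of u]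
    gmult_odd_commute[OF f(1) g f(2)] by simp

lemma gint_sum_right:
  assumes "finite S" "f \<in> ext_poly S"
  shows "gint f (\<Sum>k\<in>K. F k) = (\<Sum>k\<in>K. gint f (F k))"
  by (induction K rule: infinite_finite_induct) (simp_all add: gint_linear_right(1)[OF assms])

lemma homogeneous_lderiv:
  assumes "f \<in> ext_poly S"
  shows "homogeneous k (lderiv j f) = lderiv j (homogeneous (Suc k) f)"
proof (rule HOL.ext, clarify)
  fix J and K :: "nat multiset"
  show "homogeneous k (lderiv j f) (J, K) = lderiv j (homogeneous (Suc k) f) (J, K)"
  proof (cases "finite J")
    case False
    then have "f (insert j J, K) = 0" using ext_polyD[OF assms, of "insert j J" K] by auto
    then show ?thesis by (simp add: homogeneous_def lderiv_def)
  qed (simp add: homogeneous_def lderiv_def)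
qed

context smooth_bundle
begin

lemma dual_xi_theta: "dual_vars (\<lambda>a. xi a) (\<lambda>a. theta a)" and dual_theta_xi: "dual_vars (\<lambda>a. theta a) (\<lambda>a. xi a)"
  by (simp_all add: dual_vars_def)

text \<open>The interior product only sees the part of its first argument that is free of momenta.\<close>

definition linear_at :: "(nat \<Rightarrow> nat) \<Rightarrow> gpoly \<Rightarrow> bool" where
  "linear_at q f \<longleftrightarrow> (\<forall>J. f (J, {#}) \<noteq> 0 \<longrightarrow> (\<exists>k<r. J = {q k}))"

lemma linear_in_linear_at:
  assumes "linear_in q f"
  shows "linear_at q f"
  unfolding linear_at_def
proof (intro allI impI)
  fix J assume nz: "f (J, {#}) \<noteq> 0"
  have J: "J \<subseteq> q ` {..<r}" using assms ext_polyD[where f = f and J = J and K = "{#}"] nz unfolding linear_in_def by blast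
  have "homogeneous 1 f (J, {#}) \<noteq> 0" using assms nz unfolding linear_in_def by simp
  then have "card J = 1" by (simp add: homogeneous_def split: if_splits)
  then obtain j where "J = {j}" by (rule card_1_singletonE)
  then show "\<exists>k<r. J = {q k}" using J by auto
qed

lemma linear_in_sum: "(\<And>i. i \<in> I \<Longrightarrow> linear_in q (F i)) \<Longrightarrow> linear_in q (\<Sum>i\<in>I. t i *\<^sub>g F i)"
  unfolding linear_in_def by (simp add: homogeneous_sum homogeneous_scale cong: sum.cong_simp)

lemma linear_in_godd: "a < r \<Longrightarrow> linear_in q (godd (q a))"
  unfolding linear_in_def by (simp add: homogeneous_godd)

lemma linear_in_0: "linear_in q 0"
  unfolding linear_in_def by simp

lemma gint_linear_at:
  assumes pq: "dual_vars p q" and f: "linear_at q f"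
  shows "\<exists>g. linear_in q g \<and> (\<forall>u. gint f u = gint g u)"
proof -
  let ?g = "\<Sum>k<r. f ({q k}, {#}) *\<^sub>g godd (q k)"
  have "gint f u = gint ?g u" for u
  proof -
    have "gint f u = (\<Sum>J\<in>(\<lambda>k. {q k}) ` {..<r}. f (J, {#}) *\<^sub>g foldr (\<lambda>j. lderiv (oconj j)) (sorted_list_of_set J) u)"
      unfolding gint_def
    proof (rule sum.mono_neutral_left)
      show "{J. f (J, {#}) \<noteq> 0} \<subseteq> (\<lambda>k. {q k}) ` {..<r}" using f unfolding linear_at_def by blast
    qed auto
    also have "\<dots> = (\<Sum>k<r. f ({q k}, {#}) *\<^sub>g lderiv (p k) u)"
      by (subst sum.reindex) (auto simp: inj_on_def dual_varsD(4)[OF pq] dual_varsD(6)[OF pq])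
    also have "\<dots> = gint ?g u" by (rule gint_degree_one[OF pq refl, symmetric])
    finally show ?thesis .
  qed
  moreover have "linear_in q ?g" by (rule linear_in_sum) (simp add: linear_in_godd)
  ultimately show ?thesis by blast
qed

lemma linear_inD:
  assumes "linear_in q f"
  shows "f \<in> ext_poly (q ` {..<r})" "ginv f = - f"
proof -
  show "f \<in> ext_poly (q ` {..<r})" using assms by (simp add: linear_in_def)
  have "ginv f = (-1) ^ 1 *\<^sub>g f" by (rule ginv_homogeneous) (use assms in \<open>simp add: linear_in_def\<close>)
  then show "ginv f = - f" by (simp add: gscale_def fun_eq_iff fun_app)
qed

lemma gint_scalar:
  assumes pq: "dual_vars p q" and X: "linear_in q X"
  shows "gint X (s *\<^sub>g gone) = 0"
  unfolding gint_degree_one[OF pq linear_in_expand[OF pq X]] by simp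

lemma derivation_iprod:
  assumes W: "\<And>c m. c \<in> atlas B \<Longrightarrow> m \<in> cdom c \<Longrightarrow> linear_at (\<lambda>a. theta a) (W c m)"
  shows "derivation True (iprod W)"
proof -
  have "\<exists>g. linear_in (\<lambda>a. theta a) g \<and> (\<forall>u\<in>forms B. iprod W u c m = gint g (u c m))" for c m
  proof (cases "c \<in> atlas B \<and> m \<in> cdom c")
    case True
    then show ?thesis using gint_linear_at[OF dual_xi_theta W, of c m] unfolding iprod_def by blast
  next
    case False
    then have "iprod W u c m = gint 0 (u c m)" if "u \<in> forms B" for u
      using formsD(1)[OF that, of c m] by (simp add: iprod_def)
    then show ?thesis using linear_in_0 by blast
  qed
  note ex = someI_ex[OF this]
  define g where "g c m = (SOME g. linear_in (\<lambda>a. theta a) g \<and> (\<forall>u\<in>forms B. iprod W u c m = gint g (u c m)))" for c m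
  have g: "\<And>c m. linear_in (\<lambda>a. theta a) (g c m)"
    "\<And>u c m. u \<in> forms B \<Longrightarrow> iprod W u c m = gint (g c m) (u c m)"
    unfolding g_def using ex by blast+
  have fin: "finite ((\<lambda>a. theta a) ` {..<r})" by simp
  note e = linear_inD(1)[OF g(1)]
  show ?thesis
    unfolding derivation_def
  proof (intro conjI ballI allI impI)
    fix u v assume u: "u \<in> forms B" and v: "v \<in> forms B"
    show "iprod W (u + v) = iprod W u + iprod W v"
      by (rule sfield_ext) (simp add: g(2) u v fun_app gint_linear_right(1)[OF fin e])
    have "gint (g c m) (u c m \<otimes> v c m) = gint (g c m) (u c m) \<otimes> v c m + ginv (u c m) \<otimes> gint (g c m) (v c m)" for c m
      by (rule gint_derivation[OF dual_xi_theta g(1) formsD(2)[OF u] _ formsD(2)[OF v]]) simp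
    moreover have "iprod W (u \<odot> v) c m = gint (g c m) (u c m \<otimes> v c m)" for c m
      using g(2)[OF forms_mult[OF u v], of c m] by (simp add: smult_def)
    ultimately show "iprod W (u \<odot> v) = iprod W u \<odot> v + (if True then grading_inv u else u) \<odot> iprod W v"
      by (intro sfield_ext) (simp add: smult_def grading_inv_eq g(2) u v fun_app)
  next
    fix u c m assume u: "u \<in> forms B"
    show "iprod W u c m \<in> ext_poly {..<2 * r}"
      unfolding g(2)[OF u] by (rule ext_poly_gint[OF fin e]) (simp add: u)
  next
    fix u c m assume "u \<in> forms B" "c \<notin> atlas B \<or> m \<notin> cdom c"
    then show "iprod W u c m = 0" using formsD(1) by (simp add: iprod_def)
  qed
qed

lemma odd_op_iprod:
  assumes X: "X \<in> multivectors B" and o: "\<And>c m. ginv (X c m) = - X c m"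
  shows "odd_op (iprod X)"
  unfolding odd_op_def
proof (intro conjI ballI)
  have fin: "finite (theta_vars r)" by simp
  note e = multivectorsD(2)[OF X]
  fix u v assume u: "u \<in> forms B"
  show "iprod X u \<in> forms B" using X u by simp
  show "grading_inv (iprod X u) = - iprod X (grading_inv u)"
    by (rule sfield_ext)
      (simp add: grading_inv_eq iprod_def fun_app ginv_gint[OF fin e formsD(2)[OF u]] o gint_minus_left[OF fin e])
  show "iprod X (u + v) = iprod X u + iprod X v"
    by (rule sfield_ext) (simp add: iprod_def fun_app gint_linear_right(1)[OF fin e])
qed

lemma forms_eqI:
  assumes "u \<in> forms B" "v \<in> forms B" "\<And>c m. c \<in> atlas B \<Longrightarrow> m \<in> cdom c \<Longrightarrow> u c m = v c m"
  shows "u = v"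
  by (rule sfield_eqI) (use assms formsD(1) in auto)

lemma odd_op_eprod: "Z \<in> forms B \<Longrightarrow> grading_inv Z = - Z \<Longrightarrow> odd_op (eprod Z)"
  unfolding odd_op_def eprod_def by (simp add: grading_inv_smult)

lemma ginv_anchor:
  assumes "dual_vars p q" "anchor_bracket_type p q f"
  shows "linear_in p (pderiv_mom i f)" "ginv (pderiv_mom i f) = - pderiv_mom i f"
proof -
  have "homogeneous 1 (pderiv_mom i f) (J, K) = pderiv_mom i f (J, K)" for J K
    unfolding anchor_eq[OF assms] homogeneous_def by auto
  then show "linear_in p (pderiv_mom i f)" unfolding linear_in_def using ext_anchor[OF assms] by (auto intro!: HOL.ext)
  then show "ginv (pderiv_mom i f) = - pderiv_mom i f" by (rule linear_inD(2))
qed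

lemma homogeneous_bracket:
  assumes "dual_vars p q" "anchor_bracket_type p q f"
  shows "homogeneous 2 (rderiv (q k) f) = rderiv (q k) f" "ginv (rderiv (q k) f) = rderiv (q k) f"
proof -
  have "homogeneous 2 (rderiv (q k) f) (J, K) = rderiv (q k) f (J, K)" for J K
  proof (cases "rderiv (q k) f (J, K) = 0")
    case False
    then obtain a b where "a \<noteq> b" "J = {p a, p b}" using bracket_nonzero[OF assms] by blast
    then have "card J = 2" using dual_varsD(3)[OF assms(1)] by simp
    then show ?thesis by (simp add: homogeneous_def)
  qed (simp add: homogeneous_def)
  then show h: "homogeneous 2 (rderiv (q k) f) = rderiv (q k) f" by (auto intro!: HOL.ext)
  show "ginv (rderiv (q k) f) = rderiv (q k) f"
    using ginv_homogeneous[OF h] by simp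
qed

lemma has_dpoly_ginv: "has_dpoly c i F m D \<Longrightarrow> has_dpoly c i (\<lambda>m. ginv (F m)) m (ginv D)"
  unfolding has_dpoly_def ginv_def by (simp add: has_cderiv_cmult split_paired_all)

text \<open>
  In a chart the quasi-differential is an odd field of derivations: the anchor coefficients are odd and
  multiply derivatives along the base, the bracket coefficients are even and multiply odd derivatives.
\<close>

lemma odd_derivation_quasi_diff:
  assumes \<Theta>: "\<Theta> \<in> sfunctions B" and tp: "\<And>c m. anchor_bracket_type (\<lambda>a. xi a) (\<lambda>a. theta a) (\<Theta> c m)"
  shows "odd_derivation (quasi_diff B \<Theta>)"
    and "u \<in> forms B \<Longrightarrow> quasi_diff B \<Theta> (s *\<^sub>s u) = s *\<^sub>s quasi_diff B \<Theta> u"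
proof -
  let ?d = "quasi_diff B \<Theta>"
  define A where "A c m i = pderiv_mom i (\<Theta> c m)" for c m i
  define R where "R c m a = rderiv (theta a) (\<Theta> c m)" for c m a
  have A: "A c m i \<in> ext_poly (xi_vars r)" "ginv (A c m i) = - A c m i" for c m i
    unfolding A_def by (rule ext_anchor[OF dual_xi_theta tp] ginv_anchor(2)[OF dual_xi_theta tp])+
  have R: "R c m a \<in> ext_poly (xi_vars r)" "ginv (R c m a) = R c m a" for c m a
    unfolding R_def by (rule ext_bracket[OF dual_xi_theta tp] homogeneous_bracket(2)[OF dual_xi_theta tp])+
  have q: "?d u c m = (\<Sum>i<n. A c m i \<otimes> dpoly c i (u c) m) + (\<Sum>a<r. R c m a \<otimes> lderiv (xi a) (u c m))"
    if "u \<in> forms B" for u c m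
    unfolding A_def R_def by (rule quasi_diff_coords[where u = u and \<Theta> = \<Theta>, OF dual_xi_theta formsD(2)[OF that]])
  have F: "?d u \<in> forms B" if "u \<in> forms B" for u by (rule forms_quasi_diff[OF \<Theta> tp that])
  have hd: "has_dpoly c i (u c) m (dpoly c i (u c) m)"
    if "u \<in> forms B" "c \<in> atlas B" "m \<in> cdom c" "i < n" for u c m i
    by (rule smooth_poly_has_dpoly[OF chart_open_cdom[OF that(2)] formsD(3)[OF that(1,2)] that(4,3)])
  have de: "dpoly c i (u c) m \<in> ext_poly (xi_vars r)" if "u \<in> forms B" for u c m i
    by (rule ext_poly_dpoly) (rule formsD(2)[OF that])
  have dadd: "dpoly c i ((u + v) c) m = dpoly c i (u c) m + dpoly c i (v c) m"
    if "u \<in> forms B" "v \<in> forms B" "c \<in> atlas B" "m \<in> cdom c" "i < n" for u v c m i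
  proof -
    have "(u + v) c = (\<lambda>m. u c m + v c m)" by (rule HOL.ext) (simp add: fun_app)
    then show ?thesis using has_dpoly_imp_dpoly[OF has_dpoly_add[OF hd[OF that(1,3-5)] hd[OF that(2,3-5)]]] by simp
  qed
  have dscale: "dpoly c i ((s *\<^sub>s u) c) m = s *\<^sub>g dpoly c i (u c) m"
    if "u \<in> forms B" "c \<in> atlas B" "m \<in> cdom c" "i < n" for u c m i s
  proof -
    have "(s *\<^sub>s u) c = (\<lambda>m. s *\<^sub>g u c m)" by (rule HOL.ext) (simp add: sscale_def)
    then show ?thesis using has_dpoly_imp_dpoly[OF has_dpoly_scale[OF hd[OF that]]] by simp
  qed
  have dinv: "dpoly c i (grading_inv u c) m = ginv (dpoly c i (u c) m)"
    if "u \<in> forms B" "c \<in> atlas B" "m \<in> cdom c" "i < n" for u c m i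
    unfolding grading_inv_eq by (rule has_dpoly_imp_dpoly[OF has_dpoly_ginv[OF hd[OF that]]])
  have dmult: "dpoly c i ((u \<odot> v) c) m = dpoly c i (u c) m \<otimes> v c m + u c m \<otimes> dpoly c i (v c) m"
    if "u \<in> forms B" "v \<in> forms B" "c \<in> atlas B" "m \<in> cdom c" "i < n" for u v c m i
    unfolding smult_def
    by (rule has_dpoly_imp_dpoly[OF has_dpoly_gmult[OF that(3,4) hd[OF that(1,3-5)] hd[OF that(2,3-5)]]])
  show "odd_derivation ?d"
    unfolding odd_derivation_def odd_op_def
  proof (intro conjI ballI)
    fix u v assume u: "u \<in> forms B" and v: "v \<in> forms B"
    show "?d u \<in> forms B" by (rule F[OF u])
    show "grading_inv (?d u) = - ?d (grading_inv u)"
    proof (rule forms_eqI)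
      fix c m assume c: "c \<in> atlas B" "m \<in> cdom c"
      have "ginv (A c m i \<otimes> dpoly c i (u c) m) = - (A c m i \<otimes> dpoly c i (grading_inv u c) m)" if "i < n" for i
        unfolding dinv[OF u c that] by (simp add: ginv_gmult[OF A(1)] A(2))
      moreover have "ginv (R c m a \<otimes> lderiv (xi a) (u c m)) = - (R c m a \<otimes> lderiv (xi a) (grading_inv u c m))" for a
        by (simp add: ginv_gmult[OF R(1)] R(2) ginv_lderiv[OF formsD(2)[OF u]] grading_inv_eq)
      ultimately show "grading_inv (?d u) c m = (- ?d (grading_inv u)) c m"
        by (simp add: grading_inv_apply fun_app q u ginv_sum sum_negf cong: sum.cong_simp)
    qed (simp_all add: F u)
    show "?d (u + v) = ?d u + ?d v"
    proof (rule forms_eqI)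
      fix c m assume c: "c \<in> atlas B" "m \<in> cdom c"
      have e: "(u + v) c m = u c m + v c m" by (simp add: fun_app)
      have "?d (u + v) c m = ?d u c m + ?d v c m"
        unfolding q[OF forms_add[OF u v]] q[OF u] q[OF v] e
        by (simp add: dadd[OF u v c] lderiv_add sum.distrib cong: sum.cong_simp)
      then show "?d (u + v) c m = (?d u + ?d v) c m" by (simp add: fun_app)
    qed (simp_all add: F u v)
    show "?d (u \<odot> v) = ?d u \<odot> v + grading_inv u \<odot> ?d v"
    proof (rule forms_eqI)
      fix c m assume c: "c \<in> atlas B" "m \<in> cdom c"
      have U: "u c m \<in> ext_poly (xi_vars r)" and V: "v c m \<in> ext_poly (xi_vars r)" using u v formsD(2) by auto
      have a: "A c m i \<otimes> dpoly c i ((u \<odot> v) c) m =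
          A c m i \<otimes> dpoly c i (u c) m \<otimes> v c m + ginv (u c m) \<otimes> (A c m i \<otimes> dpoly c i (v c) m)" if "i < n" for i
        unfolding dmult[OF u v c that]
        by (simp add: gmult_assoc[OF A(1) de[OF u]] gmult_odd_swap[OF A(1) U A(2)])
      have vf: "\<And>J K. v c m (J, K) \<noteq> 0 \<Longrightarrow> finite J" using ext_polyD[OF V] by blast
      have l: "lderiv j (u c m \<otimes> v c m) = lderiv j (u c m) \<otimes> v c m + ginv (u c m) \<otimes> lderiv j (v c m)" for j
        by (rule lderiv_gmult[OF _ U]) (use vf in auto)
      have b: "R c m k \<otimes> lderiv (xi k) ((u \<odot> v) c m) =
          R c m k \<otimes> lderiv (xi k) (u c m) \<otimes> v c m + ginv (u c m) \<otimes> (R c m k \<otimes> lderiv (xi k) (v c m))" for k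
        unfolding smult_def l
        by (simp add: gmult_assoc[OF R(1) ext_poly_lderiv[OF U]] gmult_even_swap[OF R(1) ext_poly_ginv[OF U] R(2)])
      have "?d (u \<odot> v) c m = ?d u c m \<otimes> v c m + ginv (u c m) \<otimes> ?d v c m"
        unfolding q[OF forms_mult[OF u v]] q[OF u] q[OF v]
        by (simp add: a b sum.distrib gmult_sum_left gmult_sum_right add_ac cong: sum.cong_simp)
      then show "?d (u \<odot> v) c m = (?d u \<odot> v + grading_inv u \<odot> ?d v) c m"
        unfolding plus_fun_apply by (simp add: smult_def[of "?d u"] smult_def[of "grading_inv u"] grading_inv_apply)
    qed (simp_all add: F u v)
  qed
  show "?d (s *\<^sub>s u) = s *\<^sub>s ?d u" if u: "u \<in> forms B"
  proof (rule forms_eqI)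
    fix c m assume c: "c \<in> atlas B" "m \<in> cdom c"
    have "lderiv j ((s *\<^sub>s u) c m) = s *\<^sub>g lderiv j (u c m)" for j by (simp add: sscale_def lderiv_scale)
    then show "?d (s *\<^sub>s u) c m = (s *\<^sub>s ?d u) c m"
      using u by (simp add: q dscale[OF u c] sscale_def[of s "?d u"] gscale_sum cong: sum.cong_simp)
  qed (simp_all add: F u)
qed

lemma function_expand:
  assumes "f \<in> forms_deg B 0"
  shows "f c m = f c m ({}, {#}) *\<^sub>g gone" "dbase c i f m = dbase c i f m ({}, {#}) *\<^sub>g gone"
proof -
  note e = formsD(2)[OF forms_deg_forms[OF assms]] and h = homogeneous_forms_deg[OF assms]
  show "f c m = f c m ({}, {#}) *\<^sub>g gone" by (rule degree_zero_expand[OF e h])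
  show "dbase c i f m = dbase c i f m ({}, {#}) *\<^sub>g gone"
    unfolding dbase_eq_dpoly
    by (rule degree_zero_expand[OF ext_poly_dpoly[where F = "f c", OF e] homogeneous_dpoly[where F = "f c", OF h]])
qed

lemma quasi_diff_function:
  assumes pq: "dual_vars p q" and tp: "anchor_bracket_type p q (\<Theta> c m)" and f: "f \<in> forms_deg B 0"
  shows "quasi_diff B \<Theta> f c m = (\<Sum>i<n. dbase c i f m ({}, {#}) *\<^sub>g pderiv_mom i (\<Theta> c m))"
    and "linear_in p (quasi_diff B \<Theta> f c m)"
proof -
  note f0 = function_expand(1)[OF f, of c m]
  obtain s where s: "f c m = s *\<^sub>g gone" using f0 by blast
  have e: "f c m \<in> ext_poly (p ` {..<r})" unfolding s by simp
  have l: "lderiv j (f c m) = 0" for j unfolding s by (simp add: lderiv_scale)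
  have "pderiv_mom i (\<Theta> c m) \<otimes> dbase c i f m = dbase c i f m ({}, {#}) *\<^sub>g pderiv_mom i (\<Theta> c m)" for i
    using arg_cong[OF function_expand(2)[OF f, of c i m], of "\<lambda>g. pderiv_mom i (\<Theta> c m) \<otimes> g"]
    by (simp add: gmult_gone_right[OF ext_anchor[OF pq tp]])
  then show 1: "quasi_diff B \<Theta> f c m = (\<Sum>i<n. dbase c i f m ({}, {#}) *\<^sub>g pderiv_mom i (\<Theta> c m))"
    unfolding quasi_diff_coords[where u = f and \<Theta> = \<Theta>, OF pq e] l dbase_eq_dpoly[symmetric] by simp
  show "linear_in p (quasi_diff B \<Theta> f c m)"
    unfolding 1 by (rule linear_in_sum) (rule ginv_anchor(1)[OF pq tp])
qed

lemma gint_quasi_diff_function: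
  assumes pq: "dual_vars p q" and tp: "anchor_bracket_type p q (\<Theta> c m)" and X: "section_in q X"
    and f: "f \<in> forms_deg B 0"
  shows "gint (X c m) (quasi_diff B \<Theta> f c m) = derived_bracket B \<Theta> X f c m"
    and "\<exists>s. derived_bracket B \<Theta> X f c m = s *\<^sub>g gone"
proof -
  have lin: "linear_in q (X c m)" using X by (simp add: section_in_def)
  have fin: "finite (q ` {..<r})" by simp
  have d: "derived_bracket B \<Theta> X f c m =
    (\<Sum>i<n. (\<Sum>a<r. comp_in q (X c m) a * pderiv_mom i (\<Theta> c m) ({p a}, {#})) * dbase c i f m ({}, {#})) *\<^sub>g gone"
    by (rule derived_bracket_function[where X = X and \<Theta> = \<Theta> and f = f, OF pq tp linear_in_expand[OF pq lin]
          linear_in_expand[OF pq linear_in_dbase[OF X]] function_expand(1)[OF f] function_expand(2)[OF f]])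
  then show "\<exists>s. derived_bracket B \<Theta> X f c m = s *\<^sub>g gone" by blast
  show "gint (X c m) (quasi_diff B \<Theta> f c m) = derived_bracket B \<Theta> X f c m"
    unfolding quasi_diff_function(1)[where \<Theta> = \<Theta>, OF pq tp f] d gint_sum_right[OF fin linear_inD(1)[OF lin]]
      gint_linear_right(2)[OF fin linear_inD(1)[OF lin]] pairing[OF pq lin ginv_anchor(1)[OF pq tp]] gscale_gscale
    by (subst gscale_sum_left) (simp add: mult.commute)
qed

lemma linear_in_gint:
  assumes pq: "dual_vars p q" and X: "linear_in q X" and f: "f \<in> ext_poly (p ` {..<r})" "homogeneous 2 f = f"
  shows "linear_in p (gint X f)"
proof -
  have "homogeneous 1 (lderiv j f) = lderiv j f" for j
    using homogeneous_lderiv[OF f(1), of 1 j] f(2) by (simp add: numeral_2_eq_2)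
  then have "linear_in p (lderiv j f)" for j using f(1) by (simp add: linear_in_def)
  then show ?thesis
    unfolding gint_degree_one[OF pq linear_in_expand[OF pq X]] by (intro linear_in_sum)
qed

lemma quasi_diff_section:
  assumes pq: "dual_vars p q" and tp: "anchor_bracket_type p q (\<Theta> c m)" and E: "section_in p E"
  shows "quasi_diff B \<Theta> E c m \<in> ext_poly (p ` {..<r})" "homogeneous 2 (quasi_diff B \<Theta> E c m) = quasi_diff B \<Theta> E c m"
proof -
  have lin: "linear_in p (E c m)" using E by (simp add: section_in_def)
  have dlin: "linear_in p (dpoly c i (E c) m)" for i using linear_in_dbase[OF E] by (simp add: dbase_eq_dpoly)
  have qd: "quasi_diff B \<Theta> E c m = (\<Sum>i<n. pderiv_mom i (\<Theta> c m) \<otimes> dpoly c i (E c) m)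
      + (\<Sum>a<r. rderiv (q a) (\<Theta> c m) \<otimes> lderiv (p a) (E c m))"
    by (rule quasi_diff_coords[where u = E and \<Theta> = \<Theta>, OF pq linear_inD(1)[OF lin]])
  show "quasi_diff B \<Theta> E c m \<in> ext_poly (p ` {..<r})"
    unfolding qd
    by (intro ext_poly_add ext_poly_sum ext_poly_gmult ext_anchor[OF pq tp] ext_bracket[OF pq tp] ext_poly_lderiv
        linear_inD(1)[OF lin] linear_inD(1)[OF dlin])
  have a: "homogeneous 2 (pderiv_mom i (\<Theta> c m) \<otimes> dpoly c i (E c) m) = pderiv_mom i (\<Theta> c m) \<otimes> dpoly c i (E c) m" for i
    using homogeneous_mult_linear[OF linear_inD(1)[OF ginv_anchor(1)[OF pq tp]], of i 2 "dpoly c i (E c) m"]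
      ginv_anchor(1)[OF pq tp, of i] dlin[of i] by (simp add: linear_in_def numeral_2_eq_2)
  have l: "homogeneous 0 (lderiv (p k) (E c m)) = lderiv (p k) (E c m)" for k
    using homogeneous_lderiv[OF linear_inD(1)[OF lin], of 0 "p k"] lin by (simp add: linear_in_def)
  have b: "homogeneous 2 (rderiv (q k) (\<Theta> c m) \<otimes> lderiv (p k) (E c m)) = rderiv (q k) (\<Theta> c m) \<otimes> lderiv (p k) (E c m)" for k
  proof -
    obtain s where e: "lderiv (p k) (E c m) = s *\<^sub>g gone"
      using degree_zero_expand[OF ext_poly_lderiv[OF linear_inD(1)[OF lin]] l] by blast
    show ?thesis
      unfolding e by (simp add: gmult_gone_right[OF ext_bracket[OF pq tp]] homogeneous_scale homogeneous_bracket(1)[OF pq tp])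
  qed
  show "homogeneous 2 (quasi_diff B \<Theta> E c m) = quasi_diff B \<Theta> E c m"
    unfolding qd homogeneous_add homogeneous_sum a b ..
qed

text \<open>
  Each factor of the multivector either contracts with the one-form or passes it with a sign.
\<close>

lemma gint_one_form_mult:
  assumes \<xi>: "linear_in (\<lambda>a. xi a) \<xi>" and f: "f \<in> ext_poly (theta_vars r)" and u: "u \<in> ext_poly T"
  shows "gint f (\<xi> \<otimes> u) = \<xi> \<otimes> gint (ginv f) u - gint (gint \<xi> (ginv f)) u"
proof -
  have S: "finite (theta_vars r)" by simp
  have xf: "finite ((\<lambda>a. xi a) ` {..<r})" by simp
  note xe = linear_inD(1)[OF \<xi>]
  show ?thesis
    using S f
  proof (induction f rule: ext_poly_induct)
    case gone
    show ?case using gint_scalar[OF dual_theta_xi \<xi>, of 1] by simp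
  next
    case (godd k g)
    let ?h = "ginv g"
    have he: "?h \<in> ext_poly (theta_vars r)" using godd(2) by simp
    have kl: "linear_in (\<lambda>a. theta a) (godd k)" using godd(1) linear_in_godd by blast
    obtain s where s: "gint \<xi> (godd k) = s *\<^sub>g gone" using pairing[OF dual_theta_xi \<xi> kl] by blast
    note s = s trans[OF pairing_commute[OF dual_theta_xi \<xi> kl, symmetric] s]
    have \<xi>h: "gint \<xi> ?h \<in> ext_poly (theta_vars r)" by (rule ext_poly_gint[OF xf xe he])
    have d: "gint \<xi> (godd k \<otimes> ?h) = s *\<^sub>g ?h - godd k \<otimes> gint \<xi> ?h"
      using gint_derivation[OF dual_theta_xi \<xi> ext_poly_godd[OF godd(1)] S he] he by (simp add: s)
    have l: "lderiv (oconj k) \<xi> = s *\<^sub>g gone" using s(2) by (simp add: gint_godd)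
    have ge: "gint ?h u \<in> ext_poly T" by (rule ext_poly_gint[OF S he u])
    have gf: "\<And>J K. gint ?h u (J, K) \<noteq> 0 \<Longrightarrow> finite J" using ext_polyD[OF ge] by blast
    have lm: "lderiv (oconj k) (\<xi> \<otimes> gint ?h u) = s *\<^sub>g gint ?h u - \<xi> \<otimes> lderiv (oconj k) (gint ?h u)"
      using lderiv_gmult[OF xf xe gf, where j = "oconj k"] ge by (simp add: l linear_inD(2)[OF \<xi>])
    have gk: "ginv (godd k \<otimes> g) = - (godd k \<otimes> ?h)" by (simp add: ginv_gmult[OF ext_poly_godd[OF godd(1)]])
    have hk: "godd k \<otimes> ?h \<in> ext_poly (theta_vars r)" using godd(1) he by simp
    have "gint (gint \<xi> (- (godd k \<otimes> ?h))) u = - (s *\<^sub>g gint ?h u - lderiv (oconj k) (gint (gint \<xi> ?h) u))"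
    proof -
      have "gint \<xi> (- (godd k \<otimes> ?h)) = (- s) *\<^sub>g ?h + godd k \<otimes> gint \<xi> ?h"
        unfolding gint_minus_right[OF xf xe] d by (simp add: gscale_def fun_eq_iff fun_app)
      then have "gint (gint \<xi> (- (godd k \<otimes> ?h))) u = gint ((- s) *\<^sub>g ?h + godd k \<otimes> gint \<xi> ?h) u" by simp
      also have "\<dots> = gint ((- s) *\<^sub>g ?h) u + gint (godd k \<otimes> gint \<xi> ?h) u"
        by (rule gint_add_left[OF S ext_poly_scale[OF he] ext_poly_gmult[OF ext_poly_godd[OF godd(1)] \<xi>h]])
      also have "\<dots> = (- s) *\<^sub>g gint ?h u + lderiv (oconj k) (gint (gint \<xi> ?h) u)"
        by (simp only: gint_scale_left[OF S he] gint_godd_mult[OF S \<xi>h godd(1)])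
      finally show ?thesis by (simp add: gscale_def fun_eq_iff fun_app)
    qed
    then show ?case
      unfolding gk gint_godd_mult[OF S godd(2,1)] gint_minus_left[OF S hk] gint_godd_mult[OF S he godd(1)] godd(3)
      by (simp add: lderiv_diff lm)
  next
    case (add f g)
    have "gint \<xi> (ginv f) \<in> ext_poly (theta_vars r)" "gint \<xi> (ginv g) \<in> ext_poly (theta_vars r)"
      using ext_poly_gint[OF xf xe] add(1,2) by simp_all
    with add show ?case by (simp add: gint_add_left[OF S] gint_linear_right[OF xf xe])
  next
    case (scale s g)
    have "gint \<xi> (ginv g) \<in> ext_poly (theta_vars r)" using ext_poly_gint[OF xf xe] scale(1) by simp
    with scale show ?case
      by (simp add: gint_scale_left[OF S] gint_linear_right[OF xf xe])
  qed
qed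

lemma forms_deg_induct [consumes 1, case_names deg add]:
  assumes u: "u \<in> forms B" and deg: "\<And>k v. v \<in> forms_deg B k \<Longrightarrow> P v"
    and add: "\<And>v w. v \<in> forms B \<Longrightarrow> w \<in> forms B \<Longrightarrow> P v \<Longrightarrow> P w \<Longrightarrow> P (v + w)"
  shows "P u"
proof -
  have sf: "shom k u \<in> forms B" for k by (rule forms_deg_forms[OF forms_deg_shom[OF u]])
  have "(\<Sum>k\<le>N. shom k u) \<in> forms B \<and> P (\<Sum>k\<le>N. shom k u)" for N
  proof (induction N)
    case 0
    show ?case using sf deg[OF forms_deg_shom[OF u]] by simp
  next
    case (Suc N)
    then show ?case using sf deg[OF forms_deg_shom[OF u]] by (simp add: add)
  qed
  then show ?thesis using subst[OF forms_eq_sum_shom[OF u, symmetric], of P] by blast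
qed

end

section \<open>Sections, functions and the generator\<close>

lemma sscale_one [simp]: "1 *\<^sub>s u = u" "(-1) *\<^sub>s u = - u"
  by (rule sfield_ext, simp add: sscale_def gscale_def fun_eq_iff fun_app)+

lemma sscale_add_right: "s *\<^sub>s (u + v) = s *\<^sub>s u + s *\<^sub>s v" "s *\<^sub>s (u - v) = s *\<^sub>s u - s *\<^sub>s v"
  by (rule sfield_ext, simp add: sscale_def gscale_def fun_eq_iff fun_app algebra_simps)+

lemma smult_sscale: "u \<odot> (s *\<^sub>s v) = s *\<^sub>s (u \<odot> v)"
  by (rule sfield_ext) (simp add: sscale_def smult_def gmult_scale_right)

lemma iprod_apply: "iprod X F c m = gint (X c m) (F c m)"
  by (simp add: iprod_def)

context smooth_bundle
begin

lemma linear_in_minus: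
  assumes "linear_in q g"
  shows "linear_in q (- g)"
proof -
  have e: "- g = (-1) *\<^sub>g g" by (simp add: gscale_def fun_eq_iff fun_app)
  show ?thesis using assms by (simp only: linear_in_def e homogeneous_scale ext_poly_scale simp_thms)
qed

lemma anchor_bracket_typeI:
  assumes pq: "dual_vars p q" and \<Theta>: "\<Theta> \<in> sfunctions B"
    and h: "\<And>c m J K. \<Theta> c m (J, K) \<noteq> 0 \<Longrightarrow> (\<exists>a i. J = {p a} \<and> K = {#i#}) \<or>
        (\<exists>a b k. a \<noteq> b \<and> J = {p a, p b, q k} \<and> K = {#})"
  shows "anchor_bracket_type p q (\<Theta> c m)"
  unfolding anchor_bracket_type_def
proof (intro allI impI)
  fix J K assume nz: "\<Theta> c m (J, K) \<noteq> 0"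
  have b: "a < r" if "p a < 2 * r \<or> q a < 2 * r" for a using that pq by (auto simp: dual_vars_def)
  note J = sfunctionsD(2)[OF \<Theta> nz] and K = sfunctionsD(3)[OF \<Theta> nz]
  from h[OF nz] show "(\<exists>a<r. \<exists>i<n. J = {p a} \<and> K = {#i#}) \<or>
     (\<exists>a<r. \<exists>b<r. \<exists>k<r. a \<noteq> b \<and> J = {p a, p b, q k} \<and> K = {#})"
  proof (elim disjE exE conjE)
    fix a i assume e: "J = {p a}" "K = {#i#}"
    have "a < r" "i < n" using J K b[of a] e by auto
    with e show ?thesis by blast
  next
    fix a b' k assume e: "a \<noteq> b'" "J = {p a, p b', q k}" "K = {#}"
    have "a < r" "b' < r" "k < r" using J b[of a] b[of b'] b[of k] e by auto
    with e show ?thesis by blast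
  qed
qed

lemma homogeneous_multivectors_deg:
  assumes "X \<in> multivectors_deg B k"
  shows "homogeneous k (X c m) = X c m"
proof (rule HOL.ext, clarify)
  fix J K
  show "homogeneous k (X c m) (J, K) = X c m (J, K)"
  proof (cases "X c m (J, K) = 0")
    case False
    then have "K = {#}" "card J + 2 * size K = k"
      using assms unfolding multivectors_deg_def multivectors_def sfunctions_deg_def by blast+
    then show ?thesis by (simp add: homogeneous_def)
  qed (simp add: homogeneous_def)
qed

lemma multivector_section:
  assumes "x \<in> multivectors_deg B 1"
  shows "x \<in> multivectors B" "section_in (\<lambda>a. theta a) x" "linear_in (\<lambda>a. theta a) (x c m)"
proof -
  show x: "x \<in> multivectors B" using assms by (simp add: multivectors_deg_def)
  have l: "linear_in (\<lambda>a. theta a) (x c m)" for c m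
    unfolding linear_in_def using multivectorsD(2)[OF x] homogeneous_multivectors_deg[OF assms] by blast
  then show "linear_in (\<lambda>a. theta a) (x c m)" .
  show "section_in (\<lambda>a. theta a) x" unfolding section_in_def using l multivectorsD(3)[OF x] by blast
qed

lemma form_section:
  assumes "\<xi> \<in> forms_deg B 1"
  shows "\<xi> \<in> forms B" "section_in (\<lambda>a. xi a) \<xi>" "linear_in (\<lambda>a. xi a) (\<xi> c m)" "grading_inv \<xi> = - \<xi>"
proof -
  show x: "\<xi> \<in> forms B" by (rule forms_deg_forms[OF assms])
  have l: "linear_in (\<lambda>a. xi a) (\<xi> c m)" for c m
    unfolding linear_in_def using formsD(2)[OF x] homogeneous_forms_deg[OF assms] by blast
  then show "linear_in (\<lambda>a. xi a) (\<xi> c m)" .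
  show "section_in (\<lambda>a. xi a) \<xi>" unfolding section_in_def using l formsD(3)[OF x] by blast
  show "grading_inv \<xi> = - \<xi>" using grading_inv_forms_deg[OF assms] by simp
qed

lemma iprod_commute:
  assumes "dual_vars p q" "section_in q X" "section_in p E"
  shows "iprod X E = iprod E X"
  by (rule sfield_ext) (use assms in \<open>simp add: iprod_def section_in_def pairing_commute[of p q]\<close>)

lemma forms_deg_0I:
  assumes u: "u \<in> forms B" and s: "\<And>c m. c \<in> atlas B \<Longrightarrow> m \<in> cdom c \<Longrightarrow> \<exists>s. u c m = s *\<^sub>g gone"
  shows "u \<in> forms_deg B 0"
proof (rule forms_degI[OF u])
  fix c m
  show "homogeneous 0 (u c m) = u c m"
  proof (cases "c \<in> atlas B \<and> m \<in> cdom c")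
    case True
    then obtain s0 where "u c m = s0 *\<^sub>g gone" using s by blast
    then show ?thesis by (simp add: homogeneous_scale homogeneous_gone)
  next
    case False
    then show ?thesis using formsD(1)[OF u, of c m] by simp
  qed
qed

lemma iprod_linear_function:
  assumes W: "\<And>c m. c \<in> atlas B \<Longrightarrow> m \<in> cdom c \<Longrightarrow> linear_at (\<lambda>a. theta a) (W c m)" and f: "f \<in> forms_deg B 0"
  shows "iprod W f = 0"
proof (rule sfield_eqI)
  fix c m assume c: "c \<in> atlas B" "m \<in> cdom c"
  obtain g where g: "linear_in (\<lambda>a. theta a) g" "gint (W c m) (f c m) = gint g (f c m)"
    using gint_linear_at[OF dual_xi_theta W[OF c]] by blast
  obtain s where "f c m = s *\<^sub>g gone" using function_expand(1)[OF f] by blast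
  then show "iprod W f c m = 0 c m" using g gint_scalar[OF dual_xi_theta g(1)] by (simp add: iprod_def zero_fun_apply)
next
  fix c m assume "c \<notin> atlas B \<or> m \<notin> cdom c"
  then show "iprod W f c m = 0" using formsD(1)[OF forms_deg_forms[OF f], of c m] by (simp add: iprod_def)
qed (simp add: zero_fun_apply)

lemma linear_at_derived_bracket:
  assumes pq: "dual_vars p q" and tp: "anchor_bracket_type p q (\<Theta> c m)"
    and X: "section_in q X" and Y: "section_in q Y"
  shows "linear_at q (derived_bracket B \<Theta> X Y c m)"
proof -
  have l: "linear_in q (X c m)" "linear_in q (Y c m)" using X Y by (simp_all add: section_in_def)
  show ?thesis
    unfolding linear_at_def
    using derived_bracket_support[where X = X and Y = Y and \<Theta> = \<Theta>, OF pq tp linear_in_expand[OF pq l(1)]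
        linear_in_expand[OF pq linear_in_dbase[OF X]] linear_in_expand[OF pq l(2)]
        linear_in_expand[OF pq linear_in_dbase[OF Y]]] by blast
qed

lemma odd_derivation_iprod:
  assumes x: "x \<in> multivectors_deg B 1"
  shows "odd_derivation (iprod x)"
proof -
  note s = multivector_section[OF x]
  have "derivation True (iprod x)" by (rule derivation_iprod) (rule linear_in_linear_at[OF s(3)])
  then show ?thesis
    using odd_op_iprod[OF s(1) linear_inD(2)[OF s(3)]] unfolding odd_derivation_def derivation_def by simp
qed

lemma iprod_function: "x \<in> multivectors_deg B 1 \<Longrightarrow> f \<in> forms_deg B 0 \<Longrightarrow> iprod x f = 0"
  by (rule iprod_linear_function[OF linear_in_linear_at[OF multivector_section(3)]])

lemma iprod_function_mult:
  "x \<in> multivectors_deg B 1 \<Longrightarrow> f \<in> forms_deg B 0 \<Longrightarrow> u \<in> forms B \<Longrightarrow> iprod x (f \<odot> u) = f \<odot> iprod x u"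
  using odd_derivationD(2)[OF odd_derivation_iprod, of x f u]
  by (simp add: iprod_function forms_deg_forms grading_inv_forms_deg)

lemma iprod_one_form_mult:
  "x \<in> multivectors_deg B 1 \<Longrightarrow> \<xi> \<in> forms_deg B 1 \<Longrightarrow> u \<in> forms B \<Longrightarrow>
    iprod x (\<xi> \<odot> u) = iprod x \<xi> \<odot> u - \<xi> \<odot> iprod x u"
  using odd_derivationD(2)[OF odd_derivation_iprod, of x \<xi> u]
  by (simp add: form_section(4) forms_deg_forms)

lemma iprod_one_form:
  assumes x: "x \<in> multivectors_deg B 1" and \<xi>: "\<xi> \<in> forms_deg B 1"
  shows "iprod x \<xi> \<in> forms_deg B 0" "iprod \<xi> x = iprod x \<xi>"
proof -
  show "iprod x \<xi> \<in> forms_deg B 0"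
  proof (rule forms_deg_0I)
    fix c m show "\<exists>s. iprod x \<xi> c m = s *\<^sub>g gone"
      using pairing[OF dual_xi_theta multivector_section(3)[OF x] form_section(3)[OF \<xi>]] unfolding iprod_def by blast
  qed (simp add: multivector_section(1)[OF x] form_section(1)[OF \<xi>])
  show "iprod \<xi> x = iprod x \<xi>"
    by (rule iprod_commute[OF dual_theta_xi form_section(2)[OF \<xi>] multivector_section(2)[OF x]])
qed

lemma iprod_anticommute:
  assumes x: "x \<in> multivectors_deg B 1" and u: "u \<in> forms B"
    and W: "\<And>c m. c \<in> atlas B \<Longrightarrow> m \<in> cdom c \<Longrightarrow> W c m \<in> ext_poly (theta_vars r) \<and> ginv (W c m) = - W c m"
  shows "iprod x (iprod W u) = - iprod W (iprod x u)"
proof (rule sfield_eqI)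
  have fin: "finite (theta_vars r)" by simp
  note lx = multivector_section(3)[OF x]
  fix c m assume c: "c \<in> atlas B" "m \<in> cdom c"
  have "gint (x c m) (gint (W c m) (u c m)) = gint (ginv (W c m)) (gint (x c m) (u c m))"
    by (rule gint_odd_commute[OF fin linear_inD[OF lx]]) (use W[OF c] in blast)
  also have "\<dots> = gint (- W c m) (gint (x c m) (u c m))" using W[OF c] by simp
  also have "\<dots> = - gint (W c m) (gint (x c m) (u c m))" by (rule gint_minus_left[OF fin]) (use W[OF c] in blast)
  finally show "iprod x (iprod W u) c m = (- iprod W (iprod x u)) c m"
    by (simp only: uminus_apply iprod_apply)
next
  fix c m assume o: "c \<notin> atlas B \<or> m \<notin> cdom c"
  show "iprod x (iprod W u) c m = 0" by (simp add: iprod_apply formsD(1)[OF u o])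
  show "(- iprod W (iprod x u)) c m = 0" unfolding uminus_apply[of "iprod W (iprod x u)"] by (simp add: iprod_apply uminus_apply[of "iprod W (iprod x u) c"] formsD(1)[OF u o])
qed

text \<open>The expression to which a double graded commutator with odd operators reduces.\<close>

definition double_comm ::
  "('m, 'a) soperator \<Rightarrow> ('m, 'a) soperator \<Rightarrow> ('m, 'a) soperator \<Rightarrow> ('m, 'a) soperator" where
  "double_comm P D Q u = P (D (Q u)) + D (P (Q u)) - Q (P (D u)) - Q (D (P u))"

lemma double_comm_deriving:
  assumes P: "odd_op P" and Q: "odd_op Q" and D: "odd_op D" "odd_op E" "odd_op F" "odd_op H" and u: "u \<in> forms B"
  shows "gcomm (gcomm P (\<lambda>u. D u - E u + F u + H u)) Q u =
    double_comm P D Q u - double_comm P E Q u + double_comm P F Q u + double_comm P H Q u"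
proof -
  note p = odd_opD[OF P] and q = odd_opD[OF Q] and d = odd_opD[OF D(1)] odd_opD[OF D(2)] odd_opD[OF D(3)] odd_opD[OF D(4)]
  have "odd_op (\<lambda>u. D u - E u + F u + H u)"
    unfolding odd_op_def by (simp add: d algebra_simps)
  note e = gcomm_gcomm[OF P this Q u]
  show ?thesis
    unfolding e double_comm_def by (simp add: u p q d algebra_simps)
qed

lemma odd_form_anticommute:
  assumes \<xi>: "\<xi> \<in> forms_deg B 1" and \<psi>: "\<psi> \<in> forms B" "grading_inv \<psi> = - \<psi>" and u: "u \<in> forms B"
  shows "\<xi> \<odot> (\<psi> \<odot> u) = - (\<psi> \<odot> (\<xi> \<odot> u))"
proof -
  have "\<xi> \<odot> \<psi> = - (\<psi> \<odot> \<xi>)"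
    using smult_commute_odd[OF form_section(1)[OF \<xi>] \<psi>(1) form_section(4)[OF \<xi>]] \<psi>(2) by simp
  then show ?thesis
    using smult_assoc[OF form_section(1)[OF \<xi>] \<psi>(1), of u] smult_assoc[OF \<psi>(1) form_section(1)[OF \<xi>], of u] by simp
qed

end

locale generated_double = smooth_bundle B for B :: "('m, 'a) vbundle" +
  fixes \<mu> \<gamma> \<phi> \<psi> :: "('m, 'a) sfield"
    and G :: "('m, 'a) sfield \<Rightarrow> ('m, 'a) sfield \<Rightarrow> ('m, 'a) sfield"
    and \<delta> :: "('m, 'a) sfield \<Rightarrow> ('m, 'a) sfield"
  assumes proto: "proto_bialgebroid B \<mu> \<gamma> \<phi> \<psi>"
    and bracket: "gerstenhaber_bracket B \<gamma> G"
    and generator: "generator B G \<delta>"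
begin

lemma in_sfunctions: "\<mu> \<in> sfunctions B" "\<gamma> \<in> sfunctions B" and \<phi>: "\<phi> \<in> multivectors_deg B 3" and \<psi>: "\<psi> \<in> forms_deg B 3"
  using proto unfolding proto_bialgebroid_def sfunctions_deg_def by blast+

lemma mu_type: "anchor_bracket_type (\<lambda>a. xi a) (\<lambda>a. theta a) (\<mu> c m)"
  by (rule anchor_bracket_typeI[OF dual_xi_theta in_sfunctions(1)])
    (rule proto[unfolded proto_bialgebroid_def, THEN conjunct2, THEN conjunct1, rule_format])

lemma gamma_type: "anchor_bracket_type (\<lambda>a. theta a) (\<lambda>a. xi a) (\<gamma> c m)"
  by (rule anchor_bracket_typeI[OF dual_theta_xi in_sfunctions(2)])
    (rule proto[unfolded proto_bialgebroid_def, THEN conjunct2, THEN conjunct2, THEN conjunct2, THEN conjunct1, rule_format])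

lemma phi_props: "\<phi> \<in> multivectors B" "\<phi> c m \<in> ext_poly (theta_vars r)" "ginv (\<phi> c m) = - \<phi> c m"
proof -
  show p: "\<phi> \<in> multivectors B" using \<phi> by (simp add: multivectors_deg_def)
  show "\<phi> c m \<in> ext_poly (theta_vars r)" by (rule multivectorsD(2)[OF p])
  show "ginv (\<phi> c m) = - \<phi> c m"
    using ginv_homogeneous[OF homogeneous_multivectors_deg[OF \<phi>], of c m] by (simp add: gscale_def fun_eq_iff fun_app)
qed

lemma psi_props: "\<psi> \<in> forms B" "grading_inv \<psi> = - \<psi>"
  using forms_deg_forms[OF \<psi>] grading_inv_forms_deg[OF \<psi>] by simp_all

lemmas d_derivation = odd_derivation_quasi_diff(1)[OF in_sfunctions(1) mu_type]
lemmas d_op = odd_derivationD(1)[OF d_derivation]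
lemmas d_mult = odd_derivationD(2)[OF d_derivation]
lemmas iphi_op = odd_op_iprod[OF phi_props(1,3)]
lemmas epsi_op = odd_op_eprod[OF psi_props]

lemma delta_linear: "linear_operator B \<delta>"
  using generator unfolding generator_def by blast

lemma delta_function: "f \<in> forms_deg B 0 \<Longrightarrow> \<delta> f = 0"
  using generator unfolding generator_def by blast

lemma delta_deg: "u \<in> forms_deg B (Suc p) \<Longrightarrow> \<delta> u \<in> forms_deg B p"
  using generator unfolding generator_def by blast

lemma generator_eq: "u \<in> forms_deg B p \<Longrightarrow> v \<in> forms B \<Longrightarrow>
    G u v = (-1) ^ p *\<^sub>s (\<delta> (u \<odot> v) - \<delta> u \<odot> v - (-1) ^ p *\<^sub>s (u \<odot> \<delta> v))"
  using generator unfolding generator_def by blast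

lemma delta_op: "odd_op \<delta>"
proof -
  have F: "\<delta> u \<in> forms B" if "u \<in> forms B" for u
    using delta_linear that unfolding linear_operator_def by blast
  have A: "\<delta> (u + v) = \<delta> u + \<delta> v" if "u \<in> forms B" "v \<in> forms B" for u v
    using delta_linear that unfolding linear_operator_def by blast
  have "\<delta> ((-1) *\<^sub>s u) = (-1) *\<^sub>s \<delta> u" if "u \<in> forms B" for u
    using delta_linear that unfolding linear_operator_def by blast
  then have M: "\<delta> (- u) = - \<delta> u" if "u \<in> forms B" for u using that by simp
  have "grading_inv (\<delta> u) = - \<delta> (grading_inv u)" if "u \<in> forms B" for u
    using that
  proof (induction u rule: forms_deg_induct)
    case (deg k v)
    then show ?case
    proof (cases k)
      case 0
      then show ?thesis using deg delta_function[of v] grading_inv_forms_deg[OF deg] by simp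
    next
      case (Suc p)
      have "\<delta> v \<in> forms_deg B p" using deg Suc delta_deg by blast
      then show ?thesis using Suc M[OF forms_deg_forms[OF deg]] grading_inv_forms_deg[OF deg] grading_inv_forms_deg[of "\<delta> v" p] by simp
    qed
  qed (simp add: A)
  then show ?thesis unfolding odd_op_def using F A by simp
qed

lemmas delta_simps = odd_opD[OF delta_op]

lemma delta_function_mult:
  assumes f: "f \<in> forms_deg B 0" and v: "v \<in> forms B"
  shows "\<delta> (f \<odot> v) = G f v + f \<odot> \<delta> v"
  using generator_eq[OF f v] by (simp add: delta_function[OF f])

lemma delta_one_form_mult:
  assumes \<xi>: "\<xi> \<in> forms_deg B 1" and v: "v \<in> forms B"
  shows "\<delta> (\<xi> \<odot> v) = \<delta> \<xi> \<odot> v - G \<xi> v - \<xi> \<odot> \<delta> v"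
  using generator_eq[OF \<xi> v] by (simp add: algebra_simps)

lemma delta_one_form: "\<xi> \<in> forms_deg B 1 \<Longrightarrow> \<delta> \<xi> \<in> forms_deg B 0"
  by (rule delta_deg) simp

lemma bracket_add: "u \<in> forms B \<Longrightarrow> v \<in> forms B \<Longrightarrow> w \<in> forms B \<Longrightarrow> G u (v + w) = G u v + G u w"
  using bracket[unfolded gerstenhaber_bracket_def, THEN conjunct1] by blast

lemma bracket_functions: "f \<in> forms_deg B 0 \<Longrightarrow> g \<in> forms_deg B 0 \<Longrightarrow> G f g = 0"
  using bracket[unfolded gerstenhaber_bracket_def, THEN conjunct2, THEN conjunct1] by blast

lemma bracket_deg: "p + q = Suc k \<Longrightarrow> u \<in> forms_deg B p \<Longrightarrow> v \<in> forms_deg B q \<Longrightarrow> G u v \<in> forms_deg B k"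
  using bracket[unfolded gerstenhaber_bracket_def, THEN conjunct2, THEN conjunct2, THEN conjunct1] by blast

lemma bracket_one_forms: "\<xi> \<in> forms_deg B 1 \<Longrightarrow> \<eta> \<in> forms_deg B 1 \<Longrightarrow> G \<xi> \<eta> = derived_bracket B \<gamma> \<xi> \<eta>"
  using bracket[unfolded gerstenhaber_bracket_def, THEN conjunct2, THEN conjunct2, THEN conjunct2, THEN conjunct1] by blast

lemma bracket_anchor: "\<xi> \<in> forms_deg B 1 \<Longrightarrow> f \<in> forms_deg B 0 \<Longrightarrow> G \<xi> f = derived_bracket B \<gamma> \<xi> f"
  using bracket[unfolded gerstenhaber_bracket_def, THEN conjunct2, THEN conjunct2, THEN conjunct2, THEN conjunct2, THEN conjunct1] by blast

lemma bracket_skew: "u \<in> forms_deg B p \<Longrightarrow> v \<in> forms_deg B q \<Longrightarrow> G u v = - ((-1) ^ ((p + 1) * (q + 1)) *\<^sub>s G v u)"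
  using bracket[unfolded gerstenhaber_bracket_def, THEN conjunct2, THEN conjunct2, THEN conjunct2, THEN conjunct2, THEN conjunct2, THEN conjunct1] by blast

lemma bracket_Leibniz: "u \<in> forms_deg B p \<Longrightarrow> v \<in> forms_deg B q \<Longrightarrow> w \<in> forms B \<Longrightarrow>
    G u (v \<odot> w) = G u v \<odot> w + (-1) ^ ((p + 1) * q) *\<^sub>s (v \<odot> G u w)"
  using bracket[unfolded gerstenhaber_bracket_def, THEN conjunct2, THEN conjunct2, THEN conjunct2, THEN conjunct2, THEN conjunct2, THEN conjunct2] by blast

lemma bracket_function_one_form:
  "f \<in> forms_deg B 0 \<Longrightarrow> \<eta> \<in> forms_deg B 1 \<Longrightarrow> G f \<eta> = - derived_bracket B \<gamma> \<eta> f"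
  using bracket_skew[of f 0 \<eta> 1] by (simp add: bracket_anchor)

text \<open>
  Parity is read off from the generator; the product rule extends from homogeneous factors by additivity.
\<close>

lemma odd_derivation_bracket:
  assumes f: "f \<in> forms_deg B 0"
  shows "odd_derivation (G f)"
proof -
  have e: "G f v = \<delta> (f \<odot> v) - f \<odot> \<delta> v" if "v \<in> forms B" for v using delta_function_mult[OF f that] by simp
  note F = forms_deg_forms[OF f]
  have "G f (u \<odot> v) = G f u \<odot> v + grading_inv u \<odot> G f v" if "u \<in> forms B" and v: "v \<in> forms B" for u v
    using that(1)
  proof (induction u rule: forms_deg_induct)
    case (deg k u)
    then show ?case using bracket_Leibniz[OF f deg v] grading_inv_forms_deg[OF deg] by (cases "even k") simp_all
  next
    case (add u w)
    then show ?case using v bracket_add[OF F, of "u \<odot> v" "w \<odot> v"] bracket_add[OF F, of u w] by (simp add: algebra_simps)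
  qed
  moreover have "odd_op (G f)"
    unfolding odd_op_def by (simp add: e F delta_simps grading_inv_smult[OF F] grading_inv_forms_deg[OF f] algebra_simps)
  ultimately show ?thesis unfolding odd_derivation_def by blast
qed

lemma even_derivation_bracket:
  assumes \<xi>: "\<xi> \<in> forms_deg B 1"
  shows "even_derivation (G \<xi>)"
proof -
  have e: "G \<xi> v = \<delta> \<xi> \<odot> v - \<delta> (\<xi> \<odot> v) - \<xi> \<odot> \<delta> v" if "v \<in> forms B" for v
    using delta_one_form_mult[OF \<xi> that] by (simp add: algebra_simps)
  note F = forms_deg_forms[OF \<xi>] and a = forms_deg_forms[OF delta_one_form[OF \<xi>]]
  have "G \<xi> (u \<odot> v) = G \<xi> u \<odot> v + u \<odot> G \<xi> v" if "u \<in> forms B" and v: "v \<in> forms B" for u v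
    using that(1)
  proof (induction u rule: forms_deg_induct)
    case (deg k u)
    have p: "(-1 :: real) ^ ((1 + 1) * k) = 1" by (simp only: one_add_one power_mult) simp
    show ?case using bracket_Leibniz[OF \<xi> deg v] unfolding p by simp
  next
    case (add u w)
    then show ?case using v bracket_add[OF F, of "u \<odot> v" "w \<odot> v"] bracket_add[OF F, of u w] by (simp add: algebra_simps)
  qed
  moreover have "G \<xi> u \<in> forms B \<and> grading_inv (G \<xi> u) = G \<xi> (grading_inv u)" if "u \<in> forms B" for u
    using that by (simp add: e F a delta_simps grading_inv_smult[OF F] grading_inv_smult[OF a]
        grading_inv_forms_deg[OF delta_one_form[OF \<xi>]] form_section(4)[OF \<xi>] algebra_simps)
  ultimately show ?thesis unfolding even_derivation_def using bracket_add[OF F] by blast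
qed

section \<open>Double commutators of the quasi-differential\<close>

text \<open>
  Both sides are derivations that kill functions, so that the identity needs checking on one-forms only,
  where it is Cartan's formula.
\<close>

lemma double_comm_d_vectors:
  assumes x: "x \<in> multivectors_deg B 1" and y: "y \<in> multivectors_deg B 1" and u: "u \<in> forms B"
  shows "double_comm (iprod x) (quasi_diff B \<mu>) (iprod y) u = iprod (derived_bracket B \<mu> x y) u"
proof -
  let ?d = "quasi_diff B \<mu>" and ?W = "derived_bracket B \<mu> x y"
  note ix = odd_derivation_iprod[OF x] and iy = odd_derivation_iprod[OF y]
  note X = odd_opD[OF odd_derivationD(1)[OF ix]] and Y = odd_opD[OF odd_derivationD(1)[OF iy]] and d = odd_opD[OF d_op]
  note D = even_odd_derivation_commutator[OF odd_derivation_commutator[OF ix d_derivation] iy]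
  have W: "linear_at (\<lambda>a. theta a) (?W c m)" for c m
    by (rule linear_at_derived_bracket[OF dual_xi_theta mu_type multivector_section(2)[OF x] multivector_section(2)[OF y]])
  have xd: "iprod z (?d f) c m = derived_bracket B \<mu> z f c m" "\<exists>s. derived_bracket B \<mu> z f c m = s *\<^sub>g gone"
    if "z \<in> multivectors_deg B 1" "f \<in> forms_deg B 0" for z f c m
    unfolding iprod_def
    by (rule gint_quasi_diff_function[where \<Theta> = \<mu>, OF dual_xi_theta mu_type multivector_section(2)[OF that(1)] that(2)])+
  have xd0: "iprod x (?d f) \<in> forms_deg B 0" if f: "f \<in> forms_deg B 0" for f
    by (rule forms_deg_0I) (use xd[OF x f] d(1) X(1) forms_deg_forms[OF f] in auto)
  have f0: "?d (iprod x (iprod y f)) = 0" "iprod x (?d (iprod y f)) = 0" "iprod y (iprod x (?d f) + ?d (iprod x f)) = 0"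
    if f: "f \<in> forms_deg B 0" for f
    using iprod_function[OF y xd0[OF f]] by (simp_all add: iprod_function[OF x f] iprod_function[OF y f] X Y d)
  have f1: "iprod x (?d (iprod y \<xi>)) + ?d (iprod x (iprod y \<xi>)) - iprod y (iprod x (?d \<xi>) + ?d (iprod x \<xi>)) = iprod ?W \<xi>"
    if \<xi>: "\<xi> \<in> forms_deg B 1" for \<xi>
  proof (rule sfield_eqI)
    note F = form_section(1)[OF \<xi>] and gx = iprod_one_form(1)[OF x \<xi>] and gy = iprod_one_form(1)[OF y \<xi>]
    have l: "iprod x (?d (iprod y \<xi>)) + ?d (iprod x (iprod y \<xi>)) - iprod y (iprod x (?d \<xi>) + ?d (iprod x \<xi>)) =
      iprod x (?d (iprod y \<xi>)) - iprod y (iprod x (?d \<xi>)) - iprod y (?d (iprod x \<xi>))" (is "?L = ?R")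
      using F by (simp add: iprod_function[OF x gy] d X Y algebra_simps)
    have "?R \<in> forms B" using F X Y d by simp
    fix c m
    show "?L c m = 0" if "c \<notin> atlas B \<or> m \<notin> cdom c"
      unfolding l by (rule formsD(1)[OF \<open>?R \<in> forms B\<close> that])
    show "iprod ?W \<xi> c m = 0" if "c \<notin> atlas B \<or> m \<notin> cdom c"
      using formsD(1)[OF F that] by (simp add: iprod_def)
    show "?L c m = iprod ?W \<xi> c m" if c: "c \<in> atlas B" "m \<in> cdom c"
      using Cartan_formula[where \<Theta> = \<mu>, OF dual_xi_theta mu_type multivector_section(2)[OF x]
          multivector_section(2)[OF y] form_section(2)[OF \<xi>] c]
      unfolding l by (simp add: fun_app xd(1)[OF x gy] xd(1)[OF y gx]) (simp add: iprod_def)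
  qed
  have "iprod x (?d (iprod y u)) + ?d (iprod x (iprod y u)) - iprod y (iprod x (?d u) + ?d (iprod x u)) = iprod ?W u"
  proof (rule derivation_eqI[OF derivation_odd[OF D] derivation_iprod, OF _ _ _ _ u])
    show "linear_at (\<lambda>a. theta a) (?W c m)" for c m by (rule W)
  next
    fix f assume f: "f \<in> forms_deg B 0"
    show "iprod x (?d (iprod y f)) + ?d (iprod x (iprod y f)) - iprod y (iprod x (?d f) + ?d (iprod x f)) = 0"
      by (simp only: f0[OF f]) simp
    show "iprod ?W f = 0" by (rule iprod_linear_function[OF W f])
  qed (rule f1)
  then show ?thesis using u by (simp add: double_comm_def X Y d algebra_simps)
qed

lemma d_one_form_mult: "\<xi> \<in> forms_deg B 1 \<Longrightarrow> u \<in> forms B \<Longrightarrow>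
    quasi_diff B \<mu> (\<xi> \<odot> u) = quasi_diff B \<mu> \<xi> \<odot> u - \<xi> \<odot> quasi_diff B \<mu> u"
  using d_mult[of \<xi> u] by (simp add: form_section forms_deg_forms)

lemma lie_deriv_mu:
  assumes x: "x \<in> multivectors_deg B 1" and \<xi>: "\<xi> \<in> forms_deg B 1"
  shows "lie_deriv B \<mu> x \<xi> = iprod x (quasi_diff B \<mu> \<xi>) + quasi_diff B \<mu> (iprod x \<xi>)"
  unfolding lie_deriv_def
  using odd_opD[OF odd_derivationD(1)[OF odd_derivation_iprod[OF x]]] odd_opD[OF d_op] form_section(1)[OF \<xi>]
  by (intro gcomm_odd_odd) simp_all

text \<open>
  The inner graded commutator of the quasi-differential with an interior product is an even derivation and that with
  an exterior product is an exterior product, so that the product rule evaluates the outer one.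
\<close>

lemma double_comm_d_mixed:
  assumes x: "x \<in> multivectors_deg B 1" and \<xi>: "\<xi> \<in> forms_deg B 1" and u: "u \<in> forms B"
  shows "double_comm (iprod x) (quasi_diff B \<mu>) (eprod \<xi>) u = eprod (lie_deriv B \<mu> x \<xi>) u"
    and "double_comm (eprod \<xi>) (quasi_diff B \<mu>) (iprod x) u = - eprod (iprod x (quasi_diff B \<mu> \<xi>)) u"
proof -
  let ?d = "quasi_diff B \<mu>"
  note ix = odd_derivation_iprod[OF x] and F = form_section(1)[OF \<xi>]
  note X = odd_opD[OF odd_derivationD(1)[OF ix]] and d = odd_opD[OF d_op]
  note E = even_derivationD(4)[OF odd_derivation_commutator[OF ix d_derivation] F u]
  show "double_comm (iprod x) ?d (eprod \<xi>) u = eprod (lie_deriv B \<mu> x \<xi>) u"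
    unfolding lie_deriv_mu[OF x \<xi>] double_comm_def eprod_def using E by (simp add: algebra_simps)
  have "grading_inv (?d \<xi>) = ?d \<xi>" using d F form_section(4)[OF \<xi>] by simp
  then have "iprod x (?d \<xi> \<odot> u) = iprod x (?d \<xi>) \<odot> u + ?d \<xi> \<odot> iprod x u"
    using odd_derivationD(2)[OF ix d(1)[OF F] u] by simp
  then show "double_comm (eprod \<xi>) ?d (iprod x) u = - eprod (iprod x (?d \<xi>)) u"
    unfolding double_comm_def eprod_def using F u
    by (simp add: d_one_form_mult[OF \<xi>] iprod_one_form_mult[OF x \<xi>] X d algebra_simps)
qed

lemma double_comm_d_forms:
  assumes \<xi>: "\<xi> \<in> forms_deg B 1" and \<eta>: "\<eta> \<in> forms_deg B 1" and u: "u \<in> forms B"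
  shows "double_comm (eprod \<xi>) (quasi_diff B \<mu>) (eprod \<eta>) u = 0"
proof -
  let ?d = "quasi_diff B \<mu>"
  note F = form_section(1)[OF \<xi>] and E = form_section(1)[OF \<eta>] and d = odd_opD[OF d_op]
  have "?d \<xi> \<odot> \<eta> = \<eta> \<odot> ?d \<xi>"
    by (rule smult_commute_even) (use d F E form_section(4)[OF \<xi>] in simp_all)
  then have "?d \<xi> \<odot> (\<eta> \<odot> u) = \<eta> \<odot> (?d \<xi> \<odot> u)"
    using smult_assoc[OF d(1)[OF F] E, of u] smult_assoc[OF E d(1)[OF F], of u] by simp
  then show ?thesis
    unfolding double_comm_def eprod_def using F E u
    by (simp add: d_one_form_mult[OF \<xi>] d algebra_simps)
qed

section \<open>Double commutators of the generator\<close>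

lemma gamma_linear:
  assumes \<xi>: "\<xi> \<in> forms_deg B 1" and x: "x \<in> multivectors_deg B 1" and f: "f \<in> forms_deg B 0"
  shows "linear_in (\<lambda>a. theta a) (iprod \<xi> (quasi_diff B \<gamma> x) c m)" "linear_in (\<lambda>a. theta a) (quasi_diff B \<gamma> f c m)"
    "gint (\<xi> c m) (quasi_diff B \<gamma> f c m) = derived_bracket B \<gamma> \<xi> f c m" "\<exists>s. derived_bracket B \<gamma> \<xi> f c m = s *\<^sub>g gone"
proof -
  show "linear_in (\<lambda>a. theta a) (iprod \<xi> (quasi_diff B \<gamma> x) c m)"
    unfolding iprod_def
    by (rule linear_in_gint[OF dual_theta_xi form_section(3)[OF \<xi>]
        quasi_diff_section[where \<Theta> = \<gamma>, OF dual_theta_xi gamma_type multivector_section(2)[OF x]]])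
  show "linear_in (\<lambda>a. theta a) (quasi_diff B \<gamma> f c m)"
    by (rule quasi_diff_function(2)[where \<Theta> = \<gamma>, OF dual_theta_xi gamma_type f])
qed (rule gint_quasi_diff_function[where \<Theta> = \<gamma>, OF dual_theta_xi gamma_type form_section(2)[OF \<xi>] f])+

text \<open>
  Both sides are odd derivations that kill functions; on one-forms they agree because the bracket is skew-symmetric
  and extends the anchor.
\<close>

lemma bracket_function_eq:
  assumes f: "f \<in> forms_deg B 0" and u: "u \<in> forms B"
  shows "G f u = iprod (- quasi_diff B \<gamma> f) u"
proof (rule derivation_eqI[OF derivation_odd[OF odd_derivation_bracket[OF f]] derivation_iprod _ _ _ u])
  have L: "linear_in (\<lambda>a. theta a) (quasi_diff B \<gamma> f c m)" for c m
    by (rule quasi_diff_function(2)[where \<Theta> = \<gamma>, OF dual_theta_xi gamma_type f])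
  have fin: "finite (theta_vars r)" by simp
  have "linear_in (\<lambda>a. theta a) (- g)" if "linear_in (\<lambda>a. theta a) g" for g
    by (rule linear_in_minus[OF that])
  then have lin: "linear_in (\<lambda>a. theta a) ((- quasi_diff B \<gamma> f) c m)" for c m using L by (simp only: uminus_apply)
  show "linear_at (\<lambda>a. theta a) ((- quasi_diff B \<gamma> f) c m)" for c m by (rule linear_in_linear_at[OF lin])
  show "iprod (- quasi_diff B \<gamma> f) g = 0" if "g \<in> forms_deg B 0" for g
    by (rule iprod_linear_function[OF linear_in_linear_at[OF lin] that])
  show "G f g = 0" if "g \<in> forms_deg B 0" for g by (rule bracket_functions[OF f that])
  show "G f \<eta> = iprod (- quasi_diff B \<gamma> f) \<eta>" if \<eta>: "\<eta> \<in> forms_deg B 1" for \<eta>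
  proof (rule sfield_ext)
    fix c m
    have "gint (- quasi_diff B \<gamma> f c m) (\<eta> c m) = - gint (quasi_diff B \<gamma> f c m) (\<eta> c m)"
      by (rule gint_minus_left[OF fin linear_inD(1)[OF L]])
    also have "gint (quasi_diff B \<gamma> f c m) (\<eta> c m) = gint (\<eta> c m) (quasi_diff B \<gamma> f c m)"
      by (rule pairing_commute[OF dual_xi_theta L form_section(3)[OF \<eta>]])
    also have "\<dots> = derived_bracket B \<gamma> \<eta> f c m"
      by (rule gint_quasi_diff_function(1)[where \<Theta> = \<gamma>, OF dual_theta_xi gamma_type form_section(2)[OF \<eta>] f])
    finally show "G f \<eta> c m = iprod (- quasi_diff B \<gamma> f) \<eta> c m"
      unfolding bracket_function_one_form[OF f \<eta>] iprod_apply uminus_apply[of "derived_bracket B \<gamma> \<eta> f"]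
        uminus_apply[of "derived_bracket B \<gamma> \<eta> f c"] uminus_apply[of "quasi_diff B \<gamma> f"]
        uminus_apply[of "quasi_diff B \<gamma> f c"] by (rule sym)
  qed
qed

lemma bracket_function_anticommute:
  assumes f: "f \<in> forms_deg B 0" and x: "x \<in> multivectors_deg B 1" and u: "u \<in> forms B"
  shows "iprod x (G f u) = - G f (iprod x u)"
proof -
  have L: "linear_in (\<lambda>a. theta a) (quasi_diff B \<gamma> f c m)" for c m
    by (rule quasi_diff_function(2)[where \<Theta> = \<gamma>, OF dual_theta_xi gamma_type f])
  have "iprod x u \<in> forms B" using multivector_section(1)[OF x] u by simp
  note iu = this
  have W: "(- quasi_diff B \<gamma> f) c m \<in> ext_poly (theta_vars r) \<and>
      ginv ((- quasi_diff B \<gamma> f) c m) = - (- quasi_diff B \<gamma> f) c m" for c m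
    using linear_inD[OF linear_in_minus[OF L[of c m]]] by (simp only: uminus_apply simp_thms)
  show ?thesis
    unfolding bracket_function_eq[OF f u] bracket_function_eq[OF f iu] by (rule iprod_anticommute[OF x u W])
qed

text \<open>
  The failure of bracketing with a one-form to commute with an interior product. As for the quasi-differential,
  both sides are derivations killing functions, and on one-forms the identity is Cartan's formula on the dual bundle.
\<close>

lemma bracket_iprod:
  assumes x: "x \<in> multivectors_deg B 1" and \<xi>: "\<xi> \<in> forms_deg B 1" and u: "u \<in> forms B"
  shows "G (iprod x \<xi>) u + (G \<xi> (iprod x u) - iprod x (G \<xi> u)) = iprod (iprod \<xi> (quasi_diff B \<gamma> x)) u"
proof -
  let ?f = "iprod x \<xi>" and ?z = "iprod \<xi> (quasi_diff B \<gamma> x)"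
  note f = iprod_one_form(1)[OF x \<xi>] and ix = odd_derivation_iprod[OF x]
  note D = odd_derivation_add[OF odd_derivation_bracket[OF f] even_odd_derivation_commutator[OF even_derivation_bracket[OF \<xi>] ix]]
  note X = odd_opD[OF odd_derivationD(1)[OF ix]] and E = even_derivationD[OF even_derivation_bracket[OF \<xi>]]
  have G0: "G \<xi> 0 = 0" using E(3)[of 0 0] by simp
  have z: "linear_in (\<lambda>a. theta a) (?z c m)" for c m by (rule gamma_linear(1)[OF \<xi> x f])
  have f0: "G ?f g + (G \<xi> (iprod x g) - iprod x (G \<xi> g)) = 0" if g: "g \<in> forms_deg B 0" for g
    using iprod_function[OF x bracket_deg[of 1 0 0, OF _ \<xi> g]]
    by (simp add: bracket_functions[OF f g] iprod_function[OF x g] G0)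
  have f1: "G ?f \<eta> + (G \<xi> (iprod x \<eta>) - iprod x (G \<xi> \<eta>)) = iprod ?z \<eta>" if \<eta>: "\<eta> \<in> forms_deg B 1" for \<eta>
  proof (rule sfield_eqI)
    note F = form_section(1)[OF \<eta>]
    have "G ?f \<eta> + (G \<xi> (iprod x \<eta>) - iprod x (G \<xi> \<eta>)) \<in> forms B" (is "?L \<in> _")
      using odd_opD(1)[OF odd_derivationD(1)[OF odd_derivation_bracket[OF f]] F] E(1) X(1) F by simp
    fix c m
    show "?L c m = 0" if "c \<notin> atlas B \<or> m \<notin> cdom c" by (rule formsD(1)[OF \<open>?L \<in> forms B\<close> that])
    show "iprod ?z \<eta> c m = 0" if "c \<notin> atlas B \<or> m \<notin> cdom c"
      using formsD(1)[OF F that] by (simp add: iprod_def)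
    show "?L c m = iprod ?z \<eta> c m" if c: "c \<in> atlas B" "m \<in> cdom c"
    proof -
      have deg: "derived_bracket B \<gamma> \<xi> \<eta> \<in> forms_deg B 1"
        using bracket_deg[of 1 1 1, OF _ \<xi> \<eta>] by (simp add: bracket_one_forms[OF \<xi> \<eta>])
      have a: "gint (derived_bracket B \<gamma> \<xi> \<eta> c m) (x c m) = gint (x c m) (derived_bracket B \<gamma> \<xi> \<eta> c m)"
        by (rule pairing_commute[OF dual_theta_xi form_section(3)[OF deg] multivector_section(3)[OF x]])
      have b: "iprod \<eta> ?z c m = iprod ?z \<eta> c m"
        unfolding iprod_def[of \<eta>] iprod_def[of ?z]
        by (rule pairing_commute[OF dual_theta_xi form_section(3)[OF \<eta>] z])
      show ?thesis
        using Cartan_formula[where \<Theta> = \<gamma>, OF dual_theta_xi gamma_type form_section(2)[OF \<xi>] form_section(2)[OF \<eta>]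
            multivector_section(2)[OF x] c]
        unfolding a b iprod_one_form(2)[OF x \<xi>] iprod_one_form(2)[OF x \<eta>]
        by (simp add: fun_app bracket_function_one_form[OF f \<eta>] bracket_anchor[OF \<xi> iprod_one_form(1)[OF x \<eta>]]
            bracket_one_forms[OF \<xi> \<eta>] iprod_def[of x "derived_bracket B \<gamma> \<xi> \<eta>"])
    qed
  qed
  show ?thesis
  proof (rule derivation_eqI[OF derivation_odd[OF D] derivation_iprod, OF _ _ _ _ u])
    show "linear_at (\<lambda>a. theta a) (?z c m)" for c m by (rule linear_in_linear_at[OF z])
    show "iprod ?z g = 0" if "g \<in> forms_deg B 0" for g by (rule iprod_linear_function[OF linear_in_linear_at[OF z] that])
  qed (rule f0 f1, assumption)+
qed

lemma lie_deriv_gamma: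
  assumes x: "x \<in> multivectors_deg B 1" and \<xi>: "\<xi> \<in> forms_deg B 1"
  shows "lie_deriv B \<gamma> \<xi> x = iprod \<xi> (quasi_diff B \<gamma> x) + quasi_diff B \<gamma> (iprod x \<xi>)"
proof -
  note f = iprod_one_form(1)[OF x \<xi>]
  have fin: "finite (xi_vars r)" by simp
  have gx: "grading_inv x = - x"
    by (rule sfield_ext) (simp add: grading_inv_apply linear_inD(2)[OF multivector_section(3)[OF x]] uminus_apply)
  have m: "iprod \<xi> (- x) = - iprod \<xi> x"
    by (rule sfield_ext) (simp add: iprod_def uminus_apply gint_minus_right[OF fin linear_inD(1)[OF form_section(3)[OF \<xi>]]])
  have a: "grading_inv (iprod \<xi> (grading_inv x)) = - iprod \<xi> x"
    unfolding gx m iprod_one_form(2)[OF x \<xi>] using grading_inv_forms_deg[OF f] by simp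
  have b: "grading_inv (quasi_diff B \<gamma> (grading_inv (iprod \<xi> x))) = - quasi_diff B \<gamma> (iprod \<xi> x)"
    unfolding iprod_one_form(2)[OF x \<xi>]
    by (rule sfield_ext) (simp add: grading_inv_forms_deg[OF f] grading_inv_apply uminus_apply
        linear_inD(2)[OF gamma_linear(2)[OF \<xi> x f]])
  have "(0 :: ('m, 'a) sfield) \<in> forms_deg B 0" by (rule forms_degI) (simp_all add: zero_fun_apply)
  then have "quasi_diff B \<gamma> 0 c m = 0" for c m
    using gint_linear_right quasi_diff_function(1)[where \<Theta> = \<gamma> and f = 0 and c = c and m = m, OF dual_theta_xi gamma_type]
      function_expand(2)[of 0 c _ m]
    by (simp add: dbase_def zero_fun_apply has_cderiv_imp_cderiv[OF has_cderiv_const])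
  then have z: "quasi_diff B \<gamma> 0 = 0" by (auto intro!: sfield_ext simp: zero_fun_apply)
  show ?thesis unfolding lie_deriv_def gcomm_odd_odd[OF a b z] by (simp add: iprod_one_form(2)[OF x \<xi>])
qed

text \<open>
  The bracket with the function \<open>i\<^sub>x \<xi>\<close> is itself an interior product; it supplies the second summand of the
  Lie derivative.
\<close>

lemma bracket_iprod_lie:
  assumes x: "x \<in> multivectors_deg B 1" and \<xi>: "\<xi> \<in> forms_deg B 1" and u: "u \<in> forms B"
  shows "iprod x (G \<xi> u) = G \<xi> (iprod x u) - iprod (lie_deriv B \<gamma> \<xi> x) u"
proof -
  note f = iprod_one_form(1)[OF x \<xi>]
  have fin: "finite (theta_vars r)" by simp
  note e = linear_inD(1)[OF gamma_linear(1)[OF \<xi> x f]] linear_inD(1)[OF gamma_linear(2)[OF \<xi> x f]]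
  have "iprod (lie_deriv B \<gamma> \<xi> x) u = iprod (iprod \<xi> (quasi_diff B \<gamma> x)) u - iprod (- quasi_diff B \<gamma> (iprod x \<xi>)) u"
    unfolding lie_deriv_gamma[OF x \<xi>]
    by (rule sfield_ext) (simp add: iprod_def[of _ u] fun_app gint_add_left[OF fin e] gint_minus_left[OF fin e(2)])
  moreover have "b = a - l" if "w + (a - b) = z" "l = z - w" for a b l w z :: "('m, 'a) sfield"
    by (simp add: that(2) that(1)[symmetric])
  ultimately show ?thesis using bracket_iprod[OF x \<xi> u, unfolded bracket_function_eq[OF f u]] by blast
qed

lemma lie_anticommute:
  assumes x: "x \<in> multivectors_deg B 1" and y: "y \<in> multivectors_deg B 1" and \<xi>: "\<xi> \<in> forms_deg B 1" and u: "u \<in> forms B"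
  shows "iprod y (iprod (lie_deriv B \<gamma> \<xi> x) u) = - iprod (lie_deriv B \<gamma> \<xi> x) (iprod y u)"
proof (rule iprod_anticommute[OF y u])
  note f = iprod_one_form(1)[OF x \<xi>]
  fix c m
  show "lie_deriv B \<gamma> \<xi> x c m \<in> ext_poly (theta_vars r) \<and> ginv (lie_deriv B \<gamma> \<xi> x c m) = - lie_deriv B \<gamma> \<xi> x c m"
    unfolding lie_deriv_gamma[OF x \<xi>] plus_fun_apply[of "iprod \<xi> (quasi_diff B \<gamma> x)" _ c]
      plus_fun_apply[of "iprod \<xi> (quasi_diff B \<gamma> x) c" _ m]
    using linear_inD[OF gamma_linear(1)[OF \<xi> x f, of c m]] linear_inD[OF gamma_linear(2)[OF \<xi> x f, of c m]] by simp
qed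

text \<open>
  Expanding with the product rules of the generator, all terms with an undifferentiated factor cancel and only
  brackets with \<open>i\<^sub>x \<xi>\<close> and with \<open>\<xi>\<close> remain.
\<close>

lemma double_comm_delta_mixed:
  assumes x: "x \<in> multivectors_deg B 1" and \<xi>: "\<xi> \<in> forms_deg B 1" and u: "u \<in> forms B"
  shows "double_comm (iprod x) \<delta> (eprod \<xi>) u = iprod (iprod \<xi> (quasi_diff B \<gamma> x)) u"
    and "double_comm (eprod \<xi>) \<delta> (iprod x) u = - iprod (lie_deriv B \<gamma> \<xi> x) u"
proof -
  note X = odd_opD[OF odd_derivationD(1)[OF odd_derivation_iprod[OF x]]] and F = form_section(1)[OF \<xi>]
    and f = iprod_one_form(1)[OF x \<xi>] and a = delta_one_form[OF \<xi>] and E = even_derivationD[OF even_derivation_bracket[OF \<xi>]]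
  note s = delta_one_form_mult[OF \<xi>] delta_function_mult[OF f] iprod_one_form_mult[OF x \<xi>] iprod_function_mult[OF x a]
    X delta_simps E(1) F u forms_deg_forms[OF f] forms_deg_forms[OF a]
  show "double_comm (iprod x) \<delta> (eprod \<xi>) u = iprod (iprod \<xi> (quasi_diff B \<gamma> x)) u"
    unfolding double_comm_def eprod_def bracket_iprod[OF x \<xi> u, symmetric] by (simp add: s algebra_simps)
  show "double_comm (eprod \<xi>) \<delta> (iprod x) u = - iprod (lie_deriv B \<gamma> \<xi> x) u"
    unfolding double_comm_def eprod_def using bracket_iprod_lie[OF x \<xi> u] by (simp add: s algebra_simps)
qed

lemma double_comm_delta_forms:
  assumes \<xi>: "\<xi> \<in> forms_deg B 1" and \<eta>: "\<eta> \<in> forms_deg B 1" and u: "u \<in> forms B"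
  shows "double_comm (eprod \<xi>) \<delta> (eprod \<eta>) u = - eprod (derived_bracket B \<gamma> \<xi> \<eta>) u"
proof -
  note F = form_section(1)[OF \<xi>] and H = form_section(1)[OF \<eta>] and a = delta_one_form[OF \<xi>]
    and E = even_derivationD[OF even_derivation_bracket[OF \<xi>]]
  have "\<delta> \<xi> \<odot> \<eta> = \<eta> \<odot> \<delta> \<xi>"
    by (rule smult_commute_even[OF forms_deg_forms[OF a] H]) (simp add: grading_inv_forms_deg[OF a])
  then have c: "\<delta> \<xi> \<odot> (\<eta> \<odot> u) = \<eta> \<odot> (\<delta> \<xi> \<odot> u)"
    using smult_assoc[OF forms_deg_forms[OF a] H, of u] smult_assoc[OF H forms_deg_forms[OF a], of u] by simp
  show ?thesis
    unfolding double_comm_def eprod_def bracket_one_forms[OF \<xi> \<eta>, symmetric]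
    using F H u by (simp add: delta_one_form_mult[OF \<xi>] c E(4) algebra_simps)
qed

text \<open>
  The double commutator with two interior products commutes with functions and, up to sign, with exterior
  multiplication by one-forms; as it has degree -3 it kills functions and one-forms, hence vanishes.
\<close>

lemma double_comm_delta_vectors:
  assumes x: "x \<in> multivectors_deg B 1" and y: "y \<in> multivectors_deg B 1" and u: "u \<in> forms B"
  shows "double_comm (iprod x) \<delta> (iprod y) u = 0"
proof (rule operator_vanishes_locally[OF _ _ _ _ _ _ u])
  note X = odd_opD[OF odd_derivationD(1)[OF odd_derivation_iprod[OF x]]] and Y = odd_opD[OF odd_derivationD(1)[OF odd_derivation_iprod[OF y]]]
  let ?C = "double_comm (iprod x) \<delta> (iprod y)"
  have F: "?C v \<in> forms B" if "v \<in> forms B" for v unfolding double_comm_def using that by (simp add: X Y delta_simps)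
  show "?C v c m \<in> ext_poly {..<2 * r}" if "v \<in> forms B" for v c m using F[OF that] by simp
  show "?C v c m = 0" if "v \<in> forms B" "c \<notin> atlas B \<or> m \<notin> cdom c" for v c m by (rule formsD(1)[OF F[OF that(1)] that(2)])
  show "?C (v + w) = ?C v + ?C w" if "v \<in> forms B" "w \<in> forms B" for v w
    unfolding double_comm_def using that by (simp add: X Y delta_simps algebra_simps)
  show "?C f = 0" if "f \<in> forms_deg B 0" for f
    unfolding double_comm_def by (simp add: iprod_function[OF x that] iprod_function[OF y that] delta_function[OF that] X Y delta_simps)
  show "?C (f \<odot> v) = f \<odot> ?C v" if f: "f \<in> forms_deg B 0" and v: "v \<in> forms B" for f v
  proof -
    note g = odd_opD[OF odd_derivationD(1)[OF odd_derivation_bracket[OF f]]]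
    show ?thesis
      unfolding double_comm_def
      by (simp add: delta_function_mult[OF f] iprod_function_mult[OF x f] iprod_function_mult[OF y f] X Y delta_simps g v
          forms_deg_forms[OF f] bracket_function_anticommute[OF f x] bracket_function_anticommute[OF f y] algebra_simps)
  qed
  show "?C (\<xi> \<odot> v) = 0" if \<xi>: "\<xi> \<in> forms_deg B 1" and v: "v \<in> forms B" and C: "?C v = 0" for \<xi> v
  proof -
    note H = form_section(1)[OF \<xi>] and h = iprod_one_form(1)[OF x \<xi>] and g = iprod_one_form(1)[OF y \<xi>]
      and a = delta_one_form[OF \<xi>]
    note Gh = odd_opD[OF odd_derivationD(1)[OF odd_derivation_bracket[OF h]]]
      and Gg = odd_opD[OF odd_derivationD(1)[OF odd_derivation_bracket[OF g]]]
      and E = even_derivationD[OF even_derivation_bracket[OF \<xi>]]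
    have lf: "iprod (lie_deriv B \<gamma> \<xi> x) w \<in> forms B" if "w \<in> forms B" for w
    proof -
      have "iprod (lie_deriv B \<gamma> \<xi> x) w = G \<xi> (iprod x w) - iprod x (G \<xi> w)" using bracket_iprod_lie[OF x \<xi> that] by simp
      then show ?thesis using that X E by simp
    qed
    have "?C (\<xi> \<odot> v) = - (\<xi> \<odot> ?C v)"
      unfolding double_comm_def
      by (simp add: delta_function_mult[OF h] delta_function_mult[OF g] delta_one_form_mult[OF \<xi>]
          iprod_function_mult[OF x h] iprod_function_mult[OF x g] iprod_function_mult[OF x a]
          iprod_function_mult[OF y h] iprod_function_mult[OF y g] iprod_function_mult[OF y a]
          iprod_one_form_mult[OF x \<xi>] iprod_one_form_mult[OF y \<xi>] X Y delta_simps Gh Gg E(1) v H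
          forms_deg_forms[OF h] forms_deg_forms[OF g] forms_deg_forms[OF a] lf
          bracket_function_anticommute[OF g x] bracket_function_anticommute[OF h y] bracket_iprod_lie[OF x \<xi>]
          lie_anticommute[OF x y \<xi>] algebra_simps)
    then show ?thesis by (simp add: C)
  qed
qed

section \<open>Double commutators of the two three-tensors\<close>

lemma iprod_phi_anticommute: "x \<in> multivectors_deg B 1 \<Longrightarrow> u \<in> forms B \<Longrightarrow> iprod x (iprod \<phi> u) = - iprod \<phi> (iprod x u)"
  by (rule iprod_anticommute, assumption, assumption, intro conjI, rule phi_props(2), rule phi_props(3))

lemma double_comm_phi_vectors:
  assumes x: "x \<in> multivectors_deg B 1" and y: "y \<in> multivectors_deg B 1" and u: "u \<in> forms B"
  shows "double_comm (iprod x) (iprod \<phi>) (iprod y) u = 0"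
  unfolding double_comm_def using multivector_section(1)[OF x] multivector_section(1)[OF y] u
    odd_opD(5)[OF iphi_op] odd_opD(5)[OF odd_derivationD(1)[OF odd_derivation_iprod[OF y]]] phi_props(1)
  by (simp add: iprod_phi_anticommute[OF x] iprod_phi_anticommute[OF y])

lemma iprod_phi_one_form_mult:
  assumes \<xi>: "\<xi> \<in> forms_deg B 1" and u: "u \<in> forms B"
  shows "iprod \<phi> (\<xi> \<odot> u) = iprod (iprod \<xi> \<phi>) u - \<xi> \<odot> iprod \<phi> u"
proof (rule sfield_ext)
  fix c m
  have fin: "finite (theta_vars r)" "finite (xi_vars r)" by simp_all
  note xe = linear_inD(1)[OF form_section(3)[OF \<xi>, of c m]] and pe = phi_props(2)[of c m]
  have ke: "gint (\<xi> c m) (\<phi> c m) \<in> ext_poly (theta_vars r)" by (rule ext_poly_gint[OF fin(2) xe pe])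
  show "iprod \<phi> (\<xi> \<odot> u) c m = (iprod (iprod \<xi> \<phi>) u - \<xi> \<odot> iprod \<phi> u) c m"
    using gint_one_form_mult[OF form_section(3)[OF \<xi>] pe formsD(2)[OF u], of c m c m]
    by (simp add: iprod_def smult_def fun_app phi_props(3) gint_minus_left[OF fin(1) pe] gint_minus_right[OF fin(2) xe]
        gint_minus_left[OF fin(1) ke])
qed

lemma iota_phi:
  assumes \<xi>: "\<xi> \<in> forms_deg B 1"
  shows "iprod \<xi> \<phi> c m \<in> ext_poly (theta_vars r)" "ginv (iprod \<xi> \<phi> c m) = iprod \<xi> \<phi> c m"
proof -
  have fin: "finite (xi_vars r)" by simp
  note xe = linear_inD[OF form_section(3)[OF \<xi>, of c m]] and pe = phi_props(2,3)[of c m]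
  show "iprod \<xi> \<phi> c m \<in> ext_poly (theta_vars r)" unfolding iprod_def by (rule ext_poly_gint[OF fin xe(1) pe(1)])
  show "ginv (iprod \<xi> \<phi> c m) = iprod \<xi> \<phi> c m"
    unfolding iprod_def ginv_gint[OF fin xe(1) pe(1)] xe(2) pe(2)
    by (simp add: gint_minus_left[OF fin xe(1)] gint_minus_right[OF fin xe(1)])
qed

lemma double_comm_phi_mixed:
  assumes x: "x \<in> multivectors_deg B 1" and \<xi>: "\<xi> \<in> forms_deg B 1" and u: "u \<in> forms B"
  shows "double_comm (iprod x) (iprod \<phi>) (eprod \<xi>) u = 0" and "double_comm (eprod \<xi>) (iprod \<phi>) (iprod x) u = 0"
proof -
  note X = odd_opD[OF odd_derivationD(1)[OF odd_derivation_iprod[OF x]]] and P = odd_opD[OF iphi_op] and F = form_section(1)[OF \<xi>]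
  have fin: "finite (theta_vars r)" by simp
  show "double_comm (iprod x) (iprod \<phi>) (eprod \<xi>) u = 0"
    unfolding double_comm_def eprod_def by (simp add: iprod_phi_anticommute[OF x] F u P)
  have "iprod x (iprod (iprod \<xi> \<phi>) u) c m = iprod (iprod \<xi> \<phi>) (iprod x u) c m" for c m
    unfolding iprod_def[of x] iprod_def[of "iprod \<xi> \<phi>"]
    using gint_odd_commute[OF fin linear_inD[OF multivector_section(3)[OF x]] iota_phi(1)[OF \<xi>], of c m c m "u c m"]
    by (simp add: iota_phi(2)[OF \<xi>])
  then have k: "iprod x (iprod (iprod \<xi> \<phi>) u) = iprod (iprod \<xi> \<phi>) (iprod x u)" by (rule sfield_ext)
  have "iprod x (\<xi> \<odot> iprod \<phi> u + iprod \<phi> (\<xi> \<odot> u)) = iprod (iprod \<xi> \<phi>) (iprod x u)"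
    by (simp add: iprod_phi_one_form_mult[OF \<xi> u] k)
  moreover have "iprod x (\<xi> \<odot> iprod \<phi> u + iprod \<phi> (\<xi> \<odot> u)) = iprod x (\<xi> \<odot> iprod \<phi> u) + iprod x (iprod \<phi> (\<xi> \<odot> u))"
    by (rule X(3)) (simp_all add: F u P)
  ultimately have "iprod x (\<xi> \<odot> iprod \<phi> u) + iprod x (iprod \<phi> (\<xi> \<odot> u)) = iprod (iprod \<xi> \<phi>) (iprod x u)" by (rule trans[OF sym, rotated])
  then show "double_comm (eprod \<xi>) (iprod \<phi>) (iprod x) u = 0"
    unfolding double_comm_def eprod_def using iprod_phi_one_form_mult[OF \<xi> X(1)[OF u]] by (simp add: algebra_simps)
qed

lemma double_comm_phi_forms:
  assumes \<xi>: "\<xi> \<in> forms_deg B 1" and \<eta>: "\<eta> \<in> forms_deg B 1" and u: "u \<in> forms B"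
  shows "double_comm (eprod \<xi>) (iprod \<phi>) (eprod \<eta>) u = iprod (iprod (\<xi> \<odot> \<eta>) \<phi>) u"
proof -
  note F = form_section(1)[OF \<xi>] and H = form_section(1)[OF \<eta>]
  let ?k = "iprod \<xi> \<phi>"
  have "double_comm (eprod \<xi>) (iprod \<phi>) (eprod \<eta>) u = iprod ?k (\<eta> \<odot> u) - \<eta> \<odot> iprod ?k u"
    unfolding double_comm_def eprod_def
    using iprod_phi_one_form_mult[OF \<xi> forms_mult[OF H u]] iprod_phi_one_form_mult[OF \<xi> u] by simp
  also have "\<dots> = iprod (iprod (\<xi> \<odot> \<eta>) \<phi>) u"
  proof (rule sfield_ext)
    fix c m
    have fin: "finite (theta_vars r)" "finite (xi_vars r)" by simp_all
    note xe = linear_inD[OF form_section(3)[OF \<xi>, of c m]] and he = linear_inD[OF form_section(3)[OF \<eta>, of c m]]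
      and pe = phi_props(2)[of c m]
    let ?h = "gint (\<eta> c m) (\<phi> c m)"
    have hp: "gint (\<xi> c m) ?h \<in> ext_poly (theta_vars r)"
      by (rule ext_poly_gint[OF fin(2) xe(1) ext_poly_gint[OF fin(2) he(1) pe]])
    have c: "gint (\<eta> c m) (gint (\<xi> c m) (\<phi> c m)) = - gint (\<xi> c m) ?h"
      using gint_odd_commute[OF fin(2) he xe(1), of "\<phi> c m"] by (simp add: xe(2) gint_minus_left[OF fin(2) xe(1)])
    show "(iprod ?k (\<eta> \<odot> u) - \<eta> \<odot> iprod ?k u) c m = iprod (iprod (\<xi> \<odot> \<eta>) \<phi>) u c m"
      using gint_one_form_mult[OF form_section(3)[OF \<eta>, of c m] iota_phi(1)[OF \<xi>, of c m] formsD(2)[OF u, of c m]] iota_phi(2)[OF \<xi>, of c m]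
      by (simp add: iprod_def smult_def fun_app c gint_minus_left[OF fin(1) hp] gint_gmult[OF fin(2) xe(1) he(1)])
  qed
  finally show ?thesis .
qed

text \<open>
  Contracting the three-form once leaves an even form, contracting it twice a one-form; the order of the two contractions
  produces the sign.
\<close>

lemma double_comm_psi_vectors:
  assumes x: "x \<in> multivectors_deg B 1" and y: "y \<in> multivectors_deg B 1" and u: "u \<in> forms B"
  shows "double_comm (iprod x) (eprod \<psi>) (iprod y) u = eprod (iprod (x \<odot> y) \<psi>) u"
proof -
  note ix = odd_derivation_iprod[OF x] and iy = odd_derivation_iprod[OF y]
  note X = odd_opD[OF odd_derivationD(1)[OF ix]] and Y = odd_opD[OF odd_derivationD(1)[OF iy]]
  have fin: "finite (theta_vars r)" by simp
  let ?\<chi> = "iprod x \<psi>"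
  have chi: "?\<chi> \<in> forms B" "grading_inv ?\<chi> = ?\<chi>" using X psi_props by simp_all
  have a: "iprod x (\<psi> \<odot> w) = ?\<chi> \<odot> w - \<psi> \<odot> iprod x w" if "w \<in> forms B" for w
    using odd_derivationD(2)[OF ix psi_props(1) that] psi_props(2) by simp
  have b: "iprod y (?\<chi> \<odot> u) = iprod y ?\<chi> \<odot> u + ?\<chi> \<odot> iprod y u"
    using odd_derivationD(2)[OF iy chi(1) u] chi(2) by simp
  have "iprod y ?\<chi> = - iprod x (iprod y \<psi>)"
    using iprod_anticommute[OF y psi_props(1), of x] multivector_section(3)[OF x] linear_inD by blast
  moreover have "iprod (x \<odot> y) \<psi> = iprod x (iprod y \<psi>)"
    by (rule sfield_ext) (simp add: iprod_def smult_def gint_gmult[OF fin linear_inD(1)[OF multivector_section(3)[OF x]]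
        linear_inD(1)[OF multivector_section(3)[OF y]]])
  ultimately have c: "iprod y ?\<chi> = - iprod (x \<odot> y) \<psi>" by simp
  show ?thesis
    unfolding double_comm_def eprod_def using u by (simp add: X Y psi_props(1) chi(1) a b c algebra_simps)
qed

lemma double_comm_psi_mixed:
  assumes x: "x \<in> multivectors_deg B 1" and \<xi>: "\<xi> \<in> forms_deg B 1" and u: "u \<in> forms B"
  shows "double_comm (iprod x) (eprod \<psi>) (eprod \<xi>) u = 0" and "double_comm (eprod \<xi>) (eprod \<psi>) (iprod x) u = 0"
proof -
  note ix = odd_derivation_iprod[OF x] and F = form_section(1)[OF \<xi>]
  note X = odd_opD[OF odd_derivationD(1)[OF ix]]
  let ?\<chi> = "iprod x \<psi>"
  have chi: "?\<chi> \<in> forms B" "grading_inv ?\<chi> = ?\<chi>" using X psi_props by simp_all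
  have a: "iprod x (\<psi> \<odot> w) = ?\<chi> \<odot> w - \<psi> \<odot> iprod x w" if "w \<in> forms B" for w
    using odd_derivationD(2)[OF ix psi_props(1) that] psi_props(2) by simp
  have s: "\<xi> \<odot> (\<psi> \<odot> w) = - (\<psi> \<odot> (\<xi> \<odot> w))" if "w \<in> forms B" for w
    by (rule odd_form_anticommute[OF \<xi> psi_props that])
  have "?\<chi> \<odot> \<xi> = \<xi> \<odot> ?\<chi>" by (rule smult_commute_even[OF chi(1) F chi(2)])
  then have "?\<chi> \<odot> (\<xi> \<odot> u) = \<xi> \<odot> (?\<chi> \<odot> u)" using smult_assoc[OF chi(1) F, of u] smult_assoc[OF F chi(1), of u] by simp
  then show "double_comm (iprod x) (eprod \<psi>) (eprod \<xi>) u = 0"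
    unfolding double_comm_def eprod_def using u by (simp add: F X psi_props(1) chi(1) a s algebra_simps)
  show "double_comm (eprod \<xi>) (eprod \<psi>) (iprod x) u = 0"
    unfolding double_comm_def eprod_def using u by (simp add: F X psi_props(1) s)
qed

lemma double_comm_psi_forms:
  assumes \<xi>: "\<xi> \<in> forms_deg B 1" and \<eta>: "\<eta> \<in> forms_deg B 1" and u: "u \<in> forms B"
  shows "double_comm (eprod \<xi>) (eprod \<psi>) (eprod \<eta>) u = 0"
  unfolding double_comm_def eprod_def
  using odd_form_anticommute[OF \<xi> psi_props forms_mult[OF form_section(1)[OF \<eta>] u]] odd_form_anticommute[OF \<xi> psi_props u] by simp

section \<open>The operator has order one\<close>

lemma linear_deriving: "linear_operator B (\<lambda>u. quasi_diff B \<mu> u - \<delta> u + iprod \<phi> u + eprod \<psi> u)"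
proof -
  have fin: "finite (theta_vars r)" by simp
  have d: "quasi_diff B \<mu> (s *\<^sub>s u) = s *\<^sub>s quasi_diff B \<mu> u" if "u \<in> forms B" for s u
    by (rule odd_derivation_quasi_diff(2)[OF in_sfunctions(1) mu_type that])
  have D: "\<delta> (s *\<^sub>s u) = s *\<^sub>s \<delta> u" if "u \<in> forms B" for s u
    using delta_linear that unfolding linear_operator_def by blast
  have p: "iprod \<phi> (s *\<^sub>s u) = s *\<^sub>s iprod \<phi> u" for s u
    by (rule sfield_ext) (simp add: iprod_def sscale_def gint_linear_right(2)[OF fin phi_props(2)])
  show ?thesis
    unfolding linear_operator_def
    by (simp add: odd_opD[OF d_op] delta_simps odd_opD[OF iphi_op] odd_opD[OF epsi_op, unfolded eprod_def] d D p eprod_def smult_sscale sscale_add_right algebra_simps)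
qed

text \<open>The commutator with a function is multiplication by its quasi-differential minus the bracket with it.\<close>

lemma differential_operator_deriving: "differential_operator B (\<lambda>u. quasi_diff B \<mu> u - \<delta> u + iprod \<phi> u + eprod \<psi> u)"
proof -
  let ?D = "\<lambda>u. quasi_diff B \<mu> u - \<delta> u + iprod \<phi> u + eprod \<psi> u"
  note d = odd_opD[OF d_op]
  have fin: "finite (theta_vars r)" by simp
  have D: "?D (f \<odot> u) - f \<odot> ?D u = quasi_diff B \<mu> f \<odot> u - G f u" if f: "f \<in> forms_deg B 0" and u: "u \<in> forms B" for f u
  proof -
    note F = forms_deg_forms[OF f]
    have p: "iprod \<phi> (f \<odot> u) = f \<odot> iprod \<phi> u"
    proof (rule sfield_ext)
      fix c m
      obtain s where s: "f c m = s *\<^sub>g gone" using function_expand(1)[OF f] by blast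
      show "iprod \<phi> (f \<odot> u) c m = (f \<odot> iprod \<phi> u) c m"
        unfolding iprod_def smult_def s gmult_function[OF formsD(2)[OF u]]
          gmult_function[OF ext_poly_gint[OF fin phi_props(2) formsD(2)[OF u]]]
        by (rule gint_linear_right(2)[OF fin phi_props(2)])
    qed
    have "f \<odot> \<psi> = \<psi> \<odot> f" by (rule smult_commute_even[OF F psi_props(1)]) (simp add: grading_inv_forms_deg[OF f])
    then have e: "\<psi> \<odot> (f \<odot> u) = f \<odot> (\<psi> \<odot> u)"
      using smult_assoc[OF F psi_props(1), of u] smult_assoc[OF psi_props(1) F, of u] by simp
    show ?thesis
      using d_mult[OF F u] by (simp add: p e eprod_def delta_function_mult[OF f u] grading_inv_forms_deg[OF f] algebra_simps)
  qed
  have lin: "linear_operator B (\<lambda>u. ?D (f \<odot> u) - f \<odot> ?D u)" if f: "f \<in> forms_deg B 0" for f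
    using linear_deriving forms_deg_forms[OF f] unfolding linear_operator_def
    by (simp add: smult_sscale sscale_add_right del: smult_linear) (simp add: smult_sscale sscale_add_right algebra_simps)
  have comm: "quasi_diff B \<mu> f \<odot> (g \<odot> u) - G f (g \<odot> u) = g \<odot> (quasi_diff B \<mu> f \<odot> u - G f u)"
    if f: "f \<in> forms_deg B 0" and g: "g \<in> forms_deg B 0" and u: "u \<in> forms B" for f g u
  proof -
    note F = forms_deg_forms[OF f] and H = forms_deg_forms[OF g]
    have "g \<odot> quasi_diff B \<mu> f = quasi_diff B \<mu> f \<odot> g"
      by (rule smult_commute_even[OF H d(1)[OF F]]) (simp add: grading_inv_forms_deg[OF g])
    then have "quasi_diff B \<mu> f \<odot> (g \<odot> u) = g \<odot> (quasi_diff B \<mu> f \<odot> u)"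
      using smult_assoc[OF H d(1)[OF F], of u] smult_assoc[OF d(1)[OF F] H, of u] by simp
    then show ?thesis
      using odd_derivationD(2)[OF odd_derivation_bracket[OF f] H u]
      by (simp add: bracket_functions[OF f g] grading_inv_forms_deg[OF g])
  qed
  have "diff_op_order B (Suc 0) ?D"
    unfolding diff_op_order.simps
  proof (intro conjI ballI)
    show "linear_operator B ?D" by (rule linear_deriving)
    fix f assume f: "f \<in> forms_deg B 0"
    show "linear_operator B (\<lambda>u. ?D (f \<odot> u) - f \<odot> ?D u)" by (rule lin[OF f])
    fix g u assume g: "g \<in> forms_deg B 0" and u: "u \<in> forms B"
    show "?D (f \<odot> (g \<odot> u)) - f \<odot> ?D (g \<odot> u) = g \<odot> (?D (f \<odot> u) - f \<odot> ?D u)"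
      unfolding D[OF f u] D[OF f forms_mult[OF forms_deg_forms[OF g] u]] by (rule comm[OF f g u])
  qed
  then show ?thesis unfolding differential_operator_def by blast
qed

lemma deriving:
  "deriving_operator B \<mu> \<gamma> \<phi> \<psi> (\<lambda>u. quasi_diff B \<mu> u - \<delta> u + iprod \<phi> u + eprod \<psi> u)"
  unfolding deriving_operator_def
proof (intro conjI ballI)
  note ops = d_op delta_op iphi_op epsi_op
  have ix: "odd_op (iprod x)" if "x \<in> multivectors_deg B 1" for x by (rule odd_derivationD(1)[OF odd_derivation_iprod[OF that]])
  have ex: "odd_op (eprod \<xi>)" if "\<xi> \<in> forms_deg B 1" for \<xi> by (rule odd_op_eprod[OF form_section(1,4)[OF that]])
  let ?D = "\<lambda>u. quasi_diff B \<mu> u - \<delta> u + iprod \<phi> u + eprod \<psi> u"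
  show "differential_operator B ?D" by (rule differential_operator_deriving)
  fix u assume u: "u \<in> forms B"
  show "gcomm (gcomm (iprod x) ?D) (iprod y) u = iprod (derived_bracket B \<mu> x y) u + eprod (iprod (x \<odot> y) \<psi>) u"
    if x: "x \<in> multivectors_deg B 1" and y: "y \<in> multivectors_deg B 1" for x y
    unfolding double_comm_deriving[OF ix[OF x] ix[OF y] ops u]
    by (simp add: double_comm_d_vectors[OF x y u] double_comm_delta_vectors[OF x y u] double_comm_phi_vectors[OF x y u]
        double_comm_psi_vectors[OF x y u])
  show "gcomm (gcomm (iprod x) ?D) (eprod \<xi>) u = - iprod (iprod \<xi> (quasi_diff B \<gamma> x)) u + eprod (lie_deriv B \<mu> x \<xi>) u"
    if x: "x \<in> multivectors_deg B 1" and \<xi>: "\<xi> \<in> forms_deg B 1" for x \<xi>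
    unfolding double_comm_deriving[OF ix[OF x] ex[OF \<xi>] ops u]
    by (simp add: double_comm_d_mixed(1)[OF x \<xi> u] double_comm_delta_mixed(1)[OF x \<xi> u] double_comm_phi_mixed(1)[OF x \<xi> u]
        double_comm_psi_mixed(1)[OF x \<xi> u])
  show "gcomm (gcomm (eprod \<xi>) ?D) (iprod x) u = iprod (lie_deriv B \<gamma> \<xi> x) u - eprod (iprod x (quasi_diff B \<mu> \<xi>)) u"
    if \<xi>: "\<xi> \<in> forms_deg B 1" and x: "x \<in> multivectors_deg B 1" for x \<xi>
    unfolding double_comm_deriving[OF ex[OF \<xi>] ix[OF x] ops u]
    by (simp add: double_comm_d_mixed(2)[OF x \<xi> u] double_comm_delta_mixed(2)[OF x \<xi> u] double_comm_phi_mixed(2)[OF x \<xi> u]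
        double_comm_psi_mixed(2)[OF x \<xi> u])
  show "gcomm (gcomm (eprod \<xi>) ?D) (eprod \<eta>) u = iprod (iprod (\<xi> \<odot> \<eta>) \<phi>) u + eprod (derived_bracket B \<gamma> \<xi> \<eta>) u"
    if \<xi>: "\<xi> \<in> forms_deg B 1" and \<eta>: "\<eta> \<in> forms_deg B 1" for \<xi> \<eta>
    unfolding double_comm_deriving[OF ex[OF \<xi>] ex[OF \<eta>] ops u]
    by (simp add: double_comm_d_forms[OF \<xi> \<eta> u] double_comm_delta_forms[OF \<xi> \<eta> u] double_comm_phi_forms[OF \<xi> \<eta> u]
        double_comm_psi_forms[OF \<xi> \<eta> u])
qed

end

theorem theorem3p2:
  fixes B :: "('m, 'a) vbundle"
    and \<mu> \<gamma> \<phi> \<psi> :: "('m, 'a) sfield"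
    and G :: "('m, 'a) sfield \<Rightarrow> ('m, 'a) sfield \<Rightarrow> ('m, 'a) sfield"
    and \<delta> :: "('m, 'a) sfield \<Rightarrow> ('m, 'a) sfield"
  assumes "vector_bundle B"
    and "proto_bialgebroid B \<mu> \<gamma> \<phi> \<psi>"
    and "gerstenhaber_bracket B \<gamma> G"
    and "generator B G \<delta>"
  shows "deriving_operator B \<mu> \<gamma> \<phi> \<psi>
    (\<lambda>u. quasi_diff B \<mu> u - \<delta> u + iprod \<phi> u + eprod \<psi> u)"
proof -
  interpret generated_double B \<mu> \<gamma> \<phi> \<psi> G \<delta>
    using assms by unfold_locales
  show ?thesis by (rule deriving)
qed

end
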